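(* Let $R$ be a unital commutative ring and $D$ a unital superdialgebra over $R$. The universal central extension of the Leibniz superalgebra $\mathfrak{sl}(2,2,D)$ is $\mathfrak{stl}(2,2,D)\oplus D_2^4\oplus D_0^2$; that is, the $R$-supermodule $\mathfrak{stl}(2,2,D)\oplus D_2^4\oplus D_0^2$ carries a Leibniz superalgebra structure for which the projection onto $\mathfrak{stl}(2,2,D)$ followed by the canonical homomorphism $\mathfrak{stl}(2,2,D)\to\mathfrak{sl}(2,2,D)$, $F_{ij}(a)\mapsto E_{ij}(a)$, is a universal central extension of $\mathfrak{sl}(2,2,D)$.
   Context: $R$ is a fixed unital commutative ring; $|x|\in\mathbb{Z}_2$ denotes the degree of a homogeneous element, and formulas involving degrees are for homogeneous elements and extended linearly. A superdialgebra $D=D_{\bar 0}\oplus D_{\bar 1}$ is a $\mathbb{Z}_2$-graded $R$-module with two associative $R$-linear operations $\vdash,\dashv\colon D\otimes_R D\to D$, compatible with the grading, such that $a\dashv(b\dashv c)=a\dashv(b\vdash c)$, $(a\vdash b)\dashv c=a\vdash(b\dashv c)$, $(a\dashv b)\vdash c=(a\vdash b)\vdash c$. It is unital if it has a chosen bar-unit, i.e. an (even) element $1$ with $a\dashv 1=a=1\vdash a$ for all $a$. An ideal of $D$ is an $R$-submodule $I$ such that $x\dashv y,\ x\vdash y\in I$ whenever $x\in I$ or $y\in I$. For an integer $k\ge 0$, $D_k$ (not to be confused with the graded parts $D_{\bar 0},D_{\bar 1}$) is $D/\mathcal{I}_k$, where $\mathcal{I}_k$ is the ideal generated by all elements $ka$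 and $a\dashv b-(-1)^{|a||b|}b\vdash a$ with $a,b\in D$. $D_k^r$ is the direct sum of $r$ copies of $D_k$, with the induced grading. A Leibniz superalgebra $L$ is an $R$-supermodule with an even $R$-linear map $[-,-]\colon L\otimes_R L\to L$ satisfying $[x,[y,z]]=[[x,y],z]-(-1)^{|y||z|}[[x,z],y]$. Its centre $\mathrm{Z}(L)$ is the set of $z$ with $[z,x]=[x,z]=0$ for all $x$. A central extension of $L$ is a surjective homomorphism $\phi\colon M\to L$ with $\mathrm{Ker}\,\phi\subseteq\mathrm{Z}(M)$; a central extension $\mathfrak{u}\colon U\to L$ is universal if for every central extension $\phi\colon M\to L$ there is a unique homomorphism $f\colon U\to M$ with $\mathfrak{u}=\phi\circ f$. For non-negative integers $m,n$ with $m+n\ge 3$ put $|i|=\bar 0$ for $1\le i\le m$ and $|i|=\bar 1$ for $m+1\le i\le m+n$. $\mathfrak{gl}(m,n,D)$ is the $R$-module of $(m+n)\times(m+n)$ matrices over $D$, where $E_{ij}(a)$ (the matrix with $a$ in position $(i,j)$ and zeros elsewhere) has degree $|i|+|j|+|a|$, with bracket $[x,y]=x\dashv y-(-1)^{|x||y|}y\vdash x$, where $(x\dashv y)_{ij}=\sum_k x_{ik}\dashv y_{kj}$ and $(x\vdash y)_{ij}=\sum_k x_{ik}\vdash y_{kj}$. $\mathfrak{sl}(m,n,D)=[\mathfrak{gl}(m,n,D),\mathfrak{gl}(m,n,D)]$. The Steinberg Leibniz superalgebra $\mathfrak{stl}(m,n,D)$ is the Leibniz superalgebra over $R$ generated by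 elements $F_{ij}(a)$, $a\in D_{\bar 0}\cup D_{\bar 1}$, $1\le i\ne j\le m+n$, of degree $|i|+|j|+|a|$, subject to: $a\mapsto F_{ij}(a)$ is $R$-linear; $[F_{ij}(a),F_{kl}(b)]=F_{il}(a\dashv b)$ if $i\ne l$ and $j=k$; $[F_{ij}(a),F_{kl}(b)]=-(-1)^{|F_{ij}(a)||F_{kl}(b)|}F_{kj}(b\vdash a)$ if $i=l$ and $j\ne k$; $[F_{ij}(a),F_{kl}(b)]=0$ if $i\ne l$ and $j\ne k$. *)

theory Defs
  imports "HOL-Algebra.Module" "HOL-Algebra.AbelCoset" "HOL-Library.Z2"
begin

section \<open>Supermodules, superdialgebras and Leibniz superalgebras\<close>

text \<open>
  Degrees live in the two-element field \<^typ>\<open>bit\<close>, so sums and products of degrees are computed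
  modulo 2. The records below extend the record of modules, which itself extends that of rings:
  the inherited field \<open>mult\<close> is never used, and \<open>one\<close> is used only for the bar-unit of a
  superdialgebra. Unused fields of concrete structures are set to \<^const>\<open>undefined\<close>.
\<close>

record ('a, 'b) supermodule = "('a, 'b) module" +
  gr :: "bit \<Rightarrow> 'b set"

record ('a, 'b) superdialg = "('a, 'b) supermodule" +
  lprod :: "'b \<Rightarrow> 'b \<Rightarrow> 'b"  (infixl \<open>\<stileturn>\<index>\<close> 70)
  rprod :: "'b \<Rightarrow> 'b \<Rightarrow> 'b"  (infixl \<open>\<turnstile>\<index>\<close> 70)

record ('a, 'b) leibniz = "('a, 'b) supermodule" +
  bracket :: "'b \<Rightarrow> 'b \<Rightarrow> 'b"

text \<open>The scalar \<open>(-1)\<^sup>p\<close>.\<close>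

definition koszul :: "('a, 'x) ring_scheme \<Rightarrow> bit \<Rightarrow> 'a" where
  "koszul R p = (if p = 0 then \<one>\<^bsub>R\<^esub> else \<ominus>\<^bsub>R\<^esub> \<one>\<^bsub>R\<^esub>)"

locale supermodule = module R M for R (structure) and M (structure) +
  assumes gr_submodule: "submodule (gr M p) R M"
    and gr_direct: "x \<in> carrier M \<Longrightarrow>
      \<exists>!y. fst y \<in> gr M 0 \<and> snd y \<in> gr M 1 \<and> x = fst y \<oplus>\<^bsub>M\<^esub> snd y"

definition even_bilinear ::
  "('a, 'x) ring_scheme \<Rightarrow> ('a, 'b, 'z) supermodule_scheme \<Rightarrow> ('b \<Rightarrow> 'b \<Rightarrow> 'b) \<Rightarrow> bool" where
  "even_bilinear R M f \<longleftrightarrow>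
     (\<forall>x\<in>carrier M. \<forall>y\<in>carrier M. f x y \<in> carrier M) \<and>
     (\<forall>x\<in>carrier M. \<forall>x'\<in>carrier M. \<forall>y\<in>carrier M.
        f (x \<oplus>\<^bsub>M\<^esub> x') y = f x y \<oplus>\<^bsub>M\<^esub> f x' y \<and> f y (x \<oplus>\<^bsub>M\<^esub> x') = f y x \<oplus>\<^bsub>M\<^esub> f y x') \<and>
     (\<forall>r\<in>carrier R. \<forall>x\<in>carrier M. \<forall>y\<in>carrier M.
        f (r \<odot>\<^bsub>M\<^esub> x) y = r \<odot>\<^bsub>M\<^esub> f x y \<and> f x (r \<odot>\<^bsub>M\<^esub> y) = r \<odot>\<^bsub>M\<^esub> f x y) \<and>
     (\<forall>p q. \<forall>x\<in>gr M p. \<forall>y\<in>gr M q. f x y \<in> gr M (p + q))"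

locale superdialgebra = supermodule R D for R (structure) and D (structure) +
  assumes lprod_even_bilinear: "even_bilinear R D (\<stileturn>\<^bsub>D\<^esub>)"
    and rprod_even_bilinear: "even_bilinear R D (\<turnstile>\<^bsub>D\<^esub>)"
    and lprod_assoc: "\<lbrakk>a \<in> carrier D; b \<in> carrier D; c \<in> carrier D\<rbrakk> \<Longrightarrow>
      (a \<stileturn>\<^bsub>D\<^esub> b) \<stileturn>\<^bsub>D\<^esub> c = a \<stileturn>\<^bsub>D\<^esub> (b \<stileturn>\<^bsub>D\<^esub> c)"
    and rprod_assoc: "\<lbrakk>a \<in> carrier D; b \<in> carrier D; c \<in> carrier D\<rbrakk> \<Longrightarrow>
      (a \<turnstile>\<^bsub>D\<^esub> b) \<turnstile>\<^bsub>D\<^esub> c = a \<turnstile>\<^bsub>D\<^esub> (b \<turnstile>\<^bsub>D\<^esub> c)"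
    and lprod_lprod_rprod: "\<lbrakk>a \<in> carrier D; b \<in> carrier D; c \<in> carrier D\<rbrakk> \<Longrightarrow>
      a \<stileturn>\<^bsub>D\<^esub> (b \<stileturn>\<^bsub>D\<^esub> c) = a \<stileturn>\<^bsub>D\<^esub> (b \<turnstile>\<^bsub>D\<^esub> c)"
    and rprod_lprod: "\<lbrakk>a \<in> carrier D; b \<in> carrier D; c \<in> carrier D\<rbrakk> \<Longrightarrow>
      (a \<turnstile>\<^bsub>D\<^esub> b) \<stileturn>\<^bsub>D\<^esub> c = a \<turnstile>\<^bsub>D\<^esub> (b \<stileturn>\<^bsub>D\<^esub> c)"
    and lprod_rprod_rprod: "\<lbrakk>a \<in> carrier D; b \<in> carrier D; c \<in> carrier D\<rbrakk> \<Longrightarrow>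
      (a \<stileturn>\<^bsub>D\<^esub> b) \<turnstile>\<^bsub>D\<^esub> c = (a \<turnstile>\<^bsub>D\<^esub> b) \<turnstile>\<^bsub>D\<^esub> c"

locale unital_superdialgebra = superdialgebra +
  assumes bar_unit_even: "\<one>\<^bsub>D\<^esub> \<in> gr D 0"
    and lprod_bar_unit: "a \<in> carrier D \<Longrightarrow> a \<stileturn>\<^bsub>D\<^esub> \<one>\<^bsub>D\<^esub> = a"
    and bar_unit_rprod: "a \<in> carrier D \<Longrightarrow> \<one>\<^bsub>D\<^esub> \<turnstile>\<^bsub>D\<^esub> a = a"

locale leibniz_superalgebra = supermodule R L for R (structure) and L (structure) +
  assumes bracket_even_bilinear: "even_bilinear R L (bracket L)"
    and leibniz_identity: "\<lbrakk>x \<in> carrier L; y \<in> gr L p; z \<in> gr L q\<rbrakk> \<Longrightarrow>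
      bracket L x (bracket L y z) =
        bracket L (bracket L x y) z \<ominus>\<^bsub>L\<^esub> koszul R (p * q) \<odot>\<^bsub>L\<^esub> bracket L (bracket L x z) y"

section \<open>Quotients and direct sums of supermodules\<close>

definition submodule_span ::
  "('a, 'x) ring_scheme \<Rightarrow> ('a, 'b, 'z) module_scheme \<Rightarrow> 'b set \<Rightarrow> 'b set" where
  "submodule_span R M S = \<Inter>{N. submodule N R M \<and> S \<subseteq> N}"

definition dialg_ideal :: "('a, 'x) ring_scheme \<Rightarrow> ('a, 'b, 'z) superdialg_scheme \<Rightarrow> 'b set \<Rightarrow> bool"
  where
  "dialg_ideal R D I \<longleftrightarrow> submodule I R D \<and>
     (\<forall>x\<in>carrier D. \<forall>y\<in>carrier D. x \<in> I \<or> y \<in> I \<longrightarrow> x \<stileturn>\<^bsub>D\<^esub> y \<in> I \<and> x \<turnstile>\<^bsub>D\<^esub> y \<in> I)"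

definition dialg_ideal_generated ::
  "('a, 'x) ring_scheme \<Rightarrow> ('a, 'b, 'z) superdialg_scheme \<Rightarrow> 'b set \<Rightarrow> 'b set" where
  "dialg_ideal_generated R D S = \<Inter>{I. dialg_ideal R D I \<and> S \<subseteq> I}"

definition I_ideal :: "('a, 'x) ring_scheme \<Rightarrow> ('a, 'b, 'z) superdialg_scheme \<Rightarrow> nat \<Rightarrow> 'b set" where
  "I_ideal R D k = dialg_ideal_generated R D
     ({[k] \<cdot>\<^bsub>D\<^esub> a | a. a \<in> carrier D} \<union>
      {a \<stileturn>\<^bsub>D\<^esub> b \<ominus>\<^bsub>D\<^esub> koszul R (p * q) \<odot>\<^bsub>D\<^esub> (b \<turnstile>\<^bsub>D\<^esub> a) | a b p q. a \<in> gr D p \<and> b \<in> gr D q})"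

definition supermodule_quot :: "('a, 'b, 'z) supermodule_scheme \<Rightarrow> 'b set \<Rightarrow> ('a, 'b set) supermodule"
  where
  "supermodule_quot M I = \<lparr>
     carrier = a_rcosets\<^bsub>M\<^esub> I, mult = undefined, one = undefined,
     zero = I, add = set_add M,
     smult = (\<lambda>r X. \<Union>x\<in>X. I +>\<^bsub>M\<^esub> (r \<odot>\<^bsub>M\<^esub> x)),
     gr = (\<lambda>p. (\<lambda>x. I +>\<^bsub>M\<^esub> x) ` gr M p)\<rparr>"

definition dialg_quot ::
  "('a, 'x) ring_scheme \<Rightarrow> ('a, 'b, 'z) superdialg_scheme \<Rightarrow> nat \<Rightarrow> ('a, 'b set) supermodule" where
  "dialg_quot R D k = supermodule_quot D (I_ideal R D k)"

definition supermodule_sum ::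
  "('a, 'b, 'y) supermodule_scheme \<Rightarrow> ('a, 'c, 'z) supermodule_scheme \<Rightarrow> ('a, 'b \<times> 'c) supermodule"
  (infixr \<open>\<oplus>\<^sub>s\<close> 65) where
  "A \<oplus>\<^sub>s B = \<lparr>
     carrier = carrier A \<times> carrier B, mult = undefined, one = undefined,
     zero = (\<zero>\<^bsub>A\<^esub>, \<zero>\<^bsub>B\<^esub>),
     add = (\<lambda>(a, b) (a', b'). (a \<oplus>\<^bsub>A\<^esub> a', b \<oplus>\<^bsub>B\<^esub> b')),
     smult = (\<lambda>r (a, b). (r \<odot>\<^bsub>A\<^esub> a, r \<odot>\<^bsub>B\<^esub> b)),
     gr = (\<lambda>p. gr A p \<times> gr B p)\<rparr>"

definition supermodule_power ::
  "('a, 'b, 'z) supermodule_scheme \<Rightarrow> nat \<Rightarrow> ('a, nat \<Rightarrow> 'b) supermodule" where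
  "supermodule_power A r = \<lparr>
     carrier = {..<r} \<rightarrow>\<^sub>E carrier A, mult = undefined, one = undefined,
     zero = (\<lambda>i\<in>{..<r}. \<zero>\<^bsub>A\<^esub>),
     add = (\<lambda>x y. \<lambda>i\<in>{..<r}. x i \<oplus>\<^bsub>A\<^esub> y i),
     smult = (\<lambda>c x. \<lambda>i\<in>{..<r}. c \<odot>\<^bsub>A\<^esub> x i),
     gr = (\<lambda>p. {..<r} \<rightarrow>\<^sub>E gr A p)\<rparr>"

definition with_bracket ::
  "('a, 'b, 'z) supermodule_scheme \<Rightarrow> ('b \<Rightarrow> 'b \<Rightarrow> 'b) \<Rightarrow> ('a, 'b) leibniz" where
  "with_bracket M br = supermodule.extend (supermodule.truncate M) (leibniz.fields br)"

section \<open>Presentations of Leibniz superalgebras\<close>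

datatype ('a, 'g) lterm =
    Gen 'g
  | TZero
  | TAdd "('a, 'g) lterm" "('a, 'g) lterm"
  | TScale 'a "('a, 'g) lterm"
  | TBr "('a, 'g) lterm" "('a, 'g) lterm"

text \<open>
  \<open>G p\<close> is the set of generators of degree \<open>p\<close>; \<open>hterms R G p\<close> and \<open>lterms R G\<close> are the homogeneous
  terms of degree \<open>p\<close> and all terms over these generators.
\<close>

inductive_set lterms :: "('a, 'x) ring_scheme \<Rightarrow> (bit \<Rightarrow> 'g set) \<Rightarrow> ('a, 'g) lterm set"
  for R :: "('a, 'x) ring_scheme" and G :: "bit \<Rightarrow> 'g set" where
  "g \<in> G p \<Longrightarrow> Gen g \<in> lterms R G"
| "TZero \<in> lterms R G"
| "s \<in> lterms R G \<Longrightarrow> t \<in> lterms R G \<Longrightarrow> TAdd s t \<in> lterms R G"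
| "r \<in> carrier R \<Longrightarrow> t \<in> lterms R G \<Longrightarrow> TScale r t \<in> lterms R G"
| "s \<in> lterms R G \<Longrightarrow> t \<in> lterms R G \<Longrightarrow> TBr s t \<in> lterms R G"

inductive homog_term ::
  "('a, 'x) ring_scheme \<Rightarrow> (bit \<Rightarrow> 'g set) \<Rightarrow> bit \<Rightarrow> ('a, 'g) lterm \<Rightarrow> bool"
  for R :: "('a, 'x) ring_scheme" and G :: "bit \<Rightarrow> 'g set" where
  "g \<in> G p \<Longrightarrow> homog_term R G p (Gen g)"
| "homog_term R G p TZero"
| "homog_term R G p s \<Longrightarrow> homog_term R G p t \<Longrightarrow> homog_term R G p (TAdd s t)"
| "r \<in> carrier R \<Longrightarrow> homog_term R G p t \<Longrightarrow> homog_term R G p (TScale r t)"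
| "homog_term R G p s \<Longrightarrow> homog_term R G q t \<Longrightarrow> homog_term R G (p + q) (TBr s t)"

definition hterms :: "('a, 'x) ring_scheme \<Rightarrow> (bit \<Rightarrow> 'g set) \<Rightarrow> bit \<Rightarrow> ('a, 'g) lterm set" where
  "hterms R G p = {t. homog_term R G p t}"

text \<open>
  The least congruence on terms containing the relations \<open>E\<close> and making the quotient a Leibniz
  superalgebra.
\<close>

inductive_set leibniz_cong ::
  "('a, 'x) ring_scheme \<Rightarrow> (bit \<Rightarrow> 'g set) \<Rightarrow> (('a, 'g) lterm \<times> ('a, 'g) lterm) set \<Rightarrow>
    (('a, 'g) lterm \<times> ('a, 'g) lterm) set"
  for R :: "('a, 'x) ring_scheme" (structure)
    and G :: "bit \<Rightarrow> 'g set"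
    and E :: "(('a, 'g) lterm \<times> ('a, 'g) lterm) set" where
  rel: "(s, t) \<in> E \<Longrightarrow> (s, t) \<in> leibniz_cong R G E"
| refl: "t \<in> lterms R G \<Longrightarrow> (t, t) \<in> leibniz_cong R G E"
| sym: "(s, t) \<in> leibniz_cong R G E \<Longrightarrow> (t, s) \<in> leibniz_cong R G E"
| trans: "(s, t) \<in> leibniz_cong R G E \<Longrightarrow> (t, u) \<in> leibniz_cong R G E \<Longrightarrow>
    (s, u) \<in> leibniz_cong R G E"
| add_cong: "(s, s') \<in> leibniz_cong R G E \<Longrightarrow> (t, t') \<in> leibniz_cong R G E \<Longrightarrow>
    (TAdd s t, TAdd s' t') \<in> leibniz_cong R G E"
| scale_cong: "r \<in> carrier R \<Longrightarrow> (t, t') \<in> leibniz_cong R G E \<Longrightarrow>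
    (TScale r t, TScale r t') \<in> leibniz_cong R G E"
| br_cong: "(s, s') \<in> leibniz_cong R G E \<Longrightarrow> (t, t') \<in> leibniz_cong R G E \<Longrightarrow>
    (TBr s t, TBr s' t') \<in> leibniz_cong R G E"
| add_assoc: "\<lbrakk>s \<in> lterms R G; t \<in> lterms R G; u \<in> lterms R G\<rbrakk> \<Longrightarrow>
    (TAdd (TAdd s t) u, TAdd s (TAdd t u)) \<in> leibniz_cong R G E"
| add_comm: "\<lbrakk>s \<in> lterms R G; t \<in> lterms R G\<rbrakk> \<Longrightarrow>
    (TAdd s t, TAdd t s) \<in> leibniz_cong R G E"
| add_zero: "t \<in> lterms R G \<Longrightarrow> (TAdd TZero t, t) \<in> leibniz_cong R G E"
| scale_zero: "t \<in> lterms R G \<Longrightarrow> (TScale \<zero> t, TZero) \<in> leibniz_cong R G E"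
| scale_one: "t \<in> lterms R G \<Longrightarrow> (TScale \<one> t, t) \<in> leibniz_cong R G E"
| scale_mult: "\<lbrakk>r \<in> carrier R; r' \<in> carrier R; t \<in> lterms R G\<rbrakk> \<Longrightarrow>
    (TScale (r \<otimes> r') t, TScale r (TScale r' t)) \<in> leibniz_cong R G E"
| scale_add_left: "\<lbrakk>r \<in> carrier R; r' \<in> carrier R; t \<in> lterms R G\<rbrakk> \<Longrightarrow>
    (TScale (r \<oplus> r') t, TAdd (TScale r t) (TScale r' t)) \<in> leibniz_cong R G E"
| scale_add_right: "\<lbrakk>r \<in> carrier R; s \<in> lterms R G; t \<in> lterms R G\<rbrakk> \<Longrightarrow>
    (TScale r (TAdd s t), TAdd (TScale r s) (TScale r t)) \<in> leibniz_cong R G E"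
| br_add_left: "\<lbrakk>s \<in> lterms R G; t \<in> lterms R G; u \<in> lterms R G\<rbrakk> \<Longrightarrow>
    (TBr (TAdd s t) u, TAdd (TBr s u) (TBr t u)) \<in> leibniz_cong R G E"
| br_add_right: "\<lbrakk>s \<in> lterms R G; t \<in> lterms R G; u \<in> lterms R G\<rbrakk> \<Longrightarrow>
    (TBr u (TAdd s t), TAdd (TBr u s) (TBr u t)) \<in> leibniz_cong R G E"
| br_scale_left: "\<lbrakk>r \<in> carrier R; s \<in> lterms R G; t \<in> lterms R G\<rbrakk> \<Longrightarrow>
    (TBr (TScale r s) t, TScale r (TBr s t)) \<in> leibniz_cong R G E"
| br_scale_right: "\<lbrakk>r \<in> carrier R; s \<in> lterms R G; t \<in> lterms R G\<rbrakk> \<Longrightarrow>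
    (TBr s (TScale r t), TScale r (TBr s t)) \<in> leibniz_cong R G E"
| leibniz: "\<lbrakk>s \<in> lterms R G; t \<in> hterms R G p; u \<in> hterms R G q\<rbrakk> \<Longrightarrow>
    (TBr s (TBr t u), TAdd (TBr (TBr s t) u) (TScale (\<ominus> koszul R (p * q)) (TBr (TBr s u) t)))
      \<in> leibniz_cong R G E"

definition presented_leibniz ::
  "('a, 'x) ring_scheme \<Rightarrow> (bit \<Rightarrow> 'g set) \<Rightarrow> (('a, 'g) lterm \<times> ('a, 'g) lterm) set \<Rightarrow>
    ('a, ('a, 'g) lterm set) leibniz" where
  "presented_leibniz R G E = \<lparr>
     carrier = lterms R G // leibniz_cong R G E, mult = undefined, one = undefined,
     zero = leibniz_cong R G E `` {TZero},
     add = (\<lambda>X Y. \<Union>s\<in>X. \<Union>t\<in>Y. leibniz_cong R G E `` {TAdd s t}),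
     smult = (\<lambda>r X. \<Union>t\<in>X. leibniz_cong R G E `` {TScale r t}),
     gr = (\<lambda>p. hterms R G p // leibniz_cong R G E),
     bracket = (\<lambda>X Y. \<Union>s\<in>X. \<Union>t\<in>Y. leibniz_cong R G E `` {TBr s t})\<rparr>"

section \<open>Universal central extensions\<close>

definition centre :: "('a, 'b) leibniz \<Rightarrow> 'b set" where
  "centre L = {z \<in> carrier L. \<forall>x\<in>carrier L. bracket L z x = \<zero>\<^bsub>L\<^esub> \<and> bracket L x z = \<zero>\<^bsub>L\<^esub>}"

definition leibniz_hom ::
  "('a, 'x) ring_scheme \<Rightarrow> ('a, 'b) leibniz \<Rightarrow> ('a, 'c) leibniz \<Rightarrow> ('b \<Rightarrow> 'c) set" where
  "leibniz_hom R L M = {f \<in> carrier L \<rightarrow> carrier M.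
     (\<forall>x\<in>carrier L. \<forall>y\<in>carrier L. f (x \<oplus>\<^bsub>L\<^esub> y) = f x \<oplus>\<^bsub>M\<^esub> f y) \<and>
     (\<forall>r\<in>carrier R. \<forall>x\<in>carrier L. f (r \<odot>\<^bsub>L\<^esub> x) = r \<odot>\<^bsub>M\<^esub> f x) \<and>
     (\<forall>p. \<forall>x\<in>gr L p. f x \<in> gr M p) \<and>
     (\<forall>x\<in>carrier L. \<forall>y\<in>carrier L. f (bracket L x y) = bracket M (f x) (f y))}"

definition central_extension ::
  "('a, 'x) ring_scheme \<Rightarrow> ('a, 'm) leibniz \<Rightarrow> ('a, 'l) leibniz \<Rightarrow> ('m \<Rightarrow> 'l) \<Rightarrow> bool" where
  "central_extension R M L \<phi> \<longleftrightarrow>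
     leibniz_superalgebra R M \<and> leibniz_superalgebra R L \<and> \<phi> \<in> leibniz_hom R M L \<and>
     \<phi> ` carrier M = carrier L \<and> a_kernel M L \<phi> \<subseteq> centre M"

text \<open>
  HOL formulas cannot quantify over types, so \<open>M\<close> ranges over the central extensions carried by one
  type, chosen large enough that nothing is lost: by \<open>universal_central_extension_any_type\<close>
  below, the universal property for this type implies the same property for every type. The reason
  is that existence and uniqueness of \<open>f\<close> only involve the subalgebra of \<open>M\<close> generated by lifts of the
  elements of \<open>L\<close> and the images of \<open>U\<close> under two homomorphisms, which is a set of values of terms.
  Homomorphisms are compared on the carrier only, hence the restriction to extensional functions.
\<close>

definition universal_central_extension ::
  "('a, 'x) ring_scheme \<Rightarrow> ('a, 'u) leibniz \<Rightarrow> ('a, 'l) leibniz \<Rightarrow> ('u \<Rightarrow> 'l) \<Rightarrow> bool" where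
  "universal_central_extension R U L \<uu> \<longleftrightarrow>
     central_extension R U L \<uu> \<and>
     (\<forall>(M :: ('a, ('a, 'l + 'u + 'u) lterm) leibniz) \<phi>. central_extension R M L \<phi> \<longrightarrow>
       (\<exists>!f. f \<in> leibniz_hom R U M \<inter> extensional (carrier U) \<and> (\<forall>x\<in>carrier U. \<uu> x = \<phi> (f x))))"

subsection \<open>Independence of the type of the test objects\<close>

definition transport :: "('a, 'm) leibniz \<Rightarrow> ('t \<Rightarrow> 'm) \<Rightarrow> 't set \<Rightarrow> ('a, 't) leibniz" where
  "transport M h C = \<lparr>
     carrier = C, mult = undefined, one = undefined,
     zero = inv_into C h \<zero>\<^bsub>M\<^esub>,
     add = (\<lambda>x y. inv_into C h (h x \<oplus>\<^bsub>M\<^esub> h y)),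
     smult = (\<lambda>r x. inv_into C h (r \<odot>\<^bsub>M\<^esub> h x)),
     gr = (\<lambda>p. {x \<in> C. h x \<in> gr M p}),
     bracket = (\<lambda>x y. inv_into C h (bracket M (h x) (h y)))\<rparr>"

lemma even_bilinearD:
  assumes "even_bilinear R M f"
  shows "x \<in> carrier M \<Longrightarrow> y \<in> carrier M \<Longrightarrow> f x y \<in> carrier M"
    and "x \<in> carrier M \<Longrightarrow> x' \<in> carrier M \<Longrightarrow> y \<in> carrier M \<Longrightarrow> f (x \<oplus>\<^bsub>M\<^esub> x') y = f x y \<oplus>\<^bsub>M\<^esub> f x' y"
    and "x \<in> carrier M \<Longrightarrow> x' \<in> carrier M \<Longrightarrow> y \<in> carrier M \<Longrightarrow> f y (x \<oplus>\<^bsub>M\<^esub> x') = f y x \<oplus>\<^bsub>M\<^esub> f y x'"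
    and "r \<in> carrier R \<Longrightarrow> x \<in> carrier M \<Longrightarrow> y \<in> carrier M \<Longrightarrow> f (r \<odot>\<^bsub>M\<^esub> x) y = r \<odot>\<^bsub>M\<^esub> f x y"
    and "r \<in> carrier R \<Longrightarrow> x \<in> carrier M \<Longrightarrow> y \<in> carrier M \<Longrightarrow> f x (r \<odot>\<^bsub>M\<^esub> y) = r \<odot>\<^bsub>M\<^esub> f x y"
    and "x \<in> gr M p \<Longrightarrow> y \<in> gr M q \<Longrightarrow> f x y \<in> gr M (p + q)"
  using assms unfolding even_bilinear_def by blast+

context supermodule
begin

lemma gr_carrier: "x \<in> gr M p \<Longrightarrow> x \<in> carrier M"
  using submoduleE(1)[OF gr_submodule] by blast

lemma gr_zero: "\<zero>\<^bsub>M\<^esub> \<in> gr M p"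
  using gr_submodule[of p] unfolding submodule_def subgroup_def by simp

lemma gr_add: "x \<in> gr M p \<Longrightarrow> y \<in> gr M p \<Longrightarrow> x \<oplus>\<^bsub>M\<^esub> y \<in> gr M p"
  using submoduleE(5)[OF gr_submodule] by blast

lemma gr_smult: "r \<in> carrier R \<Longrightarrow> x \<in> gr M p \<Longrightarrow> r \<odot>\<^bsub>M\<^esub> x \<in> gr M p"
  using submoduleE(4)[OF gr_submodule] by blast

lemma gr_decomp:
  assumes "x \<in> carrier M"
  obtains a b where "a \<in> gr M 0" "b \<in> gr M 1" "x = a \<oplus>\<^bsub>M\<^esub> b"
  using gr_direct[OF assms] by auto

lemma gr_unique:
  assumes "a \<in> gr M 0" "b \<in> gr M 1" "a' \<in> gr M 0" "b' \<in> gr M 1" "a \<oplus>\<^bsub>M\<^esub> b = a' \<oplus>\<^bsub>M\<^esub> b'"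
  shows "a = a' \<and> b = b'"
proof -
  have "a \<oplus>\<^bsub>M\<^esub> b \<in> carrier M"
    using assms gr_carrier by auto
  from gr_direct[OF this] have "(a, b) = (a', b')"
    using assms by (metis fst_conv snd_conv)
  then show ?thesis by simp
qed

end

lemma bit_cases01: "(p::bit) = 0 \<or> p = 1"
  by (cases p) auto

lemma leibniz_homD:
  assumes "f \<in> leibniz_hom R L M"
  shows "x \<in> carrier L \<Longrightarrow> f x \<in> carrier M"
    and "x \<in> carrier L \<Longrightarrow> y \<in> carrier L \<Longrightarrow> f (x \<oplus>\<^bsub>L\<^esub> y) = f x \<oplus>\<^bsub>M\<^esub> f y"
    and "r \<in> carrier R \<Longrightarrow> x \<in> carrier L \<Longrightarrow> f (r \<odot>\<^bsub>L\<^esub> x) = r \<odot>\<^bsub>M\<^esub> f x"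
    and "x \<in> gr L p \<Longrightarrow> f x \<in> gr M p"
    and "x \<in> carrier L \<Longrightarrow> y \<in> carrier L \<Longrightarrow> f (bracket L x y) = bracket M (f x) (f y)"
  using assms unfolding leibniz_hom_def by auto

lemma leibniz_hom_zero:
  assumes L: "leibniz_superalgebra R L" and M: "leibniz_superalgebra R M"
    and f: "f \<in> leibniz_hom R L M"
  shows "f \<zero>\<^bsub>L\<^esub> = \<zero>\<^bsub>M\<^esub>"
proof -
  interpret L: leibniz_superalgebra R L by fact
  interpret M: leibniz_superalgebra R M by fact
  have "\<zero>\<^bsub>R\<^esub> \<odot>\<^bsub>L\<^esub> \<zero>\<^bsub>L\<^esub> = \<zero>\<^bsub>L\<^esub>" by simp
  then have "f \<zero>\<^bsub>L\<^esub> = \<zero>\<^bsub>R\<^esub> \<odot>\<^bsub>M\<^esub> f \<zero>\<^bsub>L\<^esub>"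
    using leibniz_homD(3)[OF f, of "\<zero>\<^bsub>R\<^esub>" "\<zero>\<^bsub>L\<^esub>"] by simp
  then show ?thesis
    using leibniz_homD(1)[OF f, of "\<zero>\<^bsub>L\<^esub>"] by simp
qed

lemma leibniz_hom_comp:
  assumes "f \<in> leibniz_hom R L M" and "g \<in> leibniz_hom R M N"
  shows "g \<circ> f \<in> leibniz_hom R L N"
  using assms unfolding leibniz_hom_def by (auto simp: Pi_iff)

lemma leibniz_hom_cong:
  assumes L: "leibniz_superalgebra R L"
    and f: "f \<in> leibniz_hom R L M" and eq: "\<And>x. x \<in> carrier L \<Longrightarrow> g x = f x"
  shows "g \<in> leibniz_hom R L M"
proof -
  interpret L: leibniz_superalgebra R L by fact
  note D = leibniz_homD[OF f]
  have bc: "\<And>x y. x \<in> carrier L \<Longrightarrow> y \<in> carrier L \<Longrightarrow> bracket L x y \<in> carrier L"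
    using even_bilinearD(1)[OF L.bracket_even_bilinear] .
  show ?thesis
    unfolding leibniz_hom_def using D L.gr_carrier bc by (auto simp: eq)
qed

lemma koszul_closed: "cring R \<Longrightarrow> koszul R p \<in> carrier R"
proof -
  assume "cring R"
  then interpret cring R .
  show ?thesis by (simp add: koszul_def)
qed

lemma minus_smult:
  assumes "leibniz_superalgebra R M" and "x \<in> carrier M" "y \<in> carrier M" "c \<in> carrier R"
  shows "x \<ominus>\<^bsub>M\<^esub> c \<odot>\<^bsub>M\<^esub> y = x \<oplus>\<^bsub>M\<^esub> (\<ominus>\<^bsub>R\<^esub> c) \<odot>\<^bsub>M\<^esub> y"
proof -
  interpret M: leibniz_superalgebra R M by fact
  show ?thesis using assms by (simp add: M.smult_l_minus M.minus_eq)
qed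

lemma transport_leibniz:
  fixes R :: "('a, 'x) ring_scheme" and M :: "('a, 'm) leibniz" and h :: "'t \<Rightarrow> 'm"
  assumes M: "leibniz_superalgebra R M" and inj: "inj_on h C"
    and sub: "h ` C \<subseteq> carrier M" and zero: "\<zero>\<^bsub>M\<^esub> \<in> h ` C"
    and add: "\<And>x y. x \<in> h ` C \<Longrightarrow> y \<in> h ` C \<Longrightarrow> x \<oplus>\<^bsub>M\<^esub> y \<in> h ` C"
    and smult: "\<And>r x. r \<in> carrier R \<Longrightarrow> x \<in> h ` C \<Longrightarrow> r \<odot>\<^bsub>M\<^esub> x \<in> h ` C"
    and br: "\<And>x y. x \<in> h ` C \<Longrightarrow> y \<in> h ` C \<Longrightarrow> bracket M x y \<in> h ` C"
    and decomp: "\<And>x. x \<in> h ` C \<Longrightarrow>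
      \<exists>a\<in>gr M 0 \<inter> h ` C. \<exists>b\<in>gr M 1 \<inter> h ` C. x = a \<oplus>\<^bsub>M\<^esub> b"
  shows "leibniz_superalgebra R (transport M h C)" and "h \<in> leibniz_hom R (transport M h C) M"
proof -
  interpret M: leibniz_superalgebra R M by fact
  let ?N = "transport M h C"
  let ?g = "inv_into C h"
  have car: "carrier ?N = C" by (simp add: transport_def)
  have g: "\<And>s. s \<in> h ` C \<Longrightarrow> ?g s \<in> C" "\<And>s. s \<in> h ` C \<Longrightarrow> h (?g s) = s"
    by (auto intro: inv_into_into f_inv_into_f)
  have hc: "\<And>x. x \<in> C \<Longrightarrow> h x \<in> carrier M" using sub by auto
  have eqI: "\<And>x y. x \<in> C \<Longrightarrow> y \<in> C \<Longrightarrow> h x = h y \<Longrightarrow> x = y"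
    using inj by (auto dest: inj_onD)
  have z: "\<zero>\<^bsub>?N\<^esub> \<in> C" "h \<zero>\<^bsub>?N\<^esub> = \<zero>\<^bsub>M\<^esub>"
    using g[OF zero] by (auto simp: transport_def)
  have a: "x \<oplus>\<^bsub>?N\<^esub> y \<in> C" "h (x \<oplus>\<^bsub>?N\<^esub> y) = h x \<oplus>\<^bsub>M\<^esub> h y" if "x \<in> C" "y \<in> C" for x y
    using g[OF add, of "h x" "h y"] that by (auto simp: transport_def)
  have s: "r \<odot>\<^bsub>?N\<^esub> x \<in> C" "h (r \<odot>\<^bsub>?N\<^esub> x) = r \<odot>\<^bsub>M\<^esub> h x" if "r \<in> carrier R" "x \<in> C" for r x
    using g[OF smult, of r "h x"] that by (auto simp: transport_def)
  have b: "bracket ?N x y \<in> C" "h (bracket ?N x y) = bracket M (h x) (h y)"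
    if "x \<in> C" "y \<in> C" for x y
    using g[OF br, of "h x" "h y"] that by (auto simp: transport_def)
  have gr: "gr ?N p = {x \<in> C. h x \<in> gr M p}" for p by (simp add: transport_def)
  have m1: "\<ominus>\<^bsub>R\<^esub> \<one>\<^bsub>R\<^esub> \<in> carrier R" by simp
  have ag: "abelian_group ?N"
  proof (rule abelian_groupI, unfold car)
    fix x assume x: "x \<in> C"
    have "(\<ominus>\<^bsub>R\<^esub> \<one>\<^bsub>R\<^esub>) \<odot>\<^bsub>M\<^esub> h x \<oplus>\<^bsub>M\<^esub> h x = \<zero>\<^bsub>M\<^esub>"
      using hc[OF x] by (simp add: M.smult_l_minus M.l_neg)
    then have "(\<ominus>\<^bsub>R\<^esub> \<one>\<^bsub>R\<^esub>) \<odot>\<^bsub>?N\<^esub> x \<oplus>\<^bsub>?N\<^esub> x = \<zero>\<^bsub>?N\<^esub>"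
      by (intro eqI) (simp_all add: x s[OF m1] a z)
    then show "\<exists>y\<in>C. y \<oplus>\<^bsub>?N\<^esub> x = \<zero>\<^bsub>?N\<^esub>" using s(1)[OF m1 x] by blast
  next
    fix x y u assume "x \<in> C" "y \<in> C" "u \<in> C"
    then show "x \<oplus>\<^bsub>?N\<^esub> y \<oplus>\<^bsub>?N\<^esub> u = x \<oplus>\<^bsub>?N\<^esub> (y \<oplus>\<^bsub>?N\<^esub> u)"
      by (intro eqI) (simp_all add: a hc M.a_assoc)
  next
    fix x y assume "x \<in> C" "y \<in> C"
    then show "x \<oplus>\<^bsub>?N\<^esub> y = y \<oplus>\<^bsub>?N\<^esub> x"
      by (intro eqI) (simp_all add: a hc M.a_comm)
  next
    fix x assume "x \<in> C"
    then show "\<zero>\<^bsub>?N\<^esub> \<oplus>\<^bsub>?N\<^esub> x = x"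
      by (intro eqI) (simp_all add: a z hc)
  qed (auto simp: a z)
  have mod: "module R ?N"
  proof (rule moduleI, unfold car)
    show "cring R" by (rule M.is_cring)
    show "abelian_group ?N" by (rule ag)
  next
    fix x assume "x \<in> C"
    then show "\<one>\<^bsub>R\<^esub> \<odot>\<^bsub>?N\<^esub> x = x" by (intro eqI) (simp_all add: s hc)
  qed (auto intro!: eqI simp: a s hc M.smult_l_distr M.smult_r_distr M.smult_assoc1)
  have sup: "supermodule R ?N"
  proof (intro supermodule.intro mod supermodule_axioms.intro)
    fix p
    show "submodule (gr ?N p) R ?N"
    proof (rule module.submoduleI[OF mod])
      fix x assume x: "x \<in> gr ?N p"
      then have xC: "x \<in> C" by (simp add: gr)
      interpret N: module R ?N by (rule mod)
      have "\<ominus>\<^bsub>?N\<^esub> x = (\<ominus>\<^bsub>R\<^esub> \<one>\<^bsub>R\<^esub>) \<odot>\<^bsub>?N\<^esub> x"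
        using xC by (simp add: N.smult_l_minus car)
      then show "\<ominus>\<^bsub>?N\<^esub> x \<in> gr ?N p"
        using x s[OF m1 xC] M.gr_smult[OF m1] by (simp add: gr)
    qed (auto simp: gr car z a s M.gr_zero M.gr_add M.gr_smult)
  next
    fix x assume "x \<in> carrier ?N"
    then have x: "x \<in> C" by (simp add: car)
    then obtain u v where uv: "u \<in> C" "v \<in> C" "h u \<in> gr M 0" "h v \<in> gr M 1" "h x = h u \<oplus>\<^bsub>M\<^esub> h v"
      using decomp[of "h x"] by blast
    show "\<exists>!y. fst y \<in> gr ?N 0 \<and> snd y \<in> gr ?N 1 \<and> x = fst y \<oplus>\<^bsub>?N\<^esub> snd y"
    proof (rule ex1I[of _ "(u, v)"])
      have "x = u \<oplus>\<^bsub>?N\<^esub> v" by (rule eqI) (simp_all add: x uv a)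
      then show "fst (u, v) \<in> gr ?N 0 \<and> snd (u, v) \<in> gr ?N 1 \<and> x = fst (u, v) \<oplus>\<^bsub>?N\<^esub> snd (u, v)"
        using uv by (simp add: gr)
    next
      fix y assume y: "fst y \<in> gr ?N 0 \<and> snd y \<in> gr ?N 1 \<and> x = fst y \<oplus>\<^bsub>?N\<^esub> snd y"
      then have yC: "fst y \<in> C" "snd y \<in> C" "h (fst y) \<in> gr M 0" "h (snd y) \<in> gr M 1"
        by (auto simp: gr)
      have "h x = h (fst y) \<oplus>\<^bsub>M\<^esub> h (snd y)" using y a(2)[OF yC(1,2)] by metis
      then have "h (fst y) \<oplus>\<^bsub>M\<^esub> h (snd y) = h u \<oplus>\<^bsub>M\<^esub> h v" using uv(5) by (rule subst)
      then have "h (fst y) = h u \<and> h (snd y) = h v"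
        by (rule M.gr_unique[OF yC(3,4) uv(3,4)])
      then have "fst y = u" "snd y = v" using eqI uv yC by auto
      then show "y = (u, v)" by (cases y) simp
    qed
  qed
  note B = even_bilinearD[OF M.bracket_even_bilinear]
  show leib: "leibniz_superalgebra R ?N"
  proof (intro leibniz_superalgebra.intro sup leibniz_superalgebra_axioms.intro)
    show "even_bilinear R ?N (bracket ?N)"
      unfolding even_bilinear_def car
    proof (intro conjI ballI allI)
      fix p q x y assume "x \<in> gr ?N p" "y \<in> gr ?N q"
      then show "bracket ?N x y \<in> gr ?N (p + q)"
        using B(6)[of "h x" p "h y" q] by (simp only: gr mem_Collect_eq b)
    qed (auto intro!: eqI simp: a b s hc B)
  next
    interpret N: supermodule R ?N by (rule sup)
    fix x y u p q assume "x \<in> carrier ?N" "y \<in> gr ?N p" "u \<in> gr ?N q"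
    then have xyu: "x \<in> C" "y \<in> C" "u \<in> C" "h y \<in> gr M p" "h u \<in> gr M q"
      by (auto simp: car gr)
    let ?k = "koszul R (p * q)"
    have k: "?k \<in> carrier R" by (rule koszul_closed[OF M.is_cring])
    then have k': "\<ominus>\<^bsub>R\<^esub> ?k \<in> carrier R" by simp
    have "bracket ?N (bracket ?N x y) u \<ominus>\<^bsub>?N\<^esub> ?k \<odot>\<^bsub>?N\<^esub> bracket ?N (bracket ?N x u) y =
        bracket ?N (bracket ?N x y) u \<oplus>\<^bsub>?N\<^esub> (\<ominus>\<^bsub>R\<^esub> ?k) \<odot>\<^bsub>?N\<^esub> bracket ?N (bracket ?N x u) y"
      using xyu k by (simp add: N.smult_l_minus N.minus_eq car b)
    moreover have "bracket ?N x (bracket ?N y u) = \<dots>"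
    proof (rule eqI)
      have "bracket M (h x) (bracket M (h y) (h u)) =
          bracket M (bracket M (h x) (h y)) (h u) \<ominus>\<^bsub>M\<^esub> ?k \<odot>\<^bsub>M\<^esub> bracket M (bracket M (h x) (h u)) (h y)"
        using M.leibniz_identity[of "h x" "h y" p "h u" q] xyu hc by simp
      then show "h (bracket ?N x (bracket ?N y u)) = h (bracket ?N (bracket ?N x y) u \<oplus>\<^bsub>?N\<^esub>
          (\<ominus>\<^bsub>R\<^esub> ?k) \<odot>\<^bsub>?N\<^esub> bracket ?N (bracket ?N x u) y)"
        using xyu k k' by (simp add: a b s hc B(1) minus_smult[OF M])
    qed (use xyu k' in \<open>simp_all add: a b s\<close>)
    ultimately show "bracket ?N x (bracket ?N y u) =
        bracket ?N (bracket ?N x y) u \<ominus>\<^bsub>?N\<^esub> ?k \<odot>\<^bsub>?N\<^esub> bracket ?N (bracket ?N x u) y" by simp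
  qed
  show "h \<in> leibniz_hom R ?N M"
    unfolding leibniz_hom_def car by (auto simp: a b s hc gr)
qed

primrec lterm_eval :: "('a, 'm) leibniz \<Rightarrow> ('g \<Rightarrow> 'm) \<Rightarrow> ('a, 'g) lterm \<Rightarrow> 'm" where
  "lterm_eval M e (Gen g) = e g"
| "lterm_eval M e TZero = \<zero>\<^bsub>M\<^esub>"
| "lterm_eval M e (TAdd s t) = lterm_eval M e s \<oplus>\<^bsub>M\<^esub> lterm_eval M e t"
| "lterm_eval M e (TScale r t) = r \<odot>\<^bsub>M\<^esub> lterm_eval M e t"
| "lterm_eval M e (TBr s t) = bracket M (lterm_eval M e s) (lterm_eval M e t)"

lemma lterm_eval_closed:
  assumes M: "leibniz_superalgebra R M" and e: "\<And>p g. g \<in> G p \<Longrightarrow> e g \<in> gr M p"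
    and t: "t \<in> lterms R G"
  shows "lterm_eval M e t \<in> carrier M"
proof -
  interpret M: leibniz_superalgebra R M by fact
  show ?thesis using t
    by induction (auto intro: M.gr_carrier e even_bilinearD(1)[OF M.bracket_even_bilinear])
qed

lemma lterm_eval_decomp:
  assumes M: "leibniz_superalgebra R M" and e: "\<And>p g. g \<in> G p \<Longrightarrow> e g \<in> gr M p"
    and t: "t \<in> lterms R G"
  shows "\<exists>u\<in>gr M 0 \<inter> lterm_eval M e ` lterms R G. \<exists>v\<in>gr M 1 \<inter> lterm_eval M e ` lterms R G.
    lterm_eval M e t = u \<oplus>\<^bsub>M\<^esub> v"
proof -
  interpret M: leibniz_superalgebra R M by fact
  let ?ev = "lterm_eval M e" and ?T = "lterms R G"
  let ?S = "?ev ` ?T"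
  note B = even_bilinearD[OF M.bracket_even_bilinear]
  have zS: "\<zero>\<^bsub>M\<^esub> \<in> ?S" by (rule image_eqI[of _ _ TZero]) (auto intro: lterms.intros)
  have aS: "x \<oplus>\<^bsub>M\<^esub> y \<in> ?S" if "x \<in> ?S" "y \<in> ?S" for x y
    using that by (auto intro!: image_eqI[of _ ?ev "TAdd _ _"] lterms.intros)
  have sS: "r \<odot>\<^bsub>M\<^esub> x \<in> ?S" if "r \<in> carrier R" "x \<in> ?S" for r x
    using that by (auto intro!: image_eqI[of _ ?ev "TScale _ _"] lterms.intros)
  have bS: "bracket M x y \<in> ?S" if "x \<in> ?S" "y \<in> ?S" for x y
    using that by (auto intro!: image_eqI[of _ ?ev "TBr _ _"] lterms.intros)
  show ?thesis using t
  proof induction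
    case (1 g p)
    have c: "e g \<in> carrier M" and gS: "e g \<in> ?S"
      using M.gr_carrier e[OF 1] 1 by (auto intro!: image_eqI[of _ ?ev "Gen g"] lterms.intros)
    show ?case
    proof (cases "p = 0")
      case True
      then show ?thesis using e[OF 1] gS zS c M.gr_zero
        by (intro bexI[of _ "e g"] bexI[of _ "\<zero>\<^bsub>M\<^esub>"]) auto
    next
      case False
      then have "p = 1" using bit_cases01 by blast
      then show ?thesis using e[OF 1] gS zS c M.gr_zero
        by (intro bexI[of _ "e g"] bexI[of _ "\<zero>\<^bsub>M\<^esub>"]) auto
    qed
  next
    case 2
    show ?case using zS M.gr_zero by (intro bexI[of _ "\<zero>\<^bsub>M\<^esub>"]) auto
  next
    case (3 s t)
    then obtain u v u' v' where uv: "u \<in> gr M 0 \<inter> ?S" "v \<in> gr M 1 \<inter> ?S" "?ev s = u \<oplus>\<^bsub>M\<^esub> v"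
      "u' \<in> gr M 0 \<inter> ?S" "v' \<in> gr M 1 \<inter> ?S" "?ev t = u' \<oplus>\<^bsub>M\<^esub> v'" by blast
    have c: "u \<in> carrier M" "v \<in> carrier M" "u' \<in> carrier M" "v' \<in> carrier M"
      using uv M.gr_carrier by blast+
    have "?ev (TAdd s t) = (u \<oplus>\<^bsub>M\<^esub> u') \<oplus>\<^bsub>M\<^esub> (v \<oplus>\<^bsub>M\<^esub> v')"
      using uv c by (simp add: M.a_ac)
    moreover have "u \<oplus>\<^bsub>M\<^esub> u' \<in> gr M 0 \<inter> ?S" "v \<oplus>\<^bsub>M\<^esub> v' \<in> gr M 1 \<inter> ?S"
      using uv aS M.gr_add by blast+
    ultimately show ?case by blast
  next
    case (4 r t)
    then obtain u v where uv: "u \<in> gr M 0 \<inter> ?S" "v \<in> gr M 1 \<inter> ?S" "?ev t = u \<oplus>\<^bsub>M\<^esub> v" by blast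
    have c: "u \<in> carrier M" "v \<in> carrier M" using uv M.gr_carrier by blast+
    have "?ev (TScale r t) = (r \<odot>\<^bsub>M\<^esub> u) \<oplus>\<^bsub>M\<^esub> (r \<odot>\<^bsub>M\<^esub> v)"
      using uv c 4 by (simp add: M.smult_r_distr)
    moreover have "r \<odot>\<^bsub>M\<^esub> u \<in> gr M 0 \<inter> ?S" "r \<odot>\<^bsub>M\<^esub> v \<in> gr M 1 \<inter> ?S"
      using uv sS 4 M.gr_smult by blast+
    ultimately show ?case by blast
  next
    case (5 s t)
    then obtain u v u' v' where uv: "u \<in> gr M 0 \<inter> ?S" "v \<in> gr M 1 \<inter> ?S" "?ev s = u \<oplus>\<^bsub>M\<^esub> v"
      "u' \<in> gr M 0 \<inter> ?S" "v' \<in> gr M 1 \<inter> ?S" "?ev t = u' \<oplus>\<^bsub>M\<^esub> v'" by blast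
    have c: "u \<in> carrier M" "v \<in> carrier M" "u' \<in> carrier M" "v' \<in> carrier M"
      using uv M.gr_carrier by blast+
    let ?b = "bracket M"
    have "?ev (TBr s t) = (?b u u' \<oplus>\<^bsub>M\<^esub> ?b v v') \<oplus>\<^bsub>M\<^esub> (?b u v' \<oplus>\<^bsub>M\<^esub> ?b v u')"
      using uv c by (simp add: B M.a_ac)
    moreover have "?b u u' \<in> gr M 0" "?b v v' \<in> gr M 0" "?b u v' \<in> gr M 1" "?b v u' \<in> gr M 1"
      using uv B(6)[of u 0 u' 0] B(6)[of v 1 v' 1] B(6)[of u 0 v' 1] B(6)[of v 1 u' 0] by auto
    then have "?b u u' \<oplus>\<^bsub>M\<^esub> ?b v v' \<in> gr M 0 \<inter> ?S" "?b u v' \<oplus>\<^bsub>M\<^esub> ?b v u' \<in> gr M 1 \<inter> ?S"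
      using uv by (intro IntI M.gr_add aS bS; simp)+
    ultimately show ?case by blast
  qed
qed

lemma central_extension_small:
  fixes R :: "('a, 'x) ring_scheme" and M :: "('a, 'm) leibniz" and L :: "('a, 'l) leibniz"
    and U :: "('a, 'u) leibniz"
  assumes U: "leibniz_superalgebra R U" and ce: "central_extension R M L \<phi>"
    and f: "f \<in> leibniz_hom R U M" and g: "g \<in> leibniz_hom R U M"
  obtains N :: "('a, ('a, 'l + 'u + 'u) lterm) leibniz" and \<iota>
  where "\<iota> \<in> leibniz_hom R N M" "inj_on \<iota> (carrier N)" "central_extension R N L (\<phi> \<circ> \<iota>)"
    and "\<And>p x. x \<in> carrier N \<Longrightarrow> \<iota> x \<in> gr M p \<Longrightarrow> x \<in> gr N p"
    and "f ` carrier U \<subseteq> \<iota> ` carrier N" "g ` carrier U \<subseteq> \<iota> ` carrier N"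
proof -
  have M: "leibniz_superalgebra R M" and L: "leibniz_superalgebra R L"
    and phi: "\<phi> \<in> leibniz_hom R M L" and surj: "\<phi> ` carrier M = carrier L"
    and ker: "a_kernel M L \<phi> \<subseteq> centre M"
    using ce by (auto simp: central_extension_def)
  interpret M: leibniz_superalgebra R M by fact
  interpret L: leibniz_superalgebra R L by fact
  interpret U: leibniz_superalgebra R U by fact
  note P = leibniz_homD[OF phi]
  have lift: "\<exists>m. (\<exists>q. m \<in> gr M q) \<and> \<phi> m = l" if l: "l \<in> gr L p" for l p
  proof -
    obtain m where m: "m \<in> carrier M" "\<phi> m = l"
      using surj L.gr_carrier[OF l] by (metis imageE)
    obtain a b where ab: "a \<in> gr M 0" "b \<in> gr M 1" "m = a \<oplus>\<^bsub>M\<^esub> b"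
      using M.gr_decomp[OF m(1)] by blast
    have c: "a \<in> carrier M" "b \<in> carrier M" using ab M.gr_carrier by auto
    have lc: "l \<in> carrier L" using L.gr_carrier[OF l] .
    have e: "\<phi> a \<oplus>\<^bsub>L\<^esub> \<phi> b = l" using m ab P(2)[OF c] by simp
    have d: "\<phi> a \<in> gr L 0" "\<phi> b \<in> gr L 1" using P(4) ab by auto
    show ?thesis
    proof (cases "p = 0")
      case True
      then have "\<phi> a = l"
        using L.gr_unique[of "\<phi> a" "\<phi> b" l "\<zero>\<^bsub>L\<^esub>"] d e l lc L.gr_zero by simp
      then show ?thesis using ab by blast
    next
      case False
      then have "p = 1" using bit_cases01 by blast
      then have "\<phi> b = l"
        using L.gr_unique[of "\<phi> a" "\<phi> b" "\<zero>\<^bsub>L\<^esub>" l] d e l lc L.gr_zero by simp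
      then show ?thesis using ab by blast
    qed
  qed
  define s where "s l = (SOME m. (\<exists>q. m \<in> gr M q) \<and> \<phi> m = l)" for l
  have s: "\<exists>q. s l \<in> gr M q" "\<phi> (s l) = l" if "l \<in> gr L p" for l p
    using someI_ex[OF lift[OF that]] unfolding s_def by auto
  define e where "e = case_sum s (case_sum f g)"
  define G where "G p = {x. e x \<in> gr M p}" for p
  have eG: "\<And>p x. x \<in> G p \<Longrightarrow> e x \<in> gr M p" by (simp add: G_def)
  let ?ev = "lterm_eval M e" and ?T = "lterms R G :: ('a, 'l + 'u + 'u) lterm set"
  let ?S = "?ev ` ?T"
  obtain C where C: "C \<subseteq> ?T" "inj_on ?ev C" "?ev ` C = ?S"
    using subset_image_inj[of ?S ?ev ?T] by auto
  let ?N = "transport M ?ev C"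
  have zS: "\<zero>\<^bsub>M\<^esub> \<in> ?S" by (rule image_eqI[of _ _ TZero]) (auto intro: lterms.intros)
  have aS: "x \<oplus>\<^bsub>M\<^esub> y \<in> ?S" if "x \<in> ?S" "y \<in> ?S" for x y
    using that by (auto intro!: image_eqI[of _ ?ev "TAdd _ _"] lterms.intros)
  have sS: "r \<odot>\<^bsub>M\<^esub> x \<in> ?S" if "r \<in> carrier R" "x \<in> ?S" for r x
    using that by (auto intro!: image_eqI[of _ ?ev "TScale _ _"] lterms.intros)
  have bS: "bracket M x y \<in> ?S" if "x \<in> ?S" "y \<in> ?S" for x y
    using that by (auto intro!: image_eqI[of _ ?ev "TBr _ _"] lterms.intros)
  have gS: "e x \<in> ?S" if "e x \<in> gr M q" for x q
    using that by (auto intro!: image_eqI[of _ ?ev "Gen x"] lterms.intros simp: G_def)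
  have subS: "?S \<subseteq> carrier M" using lterm_eval_closed[where G=G, OF M eG] by auto
  have decS: "\<exists>a\<in>gr M 0 \<inter> ?S. \<exists>b\<in>gr M 1 \<inter> ?S. x = a \<oplus>\<^bsub>M\<^esub> b" if "x \<in> ?S" for x
    using that lterm_eval_decomp[where G=G, OF M eG] by auto
  have N: "leibniz_superalgebra R ?N" and i: "?ev \<in> leibniz_hom R ?N M"
    using transport_leibniz[of R M ?ev C] M C(2) subS zS aS sS bS decS unfolding C(3) by auto
  have car: "carrier ?N = C" by (simp add: transport_def)
  have inS: "f' ` carrier U \<subseteq> ?S"
    if f': "f' \<in> leibniz_hom R U M" "\<And>x. f' x = e (k x)" for f' k
  proof
    fix y assume "y \<in> f' ` carrier U"
    then obtain x where x: "x \<in> carrier U" "y = f' x" by blast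
    obtain a b where ab: "a \<in> gr U 0" "b \<in> gr U 1" "x = a \<oplus>\<^bsub>U\<^esub> b"
      using U.gr_decomp[OF x(1)] by blast
    have "f' a \<in> ?S" "f' b \<in> ?S"
      using gS leibniz_homD(4)[OF f'(1)] ab unfolding f'(2) by blast+
    moreover have "y = f' a \<oplus>\<^bsub>M\<^esub> f' b"
      using x ab leibniz_homD(2)[OF f'(1)] U.gr_carrier by simp
    ultimately show "y \<in> ?S" using aS by simp
  qed
  have surjS: "\<phi> ` ?S = carrier L"
  proof
    show "\<phi> ` ?S \<subseteq> carrier L" using subS surj by blast
    show "carrier L \<subseteq> \<phi> ` ?S"
    proof
      fix l assume "l \<in> carrier L"
      then obtain a b where ab: "a \<in> gr L 0" "b \<in> gr L 1" "l = a \<oplus>\<^bsub>L\<^esub> b"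
        using L.gr_decomp by blast
      have "s a \<in> ?S" "s b \<in> ?S"
        using s(1)[OF ab(1)] s(1)[OF ab(2)] gS[of "Inl a"] gS[of "Inl b"] by (auto simp: e_def)
      moreover from this have "s a \<in> carrier M" "s b \<in> carrier M" using subS by auto
      then have "\<phi> (s a \<oplus>\<^bsub>M\<^esub> s b) = l"
        using s(2)[OF ab(1)] s(2)[OF ab(2)] P(2) ab(3) by simp
      ultimately show "l \<in> \<phi> ` ?S" using aS[of "s a" "s b"] by (metis imageI)
    qed
  qed
  have hc: "\<phi> \<circ> ?ev \<in> leibniz_hom R ?N L" by (rule leibniz_hom_comp[OF i phi])
  have "a_kernel ?N L (\<phi> \<circ> ?ev) \<subseteq> centre ?N"
  proof
    fix x assume "x \<in> a_kernel ?N L (\<phi> \<circ> ?ev)"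
    then have x: "x \<in> C" "\<phi> (?ev x) = \<zero>\<^bsub>L\<^esub>" by (auto simp: a_kernel_def' car)
    have "?ev x \<in> carrier M" using x(1) C subS by auto
    then have "?ev x \<in> centre M" using ker x(2) by (auto simp: a_kernel_def')
    moreover have "\<And>y. y \<in> C \<Longrightarrow> ?ev y \<in> carrier M" using C subS by auto
    ultimately show "x \<in> centre ?N"
      using x(1) by (simp add: centre_def transport_def)
  qed
  moreover have "(\<phi> \<circ> ?ev) ` C = carrier L"
    using surjS unfolding image_comp[symmetric] C(3) .
  ultimately have ceN: "central_extension R ?N L (\<phi> \<circ> ?ev)"
    using N L hc unfolding central_extension_def car by blast
  show thesis
  proof (rule that[of ?ev ?N])
    show "inj_on ?ev (carrier ?N)" using C by (simp add: car)
    show "f ` carrier U \<subseteq> ?ev ` carrier ?N"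
      using inS[OF f, of "Inr \<circ> Inl"] unfolding car C(3) by (simp add: e_def)
    show "g ` carrier U \<subseteq> ?ev ` carrier ?N"
      using inS[OF g, of "Inr \<circ> Inr"] unfolding car C(3) by (simp add: e_def)
  qed (use i ceN in \<open>auto simp: transport_def\<close>)
qed

lemma zero_leibniz_hom:
  assumes "leibniz_superalgebra R U" and "leibniz_superalgebra R M"
  shows "(\<lambda>x. \<zero>\<^bsub>M\<^esub>) \<in> leibniz_hom R U M"
proof -
  interpret M: leibniz_superalgebra R M by fact
  have "bracket M \<zero>\<^bsub>M\<^esub> \<zero>\<^bsub>M\<^esub> = \<zero>\<^bsub>M\<^esub>"
    using even_bilinearD(4)[OF M.bracket_even_bilinear, of "\<zero>\<^bsub>R\<^esub>" "\<zero>\<^bsub>M\<^esub>" "\<zero>\<^bsub>M\<^esub>"]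
      even_bilinearD(1)[OF M.bracket_even_bilinear, of "\<zero>\<^bsub>M\<^esub>" "\<zero>\<^bsub>M\<^esub>"] by simp
  then show ?thesis by (simp add: leibniz_hom_def M.gr_zero)
qed

theorem universal_central_extension_any_type:
  fixes R :: "('a, 'x) ring_scheme" and M :: "('a, 'm) leibniz" and L :: "('a, 'l) leibniz"
    and U :: "('a, 'u) leibniz"
  assumes uce: "universal_central_extension R U L \<uu>" and ce: "central_extension R M L \<phi>"
  shows "\<exists>!f. f \<in> leibniz_hom R U M \<inter> extensional (carrier U) \<and> (\<forall>x\<in>carrier U. \<uu> x = \<phi> (f x))"
proof -
  have U: "leibniz_superalgebra R U" and M: "leibniz_superalgebra R M"
    using uce ce by (auto simp: universal_central_extension_def central_extension_def)
  have univ: "\<exists>!f. f \<in> leibniz_hom R U N \<inter> extensional (carrier U) \<and> (\<forall>x\<in>carrier U. \<uu> x = \<psi> (f x))"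
    if "central_extension R N L \<psi>" for N :: "('a, ('a, 'l + 'u + 'u) lterm) leibniz" and \<psi>
    using uce that unfolding universal_central_extension_def by blast
  let ?Q = "\<lambda>f. f \<in> leibniz_hom R U M \<inter> extensional (carrier U) \<and> (\<forall>x\<in>carrier U. \<uu> x = \<phi> (f x))"
  have ex: "\<exists>f. ?Q f"
  proof -
    obtain N :: "('a, ('a, 'l + 'u + 'u) lterm) leibniz" and \<iota>
      where N: "\<iota> \<in> leibniz_hom R N M" "central_extension R N L (\<phi> \<circ> \<iota>)"
      by (rule central_extension_small
          [OF U ce zero_leibniz_hom[OF U M] zero_leibniz_hom[OF U M]]) blast
    obtain k where k: "k \<in> leibniz_hom R U N" "\<forall>x\<in>carrier U. \<uu> x = (\<phi> \<circ> \<iota>) (k x)"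
      using univ[OF N(2)] by blast
    have "restrict (\<iota> \<circ> k) (carrier U) \<in> leibniz_hom R U M"
      by (rule leibniz_hom_cong[OF U leibniz_hom_comp[OF k(1) N(1)]]) simp
    then show ?thesis using k(2) by (intro exI[of _ "restrict (\<iota> \<circ> k) (carrier U)"]) auto
  qed
  have uniq: "f = g" if f: "?Q f" and g: "?Q g" for f g
  proof -
    have fh: "f \<in> leibniz_hom R U M" and gh: "g \<in> leibniz_hom R U M" using f g by auto
    obtain N :: "('a, ('a, 'l + 'u + 'u) lterm) leibniz" and \<iota>
      where i: "\<iota> \<in> leibniz_hom R N M" and inj: "inj_on \<iota> (carrier N)"
        and ceN: "central_extension R N L (\<phi> \<circ> \<iota>)"
        and gr: "\<And>p x. x \<in> carrier N \<Longrightarrow> \<iota> x \<in> gr M p \<Longrightarrow> x \<in> gr N p"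
        and fN: "f ` carrier U \<subseteq> \<iota> ` carrier N" and gN: "g ` carrier U \<subseteq> \<iota> ` carrier N"
      by (rule central_extension_small[OF U ce fh gh]) blast
    have NL: "leibniz_superalgebra R N" using ceN by (simp add: central_extension_def)
    interpret N: leibniz_superalgebra R N by fact
    interpret U: leibniz_superalgebra R U by fact
    define j where "j = inv_into (carrier N) \<iota>"
    let ?r = "\<lambda>f'. restrict (j \<circ> f') (carrier U)"
    have fact: "?r f' \<in> leibniz_hom R U N" "\<forall>x\<in>carrier U. \<iota> (?r f' x) = f' x"
      if f': "f' \<in> leibniz_hom R U M" and f'N: "f' ` carrier U \<subseteq> \<iota> ` carrier N" for f'
    proof -
      note F = leibniz_homD[OF f'] and I = leibniz_homD[OF i]
      note BU = even_bilinearD[OF U.bracket_even_bilinear]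
      note BN = even_bilinearD[OF N.bracket_even_bilinear]
      have j: "j (f' x) \<in> carrier N" "\<iota> (j (f' x)) = f' x" if "x \<in> carrier U" for x
        using that f'N unfolding j_def by (blast intro: inv_into_into f_inv_into_f)+
      have eqI: "\<And>x y. x \<in> carrier N \<Longrightarrow> y \<in> carrier N \<Longrightarrow> \<iota> x = \<iota> y \<Longrightarrow> x = y"
        using inj by (auto dest: inj_onD)
      show "\<forall>x\<in>carrier U. \<iota> (?r f' x) = f' x" using j by simp
      have "j \<circ> f' \<in> leibniz_hom R U N"
        unfolding leibniz_hom_def
      proof (intro CollectI conjI ballI allI)
        show "j \<circ> f' \<in> carrier U \<rightarrow> carrier N" using j by simp
      next
        fix x y assume "x \<in> carrier U" "y \<in> carrier U"
        then show "(j \<circ> f') (x \<oplus>\<^bsub>U\<^esub> y) = (j \<circ> f') x \<oplus>\<^bsub>N\<^esub> (j \<circ> f') y"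
          using j[of "x \<oplus>\<^bsub>U\<^esub> y"]
          by (intro eqI) (simp_all add: j F I)
      next
        fix r x assume "r \<in> carrier R" "x \<in> carrier U"
        then show "(j \<circ> f') (r \<odot>\<^bsub>U\<^esub> x) = r \<odot>\<^bsub>N\<^esub> (j \<circ> f') x"
          using j[of "r \<odot>\<^bsub>U\<^esub> x"]
          by (intro eqI) (simp_all add: j F I)
      next
        fix p x assume "x \<in> gr U p"
        then show "(j \<circ> f') x \<in> gr N p"
          using gr[of "j (f' x)" p] j[of x] F(4)[of x p] U.gr_carrier by simp
      next
        fix x y assume "x \<in> carrier U" "y \<in> carrier U"
        then show "(j \<circ> f') (bracket U x y) = bracket N ((j \<circ> f') x) ((j \<circ> f') y)"
          using j[of "bracket U x y"]
          by (intro eqI) (simp_all add: j F I BU BN)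
      qed
      then show "?r f' \<in> leibniz_hom R U N"
        by (rule leibniz_hom_cong[OF U]) simp
    qed
    have "\<forall>x\<in>carrier U. \<uu> x = (\<phi> \<circ> \<iota>) (?r f x)"
      using f fact(2)[OF fh fN] by (metis comp_apply)
    moreover have "\<forall>x\<in>carrier U. \<uu> x = (\<phi> \<circ> \<iota>) (?r g x)"
      using g fact(2)[OF gh gN] by (metis comp_apply)
    ultimately have eq: "?r f = ?r g"
      using univ[OF ceN] fact(1)[OF fh fN] fact(1)[OF gh gN] by (metis IntI restrict_extensional)
    show "f = g"
    proof (rule extensionalityI[of _ "carrier U"])
      fix x assume "x \<in> carrier U"
      then show "f x = g x" using eq fact(2)[OF fh fN] fact(2)[OF gh gN] by metis
    qed (use f g in auto)
  qed
  show ?thesis using ex uniq by blast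
qed

section \<open>Matrices and the Steinberg Leibniz superalgebra\<close>

definition idx_deg :: "nat \<Rightarrow> nat \<Rightarrow> bit" where
  "idx_deg m i = (if i \<le> m then 0 else 1)"

definition mat_superdialg ::
  "nat \<Rightarrow> nat \<Rightarrow> ('a, 'd, 'z) superdialg_scheme \<Rightarrow> ('a, nat \<times> nat \<Rightarrow> 'd) superdialg" where
  "mat_superdialg m n D = (let N = {1..m + n} in \<lparr>
     carrier = N \<times> N \<rightarrow>\<^sub>E carrier D, mult = undefined, one = undefined,
     zero = (\<lambda>ij\<in>N \<times> N. \<zero>\<^bsub>D\<^esub>),
     add = (\<lambda>x y. \<lambda>ij\<in>N \<times> N. x ij \<oplus>\<^bsub>D\<^esub> y ij),
     smult = (\<lambda>r x. \<lambda>ij\<in>N \<times> N. r \<odot>\<^bsub>D\<^esub> x ij),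
     gr = (\<lambda>p. \<Pi>\<^sub>E (i, j)\<in>N \<times> N. gr D (p + idx_deg m i + idx_deg m j)),
     lprod = (\<lambda>x y. \<lambda>(i, j)\<in>N \<times> N. \<Oplus>\<^bsub>D\<^esub>k\<in>N. x (i, k) \<stileturn>\<^bsub>D\<^esub> y (k, j)),
     rprod = (\<lambda>x y. \<lambda>(i, j)\<in>N \<times> N. \<Oplus>\<^bsub>D\<^esub>k\<in>N. x (i, k) \<turnstile>\<^bsub>D\<^esub> y (k, j))\<rparr>)"

definition elem_mat ::
  "nat \<Rightarrow> nat \<Rightarrow> ('a, 'd, 'z) superdialg_scheme \<Rightarrow> nat \<Rightarrow> nat \<Rightarrow> 'd \<Rightarrow> nat \<times> nat \<Rightarrow> 'd" where
  "elem_mat m n D i j a =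
     (\<lambda>kl\<in>{1..m + n} \<times> {1..m + n}. if kl = (i, j) then a else \<zero>\<^bsub>D\<^esub>)"

definition hcomp :: "('a, 'b, 'z) supermodule_scheme \<Rightarrow> bit \<Rightarrow> 'b \<Rightarrow> 'b" where
  "hcomp M p x = (THE y. y \<in> gr M p \<and> (\<exists>z\<in>gr M (p + 1). x = y \<oplus>\<^bsub>M\<^esub> z))"

text \<open>The bilinear extension of \<open>[x, y] = x \<stileturn> y - (-1)\<^bsup>|x||y|\<^esup> y \<turnstile> x\<close> to inhomogeneous elements.\<close>

definition dialg_bracket ::
  "('a, 'x) ring_scheme \<Rightarrow> ('a, 'b, 'z) superdialg_scheme \<Rightarrow> 'b \<Rightarrow> 'b \<Rightarrow> 'b" where
  "dialg_bracket R A x y = (\<Oplus>\<^bsub>A\<^esub>p\<in>{0, 1}. \<Oplus>\<^bsub>A\<^esub>q\<in>{0, 1}.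
     hcomp A p x \<stileturn>\<^bsub>A\<^esub> hcomp A q y \<ominus>\<^bsub>A\<^esub> koszul R (p * q) \<odot>\<^bsub>A\<^esub> (hcomp A q y \<turnstile>\<^bsub>A\<^esub> hcomp A p x))"

definition gl ::
  "('a, 'x) ring_scheme \<Rightarrow> nat \<Rightarrow> nat \<Rightarrow> ('a, 'd, 'z) superdialg_scheme \<Rightarrow>
    ('a, nat \<times> nat \<Rightarrow> 'd) leibniz" where
  "gl R m n D = with_bracket (mat_superdialg m n D) (dialg_bracket R (mat_superdialg m n D))"

definition sl ::
  "('a, 'x) ring_scheme \<Rightarrow> nat \<Rightarrow> nat \<Rightarrow> ('a, 'd, 'z) superdialg_scheme \<Rightarrow>
    ('a, nat \<times> nat \<Rightarrow> 'd) leibniz" where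
  "sl R m n D = (let g = gl R m n D;
       S = submodule_span R g {bracket g x y | x y. x \<in> carrier g \<and> y \<in> carrier g}
     in g\<lparr>carrier := S, gr := \<lambda>p. gr g p \<inter> S\<rparr>)"

definition stl_gens ::
  "nat \<Rightarrow> nat \<Rightarrow> ('a, 'd, 'z) superdialg_scheme \<Rightarrow> bit \<Rightarrow> (nat \<times> nat \<times> 'd) set" where
  "stl_gens m n D p = {(i, j, a). i \<in> {1..m + n} \<and> j \<in> {1..m + n} \<and> i \<noteq> j \<and>
     a \<in> gr D (p + idx_deg m i + idx_deg m j)}"

inductive_set stl_rels ::
  "('a, 'x) ring_scheme \<Rightarrow> nat \<Rightarrow> nat \<Rightarrow> ('a, 'd, 'z) superdialg_scheme \<Rightarrow>
    (('a, nat \<times> nat \<times> 'd) lterm \<times> ('a, nat \<times> nat \<times> 'd) lterm) set"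
  for R :: "('a, 'x) ring_scheme" and m n :: nat and D :: "('a, 'd, 'z) superdialg_scheme" where
  add: "\<lbrakk>i \<in> {1..m + n}; j \<in> {1..m + n}; i \<noteq> j; a \<in> gr D p; b \<in> gr D p\<rbrakk> \<Longrightarrow>
    (Gen (i, j, a \<oplus>\<^bsub>D\<^esub> b), TAdd (Gen (i, j, a)) (Gen (i, j, b))) \<in> stl_rels R m n D"
| smult: "\<lbrakk>i \<in> {1..m + n}; j \<in> {1..m + n}; i \<noteq> j; r \<in> carrier R; a \<in> gr D p\<rbrakk> \<Longrightarrow>
    (Gen (i, j, r \<odot>\<^bsub>D\<^esub> a), TScale r (Gen (i, j, a))) \<in> stl_rels R m n D"
| left: "\<lbrakk>{i, j, k, l} \<subseteq> {1..m + n}; i \<noteq> j; k \<noteq> l; a \<in> gr D p; b \<in> gr D q; i \<noteq> l; j = k\<rbrakk> \<Longrightarrow>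
    (TBr (Gen (i, j, a)) (Gen (k, l, b)), Gen (i, l, a \<stileturn>\<^bsub>D\<^esub> b)) \<in> stl_rels R m n D"
| right: "\<lbrakk>{i, j, k, l} \<subseteq> {1..m + n}; i \<noteq> j; k \<noteq> l; a \<in> gr D p; b \<in> gr D q; i = l; j \<noteq> k\<rbrakk> \<Longrightarrow>
    (TBr (Gen (i, j, a)) (Gen (k, l, b)),
     TScale (\<ominus>\<^bsub>R\<^esub> koszul R ((idx_deg m i + idx_deg m j + p) * (idx_deg m k + idx_deg m l + q)))
       (Gen (k, j, b \<turnstile>\<^bsub>D\<^esub> a))) \<in> stl_rels R m n D"
| zero: "\<lbrakk>{i, j, k, l} \<subseteq> {1..m + n}; i \<noteq> j; k \<noteq> l; a \<in> gr D p; b \<in> gr D q; i \<noteq> l; j \<noteq> k\<rbrakk> \<Longrightarrow>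
    (TBr (Gen (i, j, a)) (Gen (k, l, b)), TZero) \<in> stl_rels R m n D"

definition stl ::
  "('a, 'x) ring_scheme \<Rightarrow> nat \<Rightarrow> nat \<Rightarrow> ('a, 'd, 'z) superdialg_scheme \<Rightarrow>
    ('a, ('a, nat \<times> nat \<times> 'd) lterm set) leibniz" where
  "stl R m n D = presented_leibniz R (stl_gens m n D) (stl_rels R m n D)"

definition stl_gen ::
  "('a, 'x) ring_scheme \<Rightarrow> nat \<Rightarrow> nat \<Rightarrow> ('a, 'd, 'z) superdialg_scheme \<Rightarrow> nat \<Rightarrow> nat \<Rightarrow> 'd \<Rightarrow>
    ('a, nat \<times> nat \<times> 'd) lterm set" where
  "stl_gen R m n D i j a =
     leibniz_cong R (stl_gens m n D) (stl_rels R m n D) `` {Gen (i, j, a)}"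

end

theory Submission
  imports Defs
begin

text \<open>
  For a cocycle \<open>B\<close> on \<open>sl(2, 2, D)\<close> all values \<open>B(E\<^sub>i\<^sub>j(a), E\<^sub>k\<^sub>l(b))\<close> with \<open>{i, k}\<close> and \<open>{j, l}\<close> fixed and
  complementary are, up to sign, values of one linear function of \<open>a \<stileturn> b\<close>, and the cocycle identity
  makes this function vanish on \<open>\<I>\<^sub>2\<close> if \<open>i\<close> and \<open>k\<close> have different parity and on \<open>\<I>\<^sub>0\<close> if they have the same.
  Conversely, the minor \<open>x\<^sub>i\<^sub>j x\<^sub>k\<^sub>l - x\<^sub>i\<^sub>l x\<^sub>k\<^sub>j\<close>, polarised and read in \<open>D\<^sub>2\<close> or \<open>D\<^sub>0\<close>, is a cocycle. The six
  choices of \<open>{i, k}\<close> give the cocycle \<open>\<Psi>\<close> with values in \<open>D\<^sub>2\<^sup>4 \<oplus> D\<^sub>0\<^sup>2\<close>. If \<open>M\<close> is a central extension of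
  \<open>sl(2, 2, D)\<close>, its lifted bracket is such a cocycle, so the brackets of lifts with four distinct indices
  are \<open>H \<circ> \<Psi>\<close> for a linear \<open>H\<close>. Subtracting \<open>H \<circ> \<Psi>\<close> from the bracket of \<open>M\<close> yields a Leibniz
  superalgebra in which the Steinberg relations hold; the resulting homomorphism together with \<open>H\<close> is the
  homomorphism from the extension of \<open>stl(2, 2, D)\<close> by \<open>\<Psi>\<close>. It is unique because that extension is perfect.
  The kernel of \<open>stl(2, 2, D) \<rightarrow> sl(2, 2, D)\<close> is central because \<open>stl(2, 2, D)\<close> is the sum of its root
  spaces and of a part that preserves each root space.
\<close>

section \<open>Graded modules, bilinear maps and cocycles\<close>

text \<open>The obstacle is the number of indices. A fifth index u would give E_kl(b) =
  [E_ku(b), E_ul(1)] with both factors commuting with E_ij(a), so every cocycle would vanish on four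
  distinct indices. Here the factorisation has to pass through i or j, and it merely exchanges the
  columns or the rows of the pair. Exchanging the columns twice returns the same value with the sign
  (-1)^(|j| + |l|), which forces 2-torsion when j and l have different parity. As two of the four
  indices are even and two are odd, |j| and |l| differ iff |i| and |k| do: this is the origin of the
  numbers 2 and 0. Exchanging the rows turns \<open>a \<stileturn> b\<close> into
  \<open>b \<turnstile> a\<close> up to sign, which is the other generator of the ideals. In the
  converse direction the cocycle identity for a minor, tested against E_ij with i a row and j a
  column of the minor, leaves products with diagonal entries. They cancel once the supertraces lie
  in the ideal, which holds on sl; this is why the identity is proved for homogeneous elements
  generated by off-diagonal elementary matrices and not for arbitrary matrices.\<close>

context abelian_group
begin

lemma add_diff_eq:
  "\<lbrakk>x \<in> carrier G; y \<in> carrier G; z \<in> carrier G\<rbrakk> \<Longrightarrow> x \<oplus> (y \<ominus> z) = (x \<oplus> y) \<ominus> z"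
  by (simp add: minus_eq a_ac)

lemma diff_add_eq:
  "\<lbrakk>x \<in> carrier G; y \<in> carrier G; z \<in> carrier G\<rbrakk> \<Longrightarrow> (x \<ominus> y) \<oplus> z = (x \<oplus> z) \<ominus> y"
  by (simp add: minus_eq a_ac)

lemma diff_diff_eq:
  "\<lbrakk>x \<in> carrier G; y \<in> carrier G; z \<in> carrier G\<rbrakk> \<Longrightarrow> (x \<ominus> y) \<ominus> z = x \<ominus> (y \<oplus> z)"
  by (simp add: minus_eq minus_add a_ac)

lemma diff_diff_eq2:
  "\<lbrakk>x \<in> carrier G; y \<in> carrier G; z \<in> carrier G\<rbrakk> \<Longrightarrow> x \<ominus> (y \<ominus> z) = (x \<oplus> z) \<ominus> y"
  by (simp add: minus_eq minus_add a_ac)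

lemma diff_eq_eq:
  assumes "x \<in> carrier G" "y \<in> carrier G" "z \<in> carrier G"
  shows "x \<ominus> y = z \<longleftrightarrow> x = z \<oplus> y"
proof
  assume "x \<ominus> y = z"
  then have "z \<oplus> y = (x \<ominus> y) \<oplus> y" by simp
  then show "x = z \<oplus> y" using assms by (simp add: minus_eq a_assoc l_neg)
next
  assume "x = z \<oplus> y"
  then show "x \<ominus> y = z" using assms by (simp add: minus_eq a_assoc r_neg)
qed

lemma eq_diff_eq:
  assumes "x \<in> carrier G" "y \<in> carrier G" "z \<in> carrier G"
  shows "z = x \<ominus> y \<longleftrightarrow> z \<oplus> y = x"
  using diff_eq_eq[OF assms] by metis

lemma neg_add_eq: "\<lbrakk>x \<in> carrier G; y \<in> carrier G\<rbrakk> \<Longrightarrow> (\<ominus> x) \<oplus> y = y \<ominus> x"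
  by (simp add: minus_eq a_ac)

lemma add_neg_eq: "\<lbrakk>x \<in> carrier G; y \<in> carrier G\<rbrakk> \<Longrightarrow> y \<oplus> (\<ominus> x) = y \<ominus> x"
  by (simp add: minus_eq)

lemma neg_diff_eq: "\<lbrakk>x \<in> carrier G; y \<in> carrier G\<rbrakk> \<Longrightarrow> \<ominus> (x \<ominus> y) = y \<ominus> x"
  by (simp add: minus_eq minus_add a_ac)

lemma diff_neg_eq: "\<lbrakk>x \<in> carrier G; y \<in> carrier G\<rbrakk> \<Longrightarrow> x \<ominus> (\<ominus> y) = x \<oplus> y"
  by (simp add: minus_eq)

lemma neg_diff_eq2: "\<lbrakk>x \<in> carrier G; y \<in> carrier G\<rbrakk> \<Longrightarrow> (\<ominus> x) \<ominus> y = \<ominus> (x \<oplus> y)"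
  by (simp add: minus_eq minus_add)

lemma neg_eq_eq: "\<lbrakk>x \<in> carrier G; y \<in> carrier G\<rbrakk> \<Longrightarrow> \<ominus> x = y \<longleftrightarrow> \<zero> = y \<oplus> x"
  using diff_eq_eq[of \<zero> x y] by (simp add: minus_eq)

lemma eq_neg_eq: "\<lbrakk>x \<in> carrier G; y \<in> carrier G\<rbrakk> \<Longrightarrow> y = \<ominus> x \<longleftrightarrow> y \<oplus> x = \<zero>"
  using eq_diff_eq[of \<zero> x y] by (simp add: minus_eq)

lemma diff_zero: "x \<in> carrier G \<Longrightarrow> x \<ominus> \<zero> = x"
  by (simp add: minus_eq)

lemma zero_diff: "x \<in> carrier G \<Longrightarrow> \<zero> \<ominus> x = \<ominus> x"
  by (simp add: minus_eq)

lemma diff_self: "x \<in> carrier G \<Longrightarrow> x \<ominus> x = \<zero>"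
  by (simp add: minus_eq r_neg)

text \<open>As rewrite rules these move every subtrahend to the other side, so that an equation
  between differences becomes one between sums, which \<open>a_ac\<close> settles.\<close>

lemmas diff_simps = add_diff_eq diff_add_eq diff_diff_eq diff_diff_eq2 diff_eq_eq eq_diff_eq
  neg_add_eq add_neg_eq neg_diff_eq diff_neg_eq neg_diff_eq2 neg_eq_eq eq_neg_eq
  diff_zero zero_diff diff_self

end

section \<open>Signs and degrees modulo 2\<close>

lemma koszul_simps [simp]: "koszul R 0 = \<one>\<^bsub>R\<^esub>" "koszul R 1 = \<ominus>\<^bsub>R\<^esub> \<one>\<^bsub>R\<^esub>"
  by (simp_all add: koszul_def)

lemma bit_add_self [simp]: "(p::bit) + p = 0" "p + (p + q) = q"
  by (cases p; cases q; simp)+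

text \<open>Degree sums and products stay in field notation, where commutativity and the rules below
  apply; otherwise they would be rewritten to bit operations.\<close>

declare add_bit_eq_xor [simp del] mult_bit_eq_and [simp del]

lemma bit_mult_self [simp]: "(p::bit) * p = p" "p * (p * q) = p * q"
  by (cases p; cases q; simp)+

lemma (in module) koszul_closed_R [simp]: "koszul R p \<in> carrier R"
  by (rule koszul_closed[OF is_cring])

lemma (in module) koszul_smult [simp]:
  assumes "x \<in> carrier M"
  shows "\<one>\<^bsub>R\<^esub> \<odot>\<^bsub>M\<^esub> x = x" "(\<ominus>\<^bsub>R\<^esub> \<one>\<^bsub>R\<^esub>) \<odot>\<^bsub>M\<^esub> x = \<ominus>\<^bsub>M\<^esub> x"
  using assms by (simp_all add: smult_l_minus)

lemma (in module) koszul_koszul: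
  assumes "x \<in> carrier M"
  shows "koszul R p \<odot>\<^bsub>M\<^esub> (koszul R q \<odot>\<^bsub>M\<^esub> x) = koszul R (p + q) \<odot>\<^bsub>M\<^esub> x"
  using assms by (cases p; cases q) (simp_all add: M.minus_minus)

lemma (in module) smult_diff:
  "\<lbrakk>r \<in> carrier R; x \<in> carrier M; y \<in> carrier M\<rbrakk> \<Longrightarrow> r \<odot>\<^bsub>M\<^esub> (x \<ominus>\<^bsub>M\<^esub> y) = r \<odot>\<^bsub>M\<^esub> x \<ominus>\<^bsub>M\<^esub> r \<odot>\<^bsub>M\<^esub> y"
  by (simp add: M.minus_eq smult_r_distr smult_r_minus)

lemma (in module) smult_koszul_commute:
  "\<lbrakk>r \<in> carrier R; x \<in> carrier M\<rbrakk> \<Longrightarrow>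
    r \<odot>\<^bsub>M\<^esub> (koszul R p \<odot>\<^bsub>M\<^esub> x) = koszul R p \<odot>\<^bsub>M\<^esub> (r \<odot>\<^bsub>M\<^esub> x)"
  by (cases p) (simp_all add: smult_r_minus)

text \<open>A module with a bracket attached and a substructure with restricted grading are
  different records from the modules they come from, so the module laws are carried over field by
  field.\<close>

lemma module_cong:
  fixes M :: "('a, 'b, 'y) module_scheme" and N :: "('a, 'b, 'z) module_scheme"
  assumes "module R M" and eq: "carrier N = carrier M" "zero N = zero M" "add N = add M" "smult N = smult M"
  shows "module R N"
proof -
  interpret M: module R M by fact
  have "abelian_group N"
    by (rule abelian_groupI) (auto simp: eq M.a_ac intro!: bexI[of _ "\<ominus>\<^bsub>M\<^esub> _"] M.l_neg)
  then show ?thesis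
    using assms M.is_cring M.smult_l_distr M.smult_r_distr M.smult_assoc1
    by (intro moduleI) (simp_all add: eq)
qed

lemma submodule_cong:
  fixes M :: "('a, 'b, 'y) module_scheme" and N :: "('a, 'b, 'z) module_scheme"
  assumes "module R M" and H: "submodule H R M"
    and eq: "carrier N = carrier M" "zero N = zero M" "add N = add M" "smult N = smult M"
  shows "submodule H R N"
proof -
  interpret M: module R M by fact
  interpret N: module R N by (rule module_cong[OF assms(1) eq])
  have "\<zero>\<^bsub>M\<^esub> \<in> H"
    using H by (simp add: submodule_def subgroup_def)
  moreover have "\<ominus>\<^bsub>N\<^esub> a \<in> H" if "a \<in> H" for a
  proof -
    have "a \<in> carrier M" using M.submoduleE(1)[OF H] that by blast
    then have "\<ominus>\<^bsub>N\<^esub> a = (\<ominus>\<^bsub>R\<^esub> \<one>\<^bsub>R\<^esub>) \<odot>\<^bsub>M\<^esub> a" using N.koszul_smult(2)[of a] by (simp add: eq)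
    then show ?thesis using M.submoduleE(4)[OF H, of "\<ominus>\<^bsub>R\<^esub> \<one>\<^bsub>R\<^esub>" a] that by simp
  qed
  ultimately show ?thesis
    using M.submoduleE[OF H] by (intro N.submoduleI) (simp_all add: eq)
qed

text \<open>Uniqueness of the decomposition comes from the trivial intersection: if a + b = a' + b',
  then a - a' = b' - b lies in both graded parts.\<close>

lemma supermoduleI:
  assumes "module R M" and "\<And>p. submodule (gr M p) R M"
    and "\<And>x. x \<in> carrier M \<Longrightarrow> \<exists>a\<in>gr M 0. \<exists>b\<in>gr M 1. x = a \<oplus>\<^bsub>M\<^esub> b"
    and "\<And>x. x \<in> gr M 0 \<Longrightarrow> x \<in> gr M 1 \<Longrightarrow> x = \<zero>\<^bsub>M\<^esub>"
  shows "supermodule R M"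
proof -
  interpret M: module R M by fact
  note gr = M.submoduleE[OF assms(2)]
  show ?thesis
  proof (intro supermodule.intro supermodule_axioms.intro assms(1,2))
    fix x assume "x \<in> carrier M"
    then obtain a b where ab: "a \<in> gr M 0" "b \<in> gr M 1" "x = a \<oplus>\<^bsub>M\<^esub> b" using assms(3) by blast
    show "\<exists>!y. fst y \<in> gr M 0 \<and> snd y \<in> gr M 1 \<and> x = fst y \<oplus>\<^bsub>M\<^esub> snd y"
    proof (rule ex1I[of _ "(a, b)"])
      fix y assume y: "fst y \<in> gr M 0 \<and> snd y \<in> gr M 1 \<and> x = fst y \<oplus>\<^bsub>M\<^esub> snd y"
      have c: "a \<in> carrier M" "b \<in> carrier M" "fst y \<in> carrier M" "snd y \<in> carrier M"
        using ab y gr(1) by blast+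
      have "a \<oplus>\<^bsub>M\<^esub> b = fst y \<oplus>\<^bsub>M\<^esub> snd y" using y ab by simp
      then have e: "a \<ominus>\<^bsub>M\<^esub> fst y = snd y \<ominus>\<^bsub>M\<^esub> b"
        using c by (simp add: M.M.diff_simps M.M.a_ac)
      have "a \<ominus>\<^bsub>M\<^esub> fst y \<in> gr M 0" "snd y \<ominus>\<^bsub>M\<^esub> b \<in> gr M 1"
        using ab y gr(3,5) unfolding M.M.minus_eq by blast+
      then have "a \<ominus>\<^bsub>M\<^esub> fst y = \<zero>\<^bsub>M\<^esub>" "snd y \<ominus>\<^bsub>M\<^esub> b = \<zero>\<^bsub>M\<^esub>" using assms(4) e by auto
      then show "y = (a, b)" using c by (cases y) (simp add: M.M.diff_simps)
    qed (use ab in auto)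
  qed
qed

section \<open>Homogeneous components\<close>

context supermodule
begin

lemma gr_uminus: "x \<in> gr M p \<Longrightarrow> \<ominus>\<^bsub>M\<^esub> x \<in> gr M p"
  using submoduleE(3)[OF gr_submodule] .

lemma gr_minus: "x \<in> gr M p \<Longrightarrow> y \<in> gr M p \<Longrightarrow> x \<ominus>\<^bsub>M\<^esub> y \<in> gr M p"
  by (simp add: M.minus_eq gr_uminus gr_add)

lemma gr_disjoint: "x \<in> gr M p \<Longrightarrow> x \<in> gr M q \<Longrightarrow> p \<noteq> q \<Longrightarrow> x = \<zero>\<^bsub>M\<^esub>"
proof -
  assume x: "x \<in> gr M p" "x \<in> gr M q" "p \<noteq> q"
  then have "x \<in> gr M 0" "x \<in> gr M 1" by (cases p; cases q; simp)+
  moreover have "x \<oplus>\<^bsub>M\<^esub> \<zero>\<^bsub>M\<^esub> = \<zero>\<^bsub>M\<^esub> \<oplus>\<^bsub>M\<^esub> x" using gr_carrier[OF x(1)] by simp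
  ultimately show ?thesis using gr_unique[OF _ gr_zero gr_zero] by blast
qed

lemma hcomp_eqI:
  assumes "a \<in> gr M p" "b \<in> gr M (p + 1)"
  shows "hcomp M p (a \<oplus>\<^bsub>M\<^esub> b) = a"
  unfolding hcomp_def
proof (rule the_equality)
  fix y assume "y \<in> gr M p \<and> (\<exists>z\<in>gr M (p + 1). a \<oplus>\<^bsub>M\<^esub> b = y \<oplus>\<^bsub>M\<^esub> z)"
  then obtain z where z: "y \<in> gr M p" "z \<in> gr M (p + 1)" "a \<oplus>\<^bsub>M\<^esub> b = y \<oplus>\<^bsub>M\<^esub> z" by blast
  have c: "a \<in> carrier M" "b \<in> carrier M" "y \<in> carrier M" "z \<in> carrier M"
    using assms z gr_carrier by blast+
  have z': "b \<oplus>\<^bsub>M\<^esub> a = z \<oplus>\<^bsub>M\<^esub> y" using z(3) M.a_comm c by simp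
  show "y = a"
    using gr_unique[OF _ _ _ _ z(3)] gr_unique[OF _ _ _ _ z'] assms z(1,2)
    by (cases p) auto
qed (use assms in auto)

lemma hcomp_closed: "x \<in> carrier M \<Longrightarrow> hcomp M p x \<in> gr M p"
proof -
  assume "x \<in> carrier M"
  then obtain a b where ab: "a \<in> gr M 0" "b \<in> gr M 1" "x = a \<oplus>\<^bsub>M\<^esub> b" by (rule gr_decomp)
  then show ?thesis
    using hcomp_eqI[of a 0 b] hcomp_eqI[of b 1 a] M.a_comm[OF gr_carrier gr_carrier] by (cases p) auto
qed

lemma hcomp_carrier [simp]: "x \<in> carrier M \<Longrightarrow> hcomp M p x \<in> carrier M"
  using hcomp_closed gr_carrier by blast

lemma hcomp_decomp: "x \<in> carrier M \<Longrightarrow> hcomp M 0 x \<oplus>\<^bsub>M\<^esub> hcomp M 1 x = x"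
proof -
  assume "x \<in> carrier M"
  then obtain a b where ab: "a \<in> gr M 0" "b \<in> gr M 1" "x = a \<oplus>\<^bsub>M\<^esub> b" by (rule gr_decomp)
  then show ?thesis
    using hcomp_eqI[of a 0 b] hcomp_eqI[of b 1 a] M.a_comm[of a b] gr_carrier by auto
qed

lemma hcomp_unique:
  assumes "a \<in> gr M 0" "b \<in> gr M 1" "x = a \<oplus>\<^bsub>M\<^esub> b"
  shows "hcomp M p x = (if p = 0 then a else b)"
  using assms hcomp_eqI[of a 0 b] hcomp_eqI[of b 1 a] M.a_comm[of a b] gr_carrier by (cases p) auto

lemma hcomp_homog: "x \<in> gr M q \<Longrightarrow> hcomp M p x = (if p = q then x else \<zero>\<^bsub>M\<^esub>)"
  using hcomp_unique[of x "\<zero>\<^bsub>M\<^esub>" x p] hcomp_unique[of "\<zero>\<^bsub>M\<^esub>" x x p] gr_carrier[of x q]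
  by (cases q; cases p) (auto simp: gr_zero)

lemma hcomp_zero [simp]: "hcomp M p \<zero>\<^bsub>M\<^esub> = \<zero>\<^bsub>M\<^esub>"
  using hcomp_homog[OF gr_zero] by simp

lemma hcomp_add:
  assumes "x \<in> carrier M" "y \<in> carrier M"
  shows "hcomp M p (x \<oplus>\<^bsub>M\<^esub> y) = hcomp M p x \<oplus>\<^bsub>M\<^esub> hcomp M p y"
proof -
  have "x \<oplus>\<^bsub>M\<^esub> y = (hcomp M 0 x \<oplus>\<^bsub>M\<^esub> hcomp M 1 x) \<oplus>\<^bsub>M\<^esub> (hcomp M 0 y \<oplus>\<^bsub>M\<^esub> hcomp M 1 y)"
    using assms by (simp add: hcomp_decomp)
  also have "\<dots> = (hcomp M 0 x \<oplus>\<^bsub>M\<^esub> hcomp M 0 y) \<oplus>\<^bsub>M\<^esub> (hcomp M 1 x \<oplus>\<^bsub>M\<^esub> hcomp M 1 y)"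
    using assms by (simp add: M.a_ac)
  finally show ?thesis
    using assms by (subst hcomp_unique) (auto intro: gr_add hcomp_closed)
qed

lemma hcomp_smult:
  assumes "r \<in> carrier R" "x \<in> carrier M"
  shows "hcomp M p (r \<odot>\<^bsub>M\<^esub> x) = r \<odot>\<^bsub>M\<^esub> hcomp M p x"
proof -
  have "r \<odot>\<^bsub>M\<^esub> x = r \<odot>\<^bsub>M\<^esub> hcomp M 0 x \<oplus>\<^bsub>M\<^esub> r \<odot>\<^bsub>M\<^esub> hcomp M 1 x"
    using assms by (simp add: hcomp_decomp smult_r_distr[symmetric])
  then show ?thesis
    using assms by (subst hcomp_unique) (auto intro: gr_smult hcomp_closed)
qed

lemma gr_koszul_smult: "x \<in> gr M p \<Longrightarrow> koszul R q \<odot>\<^bsub>M\<^esub> x \<in> gr M p"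
  by (simp add: gr_smult)

end

section \<open>Even linear maps, even bilinear maps and cocycles\<close>

definition even_linear ::
  "('a, 'x) ring_scheme \<Rightarrow> ('a, 'b, 'y) supermodule_scheme \<Rightarrow> ('a, 'c, 'z) supermodule_scheme \<Rightarrow>
    ('b \<Rightarrow> 'c) \<Rightarrow> bool" where
  "even_linear R M N f \<longleftrightarrow>
     (\<forall>x\<in>carrier M. f x \<in> carrier N) \<and>
     (\<forall>x\<in>carrier M. \<forall>y\<in>carrier M. f (x \<oplus>\<^bsub>M\<^esub> y) = f x \<oplus>\<^bsub>N\<^esub> f y) \<and>
     (\<forall>r\<in>carrier R. \<forall>x\<in>carrier M. f (r \<odot>\<^bsub>M\<^esub> x) = r \<odot>\<^bsub>N\<^esub> f x) \<and>
     (\<forall>p. \<forall>x\<in>gr M p. f x \<in> gr N p)"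

lemma leibniz_hom_even_linear: "f \<in> leibniz_hom R L M \<Longrightarrow> even_linear R L M f"
  unfolding leibniz_hom_def even_linear_def by auto

locale even_linear_map = M: supermodule R M + N: supermodule R N
  for R (structure) and M (structure) and N (structure) and f +
  assumes even_linear: "even_linear R M N f"
begin

lemma closed [simp]: "x \<in> carrier M \<Longrightarrow> f x \<in> carrier N"
  and add: "x \<in> carrier M \<Longrightarrow> y \<in> carrier M \<Longrightarrow> f (x \<oplus>\<^bsub>M\<^esub> y) = f x \<oplus>\<^bsub>N\<^esub> f y"
  and smult: "r \<in> carrier R \<Longrightarrow> x \<in> carrier M \<Longrightarrow> f (r \<odot>\<^bsub>M\<^esub> x) = r \<odot>\<^bsub>N\<^esub> f x"
  and graded: "x \<in> gr M p \<Longrightarrow> f x \<in> gr N p"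
  using even_linear unfolding even_linear_def by auto

lemma zero [simp]: "f \<zero>\<^bsub>M\<^esub> = \<zero>\<^bsub>N\<^esub>"
  using smult[of "\<zero>\<^bsub>R\<^esub>" "\<zero>\<^bsub>M\<^esub>"] by simp

lemma uminus: "x \<in> carrier M \<Longrightarrow> f (\<ominus>\<^bsub>M\<^esub> x) = \<ominus>\<^bsub>N\<^esub> f x"
  using smult[of "\<ominus>\<^bsub>R\<^esub> \<one>\<^bsub>R\<^esub>" x] by simp

lemma minus: "x \<in> carrier M \<Longrightarrow> y \<in> carrier M \<Longrightarrow> f (x \<ominus>\<^bsub>M\<^esub> y) = f x \<ominus>\<^bsub>N\<^esub> f y"
  by (simp add: M.minus_eq N.minus_eq add uminus)

lemma hcomp: "x \<in> carrier M \<Longrightarrow> f (hcomp M p x) = hcomp N p (f x)"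
proof -
  assume x: "x \<in> carrier M"
  have "f x = f (hcomp M 0 x) \<oplus>\<^bsub>N\<^esub> f (hcomp M 1 x)"
    using x by (simp add: add[symmetric] M.hcomp_decomp)
  then show ?thesis
    using x by (subst N.hcomp_unique) (auto intro: graded M.hcomp_closed)
qed

end

text \<open>The clauses of \<open>even_bilinear\<close> with a second supermodule as target, as
  cocycles require.\<close>

definition even_bilinear_map ::
  "('a, 'x) ring_scheme \<Rightarrow> ('a, 'b, 'y) supermodule_scheme \<Rightarrow> ('a, 'c, 'z) supermodule_scheme \<Rightarrow>
    ('b \<Rightarrow> 'b \<Rightarrow> 'c) \<Rightarrow> bool" where
  "even_bilinear_map R M V f \<longleftrightarrow>
     (\<forall>x\<in>carrier M. \<forall>y\<in>carrier M. f x y \<in> carrier V) \<and>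
     (\<forall>x\<in>carrier M. \<forall>x'\<in>carrier M. \<forall>y\<in>carrier M.
        f (x \<oplus>\<^bsub>M\<^esub> x') y = f x y \<oplus>\<^bsub>V\<^esub> f x' y \<and> f y (x \<oplus>\<^bsub>M\<^esub> x') = f y x \<oplus>\<^bsub>V\<^esub> f y x') \<and>
     (\<forall>r\<in>carrier R. \<forall>x\<in>carrier M. \<forall>y\<in>carrier M.
        f (r \<odot>\<^bsub>M\<^esub> x) y = r \<odot>\<^bsub>V\<^esub> f x y \<and> f x (r \<odot>\<^bsub>M\<^esub> y) = r \<odot>\<^bsub>V\<^esub> f x y) \<and>
     (\<forall>p q. \<forall>x\<in>gr M p. \<forall>y\<in>gr M q. f x y \<in> gr V (p + q))"

lemma even_bilinear_iff: "even_bilinear R M f \<longleftrightarrow> even_bilinear_map R M M f"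
  unfolding even_bilinear_def even_bilinear_map_def ..

locale bilinear_map = M: supermodule R M + V: supermodule R V
  for R (structure) and M (structure) and V (structure) and f +
  assumes bilinear: "even_bilinear_map R M V f"
begin

lemma closed [simp]: "x \<in> carrier M \<Longrightarrow> y \<in> carrier M \<Longrightarrow> f x y \<in> carrier V"
  and add_l: "x \<in> carrier M \<Longrightarrow> x' \<in> carrier M \<Longrightarrow> y \<in> carrier M \<Longrightarrow> f (x \<oplus>\<^bsub>M\<^esub> x') y = f x y \<oplus>\<^bsub>V\<^esub> f x' y"
  and add_r: "x \<in> carrier M \<Longrightarrow> x' \<in> carrier M \<Longrightarrow> y \<in> carrier M \<Longrightarrow> f y (x \<oplus>\<^bsub>M\<^esub> x') = f y x \<oplus>\<^bsub>V\<^esub> f y x'"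
  and smult_l: "r \<in> carrier R \<Longrightarrow> x \<in> carrier M \<Longrightarrow> y \<in> carrier M \<Longrightarrow> f (r \<odot>\<^bsub>M\<^esub> x) y = r \<odot>\<^bsub>V\<^esub> f x y"
  and smult_r: "r \<in> carrier R \<Longrightarrow> x \<in> carrier M \<Longrightarrow> y \<in> carrier M \<Longrightarrow> f x (r \<odot>\<^bsub>M\<^esub> y) = r \<odot>\<^bsub>V\<^esub> f x y"
  and graded: "x \<in> gr M p \<Longrightarrow> y \<in> gr M q \<Longrightarrow> f x y \<in> gr V (p + q)"
  using bilinear unfolding even_bilinear_map_def by blast+

lemma zero_l [simp]: "y \<in> carrier M \<Longrightarrow> f \<zero>\<^bsub>M\<^esub> y = \<zero>\<^bsub>V\<^esub>"
  using smult_l[of "\<zero>\<^bsub>R\<^esub>" "\<zero>\<^bsub>M\<^esub>" y] by simp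

lemma zero_r [simp]: "y \<in> carrier M \<Longrightarrow> f y \<zero>\<^bsub>M\<^esub> = \<zero>\<^bsub>V\<^esub>"
  using smult_r[of "\<zero>\<^bsub>R\<^esub>" y "\<zero>\<^bsub>M\<^esub>"] by simp

lemma uminus_l: "x \<in> carrier M \<Longrightarrow> y \<in> carrier M \<Longrightarrow> f (\<ominus>\<^bsub>M\<^esub> x) y = \<ominus>\<^bsub>V\<^esub> f x y"
  using smult_l[of "\<ominus>\<^bsub>R\<^esub> \<one>\<^bsub>R\<^esub>" x y] by simp

lemma uminus_r: "x \<in> carrier M \<Longrightarrow> y \<in> carrier M \<Longrightarrow> f x (\<ominus>\<^bsub>M\<^esub> y) = \<ominus>\<^bsub>V\<^esub> f x y"
  using smult_r[of "\<ominus>\<^bsub>R\<^esub> \<one>\<^bsub>R\<^esub>" x y] by simp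

lemma minus_l: "x \<in> carrier M \<Longrightarrow> x' \<in> carrier M \<Longrightarrow> y \<in> carrier M \<Longrightarrow>
    f (x \<ominus>\<^bsub>M\<^esub> x') y = f x y \<ominus>\<^bsub>V\<^esub> f x' y"
  by (simp add: M.minus_eq V.minus_eq add_l uminus_l)

lemma minus_r: "x \<in> carrier M \<Longrightarrow> x' \<in> carrier M \<Longrightarrow> y \<in> carrier M \<Longrightarrow>
    f y (x \<ominus>\<^bsub>M\<^esub> x') = f y x \<ominus>\<^bsub>V\<^esub> f y x'"
  by (simp add: M.minus_eq V.minus_eq add_r uminus_r)

lemmas linear_simps = add_l add_r smult_l smult_r uminus_l uminus_r minus_l minus_r

lemma finsum_l: "finite A \<Longrightarrow> g \<in> A \<rightarrow> carrier M \<Longrightarrow> y \<in> carrier M \<Longrightarrow>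
    f (\<Oplus>\<^bsub>M\<^esub>i\<in>A. g i) y = (\<Oplus>\<^bsub>V\<^esub>i\<in>A. f (g i) y)"
  by (induction rule: finite_induct) (auto simp: add_l Pi_iff)

lemma finsum_r: "finite A \<Longrightarrow> g \<in> A \<rightarrow> carrier M \<Longrightarrow> y \<in> carrier M \<Longrightarrow>
    f y (\<Oplus>\<^bsub>M\<^esub>i\<in>A. g i) = (\<Oplus>\<^bsub>V\<^esub>i\<in>A. f y (g i))"
  by (induction rule: finite_induct) (auto simp: add_r Pi_iff)

end

text \<open>This is the Leibniz identity with the outer bracket replaced by \<psi>, the cocycle
  condition for trivial coefficients: it makes \<open>([x, y], \<psi> x y)\<close> a Leibniz bracket
  on the sum of L and V. The bracket of L satisfies it with V = L, so one set of rules serves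
  both.\<close>

definition leibniz_cocycle ::
  "('a, 'x) ring_scheme \<Rightarrow> ('a, 'b, 'y) leibniz_scheme \<Rightarrow> ('a, 'c, 'z) supermodule_scheme \<Rightarrow>
    ('b \<Rightarrow> 'b \<Rightarrow> 'c) \<Rightarrow> bool" where
  "leibniz_cocycle R L V \<psi> \<longleftrightarrow> even_bilinear_map R L V \<psi> \<and>
     (\<forall>p q. \<forall>x\<in>carrier L. \<forall>y\<in>gr L p. \<forall>z\<in>gr L q.
        \<psi> x (bracket L y z) =
          \<psi> (bracket L x y) z \<ominus>\<^bsub>V\<^esub> koszul R (p * q) \<odot>\<^bsub>V\<^esub> \<psi> (bracket L x z) y)"

lemma leibniz_superalgebra_iff:
  "leibniz_superalgebra R L \<longleftrightarrow> supermodule R L \<and> leibniz_cocycle R L L (bracket L)"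
  unfolding leibniz_superalgebra_def leibniz_superalgebra_axioms_def leibniz_cocycle_def even_bilinear_iff
  by blast

locale cocycle = L: leibniz_superalgebra R L + V: supermodule R V
  for R (structure) and L (structure) and V (structure) and \<psi> +
  assumes cocycle: "leibniz_cocycle R L V \<psi>"
begin

sublocale bilinear_map R L V \<psi>
  using cocycle unfolding leibniz_cocycle_def by unfold_locales blast

lemma identity: "x \<in> carrier L \<Longrightarrow> y \<in> gr L p \<Longrightarrow> z \<in> gr L q \<Longrightarrow>
   \<psi> x (bracket L y z) = \<psi> (bracket L x y) z \<ominus>\<^bsub>V\<^esub> koszul R (p * q) \<odot>\<^bsub>V\<^esub> \<psi> (bracket L x z) y"
  using cocycle unfolding leibniz_cocycle_def by blast

end

context leibniz_superalgebra
begin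

sublocale br: bilinear_map R L L "bracket L"
  using bracket_even_bilinear unfolding even_bilinear_iff by unfold_locales

lemma bracket_cocycle: "leibniz_cocycle R L L (bracket L)"
  using leibniz_superalgebra_axioms leibniz_superalgebra_iff by blast

lemma leibniz_left:
  assumes "x \<in> carrier L" "y \<in> gr L p" "z \<in> gr L q"
  shows "bracket L (bracket L x y) z =
    bracket L x (bracket L y z) \<oplus>\<^bsub>L\<^esub> koszul R (p * q) \<odot>\<^bsub>L\<^esub> bracket L (bracket L x z) y"
  using leibniz_identity[OF assms] assms gr_carrier
  by (simp add: M.diff_simps)

end

lemma with_bracket_simps [simp]:
  "carrier (with_bracket M br) = carrier M" "zero (with_bracket M br) = zero M"
  "add (with_bracket M br) = add M" "smult (with_bracket M br) = smult M"
  "gr (with_bracket M br) = gr M" "bracket (with_bracket M br) = br"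
  by (simp_all add: with_bracket_def supermodule.defs leibniz.defs)

lemma supermodule_cong:
  fixes M :: "('a, 'b, 'y) supermodule_scheme" and N :: "('a, 'b, 'z) supermodule_scheme"
  assumes "supermodule R M" and eq: "carrier N = carrier M" "zero N = zero M" "add N = add M" "smult N = smult M"
    "gr N = gr M"
  shows "supermodule R N"
proof -
  interpret M: supermodule R M by fact
  show ?thesis
    using module_cong[OF M.module_axioms eq(1-4)]
      submodule_cong[OF M.module_axioms M.gr_submodule eq(1-4)] M.gr_direct
    by (intro supermodule.intro supermodule_axioms.intro) (simp_all add: eq)
qed

lemma a_minus_cong:
  assumes "carrier N = carrier M" "zero N = zero M" "add N = add M"
  shows "a_minus N = a_minus M" "a_inv N = a_inv M"
proof -
  show "a_inv N = a_inv M" using assms by (simp add: a_inv_def m_inv_def fun_eq_iff)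
  then show "a_minus N = a_minus M" by (simp add: fun_eq_iff a_minus_def assms(3))
qed

text \<open>Both sides are additive in the first argument, so the identity need only be tested on
  homogeneous x, although a Leibniz superalgebra demands it for all x.\<close>

lemma with_bracket_leibnizI:
  assumes M: "supermodule R M" and b: "even_bilinear_map R M M br"
    and id: "\<And>x y z p q r. x \<in> gr M r \<Longrightarrow> y \<in> gr M p \<Longrightarrow> z \<in> gr M q \<Longrightarrow>
        br x (br y z) = br (br x y) z \<ominus>\<^bsub>M\<^esub> koszul R (p * q) \<odot>\<^bsub>M\<^esub> br (br x z) y"
  shows "leibniz_superalgebra R (with_bracket M br)"
proof -
  interpret M: supermodule R M by fact
  interpret b: bilinear_map R M M br by unfold_locales (rule b)
  have s: "supermodule R (with_bracket M br)" by (rule supermodule_cong[OF M]) simp_all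
  have mc: "a_minus (with_bracket M br) = a_minus M" by (rule a_minus_cong) simp_all
  show ?thesis
  proof (intro leibniz_superalgebra.intro s leibniz_superalgebra_axioms.intro)
    show "even_bilinear R (with_bracket M br) (bracket (with_bracket M br))"
      using b unfolding even_bilinear_def even_bilinear_map_def by simp
  next
    fix x y z p q
    assume "x \<in> carrier (with_bracket M br)" "y \<in> gr (with_bracket M br) p" "z \<in> gr (with_bracket M br) q"
    then have xyz: "x \<in> carrier M" "y \<in> gr M p" "z \<in> gr M q" by simp_all
    then have c: "y \<in> carrier M" "z \<in> carrier M" using M.gr_carrier by auto
    obtain a b where ab: "a \<in> gr M 0" "b \<in> gr M 1" "x = a \<oplus>\<^bsub>M\<^esub> b" by (rule M.gr_decomp[OF xyz(1)])
    then have d: "a \<in> carrier M" "b \<in> carrier M" using M.gr_carrier by auto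
    have "br x (br y z) = br (br x y) z \<ominus>\<^bsub>M\<^esub> koszul R (p * q) \<odot>\<^bsub>M\<^esub> br (br x z) y"
      using id[OF ab(1) xyz(2,3)] id[OF ab(2) xyz(2,3)] c d unfolding ab(3)
      by (simp add: b.linear_simps M.smult_r_distr M.M.minus_eq M.M.minus_add M.M.a_ac)
    then show "bracket (with_bracket M br) x (bracket (with_bracket M br) y z) =
      bracket (with_bracket M br) (bracket (with_bracket M br) x y) z \<ominus>\<^bsub>with_bracket M br\<^esub>
      koszul R (p * q) \<odot>\<^bsub>with_bracket M br\<^esub>
      bracket (with_bracket M br) (bracket (with_bracket M br) x z) y"
      by (simp add: mc)
  qed
qed

section \<open>Presented Leibniz superalgebras\<close>

text \<open>Operations on classes are unions over representatives; this evaluates such a union once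
  it does not depend on the representative.\<close>

lemma UN_const_eq: "a \<in> A \<Longrightarrow> (\<And>x. x \<in> A \<Longrightarrow> f x = c) \<Longrightarrow> (\<Union>x\<in>A. f x) = c"
  by auto

lemma homog_term_lterms: "homog_term R G p t \<Longrightarrow> t \<in> lterms R G"
  by (induction rule: homog_term.induct) (auto intro: lterms.intros)

lemma lterm_eval_homog:
  assumes M: "leibniz_superalgebra R M" and e: "\<And>p g. g \<in> G p \<Longrightarrow> e g \<in> gr M p"
    and t: "homog_term R G p t"
  shows "lterm_eval M e t \<in> gr M p"
proof -
  interpret M: leibniz_superalgebra R M by fact
  show ?thesis using t
    by induction (simp_all add: e M.gr_zero M.gr_add M.gr_smult M.br.graded)
qed

text \<open>A generator may have both degrees, as \<open>(i, j, 0)\<close> does in the Steinberg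
  presentation. \<open>overlap\<close> asks that it be congruent to zero and
  \<open>homog_rels\<close> that relations be homogeneous; together they make the two graded parts
  of the quotient meet in zero.\<close>

locale presentation =
  fixes R :: "('a, 'x) ring_scheme" (structure) and G :: "bit \<Rightarrow> 'g set"
    and E :: "(('a, 'g) lterm \<times> ('a, 'g) lterm) set"
  assumes cring: "cring R"
    and homog_rels: "(s, t) \<in> E \<Longrightarrow> \<exists>p. homog_term R G p s \<and> homog_term R G p t"
    and overlap: "g \<in> G 0 \<Longrightarrow> g \<in> G 1 \<Longrightarrow> (Gen g, TZero) \<in> leibniz_cong R G E"
begin

interpretation R: cring R by (rule cring)

abbreviation "T \<equiv> lterms R G"
abbreviation "Q \<equiv> presented_leibniz R G E"

definition "cls t = leibniz_cong R G E `` {t}"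

lemma cls_eqI: "(s, t) \<in> leibniz_cong R G E \<Longrightarrow> cls s = cls t"
  unfolding cls_def by (auto intro: leibniz_cong.sym leibniz_cong.trans)

lemma cls_self: "t \<in> T \<Longrightarrow> t \<in> cls t"
  unfolding cls_def by (auto intro: leibniz_cong.refl)

lemma cls_eqD: "cls s = cls t \<Longrightarrow> t \<in> T \<Longrightarrow> (s, t) \<in> leibniz_cong R G E"
  using cls_self[of t] unfolding cls_def by auto

lemma in_cls: "s \<in> cls t \<Longrightarrow> (t, s) \<in> leibniz_cong R G E"
  unfolding cls_def by auto

lemma carrier_presented: "carrier Q = cls ` T"
  unfolding presented_leibniz_def quotient_def cls_def by auto

lemma gr_presented: "gr Q p = cls ` hterms R G p"
  unfolding presented_leibniz_def quotient_def cls_def by auto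

lemma zero_presented: "\<zero>\<^bsub>Q\<^esub> = cls TZero"
  unfolding presented_leibniz_def cls_def by simp

lemma add_presented: "s \<in> T \<Longrightarrow> t \<in> T \<Longrightarrow> cls s \<oplus>\<^bsub>Q\<^esub> cls t = cls (TAdd s t)"
  unfolding presented_leibniz_def
  by (simp add: cls_def[symmetric])
    (intro UN_const_eq[of s] UN_const_eq[of t] cls_self cls_eqI leibniz_cong.add_cong
      leibniz_cong.sym[OF in_cls])

lemma smult_presented: "r \<in> carrier R \<Longrightarrow> t \<in> T \<Longrightarrow> r \<odot>\<^bsub>Q\<^esub> cls t = cls (TScale r t)"
  unfolding presented_leibniz_def
  by (simp add: cls_def[symmetric])
    (intro UN_const_eq[of t] cls_self cls_eqI leibniz_cong.scale_cong leibniz_cong.sym[OF in_cls])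

lemma bracket_presented: "s \<in> T \<Longrightarrow> t \<in> T \<Longrightarrow> bracket Q (cls s) (cls t) = cls (TBr s t)"
  unfolding presented_leibniz_def
  by (simp add: cls_def[symmetric])
    (intro UN_const_eq[of s] UN_const_eq[of t] cls_self cls_eqI leibniz_cong.br_cong
      leibniz_cong.sym[OF in_cls])

lemmas presented_simps = carrier_presented gr_presented zero_presented add_presented
  smult_presented bracket_presented

lemma module_presented: "module R Q"
proof -
  note [intro] = lterms.intros
  have ag: "abelian_group Q"
  proof (rule abelian_groupI)
    fix x y z assume "x \<in> carrier Q" "y \<in> carrier Q" "z \<in> carrier Q"
    then show "x \<oplus>\<^bsub>Q\<^esub> y \<oplus>\<^bsub>Q\<^esub> z = x \<oplus>\<^bsub>Q\<^esub> (y \<oplus>\<^bsub>Q\<^esub> z)"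
      by (auto simp: presented_simps lterms.intros cls_eqI[OF leibniz_cong.add_assoc])
  next
    fix x y assume "x \<in> carrier Q" "y \<in> carrier Q"
    then show "x \<oplus>\<^bsub>Q\<^esub> y = y \<oplus>\<^bsub>Q\<^esub> x"
      by (auto simp: presented_simps cls_eqI[OF leibniz_cong.add_comm])
  next
    fix x assume "x \<in> carrier Q"
    then obtain t where t: "t \<in> T" "x = cls t" by (auto simp: presented_simps)
    show "\<zero>\<^bsub>Q\<^esub> \<oplus>\<^bsub>Q\<^esub> x = x"
      using t by (auto simp: presented_simps lterms.intros cls_eqI[OF leibniz_cong.add_zero])
    \<comment> \<open>Terms have no negation, so the inverse of a class is its multiple by
      \<open>\<ominus>\<one>\<close>.\<close>
    have m: "\<ominus>\<one> \<in> carrier R" by simp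
    have "cls (TScale (\<ominus>\<one>) t) \<oplus>\<^bsub>Q\<^esub> cls t = cls (TAdd (TScale (\<ominus>\<one>) t) (TScale \<one> t))"
      using t m by (subst add_presented) (blast intro!: cls_eqI leibniz_cong.add_cong
          leibniz_cong.refl leibniz_cong.sym[OF leibniz_cong.scale_one])+
    also have "\<dots> = cls (TScale (\<ominus>\<one> \<oplus> \<one>) t)"
      using t m by (intro cls_eqI leibniz_cong.sym[OF leibniz_cong.scale_add_left]) auto
    also have "\<dots> = \<zero>\<^bsub>Q\<^esub>"
      using t by (auto simp: zero_presented R.l_neg intro!: cls_eqI leibniz_cong.scale_zero)
    finally show "\<exists>y\<in>carrier Q. y \<oplus>\<^bsub>Q\<^esub> x = \<zero>\<^bsub>Q\<^esub>"
      using t m by (intro bexI[of _ "cls (TScale (\<ominus>\<one>) t)"]) (auto simp: carrier_presented)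
  qed (auto simp: presented_simps)
  show ?thesis
    by (intro moduleI cring ag)
      (auto simp: presented_simps lterms.intros cls_eqI[OF leibniz_cong.scale_add_left]
        cls_eqI[OF leibniz_cong.scale_add_right] cls_eqI[OF leibniz_cong.scale_mult]
        cls_eqI[OF leibniz_cong.scale_one])
qed

interpretation Q: module R Q by (rule module_presented)

lemma cls_closed: "t \<in> T \<Longrightarrow> cls t \<in> carrier Q"
  by (simp add: carrier_presented)

lemma bracket_simps:
  shows "x \<in> carrier Q \<Longrightarrow> y \<in> carrier Q \<Longrightarrow> bracket Q x y \<in> carrier Q"
    "x \<in> carrier Q \<Longrightarrow> y \<in> carrier Q \<Longrightarrow> z \<in> carrier Q \<Longrightarrow>
      bracket Q (x \<oplus>\<^bsub>Q\<^esub> y) z = bracket Q x z \<oplus>\<^bsub>Q\<^esub> bracket Q y z"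
    "x \<in> carrier Q \<Longrightarrow> y \<in> carrier Q \<Longrightarrow> z \<in> carrier Q \<Longrightarrow>
      bracket Q z (x \<oplus>\<^bsub>Q\<^esub> y) = bracket Q z x \<oplus>\<^bsub>Q\<^esub> bracket Q z y"
    "r \<in> carrier R \<Longrightarrow> x \<in> carrier Q \<Longrightarrow> y \<in> carrier Q \<Longrightarrow>
      bracket Q (r \<odot>\<^bsub>Q\<^esub> x) y = r \<odot>\<^bsub>Q\<^esub> bracket Q x y"
    "r \<in> carrier R \<Longrightarrow> x \<in> carrier Q \<Longrightarrow> y \<in> carrier Q \<Longrightarrow>
      bracket Q x (r \<odot>\<^bsub>Q\<^esub> y) = r \<odot>\<^bsub>Q\<^esub> bracket Q x y"
  by (auto simp: presented_simps lterms.intros cls_eqI[OF leibniz_cong.br_add_left]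
      cls_eqI[OF leibniz_cong.br_add_right] cls_eqI[OF leibniz_cong.br_scale_left]
      cls_eqI[OF leibniz_cong.br_scale_right])

lemma bracket_zero:
  assumes "x \<in> carrier Q"
  shows "bracket Q \<zero>\<^bsub>Q\<^esub> x = \<zero>\<^bsub>Q\<^esub>" "bracket Q x \<zero>\<^bsub>Q\<^esub> = \<zero>\<^bsub>Q\<^esub>"
  using bracket_simps(4)[of \<zero> "\<zero>\<^bsub>Q\<^esub>" x] bracket_simps(5)[of \<zero> x "\<zero>\<^bsub>Q\<^esub>"]
    bracket_simps(1)[of x "\<zero>\<^bsub>Q\<^esub>"] bracket_simps(1)[of "\<zero>\<^bsub>Q\<^esub>" x] assms
  by simp_all

lemma leibniz_presented:
  assumes "x \<in> carrier Q" "t \<in> hterms R G p" "u \<in> hterms R G q"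
  shows "bracket Q x (bracket Q (cls t) (cls u)) = bracket Q (bracket Q x (cls t)) (cls u) \<ominus>\<^bsub>Q\<^esub>
    koszul R (p * q) \<odot>\<^bsub>Q\<^esub> bracket Q (bracket Q x (cls u)) (cls t)"
proof -
  obtain s where s: "s \<in> T" "x = cls s" using assms by (auto simp: carrier_presented)
  have tu: "t \<in> T" "u \<in> T" using assms by (auto simp: hterms_def intro: homog_term_lterms)
  let ?k = "koszul R (p * q)"
  have "bracket Q x (bracket Q (cls t) (cls u)) =
      bracket Q (bracket Q x (cls t)) (cls u) \<oplus>\<^bsub>Q\<^esub> (\<ominus> ?k) \<odot>\<^bsub>Q\<^esub> bracket Q (bracket Q x (cls u)) (cls t)"
    using s tu assms
    by (simp add: presented_simps lterms.intros cls_eqI[OF leibniz_cong.leibniz])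
  then show ?thesis
    using s tu by (simp add: Q.M.minus_eq Q.smult_l_minus bracket_simps(1) cls_closed)
qed

text \<open>The homogeneous components of a term; well defined on classes since all relations are homogeneous.\<close>

primrec component :: "('a, 'g) lterm \<Rightarrow> bit \<Rightarrow> ('a, 'g) lterm set" where
  "component (Gen g) = (\<lambda>p. if g \<in> G p then cls (Gen g) else \<zero>\<^bsub>Q\<^esub>)"
| "component TZero = (\<lambda>p. \<zero>\<^bsub>Q\<^esub>)"
| "component (TAdd s t) = (\<lambda>p. component s p \<oplus>\<^bsub>Q\<^esub> component t p)"
| "component (TScale r t) = (\<lambda>p. r \<odot>\<^bsub>Q\<^esub> component t p)"
| "component (TBr s t) = (\<lambda>p. bracket Q (component s 0) (component t p) \<oplus>\<^bsub>Q\<^esub>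
    bracket Q (component s 1) (component t (p + 1)))"

lemma gr_presented_carrier: "x \<in> gr Q p \<Longrightarrow> x \<in> carrier Q"
  by (auto simp: carrier_presented gr_presented hterms_def intro: homog_term_lterms)

lemma gr_presented_closed:
  shows "\<zero>\<^bsub>Q\<^esub> \<in> gr Q p"
    and "x \<in> gr Q p \<Longrightarrow> y \<in> gr Q p \<Longrightarrow> x \<oplus>\<^bsub>Q\<^esub> y \<in> gr Q p"
    and "r \<in> carrier R \<Longrightarrow> x \<in> gr Q p \<Longrightarrow> r \<odot>\<^bsub>Q\<^esub> x \<in> gr Q p"
    and "x \<in> gr Q p \<Longrightarrow> y \<in> gr Q q \<Longrightarrow> bracket Q x y \<in> gr Q (p + q)"
  by (auto simp: presented_simps hterms_def homog_term_lterms
      intro!: imageI homog_term.intros(2-5))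

lemma component_gr: "t \<in> T \<Longrightarrow> component t p \<in> gr Q p"
proof (induction arbitrary: p rule: lterms.induct)
  case (1 g q)
  then show ?case
    by (auto simp: gr_presented_closed(1)) (auto simp: gr_presented hterms_def intro: homog_term.intros)
next
  case (5 s t)
  then show ?case
    using gr_presented_closed(4)[of _ 0 _ p] gr_presented_closed(4)[of _ 1 _ "p + 1"]
    by (cases p) (auto intro!: gr_presented_closed)
qed (auto intro: gr_presented_closed)

lemma component_closed: "t \<in> T \<Longrightarrow> component t p \<in> carrier Q"
  by (rule gr_presented_carrier[OF component_gr])

text \<open>Only a generator of both degrees is delicate: \<open>component\<close> assigns it its
  own class in both degrees, and \<open>overlap\<close> makes that class zero.\<close>

lemma component_homog: "homog_term R G q t \<Longrightarrow> component t p = (if p = q then cls t else \<zero>\<^bsub>Q\<^esub>)"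
proof (induction arbitrary: p rule: homog_term.induct)
  case (1 g q)
  then show ?case
    using cls_eqI[OF overlap] by (cases p; cases q) (auto simp: zero_presented)
next
  case (2 q)
  then show ?case by (simp add: zero_presented)
next
  case (3 q s t)
  then have "s \<in> T" "t \<in> T" using homog_term_lterms by blast+
  then show ?case using 3 by (simp add: add_presented)
next
  case (4 r q t)
  then have "t \<in> T" using homog_term_lterms by blast
  then show ?case using 4 by (simp add: smult_presented)
next
  case (5 q1 s q2 t)
  have st: "s \<in> T" "t \<in> T" using 5 homog_term_lterms by blast+
  then have "cls s \<in> carrier Q" "cls t \<in> carrier Q" "cls (TBr s t) \<in> carrier Q"
    by (auto intro!: cls_closed lterms.intros)
  then show ?case
    using 5(3,4) st by (cases p; cases q1; cases q2) (simp_all add: bracket_presented bracket_zero)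
qed

lemma component_sum: "t \<in> T \<Longrightarrow> component t 0 \<oplus>\<^bsub>Q\<^esub> component t 1 = cls t"
proof (induction rule: lterms.induct)
  case (1 g p)
  then have "homog_term R G p (Gen g)" by (rule homog_term.intros)
  from component_homog[OF this] cls_closed[OF homog_term_lterms[OF this]] show ?case
    by (cases p) (simp_all del: component.simps)
next
  case 2
  then show ?case by (simp add: zero_presented[symmetric])
next
  case (3 s t)
  from 3(1,2) have "component (TAdd s t) 0 \<oplus>\<^bsub>Q\<^esub> component (TAdd s t) 1 =
      (component s 0 \<oplus>\<^bsub>Q\<^esub> component s 1) \<oplus>\<^bsub>Q\<^esub> (component t 0 \<oplus>\<^bsub>Q\<^esub> component t 1)"
    by (simp add: component_closed Q.M.a_ac)
  also have "\<dots> = cls (TAdd s t)" using 3 by (simp only: add_presented)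
  finally show ?case .
next
  case (4 r t)
  then show ?case
    by (simp add: component_closed Q.smult_r_distr[symmetric] smult_presented)
next
  case (5 s t)
  from 5(1,2) have "component (TBr s t) 0 \<oplus>\<^bsub>Q\<^esub> component (TBr s t) 1 =
      bracket Q (component s 0 \<oplus>\<^bsub>Q\<^esub> component s 1) (component t 0 \<oplus>\<^bsub>Q\<^esub> component t 1)"
    by (simp add: component_closed bracket_simps Q.M.a_ac)
  then show ?case using 5 by (simp add: bracket_presented)
qed

lemma component_bracket_homog:
  assumes "s \<in> T" "homog_term R G q t"
  shows "component (TBr s t) p = bracket Q (component s (p + q)) (cls t)"
  using assms cls_closed[OF homog_term_lterms[OF assms(2)]]
  by (cases p; cases q) (simp_all add: component_homog[OF assms(2)] bracket_zero bracket_simps component_closed)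

text \<open>Relations are homogeneous, so \<open>component_homog\<close> computes both sides. In the
  Leibniz clause the first argument may be inhomogeneous, but t and u are homogeneous; hence only
  its component of degree p + q1 + q2 enters, and the identity in the quotient applies to that
  component.\<close>

lemma component_cong: "(s, t) \<in> leibniz_cong R G E \<Longrightarrow> component s p = component t p"
proof (induction arbitrary: p rule: leibniz_cong.induct)
  case (rel s t)
  then obtain q where "homog_term R G q s" "homog_term R G q t" using homog_rels by blast
  then show ?case using cls_eqI[OF leibniz_cong.rel[OF rel]] by (simp add: component_homog)
next
  case (br_scale_left r s t)
  then show ?case by (simp add: component_closed bracket_simps Q.smult_r_distr)
next
  case (br_scale_right r s t)
  then show ?case by (simp add: component_closed bracket_simps Q.smult_r_distr)
next
  case (leibniz s t q1 u q2)
  then have h: "homog_term R G q1 t" "homog_term R G q2 u" by (auto simp: hterms_def)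
  have tu: "t \<in> T" "u \<in> T" using h homog_term_lterms by blast+
  have "homog_term R G (q1 + q2) (TBr t u)" using h by (rule homog_term.intros)
  then have "component (TBr s (TBr t u)) p =
      bracket Q (component s (p + q1 + q2)) (bracket Q (cls t) (cls u))"
    using leibniz tu by (simp add: component_bracket_homog bracket_presented add.assoc del: component.simps(5))
  also have "\<dots> = bracket Q (bracket Q (component s (p + q1 + q2)) (cls t)) (cls u) \<oplus>\<^bsub>Q\<^esub>
    (\<ominus> koszul R (q1 * q2)) \<odot>\<^bsub>Q\<^esub> bracket Q (bracket Q (component s (p + q1 + q2)) (cls u)) (cls t)"
    using leibniz_presented[OF component_closed[OF leibniz(1)] leibniz(2,3)] leibniz(1) tu
    by (simp add: Q.M.minus_eq Q.smult_l_minus bracket_simps(1) cls_closed component_closed)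
  also have "\<dots> = component (TAdd (TBr (TBr s t) u) (TScale (\<ominus> koszul R (q1 * q2)) (TBr (TBr s u) t))) p"
    using leibniz(1) tu h
    by (simp add: component_bracket_homog lterms.intros ac_simps del: component.simps(5))
  finally show ?case .
qed (auto simp: component_closed bracket_simps Q.M.a_ac Q.smult_l_distr Q.smult_r_distr Q.smult_assoc1)

lemma leibniz_superalgebra_presented: "leibniz_superalgebra R Q"
proof (intro leibniz_superalgebra.intro leibniz_superalgebra_axioms.intro)
  show "supermodule R Q"
  proof (rule supermoduleI)
    show "submodule (gr Q p) R Q" for p
    proof (rule Q.submoduleI)
      fix a assume a: "a \<in> gr Q p"
      then have "\<ominus>\<^bsub>Q\<^esub> a = (\<ominus> \<one>) \<odot>\<^bsub>Q\<^esub> a" using gr_presented_carrier by simp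
      then show "\<ominus>\<^bsub>Q\<^esub> a \<in> gr Q p" using a gr_presented_closed(3) by simp
    qed (auto intro: gr_presented_closed gr_presented_carrier)
  next
    fix x assume "x \<in> carrier Q"
    then obtain t where t: "t \<in> T" "x = cls t" by (auto simp: carrier_presented)
    show "\<exists>a\<in>gr Q 0. \<exists>b\<in>gr Q 1. x = a \<oplus>\<^bsub>Q\<^esub> b"
      using component_sum[OF t(1)] component_gr[OF t(1)] t(2) by metis
  next
    fix x assume "x \<in> gr Q 0" "x \<in> gr Q 1"
    then obtain s t where st: "homog_term R G 0 s" "homog_term R G 1 t" "x = cls s" "x = cls t"
      by (auto simp: gr_presented hterms_def)
    \<comment> \<open>The even component of this class is the class itself when computed from s, and
      zero when computed from t.\<close>
    then have "(s, t) \<in> leibniz_cong R G E" by (auto intro: cls_eqD homog_term_lterms)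
    from component_cong[OF this, of 0] st show "x = \<zero>\<^bsub>Q\<^esub>"
      by (simp add: component_homog)
  qed (rule module_presented)
  show "even_bilinear R Q (bracket Q)"
    unfolding even_bilinear_def using bracket_simps gr_presented_closed(4) by auto
qed (auto simp: gr_presented leibniz_presented)

text \<open>Evaluation in M respects every clause of the congruence, the structural ones because M
  is a Leibniz superalgebra and the relations by assumption, so the value at a chosen representative
  is well defined.\<close>

lemma presented_hom:
  assumes M: "leibniz_superalgebra R M" and e: "\<And>p g. g \<in> G p \<Longrightarrow> e g \<in> gr M p"
    and rels: "\<And>s t. (s, t) \<in> E \<Longrightarrow> lterm_eval M e s = lterm_eval M e t"
  shows "\<exists>f\<in>leibniz_hom R Q M. \<forall>t\<in>T. f (cls t) = lterm_eval M e t"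
proof -
  interpret M: leibniz_superalgebra R M by fact
  let ?ev = "lterm_eval M e"
  have ev [simp]: "?ev t \<in> carrier M" if "t \<in> T" for t
    by (rule lterm_eval_closed[where G=G, OF M e that])
  have cong: "?ev s = ?ev t" if "(s, t) \<in> leibniz_cong R G E" for s t
    using that
  proof (induction rule: leibniz_cong.induct)
    case (leibniz s t p u q)
    then have h: "homog_term R G p t" "homog_term R G q u" by (auto simp: hterms_def)
    have tu: "t \<in> T" "u \<in> T" using h homog_term_lterms by blast+
    show ?case
      using M.leibniz_identity[OF ev[OF leibniz(1)] lterm_eval_homog[OF M e h(1)] lterm_eval_homog[OF M e h(2)]]
        leibniz(1) tu by (simp add: minus_smult[OF M])
  qed (auto simp: rels M.br.linear_simps M.M.a_ac M.smult_l_distr M.smult_r_distr M.smult_assoc1)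
  define f where "f X = ?ev (SOME t. t \<in> X)" for X
  have f: "f (cls t) = ?ev t" if "t \<in> T" for t
    unfolding f_def using cong[OF in_cls, of "SOME s. s \<in> cls t" t] someI[of "\<lambda>s. s \<in> cls t" t]
      cls_self[OF that] by simp
  have "f \<in> leibniz_hom R Q M"
    unfolding leibniz_hom_def
  proof (intro CollectI conjI ballI allI)
    show "f \<in> carrier Q \<rightarrow> carrier M" by (auto simp: carrier_presented f)
    show "f x \<in> gr M p" if "x \<in> gr Q p" for p x
      using that by (auto simp: gr_presented hterms_def f homog_term_lterms lterm_eval_homog[OF M e])
  qed (auto simp: presented_simps f lterms.intros)
  then show ?thesis using f by blast
qed

lemma lterm_eval_presented: "t \<in> T \<Longrightarrow> lterm_eval Q (\<lambda>g. cls (Gen g)) t = cls t"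
  by (induction rule: lterms.induct) (simp_all add: presented_simps)

end

section \<open>The Leibniz superalgebra of a superdialgebra\<close>

lemma (in abelian_group) neg_zero [simp]: "\<ominus> \<zero> = \<zero>"
  using minus_equality[of \<zero> \<zero>] by simp

context superdialgebra
begin

sublocale lp: bilinear_map R D D "(\<stileturn>\<^bsub>D\<^esub>)"
  using lprod_even_bilinear unfolding even_bilinear_iff by unfold_locales

sublocale rp: bilinear_map R D D "(\<turnstile>\<^bsub>D\<^esub>)"
  using rprod_even_bilinear unfolding even_bilinear_iff by unfold_locales

text \<open>These rules leave three normal forms of a triple product, one for each choice of the
  central factor, as in the free dialgebra: \<open>(a \<stileturn> b) \<stileturn> c\<close>,
  \<open>a \<turnstile> (b \<stileturn> c)\<close> and
  \<open>a \<turnstile> (b \<turnstile> c)\<close>.\<close>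

lemma assoc_simps:
  assumes "a \<in> carrier D" "b \<in> carrier D" "c \<in> carrier D"
  shows "a \<stileturn>\<^bsub>D\<^esub> (b \<stileturn>\<^bsub>D\<^esub> c) = (a \<stileturn>\<^bsub>D\<^esub> b) \<stileturn>\<^bsub>D\<^esub> c"
    and "a \<stileturn>\<^bsub>D\<^esub> (b \<turnstile>\<^bsub>D\<^esub> c) = (a \<stileturn>\<^bsub>D\<^esub> b) \<stileturn>\<^bsub>D\<^esub> c"
    and "(a \<turnstile>\<^bsub>D\<^esub> b) \<stileturn>\<^bsub>D\<^esub> c = a \<turnstile>\<^bsub>D\<^esub> (b \<stileturn>\<^bsub>D\<^esub> c)"
    and "(a \<turnstile>\<^bsub>D\<^esub> b) \<turnstile>\<^bsub>D\<^esub> c = a \<turnstile>\<^bsub>D\<^esub> (b \<turnstile>\<^bsub>D\<^esub> c)"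
    and "(a \<stileturn>\<^bsub>D\<^esub> b) \<turnstile>\<^bsub>D\<^esub> c = a \<turnstile>\<^bsub>D\<^esub> (b \<turnstile>\<^bsub>D\<^esub> c)"
  using assms lprod_assoc[OF assms] rprod_assoc[OF assms] lprod_lprod_rprod[OF assms]
    rprod_lprod[OF assms] lprod_rprod_rprod[OF assms] by simp_all

lemma dialg_bracket_expand:
  assumes "x \<in> carrier D" "y \<in> carrier D"
  defines "c p q \<equiv> hcomp D p x \<stileturn>\<^bsub>D\<^esub> hcomp D q y \<ominus>\<^bsub>D\<^esub>
    koszul R (p * q) \<odot>\<^bsub>D\<^esub> (hcomp D q y \<turnstile>\<^bsub>D\<^esub> hcomp D p x)"
  shows "dialg_bracket R D x y = (c 0 0 \<oplus>\<^bsub>D\<^esub> c 0 1) \<oplus>\<^bsub>D\<^esub> (c 1 0 \<oplus>\<^bsub>D\<^esub> c 1 1)"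
proof -
  have c: "c p q \<in> carrier D" for p q using assms by (simp add: c_def)
  show ?thesis unfolding dialg_bracket_def c_def[symmetric]
    using c by (simp add: M.finsum_insert Pi_iff M.a_ac)
qed

lemma dialg_bracket_homog:
  assumes "x \<in> gr D p" "y \<in> gr D q"
  shows "dialg_bracket R D x y = x \<stileturn>\<^bsub>D\<^esub> y \<ominus>\<^bsub>D\<^esub> koszul R (p * q) \<odot>\<^bsub>D\<^esub> (y \<turnstile>\<^bsub>D\<^esub> x)"
proof -
  have c: "x \<in> carrier D" "y \<in> carrier D" using assms gr_carrier by auto
  show ?thesis
    unfolding dialg_bracket_expand[OF c] hcomp_homog[OF assms(1)] hcomp_homog[OF assms(2)]
    using c by (cases p; cases q) (simp_all add: M.minus_eq)
qed

lemma dialg_bracket_bilinear: "even_bilinear_map R D D (dialg_bracket R D)"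
proof -
  have "dialg_bracket R D x y \<in> gr D (p + q)" if "x \<in> gr D p" "y \<in> gr D q" for p q x y
    using lp.graded[OF that] rp.graded[OF that(2,1)] unfolding dialg_bracket_homog[OF that]
    by (auto intro!: gr_minus gr_smult simp: add.commute)
  then show ?thesis
    unfolding even_bilinear_map_def
    by (auto simp: dialg_bracket_expand hcomp_add hcomp_smult lp.linear_simps rp.linear_simps
        smult_r_distr smult_r_minus M.minus_eq M.minus_add M.a_ac smult_koszul_commute)
qed

text \<open>For homogeneous arguments both sides expand into signed triple products in normal form,
  which are compared for each of the eight choices of degrees.\<close>

theorem dialg_leibniz: "leibniz_superalgebra R (with_bracket D (dialg_bracket R D))"
proof (rule with_bracket_leibnizI)
  fix x y z p q r assume h: "x \<in> gr D r" "y \<in> gr D p" "z \<in> gr D q"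
  then have c: "x \<in> carrier D" "y \<in> carrier D" "z \<in> carrier D" using gr_carrier by auto
  interpret b: bilinear_map R D D "dialg_bracket R D"
    using dialg_bracket_bilinear by unfold_locales
  note B = dialg_bracket_homog
  show "dialg_bracket R D x (dialg_bracket R D y z) =
    dialg_bracket R D (dialg_bracket R D x y) z \<ominus>\<^bsub>D\<^esub>
    koszul R (p * q) \<odot>\<^bsub>D\<^esub> dialg_bracket R D (dialg_bracket R D x z) y"
    unfolding B[OF h(1) b.graded[OF h(2,3)]] B[OF b.graded[OF h(1,2)] h(3)]
      B[OF b.graded[OF h(1,3)] h(2)] unfolding B[OF h(2,3)] B[OF h(1,2)] B[OF h(1,3)]
    using c
    by (cases p; cases q; cases r)
      (simp_all add: lp.linear_simps rp.linear_simps assoc_simps M.diff_simps M.a_ac)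
qed (rule supermodule_axioms dialg_bracket_bilinear)+

end

section \<open>Matrices over a superdialgebra\<close>

lemma (in abelian_monoid) finsum_swap:
  assumes "finite A" "finite B" and "\<And>i j. i \<in> A \<Longrightarrow> j \<in> B \<Longrightarrow> f i j \<in> carrier G"
  shows "(\<Oplus>i\<in>A. \<Oplus>j\<in>B. f i j) = (\<Oplus>j\<in>B. \<Oplus>i\<in>A. f i j)"
  using assms(1,3)
proof (induction rule: finite_induct)
  case empty
  then show ?case by simp
next
  case (insert a A)
  then have "(\<Oplus>j\<in>B. \<Oplus>i\<in>insert a A. f i j) = (\<Oplus>j\<in>B. f a j \<oplus> (\<Oplus>i\<in>A. f i j))"
    by (intro finsum_cong') (auto simp: Pi_iff intro!: finsum_closed)
  also have "\<dots> = (\<Oplus>j\<in>B. f a j) \<oplus> (\<Oplus>j\<in>B. \<Oplus>i\<in>A. f i j)"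
    using insert by (intro finsum_addf) (auto simp: Pi_iff intro!: finsum_closed)
  finally show ?case using insert by (simp add: Pi_iff)
qed

lemma (in abelian_monoid) finsum_single:
  assumes "finite A" "k \<in> A" "a \<in> carrier G"
  shows "(\<Oplus>i\<in>A. if i = k then a else \<zero>) = a"
proof -
  have "(\<Oplus>i\<in>A. if i = k then a else \<zero>) = (\<Oplus>i\<in>A. if k = i then a else \<zero>)"
    using assms by (intro finsum_cong') auto
  then show ?thesis using finsum_singleton[of k A "\<lambda>_. a"] assms by simp
qed

lemma (in supermodule) finsum_gr:
  "finite A \<Longrightarrow> (\<And>i. i \<in> A \<Longrightarrow> f i \<in> gr M p) \<Longrightarrow> (\<Oplus>\<^bsub>M\<^esub>i\<in>A. f i) \<in> gr M p"
proof (induction rule: finite_induct)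
  case (insert x F)
  then have "f \<in> F \<rightarrow> carrier M" "f x \<in> carrier M" using gr_carrier by blast+
  then show ?case using insert by (simp add: gr_add)
qed (simp add: gr_zero)

context superdialgebra
begin

context
  fixes m n :: nat
begin

abbreviation "N \<equiv> {1..m + n}"
abbreviation "Mat \<equiv> mat_superdialg m n D"
abbreviation "dg \<equiv> idx_deg m"

text \<open>The operation on entries is a parameter so that \<open>\<stileturn>\<close>,
  \<open>\<turnstile>\<close> and their mixed associativity laws are treated together.\<close>

definition "mat_prod f x y = (\<lambda>(i, j)\<in>N \<times> N. \<Oplus>\<^bsub>D\<^esub>k\<in>N. f (x (i, k)) (y (k, j)))"

lemma mat_sel:
  "carrier Mat = N \<times> N \<rightarrow>\<^sub>E carrier D" "\<zero>\<^bsub>Mat\<^esub> = (\<lambda>ij\<in>N \<times> N. \<zero>\<^bsub>D\<^esub>)"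
  "x \<oplus>\<^bsub>Mat\<^esub> y = (\<lambda>ij\<in>N \<times> N. x ij \<oplus>\<^bsub>D\<^esub> y ij)"
  "r \<odot>\<^bsub>Mat\<^esub> x = (\<lambda>ij\<in>N \<times> N. r \<odot>\<^bsub>D\<^esub> x ij)"
  "gr Mat p = (\<Pi>\<^sub>E (i, j)\<in>N \<times> N. gr D (p + dg i + dg j))"
  "(\<stileturn>\<^bsub>Mat\<^esub>) = mat_prod (\<stileturn>\<^bsub>D\<^esub>)" "(\<turnstile>\<^bsub>Mat\<^esub>) = mat_prod (\<turnstile>\<^bsub>D\<^esub>)"
  by (simp_all add: mat_superdialg_def Let_def mat_prod_def fun_eq_iff)

lemma mat_entry_closed [simp]: "x \<in> carrier Mat \<Longrightarrow> i \<in> N \<Longrightarrow> j \<in> N \<Longrightarrow> x (i, j) \<in> carrier D"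
  by (auto simp: mat_sel PiE_iff)

lemma mat_eqI:
  assumes "x \<in> carrier Mat" "y \<in> carrier Mat" "\<And>i j. i \<in> N \<Longrightarrow> j \<in> N \<Longrightarrow> x (i, j) = y (i, j)"
  shows "x = y"
  using assms unfolding mat_sel by (intro PiE_ext[of x "N \<times> N"]) auto

lemma mat_gr_iff: "x \<in> gr Mat p \<longleftrightarrow> x \<in> extensional (N \<times> N) \<and> (\<forall>i\<in>N. \<forall>j\<in>N. x (i, j) \<in> gr D (p + dg i + dg j))"
  unfolding mat_sel PiE_iff by auto

lemma mat_carrier_iff: "x \<in> carrier Mat \<longleftrightarrow> x \<in> extensional (N \<times> N) \<and> (\<forall>i\<in>N. \<forall>j\<in>N. x (i, j) \<in> carrier D)"
  unfolding mat_sel PiE_iff by auto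

lemma mat_gr_entry: "x \<in> gr Mat p \<Longrightarrow> i \<in> N \<Longrightarrow> j \<in> N \<Longrightarrow> x (i, j) \<in> gr D (p + dg i + dg j)"
  unfolding mat_gr_iff by blast

lemma mat_gr_carrier: "x \<in> gr Mat p \<Longrightarrow> x \<in> carrier Mat"
  unfolding mat_gr_iff mat_carrier_iff using gr_carrier by blast

lemma mat_add_entry [simp]: "i \<in> N \<Longrightarrow> j \<in> N \<Longrightarrow> (x \<oplus>\<^bsub>Mat\<^esub> y) (i, j) = x (i, j) \<oplus>\<^bsub>D\<^esub> y (i, j)"
  and mat_smult_entry [simp]: "i \<in> N \<Longrightarrow> j \<in> N \<Longrightarrow> (r \<odot>\<^bsub>Mat\<^esub> x) (i, j) = r \<odot>\<^bsub>D\<^esub> x (i, j)"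
  and mat_zero_entry [simp]: "i \<in> N \<Longrightarrow> j \<in> N \<Longrightarrow> \<zero>\<^bsub>Mat\<^esub> (i, j) = \<zero>\<^bsub>D\<^esub>"
  by (simp_all add: mat_sel)

lemma mat_closed [simp]:
  "\<zero>\<^bsub>Mat\<^esub> \<in> carrier Mat"
  "x \<in> carrier Mat \<Longrightarrow> y \<in> carrier Mat \<Longrightarrow> x \<oplus>\<^bsub>Mat\<^esub> y \<in> carrier Mat"
  "r \<in> carrier R \<Longrightarrow> x \<in> carrier Mat \<Longrightarrow> r \<odot>\<^bsub>Mat\<^esub> x \<in> carrier Mat"
  by (auto simp: mat_sel)

lemma module_mat: "module R Mat"
proof (rule moduleI)
  show "abelian_group Mat"
  proof (rule abelian_groupI)
    fix x assume x: "x \<in> carrier Mat"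
    let ?y = "(\<ominus>\<^bsub>R\<^esub> \<one>\<^bsub>R\<^esub>) \<odot>\<^bsub>Mat\<^esub> x"
    have y: "?y \<in> carrier Mat" using x by simp
    moreover have "?y \<oplus>\<^bsub>Mat\<^esub> x = \<zero>\<^bsub>Mat\<^esub>"
      using x y by (intro mat_eqI) (simp_all add: M.l_neg)
    ultimately show "\<exists>y\<in>carrier Mat. y \<oplus>\<^bsub>Mat\<^esub> x = \<zero>\<^bsub>Mat\<^esub>" by blast
  qed (auto intro!: mat_eqI simp: M.a_ac)
qed (auto intro!: mat_eqI simp: is_cring smult_l_distr smult_r_distr smult_assoc1)

interpretation Mat: module R Mat by (rule module_mat)

lemma mat_uminus_entry: "x \<in> carrier Mat \<Longrightarrow> i \<in> N \<Longrightarrow> j \<in> N \<Longrightarrow> (\<ominus>\<^bsub>Mat\<^esub> x) (i, j) = \<ominus>\<^bsub>D\<^esub> x (i, j)"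
proof -
  assume *: "x \<in> carrier Mat" "i \<in> N" "j \<in> N"
  then have "\<ominus>\<^bsub>Mat\<^esub> x = (\<ominus>\<^bsub>R\<^esub> \<one>\<^bsub>R\<^esub>) \<odot>\<^bsub>Mat\<^esub> x" by simp
  then show ?thesis using * by (simp del: Mat.koszul_smult)
qed

lemma mat_minus_entry: "x \<in> carrier Mat \<Longrightarrow> y \<in> carrier Mat \<Longrightarrow> i \<in> N \<Longrightarrow> j \<in> N \<Longrightarrow>
    (x \<ominus>\<^bsub>Mat\<^esub> y) (i, j) = x (i, j) \<ominus>\<^bsub>D\<^esub> y (i, j)"
  by (simp add: Mat.M.minus_eq M.minus_eq mat_uminus_entry)

lemma supermodule_mat: "supermodule R Mat"
proof (rule supermoduleI)
  show "submodule (gr Mat p) R Mat" for p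
  proof (rule Mat.submoduleI)
    fix a assume a: "a \<in> gr Mat p"
    then have "\<ominus>\<^bsub>Mat\<^esub> a \<in> carrier Mat" using mat_gr_carrier by simp
    then show "\<ominus>\<^bsub>Mat\<^esub> a \<in> gr Mat p"
      using a mat_gr_carrier[OF a] by (simp add: mat_gr_iff mat_carrier_iff mat_uminus_entry gr_uminus)
  qed (auto simp: mat_gr_carrier, auto simp: mat_gr_iff gr_zero gr_add gr_smult, auto simp: mat_sel)
next
  fix x assume x: "x \<in> carrier Mat"
  \<comment> \<open>The entry at \<open>(i, j)\<close> of a matrix of degree p has degree p + |i| +
    |j|, hence the shift.\<close>
  let ?h = "\<lambda>p. \<lambda>(i, j)\<in>N \<times> N. hcomp D (p + dg i + dg j) (x (i, j))"
  have h: "?h p \<in> gr Mat p" for p using x by (auto simp: mat_gr_iff hcomp_closed)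
  have "hcomp D p a \<oplus>\<^bsub>D\<^esub> hcomp D (1 + p) a = a" if "a \<in> carrier D" for p a
    using hcomp_decomp[OF that] M.a_comm[OF hcomp_carrier hcomp_carrier, OF that that]
    by (cases p) simp_all
  then have "x (i, j) = (?h 0 \<oplus>\<^bsub>Mat\<^esub> ?h 1) (i, j)" if "i \<in> N" "j \<in> N" for i j
    using x that by (simp add: add.assoc)
  then have "x = ?h 0 \<oplus>\<^bsub>Mat\<^esub> ?h 1"
    by (rule mat_eqI[OF x mat_closed(2)[OF h[THEN mat_gr_carrier] h[THEN mat_gr_carrier]]])
  then show "\<exists>a\<in>gr Mat 0. \<exists>b\<in>gr Mat 1. x = a \<oplus>\<^bsub>Mat\<^esub> b" using h by blast
next
  fix x assume x: "x \<in> gr Mat 0" "x \<in> gr Mat 1"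
  show "x = \<zero>\<^bsub>Mat\<^esub>"
  proof (rule mat_eqI)
    fix i j assume ij: "i \<in> N" "j \<in> N"
    have "x (i, j) = \<zero>\<^bsub>D\<^esub>"
      using mat_gr_entry[OF x(1) ij] mat_gr_entry[OF x(2) ij] gr_disjoint[of "x (i, j)" "0 + dg i + dg j" "1 + dg i + dg j"]
      by (cases "dg i"; cases "dg j") auto
    then show "x (i, j) = \<zero>\<^bsub>Mat\<^esub> (i, j)" using ij by simp
  qed (use x mat_gr_carrier in auto)
qed (rule module_mat)

lemma mat_prod_entry: "i \<in> N \<Longrightarrow> j \<in> N \<Longrightarrow> mat_prod f x y (i, j) = (\<Oplus>\<^bsub>D\<^esub>k\<in>N. f (x (i, k)) (y (k, j)))"
  by (simp add: mat_prod_def)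

lemma mat_prod_closed:
  assumes "even_bilinear_map R D D f" "x \<in> carrier Mat" "y \<in> carrier Mat"
  shows "mat_prod f x y \<in> carrier Mat"
proof -
  interpret f: bilinear_map R D D f by unfold_locales (rule assms)
  show ?thesis using assms(2,3) unfolding mat_carrier_iff[of "mat_prod f x y"]
    by (auto simp: mat_prod_entry Pi_iff intro!: M.finsum_closed) (simp add: mat_prod_def)
qed

lemma mat_prod_bilinear:
  assumes "even_bilinear_map R D D f"
  shows "even_bilinear_map R Mat Mat (mat_prod f)"
proof -
  interpret f: bilinear_map R D D f by unfold_locales (rule assms)
  note c = mat_prod_closed[OF assms]
  show ?thesis
    unfolding even_bilinear_map_def
  proof (intro conjI allI ballI)
    fix x x' y assume *: "x \<in> carrier Mat" "x' \<in> carrier Mat" "y \<in> carrier Mat"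
    show "mat_prod f (x \<oplus>\<^bsub>Mat\<^esub> x') y = mat_prod f x y \<oplus>\<^bsub>Mat\<^esub> mat_prod f x' y"
    proof (rule mat_eqI)
      fix i j assume ij: "i \<in> N" "j \<in> N"
      have "mat_prod f (x \<oplus>\<^bsub>Mat\<^esub> x') y (i, j) = (\<Oplus>\<^bsub>D\<^esub>k\<in>N. f (x (i, k)) (y (k, j)) \<oplus>\<^bsub>D\<^esub> f (x' (i, k)) (y (k, j)))"
        unfolding mat_prod_entry[OF ij] using ij * by (intro M.finsum_cong') (simp_all add: f.linear_simps)
      also have "\<dots> = (mat_prod f x y \<oplus>\<^bsub>Mat\<^esub> mat_prod f x' y) (i, j)"
        using ij * by (subst M.finsum_addf) (simp_all add: mat_prod_entry Pi_iff)
      finally show "mat_prod f (x \<oplus>\<^bsub>Mat\<^esub> x') y (i, j) = (mat_prod f x y \<oplus>\<^bsub>Mat\<^esub> mat_prod f x' y) (i, j)" .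
    qed (use * c in auto)
    show "mat_prod f y (x \<oplus>\<^bsub>Mat\<^esub> x') = mat_prod f y x \<oplus>\<^bsub>Mat\<^esub> mat_prod f y x'"
    proof (rule mat_eqI)
      fix i j assume ij: "i \<in> N" "j \<in> N"
      have "mat_prod f y (x \<oplus>\<^bsub>Mat\<^esub> x') (i, j) = (\<Oplus>\<^bsub>D\<^esub>k\<in>N. f (y (i, k)) (x (k, j)) \<oplus>\<^bsub>D\<^esub> f (y (i, k)) (x' (k, j)))"
        unfolding mat_prod_entry[OF ij] using ij * by (intro M.finsum_cong') (simp_all add: f.linear_simps)
      also have "\<dots> = (mat_prod f y x \<oplus>\<^bsub>Mat\<^esub> mat_prod f y x') (i, j)"
        using ij * by (subst M.finsum_addf) (simp_all add: mat_prod_entry Pi_iff)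
      finally show "mat_prod f y (x \<oplus>\<^bsub>Mat\<^esub> x') (i, j) = (mat_prod f y x \<oplus>\<^bsub>Mat\<^esub> mat_prod f y x') (i, j)" .
    qed (use * c in auto)
  next
    fix r x y assume *: "r \<in> carrier R" "x \<in> carrier Mat" "y \<in> carrier Mat"
    show "mat_prod f (r \<odot>\<^bsub>Mat\<^esub> x) y = r \<odot>\<^bsub>Mat\<^esub> mat_prod f x y"
    proof (rule mat_eqI)
      fix i j assume ij: "i \<in> N" "j \<in> N"
      have "mat_prod f (r \<odot>\<^bsub>Mat\<^esub> x) y (i, j) = (\<Oplus>\<^bsub>D\<^esub>k\<in>N. r \<odot>\<^bsub>D\<^esub> f (x (i, k)) (y (k, j)))"
        unfolding mat_prod_entry[OF ij] using ij * by (intro M.finsum_cong') (simp_all add: f.linear_simps)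
      also have "\<dots> = (r \<odot>\<^bsub>Mat\<^esub> mat_prod f x y) (i, j)"
        using ij * by (subst finsum_smult_ldistr[symmetric]) (simp_all add: mat_prod_entry Pi_iff)
      finally show "mat_prod f (r \<odot>\<^bsub>Mat\<^esub> x) y (i, j) = (r \<odot>\<^bsub>Mat\<^esub> mat_prod f x y) (i, j)" .
    qed (use * c in auto)
    show "mat_prod f x (r \<odot>\<^bsub>Mat\<^esub> y) = r \<odot>\<^bsub>Mat\<^esub> mat_prod f x y"
    proof (rule mat_eqI)
      fix i j assume ij: "i \<in> N" "j \<in> N"
      have "mat_prod f x (r \<odot>\<^bsub>Mat\<^esub> y) (i, j) = (\<Oplus>\<^bsub>D\<^esub>k\<in>N. r \<odot>\<^bsub>D\<^esub> f (x (i, k)) (y (k, j)))"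
        unfolding mat_prod_entry[OF ij] using ij * by (intro M.finsum_cong') (simp_all add: f.linear_simps)
      also have "\<dots> = (r \<odot>\<^bsub>Mat\<^esub> mat_prod f x y) (i, j)"
        using ij * by (subst finsum_smult_ldistr[symmetric]) (simp_all add: mat_prod_entry Pi_iff)
      finally show "mat_prod f x (r \<odot>\<^bsub>Mat\<^esub> y) (i, j) = (r \<odot>\<^bsub>Mat\<^esub> mat_prod f x y) (i, j)" .
    qed (use * c in auto)
  next
    fix p q x y assume *: "x \<in> gr Mat p" "y \<in> gr Mat q"
    show "mat_prod f x y \<in> gr Mat (p + q)"
      unfolding mat_gr_iff
    proof (intro conjI ballI)
      fix i j assume ij: "i \<in> N" "j \<in> N"
      show "mat_prod f x y (i, j) \<in> gr D (p + q + dg i + dg j)"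
        unfolding mat_prod_entry[OF ij]
      proof (rule finsum_gr)
        fix k assume k: "k \<in> N"
        have "(p + dg i + dg k) + (q + dg k + dg j) = p + q + dg i + dg j"
          by (cases "dg k") (simp_all add: ac_simps)
        then show "f (x (i, k)) (y (k, j)) \<in> gr D (p + q + dg i + dg j)"
          using f.graded[OF mat_gr_entry[OF *(1) ij(1) k] mat_gr_entry[OF *(2) k ij(2)]] by metis
      qed simp
    qed (simp add: mat_prod_def)
  qed (use c in auto)
qed

text \<open>With four independent operations the associativity axioms of a superdialgebra all become
  instances; the proof is the usual exchange of two finite sums.\<close>

lemma mat_prod_assoc:
  assumes bil: "even_bilinear_map R D D f" "even_bilinear_map R D D g" "even_bilinear_map R D D h"
      "even_bilinear_map R D D k"
    and assoc: "\<And>a b c. a \<in> carrier D \<Longrightarrow> b \<in> carrier D \<Longrightarrow> c \<in> carrier D \<Longrightarrow> f (g a b) c = h a (k b c)"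
    and x: "x \<in> carrier Mat" and y: "y \<in> carrier Mat" and z: "z \<in> carrier Mat"
  shows "mat_prod f (mat_prod g x y) z = mat_prod h x (mat_prod k y z)"
proof (rule mat_eqI)
  interpret f: bilinear_map R D D f by unfold_locales (rule bil)
  interpret g: bilinear_map R D D g by unfold_locales (rule bil)
  interpret h: bilinear_map R D D h by unfold_locales (rule bil)
  interpret k: bilinear_map R D D k by unfold_locales (rule bil)
  fix i j assume ij: "i \<in> N" "j \<in> N"
  have "mat_prod f (mat_prod g x y) z (i, j) = (\<Oplus>\<^bsub>D\<^esub>u\<in>N. \<Oplus>\<^bsub>D\<^esub>v\<in>N. f (g (x (i, v)) (y (v, u))) (z (u, j)))"
    unfolding mat_prod_entry[OF ij] using ij x y z
    by (intro M.finsum_cong') (auto simp: mat_prod_entry f.finsum_l Pi_iff intro!: M.finsum_closed)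
  also have "\<dots> = (\<Oplus>\<^bsub>D\<^esub>v\<in>N. \<Oplus>\<^bsub>D\<^esub>u\<in>N. f (g (x (i, v)) (y (v, u))) (z (u, j)))"
    using ij x y z by (intro M.finsum_swap) auto
  also have "\<dots> = (\<Oplus>\<^bsub>D\<^esub>v\<in>N. h (x (i, v)) (mat_prod k y z (v, j)))"
  proof (intro M.finsum_cong')
    fix v assume v: "v \<in> N"
    have "(\<Oplus>\<^bsub>D\<^esub>u\<in>N. f (g (x (i, v)) (y (v, u))) (z (u, j))) = (\<Oplus>\<^bsub>D\<^esub>u\<in>N. h (x (i, v)) (k (y (v, u)) (z (u, j))))"
      using ij x y z v by (intro M.finsum_cong') (auto simp: assoc)
    then show "(\<Oplus>\<^bsub>D\<^esub>u\<in>N. f (g (x (i, v)) (y (v, u))) (z (u, j))) = h (x (i, v)) (mat_prod k y z (v, j))"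
      using ij x y z v by (simp add: mat_prod_entry h.finsum_r Pi_iff)
  qed (use ij x y z mat_prod_closed[OF bil(4)] in auto)
  also have "\<dots> = mat_prod h x (mat_prod k y z) (i, j)" by (simp add: mat_prod_entry[OF ij])
  finally show "mat_prod f (mat_prod g x y) z (i, j) = mat_prod h x (mat_prod k y z) (i, j)" .
qed (use bil x y z mat_prod_closed in auto)

theorem superdialgebra_mat: "superdialgebra R Mat"
proof (intro superdialgebra.intro supermodule_mat superdialgebra_axioms.intro)
  note l = lp.bilinear and r = rp.bilinear
  show "even_bilinear R Mat (\<stileturn>\<^bsub>Mat\<^esub>)" "even_bilinear R Mat (\<turnstile>\<^bsub>Mat\<^esub>)"
    unfolding even_bilinear_iff mat_sel(6,7) by (rule mat_prod_bilinear l r)+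
  fix a b c assume abc: "a \<in> carrier Mat" "b \<in> carrier Mat" "c \<in> carrier Mat"
  note P = mat_prod_assoc[OF _ _ _ _ _ abc]
  show 1: "a \<stileturn>\<^bsub>Mat\<^esub> b \<stileturn>\<^bsub>Mat\<^esub> c = a \<stileturn>\<^bsub>Mat\<^esub> (b \<stileturn>\<^bsub>Mat\<^esub> c)"
    unfolding mat_sel by (rule P[OF l l l l]) (simp add: assoc_simps)
  show 2: "a \<turnstile>\<^bsub>Mat\<^esub> b \<turnstile>\<^bsub>Mat\<^esub> c = a \<turnstile>\<^bsub>Mat\<^esub> (b \<turnstile>\<^bsub>Mat\<^esub> c)"
    unfolding mat_sel by (rule P[OF r r r r]) (simp add: assoc_simps)
  show "a \<stileturn>\<^bsub>Mat\<^esub> (b \<stileturn>\<^bsub>Mat\<^esub> c) = a \<stileturn>\<^bsub>Mat\<^esub> (b \<turnstile>\<^bsub>Mat\<^esub> c)"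
    unfolding 1[symmetric] unfolding mat_sel by (rule P[OF l l l r]) (simp add: assoc_simps)
  show "a \<turnstile>\<^bsub>Mat\<^esub> b \<stileturn>\<^bsub>Mat\<^esub> c = a \<turnstile>\<^bsub>Mat\<^esub> (b \<stileturn>\<^bsub>Mat\<^esub> c)"
    unfolding mat_sel by (rule P[OF l r r l]) (simp add: assoc_simps)
  show "a \<stileturn>\<^bsub>Mat\<^esub> b \<turnstile>\<^bsub>Mat\<^esub> c = a \<turnstile>\<^bsub>Mat\<^esub> b \<turnstile>\<^bsub>Mat\<^esub> c"
    unfolding 2 unfolding mat_sel by (rule P[OF r l r r]) (simp add: assoc_simps)
qed

abbreviation "em \<equiv> elem_mat m n D"

lemma elem_entry [simp]: "u \<in> N \<Longrightarrow> v \<in> N \<Longrightarrow> em i j a (u, v) = (if u = i \<and> v = j then a else \<zero>\<^bsub>D\<^esub>)"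
  by (simp add: elem_mat_def)

lemma elem_closed [simp]: "a \<in> carrier D \<Longrightarrow> em i j a \<in> carrier Mat"
  unfolding mat_carrier_iff by (auto simp: elem_mat_def)

lemma elem_gr:
  assumes "a \<in> gr D p" "i \<in> N" "j \<in> N"
  shows "em i j a \<in> gr Mat (p + dg i + dg j)"
proof -
  have "p + dg i + dg j + dg i + dg j = p" by (cases "dg i"; cases "dg j") simp_all
  then show ?thesis
    unfolding mat_gr_iff using assms by (auto simp: gr_zero) (simp add: elem_mat_def)
qed

lemma elem_linear:
  "a \<in> carrier D \<Longrightarrow> b \<in> carrier D \<Longrightarrow> em i j (a \<oplus>\<^bsub>D\<^esub> b) = em i j a \<oplus>\<^bsub>Mat\<^esub> em i j b"
  "a \<in> carrier D \<Longrightarrow> r \<in> carrier R \<Longrightarrow> em i j (r \<odot>\<^bsub>D\<^esub> a) = r \<odot>\<^bsub>Mat\<^esub> em i j a"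
  "em i j \<zero>\<^bsub>D\<^esub> = \<zero>\<^bsub>Mat\<^esub>"
  by (auto intro!: mat_eqI)

lemma mat_prod_elem:
  assumes bil: "even_bilinear_map R D D f" and ab: "a \<in> carrier D" "b \<in> carrier D"
    and N: "i \<in> N" "j \<in> N" "k \<in> N" "l \<in> N"
  shows "mat_prod f (em i j a) (em k l b) = (if j = k then em i l (f a b) else \<zero>\<^bsub>Mat\<^esub>)"
proof (rule mat_eqI)
  interpret f: bilinear_map R D D f by unfold_locales (rule bil)
  fix u v assume uv: "u \<in> N" "v \<in> N"
  have "mat_prod f (em i j a) (em k l b) (u, v) =
      (\<Oplus>\<^bsub>D\<^esub>w\<in>N. if w = j then (if u = i \<and> j = k \<and> v = l then f a b else \<zero>\<^bsub>D\<^esub>) else \<zero>\<^bsub>D\<^esub>)"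
    unfolding mat_prod_entry[OF uv] using uv ab by (intro M.finsum_cong') auto
  then show "mat_prod f (em i j a) (em k l b) (u, v) = (if j = k then em i l (f a b) else \<zero>\<^bsub>Mat\<^esub>) (u, v)"
    using uv ab N by (simp add: M.finsum_single)
next
  interpret f: bilinear_map R D D f by unfold_locales (rule bil)
  show "(if j = k then em i l (f a b) else \<zero>\<^bsub>Mat\<^esub>) \<in> carrier Mat" using ab by simp
qed (use ab bil mat_prod_closed in auto)

lemma elem_bracket:
  assumes "a \<in> gr D p" "b \<in> gr D q" and N: "i \<in> N" "j \<in> N" "k \<in> N" "l \<in> N"
  shows "dialg_bracket R Mat (em i j a) (em k l b) =
    (if j = k then em i l (a \<stileturn>\<^bsub>D\<^esub> b) else \<zero>\<^bsub>Mat\<^esub>) \<ominus>\<^bsub>Mat\<^esub>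
    koszul R ((p + dg i + dg j) * (q + dg k + dg l)) \<odot>\<^bsub>Mat\<^esub>
      (if l = i then em k j (b \<turnstile>\<^bsub>D\<^esub> a) else \<zero>\<^bsub>Mat\<^esub>)"
proof -
  interpret Mat: superdialgebra R Mat by (rule superdialgebra_mat)
  have c: "a \<in> carrier D" "b \<in> carrier D" using assms gr_carrier by auto
  show ?thesis
    unfolding Mat.dialg_bracket_homog[OF elem_gr[OF assms(1) N(1,2)] elem_gr[OF assms(2) N(3,4)]]
    unfolding mat_sel(6,7) mat_prod_elem[OF lp.bilinear c N] mat_prod_elem[OF rp.bilinear c(2,1) N(3,4,1,2)] ..
qed

text \<open>A matrix is built up one position at a time, and each entry is split into its two
  homogeneous parts.\<close>

lemma mat_elem_induct [consumes 1, case_names zero add elem]: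
  assumes x: "x \<in> carrier Mat"
    and zero: "P \<zero>\<^bsub>Mat\<^esub>"
    and add: "\<And>x y. x \<in> carrier Mat \<Longrightarrow> y \<in> carrier Mat \<Longrightarrow> P x \<Longrightarrow> P y \<Longrightarrow> P (x \<oplus>\<^bsub>Mat\<^esub> y)"
    and elem: "\<And>i j a p. i \<in> N \<Longrightarrow> j \<in> N \<Longrightarrow> a \<in> gr D p \<Longrightarrow> P (em i j a)"
  shows "P x"
proof -
  have elem': "P (em i j a)" if "i \<in> N" "j \<in> N" "a \<in> carrier D" for i j a
  proof -
    have "P (em i j (hcomp D p a))" for p by (rule elem[OF that(1,2) hcomp_closed[OF that(3)]])
    then have "P (em i j (hcomp D 0 a) \<oplus>\<^bsub>Mat\<^esub> em i j (hcomp D 1 a))" using that by (intro add) auto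
    then show ?thesis using that by (simp add: elem_linear(1)[symmetric] hcomp_decomp)
  qed
  let ?r = "\<lambda>F. \<lambda>ij\<in>N \<times> N. if ij \<in> F then x ij else \<zero>\<^bsub>D\<^esub>"
  have r: "?r F \<in> carrier Mat" for F using x by (auto simp: mat_carrier_iff)
  have "P (?r F)" if "finite F" "F \<subseteq> N \<times> N" for F
    using that
  proof (induction rule: finite_induct)
    case empty
    have z: "?r {} = \<zero>\<^bsub>Mat\<^esub>" by (simp add: mat_sel restrict_def fun_eq_iff)
    show ?case unfolding z by (rule zero)
  next
    case (insert ij F)
    obtain i j where ij: "ij = (i, j)" by fastforce
    then have N: "i \<in> N" "j \<in> N" using insert by auto
    have "?r (insert ij F) = ?r F \<oplus>\<^bsub>Mat\<^esub> em i j (x (i, j))"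
      by (rule mat_eqI[OF r mat_closed(2)[OF r elem_closed]]) (use x N insert ij in auto)
    moreover have "P (?r F)" using insert.prems by (intro insert.IH) blast
    ultimately show ?case using add[OF r _ _ elem'] x N by simp
  qed
  from this[of "N \<times> N"] have "P (?r (N \<times> N))" by simp
  moreover have "?r (N \<times> N) = x" by (rule mat_eqI[OF r x]) auto
  ultimately show ?thesis by simp
qed

end

end

text \<open>Prevents the index 1 from being rewritten to \<open>Suc 0\<close>.\<close>

declare One_nat_def [simp del]

section \<open>The special linear Leibniz superalgebra\<close>

context module
begin

lemma submodule_span_submodule:
  assumes "B \<subseteq> carrier M"
  shows "submodule (submodule_span R M B) R M"
proof (rule submoduleI)
  show "submodule_span R M B \<subseteq> carrier M"
    unfolding submodule_span_def using carrier_is_submodule assms by blast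
qed (auto simp: submodule_span_def dest: submoduleE(3-5), auto simp: submodule_def subgroup_def)

lemma submodule_span_incl: "B \<subseteq> submodule_span R M B"
  unfolding submodule_span_def by blast

lemma submodule_span_least: "submodule N R M \<Longrightarrow> B \<subseteq> N \<Longrightarrow> submodule_span R M B \<subseteq> N"
  unfolding submodule_span_def by blast

lemma submodule_zero: "submodule N R M \<Longrightarrow> \<zero>\<^bsub>M\<^esub> \<in> N"
  by (simp add: submodule_def subgroup_def)

lemma submodule_minus: "submodule N R M \<Longrightarrow> x \<in> N \<Longrightarrow> y \<in> N \<Longrightarrow> x \<ominus>\<^bsub>M\<^esub> y \<in> N"
  unfolding M.minus_eq using submoduleE(3,5) by blast

end

text \<open>Closure under components is what makes the restricted grading decompose S.\<close>

lemma (in leibniz_superalgebra) sub_leibniz: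
  assumes S: "submodule S R L" and hcomp: "\<And>x p. x \<in> S \<Longrightarrow> hcomp L p x \<in> S"
    and br: "\<And>x y. x \<in> S \<Longrightarrow> y \<in> S \<Longrightarrow> bracket L x y \<in> S"
  shows "leibniz_superalgebra R (L\<lparr>carrier := S, gr := \<lambda>p. gr L p \<inter> S\<rparr>)" (is "leibniz_superalgebra R ?N")
proof -
  note SE = submoduleE[OF S]
  have c: "x \<in> carrier L" if "x \<in> S" for x using SE(1) that by blast
  interpret N: module R ?N
    by (rule module_cong[OF submodule.submodule_is_module[OF S module_axioms]]) simp_all
  have neg: "\<ominus>\<^bsub>?N\<^esub> x = \<ominus>\<^bsub>L\<^esub> x" if "x \<in> S" for x
    using N.koszul_smult(2)[of x] koszul_smult(2)[of x] that c by simp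
  have sup: "supermodule R ?N"
  proof (rule supermoduleI)
    show "submodule (gr ?N p) R ?N" for p
      by (rule N.submoduleI)
        (auto simp: neg gr_zero gr_uminus gr_add gr_smult submodule_zero[OF S] SE(3-5))
  next
    fix x assume x: "x \<in> carrier ?N"
    then show "\<exists>a\<in>gr ?N 0. \<exists>b\<in>gr ?N 1. x = a \<oplus>\<^bsub>?N\<^esub> b"
      using c hcomp by (intro bexI[of _ "hcomp L 0 x"] bexI[of _ "hcomp L 1 x"])
        (auto simp: hcomp_decomp hcomp_closed)
  next
    fix x assume "x \<in> gr ?N 0" "x \<in> gr ?N 1"
    then show "x = \<zero>\<^bsub>?N\<^esub>" using gr_disjoint[of x 0 1] by simp
  qed (rule N.module_axioms)
  show ?thesis
  proof (intro leibniz_superalgebra.intro leibniz_superalgebra_axioms.intro sup)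
    show "even_bilinear R ?N (bracket ?N)"
      unfolding even_bilinear_def by (auto simp: br br.linear_simps c br.graded)
    fix x y z p q assume "x \<in> carrier ?N" "y \<in> gr ?N p" "z \<in> gr ?N q"
    then have h: "x \<in> S" "y \<in> gr L p" "z \<in> gr L q" "y \<in> S" "z \<in> S" by auto
    have k: "koszul R (p * q) \<odot>\<^bsub>L\<^esub> bracket L (bracket L x z) y \<in> S"
      using h by (auto intro!: SE(4) br)
    show "bracket ?N x (bracket ?N y z) = bracket ?N (bracket ?N x y) z \<ominus>\<^bsub>?N\<^esub>
      koszul R (p * q) \<odot>\<^bsub>?N\<^esub> bracket ?N (bracket ?N x z) y"
      using leibniz_identity[OF c[OF h(1)] h(2,3)] neg[OF k] by (simp add: a_minus_def)
  qed
qed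

context superdialgebra
begin

context
  fixes m n :: nat
begin

abbreviation "NN \<equiv> {1..m + n}"
abbreviation "MM \<equiv> mat_superdialg m n D"
abbreviation "GL \<equiv> gl R m n D"
abbreviation "SL \<equiv> sl R m n D"
abbreviation "E \<equiv> elem_mat m n D"
abbreviation "d \<equiv> idx_deg m"

lemma gl_sel:
  "carrier GL = carrier MM" "zero GL = zero MM" "add GL = add MM" "smult GL = smult MM"
  "gr GL = gr MM" "bracket GL = dialg_bracket R MM"
  by (simp_all add: gl_def)

lemma leibniz_gl: "leibniz_superalgebra R GL"
  unfolding gl_def by (rule superdialgebra.dialg_leibniz[OF superdialgebra_mat])

interpretation MM: superdialgebra R MM by (rule superdialgebra_mat)
interpretation GL: leibniz_superalgebra R GL by (rule leibniz_gl)

lemma gl_minus: "a_minus GL = a_minus MM" "a_inv GL = a_inv MM"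
  by (rule a_minus_cong; simp add: gl_sel)+

definition "Sl = submodule_span R GL {bracket GL x y | x y. x \<in> carrier GL \<and> y \<in> carrier GL}"

lemma sl_eq: "SL = GL\<lparr>carrier := Sl, gr := \<lambda>p. gr GL p \<inter> Sl\<rparr>"
  by (simp add: sl_def Let_def Sl_def)

lemma submodule_Sl: "submodule Sl R GL"
  unfolding Sl_def by (rule GL.submodule_span_submodule) auto

lemma Sl_carrier: "x \<in> Sl \<Longrightarrow> x \<in> carrier GL"
  using GL.submoduleE(1)[OF submodule_Sl] by blast

lemma bracket_in_Sl: "x \<in> carrier GL \<Longrightarrow> y \<in> carrier GL \<Longrightarrow> bracket GL x y \<in> Sl"
  unfolding Sl_def by (rule subsetD[OF GL.submodule_span_incl]) blast

lemma Sl_least: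
  "submodule P R GL \<Longrightarrow> (\<And>x y. x \<in> carrier GL \<Longrightarrow> y \<in> carrier GL \<Longrightarrow> bracket GL x y \<in> P) \<Longrightarrow> Sl \<subseteq> P"
  unfolding Sl_def by (rule GL.submodule_span_least) auto

text \<open>A bracket is a sum of four brackets of homogeneous elements, whose components are again
  brackets or zero. Hence the elements with all components in \<open>Sl\<close> form a submodule
  that contains the brackets.\<close>

lemma hcomp_Sl: "x \<in> Sl \<Longrightarrow> hcomp GL p x \<in> Sl"
proof -
  let ?K = "{x \<in> carrier GL. \<forall>p. hcomp GL p x \<in> Sl}"
  note SE = GL.submoduleE[OF submodule_Sl]
  have K: "submodule ?K R GL"
  proof (rule GL.submoduleI)
    fix a assume a: "a \<in> ?K"
    then have "\<ominus>\<^bsub>GL\<^esub> a = (\<ominus>\<^bsub>R\<^esub> \<one>\<^bsub>R\<^esub>) \<odot>\<^bsub>GL\<^esub> a" by simp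
    moreover have "(\<ominus>\<^bsub>R\<^esub> \<one>\<^bsub>R\<^esub>) \<odot>\<^bsub>GL\<^esub> a \<in> ?K"
      using a SE(4) by (simp add: GL.hcomp_smult del: GL.koszul_smult)
    ultimately show "\<ominus>\<^bsub>GL\<^esub> a \<in> ?K" by simp
  qed (auto simp: GL.hcomp_add GL.hcomp_smult SE(4,5) GL.submodule_zero[OF submodule_Sl])
  have "Sl \<subseteq> ?K"
  proof (rule Sl_least[OF K], safe)
    fix x y assume xy: "x \<in> carrier GL" "y \<in> carrier GL"
    then show "bracket GL x y \<in> carrier GL" by simp
    fix p
    obtain a b where ab: "a \<in> gr GL 0" "b \<in> gr GL 1" "x = a \<oplus>\<^bsub>GL\<^esub> b" by (rule GL.gr_decomp[OF xy(1)])
    obtain a' b' where ab': "a' \<in> gr GL 0" "b' \<in> gr GL 1" "y = a' \<oplus>\<^bsub>GL\<^esub> b'" by (rule GL.gr_decomp[OF xy(2)])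
    note cc = ab(1,2)[THEN GL.gr_carrier] ab'(1,2)[THEN GL.gr_carrier]
    have "hcomp GL p (bracket GL u v) \<in> Sl" if "u \<in> gr GL q" "v \<in> gr GL r" for u v q r
      using GL.hcomp_homog[OF GL.br.graded[OF that], of p] bracket_in_Sl[OF that[THEN GL.gr_carrier]]
        GL.submodule_zero[OF submodule_Sl] by simp
    note h = this[OF ab(1) ab'(1)] this[OF ab(2) ab'(1)] this[OF ab(1) ab'(2)] this[OF ab(2) ab'(2)]
    show "hcomp GL p (bracket GL x y) \<in> Sl"
      unfolding ab(3) ab'(3) using h cc by (simp add: GL.br.linear_simps GL.hcomp_add SE(5))
  qed
  then show "x \<in> Sl \<Longrightarrow> hcomp GL p x \<in> Sl" by blast
qed

theorem leibniz_sl: "leibniz_superalgebra R SL"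
  unfolding sl_eq
  by (rule GL.sub_leibniz) (auto simp: submodule_Sl hcomp_Sl intro: bracket_in_Sl Sl_carrier)

lemma sl_sel:
  "carrier SL = Sl" "zero SL = zero MM" "add SL = add MM" "smult SL = smult MM"
  "gr SL p = gr MM p \<inter> Sl" "bracket SL = dialg_bracket R MM"
  by (simp_all add: sl_eq gl_sel)

interpretation SL: leibniz_superalgebra R SL by (rule leibniz_sl)

lemma sl_carrier_mat: "x \<in> carrier SL \<Longrightarrow> x \<in> carrier MM"
  using Sl_carrier by (simp add: sl_sel gl_sel)

end

end

section \<open>Generation of sl by off-diagonal elementary matrices\<close>

context unital_superdialgebra
begin

lemma one_closed [simp]: "\<one>\<^bsub>D\<^esub> \<in> carrier D"
  using bar_unit_even gr_carrier by blast

context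
  fixes m n :: nat
  assumes mn: "3 \<le> m + n"
begin

interpretation MM: superdialgebra R "MM m n" by (rule superdialgebra_mat)
interpretation GL: leibniz_superalgebra R "GL m n" by (rule leibniz_gl)
interpretation SL: leibniz_superalgebra R "SL m n" by (rule leibniz_sl)

lemma third_index:
  obtains k where "k \<in> NN m n" "k \<noteq> i" "k \<noteq> j"
proof -
  have "\<not> NN m n \<subseteq> {i, j}"
  proof
    assume "NN m n \<subseteq> {i, j}"
    then have "card (NN m n) \<le> card {i, j}" by (intro card_mono) auto
    also have "\<dots> \<le> 2" by (simp add: card_insert_if)
    finally show False using mn by simp
  qed
  then show thesis using that by blast
qed

text \<open>With a third index k, \<open>E i j b\<close> is the bracket of \<open>E i k b\<close>
  and \<open>E k j 1\<close>: the reversed product vanishes because i and j differ, and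
  \<open>b \<stileturn> 1 = b\<close>.\<close>

lemma elem_in_Sl:
  assumes "a \<in> carrier D" and ij: "i \<in> NN m n" "j \<in> NN m n" "i \<noteq> j"
  shows "E m n i j a \<in> Sl m n"
proof -
  obtain k where k: "k \<in> NN m n" "k \<noteq> i" "k \<noteq> j" by (rule third_index)
  have "E m n i j b \<in> Sl m n" if "b \<in> gr D p" for b p
  proof -
    have c: "b \<in> carrier D" using that gr_carrier by blast
    have "E m n i j b = bracket (GL m n) (E m n i k b) (E m n k j \<one>\<^bsub>D\<^esub>)"
      using elem_bracket[OF that bar_unit_even ij(1) k(1) k(1) ij(2)] c ij
      by (simp add: gl_sel lprod_bar_unit MM.M.minus_eq)
    also have "\<dots> \<in> Sl m n" using c by (intro bracket_in_Sl) (simp_all add: gl_sel)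
    finally show ?thesis .
  qed
  then have "E m n i j (hcomp D 0 a) \<oplus>\<^bsub>GL m n\<^esub> E m n i j (hcomp D 1 a) \<in> Sl m n"
    using GL.submoduleE(5)[OF submodule_Sl] hcomp_closed[OF assms(1)] by blast
  then show ?thesis
    using assms(1) by (simp add: gl_sel elem_linear(1)[symmetric] hcomp_decomp)
qed

lemma elem_carrier_sl [simp]:
  "\<lbrakk>a \<in> carrier D; i \<in> NN m n; j \<in> NN m n; i \<noteq> j\<rbrakk> \<Longrightarrow> E m n i j a \<in> carrier (SL m n)"
  by (simp add: sl_sel elem_in_Sl)

lemma elem_gr_sl:
  "\<lbrakk>a \<in> gr D p; i \<in> NN m n; j \<in> NN m n; i \<noteq> j\<rbrakk> \<Longrightarrow> E m n i j a \<in> gr (SL m n) (p + d m i + d m j)"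
  by (auto simp: sl_sel elem_in_Sl gr_carrier intro: elem_gr)

abbreviation "gens \<equiv> stl_gens m n D"

definition "ev = lterm_eval (SL m n) (\<lambda>(i, j, a). E m n i j a)"

lemma gens_gr: "g \<in> gens p \<Longrightarrow> (case g of (i, j, a) \<Rightarrow> E m n i j a) \<in> gr (SL m n) p"
proof -
  assume "g \<in> gens p"
  then obtain i j a where g: "g = (i, j, a)" "i \<in> NN m n" "j \<in> NN m n" "i \<noteq> j"
    "a \<in> gr D (p + d m i + d m j)" by (auto simp: stl_gens_def)
  have "p + d m i + d m j + d m i + d m j = p" by (cases "d m i"; cases "d m j") simp_all
  then show ?thesis using elem_gr_sl[OF g(5,2,3,4)] g(1) by (simp add: add.assoc)
qed

lemma Gen_lterm:
  assumes "a \<in> gr D p" "i \<in> NN m n" "j \<in> NN m n" "i \<noteq> j"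
  shows "(i, j, a) \<in> gens (p + d m i + d m j)"
proof -
  have "p + d m i + d m j + d m i + d m j = p" by (cases "d m i"; cases "d m j") simp_all
  then show ?thesis using assms by (simp add: stl_gens_def)
qed

lemma ev_closed: "t \<in> lterms R gens \<Longrightarrow> ev t \<in> carrier (SL m n)"
  unfolding ev_def using gens_gr by (rule lterm_eval_closed[OF leibniz_sl])

text \<open>A bracket of two diagonal matrices in one position is a combination of two brackets of
  off-diagonal ones, the second of which removes the contribution to the other diagonal position.\<close>

lemma Sl_generated: "Sl m n = ev ` lterms R gens"
proof
  show "ev ` lterms R gens \<subseteq> Sl m n" using ev_closed by (auto simp: sl_sel)
  let ?T = "ev ` lterms R gens"
  have evs: "ev (Gen (i, j, a)) = E m n i j a" "ev TZero = \<zero>\<^bsub>MM m n\<^esub>" "ev (TAdd s t) = ev s \<oplus>\<^bsub>MM m n\<^esub> ev t"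
    "ev (TScale r t) = r \<odot>\<^bsub>MM m n\<^esub> ev t" "ev (TBr s t) = bracket (GL m n) (ev s) (ev t)" for i j a s t r
    by (simp_all add: ev_def sl_sel gl_sel)
  have zT: "\<zero>\<^bsub>MM m n\<^esub> \<in> ?T"
    by (rule image_eqI[of _ _ TZero]) (auto simp: evs intro: lterms.intros)
  have aT: "x \<oplus>\<^bsub>MM m n\<^esub> y \<in> ?T" if "x \<in> ?T" "y \<in> ?T" for x y
    using that by (auto simp flip: evs intro!: imageI lterms.intros)
  have sT: "r \<odot>\<^bsub>MM m n\<^esub> x \<in> ?T" if "r \<in> carrier R" "x \<in> ?T" for r x
    using that by (auto simp flip: evs intro!: imageI lterms.intros)
  have bT: "bracket (GL m n) x y \<in> ?T" if "x \<in> ?T" "y \<in> ?T" for x y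
    using that by (auto simp flip: evs intro!: imageI lterms.intros)
  have cT: "x \<in> carrier (MM m n)" if "x \<in> ?T" for x
    using that ev_closed sl_carrier_mat by blast
  have nT: "\<ominus>\<^bsub>MM m n\<^esub> x \<in> ?T" if "x \<in> ?T" for x
    using sT[of "\<ominus>\<^bsub>R\<^esub> \<one>\<^bsub>R\<^esub>" x] cT[OF that] that by simp
  have mT: "x \<ominus>\<^bsub>MM m n\<^esub> y \<in> ?T" if "x \<in> ?T" "y \<in> ?T" for x y
    unfolding MM.M.minus_eq using aT nT that by blast
  have eT: "E m n i j a \<in> ?T" if "a \<in> gr D p" "i \<in> NN m n" "j \<in> NN m n" "i \<noteq> j" for i j a p
    unfolding evs(1)[symmetric] by (intro imageI lterms.intros(1)[where p="p + d m i + d m j"] Gen_lterm that)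
  have sub: "submodule ?T R (GL m n)"
    by (rule GL.submoduleI) (auto simp: gl_sel gl_minus intro!: zT nT aT sT cT)
  have el: "bracket (GL m n) (E m n i j a) (E m n k l b) \<in> ?T"
    if N: "i \<in> NN m n" "j \<in> NN m n" "k \<in> NN m n" "l \<in> NN m n" and ab: "a \<in> gr D p" "b \<in> gr D q"
    for i j k l a b p q
  proof -
    have c: "a \<in> carrier D" "b \<in> carrier D" using ab gr_carrier by auto
    note B = elem_bracket[OF ab N, folded gl_sel(6)]
    \<comment> \<open>If one of the factors is diagonal, the bracket is an off-diagonal elementary
      matrix up to sign, or zero, or both factors sit at the same diagonal position.\<close>
    consider "i \<noteq> j \<and> k \<noteq> l" | "j = k" "i \<noteq> l" | "l = i" "j \<noteq> k" | "j \<noteq> k" "l \<noteq> i" | "i = j" "k = j" "l = j"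
      by blast
    then show ?thesis
    proof cases
      case 1
      then show ?thesis using N by (intro bT eT[OF ab(1)] eT[OF ab(2)]) auto
    next
      case 2
      have "E m n i l (a \<stileturn>\<^bsub>D\<^esub> b) \<in> ?T" using 2 N lp.graded[OF ab] by (intro eT)
      then show ?thesis unfolding B using 2 c N by (auto simp: MM.M.minus_eq)
    next
      case 3
      have "E m n k j (b \<turnstile>\<^bsub>D\<^esub> a) \<in> ?T" using 3 N rp.graded[OF ab(2,1)] by (intro eT) auto
      then show ?thesis unfolding B using 3 c N by (auto intro!: mT sT zT)
    next
      case 4
      then show ?thesis unfolding B by (auto intro!: mT sT zT)
    next
      case 5
      obtain u where u: "u \<in> NN m n" "u \<noteq> i" by (rule third_index[of i i])
      let ?X = "bracket (GL m n) (E m n i u a) (E m n u i b)"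
      \<comment> \<open>Both \<open>(b \<turnstile> a) \<stileturn> 1\<close> and
        \<open>1 \<turnstile> (b \<turnstile> a)\<close> equal \<open>b \<turnstile> a\<close>, so
        \<open>?Y\<close> carries \<open>b \<turnstile> a\<close> at \<open>(i, i)\<close> and, up
        to sign, at \<open>(u, u)\<close>. It cancels the \<open>(u, u)\<close> entry of
        \<open>?X\<close> and supplies the second term of the wanted bracket.\<close>
      let ?Y = "bracket (GL m n) (E m n i u (b \<turnstile>\<^bsub>D\<^esub> a)) (E m n u i \<one>\<^bsub>D\<^esub>)"
      have T: "?X \<in> ?T" "?Y \<in> ?T"
        using N u
        by (auto intro!: bT eT[OF ab(1)] eT[OF ab(2)] eT[OF rp.graded[OF ab(2,1)]] eT[OF bar_unit_even]
            simp del: image_iff)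
      have ba: "b \<turnstile>\<^bsub>D\<^esub> a \<in> gr D (q + p)" by (rule rp.graded[OF ab(2,1)])
      have "bracket (GL m n) (E m n i j a) (E m n k l b) = ?X \<ominus>\<^bsub>MM m n\<^esub> koszul R (p * q) \<odot>\<^bsub>MM m n\<^esub> ?Y"
        unfolding B elem_bracket[OF ab N(1) u(1) u(1) N(1), folded gl_sel(6)]
          elem_bracket[OF ba bar_unit_even N(1) u(1) u(1) N(1), folded gl_sel(6)]
        using 5 c
        by (cases "d m i"; cases "d m u"; cases p; cases q)
           (simp_all add: lprod_bar_unit bar_unit_rprod MM.smult_diff MM.M.diff_simps MM.M.a_ac)
      then show ?thesis using T by (auto intro!: mT sT)
    qed
  qed
  have "bracket (GL m n) x y \<in> ?T" if xy: "x \<in> carrier (MM m n)" "y \<in> carrier (MM m n)" for x y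
    using xy(1)
  proof (induction x rule: mat_elem_induct)
    case (add x x')
    then show ?case using xy aT by (simp add: GL.br.add_l[unfolded gl_sel] gl_sel)
  next
    case (elem i j a p)
    note ij = elem
    show ?case using xy(2)
    proof (induction y rule: mat_elem_induct)
      case (add y y')
      then show ?case using aT elem_closed[OF gr_carrier[OF ij(3)]]
        by (simp add: GL.br.add_r[unfolded gl_sel] gl_sel)
    next
      case (elem k l b q)
      show ?case by (rule el[OF ij(1,2) elem(1,2) ij(3) elem(3)])
    qed (use elem_closed[OF gr_carrier[OF ij(3)]] GL.br.zero_r[unfolded gl_sel] zT in \<open>simp add: gl_sel\<close>)
  qed (use xy GL.br.zero_l[unfolded gl_sel] zT in \<open>simp add: gl_sel\<close>)
  then show "Sl m n \<subseteq> ?T"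
    by (intro Sl_least[OF sub]) (simp add: gl_sel)
qed

end

end

section \<open>Quotients and direct sums\<close>

locale graded_submodule = supermodule R M for R (structure) and M (structure) and I +
  assumes I_submodule: "submodule I R M" and I_hcomp: "x \<in> I \<Longrightarrow> hcomp M p x \<in> I"
begin

abbreviation "QM \<equiv> supermodule_quot M I"
definition "coset x = I +>\<^bsub>M\<^esub> x"

lemma I_carrier: "x \<in> I \<Longrightarrow> x \<in> carrier M"
  using submoduleE(1)[OF I_submodule] by blast

lemma in_coset_iff: "y \<in> coset x \<longleftrightarrow> (\<exists>h\<in>I. y = h \<oplus>\<^bsub>M\<^esub> x)"
  unfolding coset_def a_r_coset_def' by auto

lemma coset_eq_iff:
  assumes xy: "x \<in> carrier M" "y \<in> carrier M"
  shows "coset x = coset y \<longleftrightarrow> x \<ominus>\<^bsub>M\<^esub> y \<in> I"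
proof
  assume "coset x = coset y"
  moreover have "x \<in> coset x"
    unfolding in_coset_iff using xy submodule_zero[OF I_submodule] by (intro bexI[of _ "\<zero>\<^bsub>M\<^esub>"]) simp_all
  ultimately have "x \<in> coset y" by simp
  then obtain h where "h \<in> I" "x = h \<oplus>\<^bsub>M\<^esub> y" unfolding in_coset_iff by (elim bexE)
  then show "x \<ominus>\<^bsub>M\<^esub> y \<in> I" using xy I_carrier by (simp add: M.minus_eq M.a_assoc M.r_neg)
next
  have sub: "coset x \<subseteq> coset y" if "x \<ominus>\<^bsub>M\<^esub> y \<in> I" and c: "x \<in> carrier M" "y \<in> carrier M" for x y
  proof
    fix z assume "z \<in> coset x"
    then obtain h where h: "h \<in> I" "z = h \<oplus>\<^bsub>M\<^esub> x" unfolding in_coset_iff by blast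
    have "z = (h \<oplus>\<^bsub>M\<^esub> (x \<ominus>\<^bsub>M\<^esub> y)) \<oplus>\<^bsub>M\<^esub> y"
      using h c I_carrier by (simp add: M.minus_eq M.a_assoc M.l_neg)
    then show "z \<in> coset y" unfolding in_coset_iff using submoduleE(5)[OF I_submodule h(1) that(1)] by blast
  qed
  assume h: "x \<ominus>\<^bsub>M\<^esub> y \<in> I"
  then have "y \<ominus>\<^bsub>M\<^esub> x \<in> I" using submoduleE(3)[OF I_submodule h] xy by (simp add: M.neg_diff_eq)
  then show "coset x = coset y" using sub h xy by blast
qed

lemma coset_self: "x \<in> carrier M \<Longrightarrow> x \<in> coset x"
  unfolding in_coset_iff using submodule_zero[OF I_submodule] by (intro bexI[of _ "\<zero>\<^bsub>M\<^esub>"]) simp_all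

lemma in_coset: "x \<in> carrier M \<Longrightarrow> y \<in> coset x \<Longrightarrow> y \<in> carrier M \<and> coset y = coset x"
proof -
  assume x: "x \<in> carrier M" and "y \<in> coset x"
  then obtain h where h: "h \<in> I" "y = h \<oplus>\<^bsub>M\<^esub> x" unfolding in_coset_iff by (elim bexE)
  then have y: "y \<in> carrier M" using x I_carrier by simp
  have "y \<ominus>\<^bsub>M\<^esub> x = h" using h x I_carrier by (simp add: M.minus_eq M.a_assoc M.r_neg)
  then show ?thesis using y h(1) coset_eq_iff[OF y x] by simp
qed

lemma quot_sel:
  "carrier QM = coset ` carrier M" "\<zero>\<^bsub>QM\<^esub> = coset \<zero>\<^bsub>M\<^esub>" "gr QM p = coset ` gr M p"
proof -
  show "carrier QM = coset ` carrier M"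
    unfolding supermodule_quot_def coset_def by (auto simp: A_RCOSETS_def')
  have "coset \<zero>\<^bsub>M\<^esub> = I" using I_carrier by (auto simp: in_coset_iff set_eq_iff)
  then show "\<zero>\<^bsub>QM\<^esub> = coset \<zero>\<^bsub>M\<^esub>" by (simp add: supermodule_quot_def)
qed (simp add: supermodule_quot_def coset_def)

lemma quot_add:
  assumes xy: "x \<in> carrier M" "y \<in> carrier M"
  shows "coset x \<oplus>\<^bsub>QM\<^esub> coset y = coset (x \<oplus>\<^bsub>M\<^esub> y)"
proof -
  have "coset x \<oplus>\<^bsub>QM\<^esub> coset y = (\<Union>h\<in>coset x. \<Union>k\<in>coset y. {h \<oplus>\<^bsub>M\<^esub> k})"
    by (simp add: supermodule_quot_def set_add_def')
  also have "\<dots> = coset (x \<oplus>\<^bsub>M\<^esub> y)"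
  proof (intro Set.set_eqI iffI)
    fix z assume "z \<in> (\<Union>h\<in>coset x. \<Union>k\<in>coset y. {h \<oplus>\<^bsub>M\<^esub> k})"
    then obtain h k where hk: "h \<in> I" "k \<in> I" "z = (h \<oplus>\<^bsub>M\<^esub> x) \<oplus>\<^bsub>M\<^esub> (k \<oplus>\<^bsub>M\<^esub> y)"
      by (auto simp: in_coset_iff)
    then have "z = (h \<oplus>\<^bsub>M\<^esub> k) \<oplus>\<^bsub>M\<^esub> (x \<oplus>\<^bsub>M\<^esub> y)" using xy I_carrier by (simp add: M.a_ac)
    then show "z \<in> coset (x \<oplus>\<^bsub>M\<^esub> y)"
      unfolding in_coset_iff using submoduleE(5)[OF I_submodule hk(1,2)] by blast
  next
    fix z assume "z \<in> coset (x \<oplus>\<^bsub>M\<^esub> y)"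
    then obtain h where h: "h \<in> I" "z = (h \<oplus>\<^bsub>M\<^esub> x) \<oplus>\<^bsub>M\<^esub> y"
      using xy I_carrier by (auto simp: in_coset_iff M.a_assoc)
    then have "h \<oplus>\<^bsub>M\<^esub> x \<in> coset x" unfolding in_coset_iff by blast
    then show "z \<in> (\<Union>h\<in>coset x. \<Union>k\<in>coset y. {h \<oplus>\<^bsub>M\<^esub> k})"
      using coset_self[OF xy(2)] h(2) by blast
  qed
  finally show ?thesis .
qed

lemma quot_smult:
  assumes r: "r \<in> carrier R" and x: "x \<in> carrier M"
  shows "r \<odot>\<^bsub>QM\<^esub> coset x = coset (r \<odot>\<^bsub>M\<^esub> x)"
proof -
  have "r \<odot>\<^bsub>QM\<^esub> coset x = (\<Union>z\<in>coset x. coset (r \<odot>\<^bsub>M\<^esub> z))"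
    by (simp add: supermodule_quot_def coset_def)
  also have "\<dots> = coset (r \<odot>\<^bsub>M\<^esub> x)"
  proof (rule UN_const_eq[OF coset_self[OF x]])
    fix z assume "z \<in> coset x"
    then have "z \<in> carrier M" "z \<ominus>\<^bsub>M\<^esub> x \<in> I" using in_coset[OF x] coset_eq_iff x by blast+
    then show "coset (r \<odot>\<^bsub>M\<^esub> z) = coset (r \<odot>\<^bsub>M\<^esub> x)"
      using r x submoduleE(4)[OF I_submodule r, of "z \<ominus>\<^bsub>M\<^esub> x"] by (simp add: coset_eq_iff smult_diff)
  qed
  finally show ?thesis .
qed

lemma coset_zero_iff: "x \<in> carrier M \<Longrightarrow> coset x = \<zero>\<^bsub>QM\<^esub> \<longleftrightarrow> x \<in> I"
  by (simp add: quot_sel coset_eq_iff M.diff_zero)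

lemma module_quot: "module R QM"
proof (rule moduleI)
  show "abelian_group QM"
  proof (rule abelian_groupI)
    fix x y z assume "x \<in> carrier QM" "y \<in> carrier QM" "z \<in> carrier QM"
    then show "x \<oplus>\<^bsub>QM\<^esub> y \<oplus>\<^bsub>QM\<^esub> z = x \<oplus>\<^bsub>QM\<^esub> (y \<oplus>\<^bsub>QM\<^esub> z)"
      unfolding quot_sel by (elim imageE) (simp add: quot_add M.a_assoc)
  next
    fix x y assume "x \<in> carrier QM" "y \<in> carrier QM"
    then show "x \<oplus>\<^bsub>QM\<^esub> y = y \<oplus>\<^bsub>QM\<^esub> x"
      unfolding quot_sel by (elim imageE) (simp add: quot_add M.a_comm)
  next
    fix x assume "x \<in> carrier QM"
    then obtain a where a: "a \<in> carrier M" "x = coset a" unfolding quot_sel by blast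
    show "\<zero>\<^bsub>QM\<^esub> \<oplus>\<^bsub>QM\<^esub> x = x" using a by (simp add: quot_sel quot_add)
    show "\<exists>y\<in>carrier QM. y \<oplus>\<^bsub>QM\<^esub> x = \<zero>\<^bsub>QM\<^esub>"
      using a by (intro bexI[of _ "coset (\<ominus>\<^bsub>M\<^esub> a)"]) (simp_all add: quot_sel quot_add M.l_neg)
  next
    fix x y assume "x \<in> carrier QM" "y \<in> carrier QM"
    then show "x \<oplus>\<^bsub>QM\<^esub> y \<in> carrier QM" unfolding quot_sel by (elim imageE) (simp add: quot_add)
  qed (simp add: quot_sel)
next
  fix a x assume "a \<in> carrier R" "x \<in> carrier QM"
  then show "a \<odot>\<^bsub>QM\<^esub> x \<in> carrier QM" unfolding quot_sel by (elim imageE) (simp add: quot_smult)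
next
  fix a b x assume "a \<in> carrier R" "b \<in> carrier R" "x \<in> carrier QM"
  then show "(a \<oplus> b) \<odot>\<^bsub>QM\<^esub> x = a \<odot>\<^bsub>QM\<^esub> x \<oplus>\<^bsub>QM\<^esub> b \<odot>\<^bsub>QM\<^esub> x"
    "a \<otimes> b \<odot>\<^bsub>QM\<^esub> x = a \<odot>\<^bsub>QM\<^esub> (b \<odot>\<^bsub>QM\<^esub> x)"
    unfolding quot_sel by (elim imageE, simp add: quot_smult quot_add smult_l_distr smult_assoc1)+
next
  fix a x y assume "a \<in> carrier R" "x \<in> carrier QM" "y \<in> carrier QM"
  then show "a \<odot>\<^bsub>QM\<^esub> (x \<oplus>\<^bsub>QM\<^esub> y) = a \<odot>\<^bsub>QM\<^esub> x \<oplus>\<^bsub>QM\<^esub> a \<odot>\<^bsub>QM\<^esub> y"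
    unfolding quot_sel by (elim imageE) (simp add: quot_smult quot_add smult_r_distr)
next
  fix x assume "x \<in> carrier QM"
  then show "\<one> \<odot>\<^bsub>QM\<^esub> x = x" unfolding quot_sel by (elim imageE) (simp add: quot_smult)
qed (rule is_cring)

lemma supermodule_quot: "supermodule R QM"
proof (rule supermoduleI)
  interpret Q: module R QM by (rule module_quot)
  have cg: "x \<in> carrier QM" if "x \<in> gr QM p" for x p
    using that gr_carrier unfolding quot_sel by blast
  show "submodule (gr QM p) R QM" for p
  proof (rule Q.submoduleI)
    fix x assume "x \<in> gr QM p"
    then obtain a where a: "a \<in> gr M p" "x = coset a" unfolding quot_sel by blast
    have "\<ominus>\<^bsub>QM\<^esub> x = (\<ominus> \<one>) \<odot>\<^bsub>QM\<^esub> x" using cg[OF \<open>x \<in> gr QM p\<close>] by simp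
    also have "\<dots> = coset ((\<ominus> \<one>) \<odot>\<^bsub>M\<^esub> a)" using a gr_carrier by (simp add: quot_smult del: koszul_smult)
    finally show "\<ominus>\<^bsub>QM\<^esub> x \<in> gr QM p" using gr_smult[OF _ a(1), of "\<ominus> \<one>"] unfolding quot_sel by simp
  next
    fix x y assume "x \<in> gr QM p" "y \<in> gr QM p"
    then show "x \<oplus>\<^bsub>QM\<^esub> y \<in> gr QM p"
      unfolding quot_sel by (elim imageE) (auto simp: quot_add gr_carrier gr_add)
  next
    fix r x assume "r \<in> carrier R" "x \<in> gr QM p"
    then show "r \<odot>\<^bsub>QM\<^esub> x \<in> gr QM p"
      unfolding quot_sel by (elim imageE) (auto simp: quot_smult gr_carrier gr_smult)
  qed (use cg in \<open>auto simp: quot_sel gr_zero\<close>)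
next
  fix x assume "x \<in> carrier QM"
  then obtain a where a: "a \<in> carrier M" "x = coset a" unfolding quot_sel by blast
  show "\<exists>u\<in>gr QM 0. \<exists>v\<in>gr QM 1. x = u \<oplus>\<^bsub>QM\<^esub> v"
    using a hcomp_decomp[OF a(1)] hcomp_closed[OF a(1)] unfolding quot_sel
    by (intro bexI[of _ "coset (hcomp M 0 a)"] bexI[of _ "coset (hcomp M 1 a)"])
      (simp_all add: quot_add)
next
  fix x assume "x \<in> gr QM 0" "x \<in> gr QM 1"
  then obtain a b where ab: "a \<in> gr M 0" "b \<in> gr M 1" "x = coset a" "coset a = coset b"
    unfolding quot_sel by blast
  \<comment> \<open>The even component of a - b is a, and I contains the components of its elements,
    so a itself lies in I.\<close>
  then have "a \<ominus>\<^bsub>M\<^esub> b \<in> I" by (simp add: gr_carrier coset_eq_iff[symmetric])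
  from I_hcomp[OF this, of 0] have "a \<in> I"
    using ab(1,2) hcomp_eqI[OF ab(1), of "\<ominus>\<^bsub>M\<^esub> b"] gr_uminus[OF ab(2)] by (simp add: M.minus_eq)
  then show "x = \<zero>\<^bsub>QM\<^esub>" using ab gr_carrier coset_zero_iff by blast
qed (rule module_quot)

lemma coset_even_linear: "even_linear R M QM coset"
  unfolding even_linear_def by (auto simp: quot_sel quot_add quot_smult)

lemma quot_factor:
  assumes f: "even_linear R M V f" and ker: "\<And>x. x \<in> I \<Longrightarrow> f x = \<zero>\<^bsub>V\<^esub>" and V: "supermodule R V"
  obtains g where "even_linear R QM V g" "\<And>x. x \<in> carrier M \<Longrightarrow> g (coset x) = f x"
proof -
  interpret V: supermodule R V by (rule V)
  interpret f: even_linear_map R M V f by unfold_locales (rule f)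
  define g where "g X = f (SOME x. x \<in> X)" for X
  have g: "g (coset x) = f x" if x: "x \<in> carrier M" for x
  proof -
    have "(SOME y. y \<in> coset x) \<in> coset x" using coset_self[OF x] by (rule someI)
    then obtain h where h: "h \<in> I" "(SOME y. y \<in> coset x) = h \<oplus>\<^bsub>M\<^esub> x" unfolding in_coset_iff by blast
    then show ?thesis unfolding g_def h(2) using x by (simp add: f.add I_carrier ker)
  qed
  have "even_linear R QM V g"
    unfolding even_linear_def quot_sel
    by (auto simp: g quot_add quot_smult f.add f.smult f.graded gr_carrier)
  then show thesis using g that by blast
qed

end

section \<open>The ideals I_k and their quotients\<close>

context superdialgebra
begin

lemma ideal_generated:
  assumes "S \<subseteq> carrier D"
  shows "dialg_ideal R D (dialg_ideal_generated R D S)" and "S \<subseteq> dialg_ideal_generated R D S"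
    and "dialg_ideal R D P \<Longrightarrow> S \<subseteq> P \<Longrightarrow> dialg_ideal_generated R D S \<subseteq> P"
proof -
  have top: "dialg_ideal R D (carrier D)"
    unfolding dialg_ideal_def using carrier_is_submodule by simp
  have "submodule (dialg_ideal_generated R D S) R D"
  proof (rule submoduleI)
    show "dialg_ideal_generated R D S \<subseteq> carrier D"
      unfolding dialg_ideal_generated_def using top assms by blast
  qed (auto simp: dialg_ideal_generated_def dialg_ideal_def submodule_zero dest: submoduleE(3-5))
  then show "dialg_ideal R D (dialg_ideal_generated R D S)"
    unfolding dialg_ideal_def by (auto simp: dialg_ideal_generated_def dialg_ideal_def)
qed (unfold dialg_ideal_generated_def, blast+)

definition "I_gens (k::nat) = {[k] \<cdot>\<^bsub>D\<^esub> a | a. a \<in> carrier D} \<union>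
   {a \<stileturn>\<^bsub>D\<^esub> b \<ominus>\<^bsub>D\<^esub> koszul R (p * q) \<odot>\<^bsub>D\<^esub> (b \<turnstile>\<^bsub>D\<^esub> a) | a b p q. a \<in> gr D p \<and> b \<in> gr D q}"

lemma I_gens_carrier: "I_gens k \<subseteq> carrier D"
  unfolding I_gens_def by (auto simp: gr_carrier)

lemma I_ideal_eq: "I_ideal R D k = dialg_ideal_generated R D (I_gens k)"
  by (simp add: I_ideal_def I_gens_def)

lemma I_ideal_ideal: "dialg_ideal R D (I_ideal R D k)"
  unfolding I_ideal_eq by (rule ideal_generated(1)[OF I_gens_carrier])

lemma I_ideal_submodule: "submodule (I_ideal R D k) R D"
  using I_ideal_ideal unfolding dialg_ideal_def by blast

lemma I_ideal_gens: "x \<in> I_gens k \<Longrightarrow> x \<in> I_ideal R D k"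
  unfolding I_ideal_eq using ideal_generated(2)[OF I_gens_carrier] by blast

lemma hcomp_nat_pow: "a \<in> carrier D \<Longrightarrow> hcomp D p ([(k::nat)] \<cdot>\<^bsub>D\<^esub> a) = [k] \<cdot>\<^bsub>D\<^esub> hcomp D p a"
  by (induction k) (simp_all add: hcomp_add)

text \<open>The elements whose components lie in K form an ideal that contains the generators, hence
  contains \<open>I_ideal\<close>. With K the homogeneous elements of the ideal this shows that
  \<open>I_ideal\<close> is graded; with a suitable kernel, in \<open>Q_kernel\<close>, that a
  linear map vanishes on it.\<close>

lemma I_ideal_hcomp_induct:
  assumes K: "\<And>p. K p \<subseteq> gr D p" "\<And>p. \<zero>\<^bsub>D\<^esub> \<in> K p"
    "\<And>p x y. x \<in> K p \<Longrightarrow> y \<in> K p \<Longrightarrow> x \<oplus>\<^bsub>D\<^esub> y \<in> K p"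
    "\<And>p r x. r \<in> carrier R \<Longrightarrow> x \<in> K p \<Longrightarrow> r \<odot>\<^bsub>D\<^esub> x \<in> K p"
    and mult: "\<And>p q x y. x \<in> K p \<Longrightarrow> y \<in> gr D q \<Longrightarrow>
      x \<stileturn>\<^bsub>D\<^esub> y \<in> K (p + q) \<and> y \<stileturn>\<^bsub>D\<^esub> x \<in> K (p + q) \<and> x \<turnstile>\<^bsub>D\<^esub> y \<in> K (p + q) \<and> y \<turnstile>\<^bsub>D\<^esub> x \<in> K (p + q)"
    and torsion: "\<And>p a. a \<in> gr D p \<Longrightarrow> [k] \<cdot>\<^bsub>D\<^esub> a \<in> K p"
    and comm: "\<And>p q a b. a \<in> gr D p \<Longrightarrow> b \<in> gr D q \<Longrightarrow>
      a \<stileturn>\<^bsub>D\<^esub> b \<ominus>\<^bsub>D\<^esub> koszul R (p * q) \<odot>\<^bsub>D\<^esub> (b \<turnstile>\<^bsub>D\<^esub> a) \<in> K (p + q)"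
    and x: "x \<in> I_ideal R D k"
  shows "hcomp D p x \<in> K p"
proof -
  let ?J = "{x \<in> carrier D. \<forall>p. hcomp D p x \<in> K p}"
  have Kc: "x \<in> carrier D" if "x \<in> K p" for x p using K(1) that gr_carrier by blast
  have J: "dialg_ideal R D ?J"
    unfolding dialg_ideal_def
  proof (intro conjI ballI impI)
    show "submodule ?J R D"
    proof (rule submoduleI)
      fix a assume a: "a \<in> ?J"
      then have "\<ominus>\<^bsub>D\<^esub> a = (\<ominus> \<one>) \<odot>\<^bsub>D\<^esub> a" by simp
      moreover have "(\<ominus> \<one>) \<odot>\<^bsub>D\<^esub> a \<in> ?J" using a K(4) by (simp add: hcomp_smult del: koszul_smult)
      ultimately show "\<ominus>\<^bsub>D\<^esub> a \<in> ?J" by simp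
    qed (auto simp: K hcomp_add hcomp_smult)
  next
    have prod: "f x y \<in> ?J"
      if f: "even_bilinear_map R D D f" and xy: "x \<in> carrier D" "y \<in> carrier D"
        and h: "\<And>p q. f (hcomp D p x) (hcomp D q y) \<in> K (p + q)" for f x y
    proof -
      interpret f: bilinear_map R D D f by unfold_locales (rule f)
      have "f x y = f (hcomp D 0 x \<oplus>\<^bsub>D\<^esub> hcomp D 1 x) (hcomp D 0 y \<oplus>\<^bsub>D\<^esub> hcomp D 1 y)"
        using xy by (simp add: hcomp_decomp)
      also have "\<dots> = (f (hcomp D 0 x) (hcomp D 0 y) \<oplus>\<^bsub>D\<^esub> f (hcomp D 1 x) (hcomp D 1 y)) \<oplus>\<^bsub>D\<^esub>
          (f (hcomp D 0 x) (hcomp D 1 y) \<oplus>\<^bsub>D\<^esub> f (hcomp D 1 x) (hcomp D 0 y))"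
        using xy by (simp add: f.linear_simps M.a_ac)
      finally have e: "f x y = \<dots>" .
      have K0: "f (hcomp D 0 x) (hcomp D 0 y) \<oplus>\<^bsub>D\<^esub> f (hcomp D 1 x) (hcomp D 1 y) \<in> K 0"
        using K(3)[OF h[of 0 0, simplified] h[of 1 1, simplified]] by simp
      have K1: "f (hcomp D 0 x) (hcomp D 1 y) \<oplus>\<^bsub>D\<^esub> f (hcomp D 1 x) (hcomp D 0 y) \<in> K 1"
        using K(3)[OF h[of 0 1, simplified] h[of 1 0, simplified]] by simp
      have "hcomp D p (f x y) \<in> K p" for p
        using hcomp_unique[OF subsetD[OF K(1) K0] subsetD[OF K(1) K1] e, of p] K0 K1 by (cases p) auto
      then show ?thesis using xy by simp
    qed
    fix x y assume xy: "x \<in> carrier D" "y \<in> carrier D" "x \<in> ?J \<or> y \<in> ?J"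
    have h: "hcomp D p x \<stileturn>\<^bsub>D\<^esub> hcomp D q y \<in> K (p + q) \<and> hcomp D p x \<turnstile>\<^bsub>D\<^esub> hcomp D q y \<in> K (p + q)" for p q
      using xy(3)
    proof
      assume "x \<in> ?J"
      then show ?thesis using mult[OF _ hcomp_closed[OF xy(2)]] by blast
    next
      assume "y \<in> ?J"
      then show ?thesis using mult[OF _ hcomp_closed[OF xy(1)], of "hcomp D q y" q p] by (simp add: add.commute)
    qed
    show "x \<stileturn>\<^bsub>D\<^esub> y \<in> ?J" by (rule prod[OF lp.bilinear xy(1,2)]) (use h in blast)
    show "x \<turnstile>\<^bsub>D\<^esub> y \<in> ?J" by (rule prod[OF rp.bilinear xy(1,2)]) (use h in blast)
  qed
  have "I_gens k \<subseteq> ?J"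
  proof
    fix x assume x: "x \<in> I_gens k"
    have "hcomp D p x \<in> K p" for p
      using x unfolding I_gens_def
    proof
      assume "x \<in> {[k] \<cdot>\<^bsub>D\<^esub> a | a. a \<in> carrier D}"
      then show ?thesis using torsion hcomp_closed by (auto simp: hcomp_nat_pow)
    next
      assume "x \<in> {a \<stileturn>\<^bsub>D\<^esub> b \<ominus>\<^bsub>D\<^esub> koszul R (p * q) \<odot>\<^bsub>D\<^esub> (b \<turnstile>\<^bsub>D\<^esub> a) | a b p q. a \<in> gr D p \<and> b \<in> gr D q}"
      then obtain q where "x \<in> K q" using comm by blast
      then show ?thesis using hcomp_homog[OF subsetD[OF K(1)], of x q p] K(2)[of p] by (cases "p = q") simp_all
    qed
    then show "x \<in> ?J" using x I_gens_carrier by blast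
  qed
  then have "I_ideal R D k \<subseteq> ?J" unfolding I_ideal_eq by (rule ideal_generated(3)[OF I_gens_carrier J])
  then show ?thesis using x by blast
qed

lemma I_ideal_mult:
  assumes "x \<in> I_ideal R D k" "y \<in> carrier D"
  shows "x \<stileturn>\<^bsub>D\<^esub> y \<in> I_ideal R D k" "y \<stileturn>\<^bsub>D\<^esub> x \<in> I_ideal R D k"
    "x \<turnstile>\<^bsub>D\<^esub> y \<in> I_ideal R D k" "y \<turnstile>\<^bsub>D\<^esub> x \<in> I_ideal R D k"
proof -
  have "x \<in> carrier D" using assms submoduleE(1)[OF I_ideal_submodule] by blast
  then show "x \<stileturn>\<^bsub>D\<^esub> y \<in> I_ideal R D k" "y \<stileturn>\<^bsub>D\<^esub> x \<in> I_ideal R D k"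
    "x \<turnstile>\<^bsub>D\<^esub> y \<in> I_ideal R D k" "y \<turnstile>\<^bsub>D\<^esub> x \<in> I_ideal R D k"
    using I_ideal_ideal[of k] assms unfolding dialg_ideal_def by blast+
qed

lemma I_ideal_hcomp: "x \<in> I_ideal R D k \<Longrightarrow> hcomp D p x \<in> I_ideal R D k"
proof -
  note SE = submoduleE[OF I_ideal_submodule[of k]]
  assume "x \<in> I_ideal R D k"
  then have "hcomp D p x \<in> gr D p \<inter> I_ideal R D k"
  proof (rule I_ideal_hcomp_induct[rotated -1])
    fix p q x y assume "x \<in> gr D p \<inter> I_ideal R D k" "y \<in> gr D q"
    then show "x \<stileturn>\<^bsub>D\<^esub> y \<in> gr D (p + q) \<inter> I_ideal R D k \<and> y \<stileturn>\<^bsub>D\<^esub> x \<in> gr D (p + q) \<inter> I_ideal R D k \<and>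
       x \<turnstile>\<^bsub>D\<^esub> y \<in> gr D (p + q) \<inter> I_ideal R D k \<and> y \<turnstile>\<^bsub>D\<^esub> x \<in> gr D (p + q) \<inter> I_ideal R D k"
      using I_ideal_mult[where x = x and y = y and k = k] gr_carrier[of y q] lp.graded[of x p y q] lp.graded[of y q x p]
        rp.graded[of x p y q] rp.graded[of y q x p] by (simp add: add.commute)
  next
    fix p a assume a: "a \<in> gr D p"
    then have "[k] \<cdot>\<^bsub>D\<^esub> a \<in> I_gens k" unfolding I_gens_def using gr_carrier by blast
    moreover have "[k] \<cdot>\<^bsub>D\<^esub> a \<in> gr D p"
      using hcomp_closed[of "[k] \<cdot>\<^bsub>D\<^esub> a" p] hcomp_nat_pow[OF gr_carrier[OF a]] hcomp_homog[OF a, of p]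
        gr_carrier[OF a] by simp
    ultimately show "[k] \<cdot>\<^bsub>D\<^esub> a \<in> gr D p \<inter> I_ideal R D k" using I_ideal_gens by blast
  next
    fix p q a b assume ab: "a \<in> gr D p" "b \<in> gr D q"
    let ?c = "a \<stileturn>\<^bsub>D\<^esub> b \<ominus>\<^bsub>D\<^esub> koszul R (p * q) \<odot>\<^bsub>D\<^esub> (b \<turnstile>\<^bsub>D\<^esub> a)"
    have "?c \<in> I_gens k" unfolding I_gens_def
      by (rule UnI2, rule CollectI, rule exI[of _ a], rule exI[of _ b], rule exI[of _ p], rule exI[of _ q])
        (simp add: ab)
    moreover have "?c \<in> gr D (p + q)"
      using lp.graded[OF ab] rp.graded[OF ab(2,1)] by (intro gr_minus gr_koszul_smult) (simp_all add: add.commute)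
    ultimately show "?c \<in> gr D (p + q) \<inter> I_ideal R D k" by (intro IntI I_ideal_gens)
  qed (simp_all add: gr_zero gr_add gr_smult SE(4,5) submodule_zero[OF I_ideal_submodule])
  then show ?thesis by blast
qed

lemma graded_submodule_I: "graded_submodule R D (I_ideal R D k)"
  by (intro graded_submodule.intro supermodule_axioms graded_submodule_axioms.intro
      I_ideal_submodule I_ideal_hcomp)

lemma supermodule_dialg_quot: "supermodule R (dialg_quot R D k)"
  unfolding dialg_quot_def by (rule graded_submodule.supermodule_quot[OF graded_submodule_I])

end

section \<open>Direct sums and powers\<close>

lemma sum_sel [simp]:
  "carrier (A \<oplus>\<^sub>s B) = carrier A \<times> carrier B" "\<zero>\<^bsub>A \<oplus>\<^sub>s B\<^esub> = (\<zero>\<^bsub>A\<^esub>, \<zero>\<^bsub>B\<^esub>)"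
  "(a, b) \<oplus>\<^bsub>A \<oplus>\<^sub>s B\<^esub> (a', b') = (a \<oplus>\<^bsub>A\<^esub> a', b \<oplus>\<^bsub>B\<^esub> b')"
  "r \<odot>\<^bsub>A \<oplus>\<^sub>s B\<^esub> (a, b) = (r \<odot>\<^bsub>A\<^esub> a, r \<odot>\<^bsub>B\<^esub> b)"
  "gr (A \<oplus>\<^sub>s B) p = gr A p \<times> gr B p"
  by (simp_all add: supermodule_sum_def)

lemma module_sum:
  assumes A: "module R A" and B: "module R B"
  shows "module R (A \<oplus>\<^sub>s B)"
proof -
  interpret A: module R A by fact
  interpret B: module R B by fact
  have "abelian_group (A \<oplus>\<^sub>s B)"
  proof (rule abelian_groupI)
    fix x assume "x \<in> carrier (A \<oplus>\<^sub>s B)"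
    then obtain a b where "x = (a, b)" "a \<in> carrier A" "b \<in> carrier B" by auto
    then show "\<exists>y\<in>carrier (A \<oplus>\<^sub>s B). y \<oplus>\<^bsub>A \<oplus>\<^sub>s B\<^esub> x = \<zero>\<^bsub>A \<oplus>\<^sub>s B\<^esub>"
      by (intro bexI[of _ "(\<ominus>\<^bsub>A\<^esub> a, \<ominus>\<^bsub>B\<^esub> b)"]) (auto simp: A.M.l_neg B.M.l_neg)
  qed (auto simp: A.M.a_ac B.M.a_ac)
  then show ?thesis
    by (intro moduleI A.is_cring)
      (auto simp: A.smult_l_distr B.smult_l_distr A.smult_r_distr B.smult_r_distr A.smult_assoc1 B.smult_assoc1)
qed

lemma sum_minus [simp]:
  assumes A: "module R A" and B: "module R B"
    and "b \<in> carrier A" "d \<in> carrier B"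
  shows "(a, c) \<ominus>\<^bsub>A \<oplus>\<^sub>s B\<^esub> (b, d) = (a \<ominus>\<^bsub>A\<^esub> b, c \<ominus>\<^bsub>B\<^esub> d)"
proof -
  interpret A: module R A by fact
  interpret B: module R B by fact
  interpret S: module R "A \<oplus>\<^sub>s B" by (rule module_sum[OF A B])
  have "\<ominus>\<^bsub>A \<oplus>\<^sub>s B\<^esub> (b, d) = (\<ominus>\<^bsub>A\<^esub> b, \<ominus>\<^bsub>B\<^esub> d)"
    using S.koszul_smult(2)[of "(b, d)"] assms(3,4) by simp
  then show ?thesis by (simp add: a_minus_def)
qed

lemma supermodule_sum:
  assumes A: "supermodule R A" and B: "supermodule R B"
  shows "supermodule R (A \<oplus>\<^sub>s B)"
proof -
  interpret A: supermodule R A by fact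
  interpret B: supermodule R B by fact
  interpret S: module R "A \<oplus>\<^sub>s B" by (rule module_sum[OF A.module_axioms B.module_axioms])
  show ?thesis
  proof (rule supermoduleI)
    show "submodule (gr (A \<oplus>\<^sub>s B) p) R (A \<oplus>\<^sub>s B)" for p
    proof (rule S.submoduleI)
      fix x assume "x \<in> gr (A \<oplus>\<^sub>s B) p"
      then obtain a b where ab: "x = (a, b)" "a \<in> gr A p" "b \<in> gr B p" by auto
      then have c: "a \<in> carrier A" "b \<in> carrier B" using A.gr_carrier B.gr_carrier by auto
      have "\<ominus>\<^bsub>A \<oplus>\<^sub>s B\<^esub> x = (\<ominus>\<^bsub>A\<^esub> a, \<ominus>\<^bsub>B\<^esub> b)"
        using S.koszul_smult(2)[of x] ab c by simp
      then show "\<ominus>\<^bsub>A \<oplus>\<^sub>s B\<^esub> x \<in> gr (A \<oplus>\<^sub>s B) p" using ab by (simp add: A.gr_uminus B.gr_uminus)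
    qed (auto simp: A.gr_carrier B.gr_carrier A.gr_zero B.gr_zero A.gr_add B.gr_add A.gr_smult B.gr_smult)
  next
    fix x assume "x \<in> carrier (A \<oplus>\<^sub>s B)"
    then obtain a b where ab: "x = (a, b)" "a \<in> carrier A" "b \<in> carrier B" by auto
    then show "\<exists>u\<in>gr (A \<oplus>\<^sub>s B) 0. \<exists>v\<in>gr (A \<oplus>\<^sub>s B) 1. x = u \<oplus>\<^bsub>A \<oplus>\<^sub>s B\<^esub> v"
      by (intro bexI[of _ "(hcomp A 0 a, hcomp B 0 b)"] bexI[of _ "(hcomp A 1 a, hcomp B 1 b)"])
        (simp_all add: A.hcomp_decomp B.hcomp_decomp A.hcomp_closed B.hcomp_closed)
  next
    fix x assume "x \<in> gr (A \<oplus>\<^sub>s B) 0" "x \<in> gr (A \<oplus>\<^sub>s B) 1"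
    then show "x = \<zero>\<^bsub>A \<oplus>\<^sub>s B\<^esub>"
      using A.gr_disjoint[of "fst x" 0 1] B.gr_disjoint[of "snd x" 0 1] by (cases x) auto
  qed (rule S.module_axioms)
qed

lemma power_sel:
  "carrier (supermodule_power A r) = {..<r} \<rightarrow>\<^sub>E carrier A"
  "\<zero>\<^bsub>supermodule_power A r\<^esub> = (\<lambda>i\<in>{..<r}. \<zero>\<^bsub>A\<^esub>)"
  "x \<oplus>\<^bsub>supermodule_power A r\<^esub> y = (\<lambda>i\<in>{..<r}. x i \<oplus>\<^bsub>A\<^esub> y i)"
  "c \<odot>\<^bsub>supermodule_power A r\<^esub> x = (\<lambda>i\<in>{..<r}. c \<odot>\<^bsub>A\<^esub> x i)"
  "gr (supermodule_power A r) p = {..<r} \<rightarrow>\<^sub>E gr A p"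
  by (simp_all add: supermodule_power_def)

lemma power_eqI:
  assumes "x \<in> carrier (supermodule_power A r)" "y \<in> carrier (supermodule_power A r)"
    "\<And>i. i < r \<Longrightarrow> x i = y i"
  shows "x = y"
  using assms unfolding power_sel by (intro PiE_ext[of x "{..<r}"]) auto

lemma supermodule_power:
  assumes A: "supermodule R A"
  shows "supermodule R (supermodule_power A r)" (is "supermodule R ?P")
    and "\<And>x y i. y \<in> carrier (supermodule_power A r) \<Longrightarrow> i < r \<Longrightarrow>
      (x \<ominus>\<^bsub>supermodule_power A r\<^esub> y) i = x i \<ominus>\<^bsub>A\<^esub> y i"
proof -
  interpret A: supermodule R A by fact
  note eqI = power_eqI[where A = A and r = r]
  have cl: "x \<oplus>\<^bsub>?P\<^esub> y \<in> carrier ?P" if "x \<in> carrier ?P" "y \<in> carrier ?P" for x y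
    using that by (auto simp: power_sel)
  have zc: "\<zero>\<^bsub>?P\<^esub> \<in> carrier ?P"
    by (auto simp: power_sel)
  have sc: "c \<odot>\<^bsub>?P\<^esub> x \<in> carrier ?P" if "c \<in> carrier R" "x \<in> carrier ?P" for c x
    using that by (auto simp: power_sel)
  have en: "i < r \<Longrightarrow> (x \<oplus>\<^bsub>?P\<^esub> y) i = x i \<oplus>\<^bsub>A\<^esub> y i" "i < r \<Longrightarrow> (c \<odot>\<^bsub>?P\<^esub> x) i = c \<odot>\<^bsub>A\<^esub> x i"
    "i < r \<Longrightarrow> \<zero>\<^bsub>?P\<^esub> i = \<zero>\<^bsub>A\<^esub>" for x y c i
    by (simp_all add: power_sel)
  have ec: "x i \<in> carrier A" if "x \<in> carrier ?P" "i < r" for x i using that by (auto simp: power_sel)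
  have m1: "\<ominus>\<^bsub>R\<^esub> \<one>\<^bsub>R\<^esub> \<in> carrier R" by simp
  have ag: "abelian_group ?P"
  proof (rule abelian_groupI)
    fix x assume x: "x \<in> carrier ?P"
    show "\<exists>y\<in>carrier ?P. y \<oplus>\<^bsub>?P\<^esub> x = \<zero>\<^bsub>?P\<^esub>"
      using x sc[OF m1 x]
      by (intro bexI[of _ "(\<ominus>\<^bsub>R\<^esub> \<one>\<^bsub>R\<^esub>) \<odot>\<^bsub>?P\<^esub> x"] eqI) (simp_all add: cl zc en ec A.M.l_neg)
  qed (auto intro!: eqI simp: cl zc en ec A.M.a_ac)
  interpret P: module R ?P
    by (rule moduleI[OF A.is_cring ag])
      (auto intro!: eqI simp: cl sc en ec A.smult_l_distr A.smult_r_distr A.smult_assoc1)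
  have neg: "(\<ominus>\<^bsub>?P\<^esub> x) i = \<ominus>\<^bsub>A\<^esub> x i" if "x \<in> carrier ?P" "i < r" for x i
    using P.koszul_smult(2)[OF that(1)] en(2)[OF that(2), of "\<ominus>\<^bsub>R\<^esub> \<one>\<^bsub>R\<^esub>" x] that by (simp add: ec)
  have gi: "x \<in> gr ?P p \<longleftrightarrow> x \<in> carrier ?P \<and> (\<forall>i<r. x i \<in> gr A p)" for x p
    by (auto simp: power_sel PiE_iff intro: A.gr_carrier)
  show "(x \<ominus>\<^bsub>?P\<^esub> y) i = x i \<ominus>\<^bsub>A\<^esub> y i" if "y \<in> carrier ?P" "i < r" for x y i
    unfolding a_minus_def using that en(1) neg by simp
  show "supermodule R ?P"
  proof (rule supermoduleI)
    show "submodule (gr ?P p) R ?P" for p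
      by (rule P.submoduleI) (auto simp: gi cl zc sc en neg A.gr_zero A.gr_add A.gr_smult A.gr_uminus)
  next
    fix x assume x: "x \<in> carrier ?P"
    let ?h = "\<lambda>p. \<lambda>i\<in>{..<r}. hcomp A p (x i)"
    have h: "?h p \<in> gr ?P p" for p using x by (auto simp: power_sel intro!: A.hcomp_closed)
    then have "?h p \<in> carrier ?P" for p using gi by blast
    then have "x = ?h 0 \<oplus>\<^bsub>?P\<^esub> ?h 1" using x by (intro eqI) (simp_all add: cl en ec A.hcomp_decomp)
    then show "\<exists>u\<in>gr ?P 0. \<exists>v\<in>gr ?P 1. x = u \<oplus>\<^bsub>?P\<^esub> v" using h by blast
  next
    fix x assume "x \<in> gr ?P 0" "x \<in> gr ?P 1"
    then show "x = \<zero>\<^bsub>?P\<^esub>"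
      unfolding gi by (intro eqI) (auto simp: zc en intro: A.gr_disjoint[of _ 0 1])
  qed (rule P.module_axioms)
qed

section \<open>Central extensions from cocycles\<close>

lemma cocycle_sum:
  assumes A: "supermodule R A" and B: "supermodule R B" and L: "leibniz_superalgebra R L"
    and "leibniz_cocycle R L A \<alpha>" "leibniz_cocycle R L B \<beta>"
  shows "leibniz_cocycle R L (A \<oplus>\<^sub>s B) (\<lambda>x y. (\<alpha> x y, \<beta> x y))"
proof -
  interpret L: leibniz_superalgebra R L by fact
  interpret a: cocycle R L A \<alpha> using assms by (intro cocycle.intro cocycle_axioms.intro)
  interpret b: cocycle R L B \<beta> using assms by (intro cocycle.intro cocycle_axioms.intro)
  show ?thesis
    unfolding leibniz_cocycle_def even_bilinear_map_def
    by (auto simp: a.linear_simps b.linear_simps a.graded b.graded a.identity b.identity L.gr_carrier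
        sum_minus[OF a.V.module_axioms b.V.module_axioms])
qed

lemma cocycle_power:
  assumes A: "supermodule R A" and L: "leibniz_superalgebra R L"
    and c: "\<And>i. i < r \<Longrightarrow> leibniz_cocycle R L A (\<alpha> i)"
  shows "leibniz_cocycle R L (supermodule_power A r) (\<lambda>x y. \<lambda>i\<in>{..<r}. \<alpha> i x y)" (is "leibniz_cocycle R L ?P ?f")
proof -
  interpret L: leibniz_superalgebra R L by fact
  interpret A: supermodule R A by fact
  interpret P: supermodule R ?P by (rule supermodule_power[OF A])
  have a: "cocycle R L A (\<alpha> i)" if "i < r" for i
    using A L c[OF that] by (intro cocycle.intro cocycle_axioms.intro)
  have b: "bilinear_map R L A (\<alpha> i)" if "i < r" for i
    using a[OF that] by (auto simp: cocycle_def intro!: bilinear_map.intro bilinear_map_axioms.intro A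
        L.supermodule_axioms c[OF that, unfolded leibniz_cocycle_def, THEN conjunct1])
  note bs = bilinear_map.linear_simps[OF b] bilinear_map.closed[OF b] bilinear_map.graded[OF b]
  have cl: "?f x y \<in> carrier ?P" if "x \<in> carrier L" "y \<in> carrier L" for x y
    using that by (auto simp: power_sel bs)
  show ?thesis
    unfolding leibniz_cocycle_def even_bilinear_map_def
  proof (intro conjI allI ballI)
    fix p q x y z assume h: "x \<in> carrier L" "y \<in> gr L p" "z \<in> gr L q"
    then have yz: "y \<in> carrier L" "z \<in> carrier L" using L.gr_carrier by auto
    have k: "koszul R (p * q) \<odot>\<^bsub>?P\<^esub> ?f (bracket L x z) y \<in> carrier ?P"
      using h yz by (intro P.smult_closed cl) simp_all
    show "?f x (bracket L y z) = ?f (bracket L x y) z \<ominus>\<^bsub>?P\<^esub> koszul R (p * q) \<odot>\<^bsub>?P\<^esub> ?f (bracket L x z) y"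
    proof (rule power_eqI[where A = A and r = r])
      fix i assume i: "i < r"
      show "?f x (bracket L y z) i = (?f (bracket L x y) z \<ominus>\<^bsub>?P\<^esub> koszul R (p * q) \<odot>\<^bsub>?P\<^esub> ?f (bracket L x z) y) i"
        unfolding supermodule_power(2)[OF A k i] using i cocycle.identity[OF a[OF i] h] by (simp add: power_sel)
    qed (use h yz k in \<open>simp_all add: cl P.M.minus_closed\<close>)
  qed (auto simp: bs power_sel L.gr_carrier intro!: restrict_ext)
qed

lemma cocycle_pullback:
  assumes L': "leibniz_superalgebra R L'" and L: "leibniz_superalgebra R L" and f: "f \<in> leibniz_hom R L' L"
    and V: "supermodule R V" and c: "leibniz_cocycle R L V \<psi>"
  shows "leibniz_cocycle R L' V (\<lambda>x y. \<psi> (f x) (f y))"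
proof -
  interpret L': leibniz_superalgebra R L' by fact
  interpret c: cocycle R L V \<psi> using assms by (intro cocycle.intro cocycle_axioms.intro)
  note F = leibniz_homD[OF f]
  show ?thesis
    unfolding leibniz_cocycle_def even_bilinear_map_def
    by (auto simp: F c.linear_simps c.graded c.identity[OF F(1) F(4) F(4)] L'.gr_carrier)
qed

lemma cocycle_pushforward:
  assumes L: "leibniz_superalgebra R L" and V: "supermodule R V" and W: "supermodule R W"
    and h: "even_linear R V W h" and c: "leibniz_cocycle R L V \<psi>"
  shows "leibniz_cocycle R L W (\<lambda>x y. h (\<psi> x y))"
proof -
  interpret c: cocycle R L V \<psi> using assms by (intro cocycle.intro cocycle_axioms.intro)
  interpret h: even_linear_map R V W h
    by (intro even_linear_map.intro V W even_linear_map_axioms.intro h)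
  show ?thesis
    unfolding leibniz_cocycle_def even_bilinear_map_def
    by (auto simp: c.linear_simps c.graded c.identity c.L.gr_carrier h.add h.smult h.graded h.minus)
qed

text \<open>The bracket ignores the V-components, so its Leibniz identity is the pair of the
  identity of L and the cocycle identity of \<psi>.\<close>

lemma cocycle_extension:
  assumes L: "leibniz_superalgebra R L" and V: "supermodule R V" and c: "leibniz_cocycle R L V \<psi>"
  shows "leibniz_superalgebra R
    (with_bracket (L \<oplus>\<^sub>s V) (\<lambda>x y. (bracket L (fst x) (fst y), \<psi> (fst x) (fst y))))"
proof -
  interpret c: cocycle R L V \<psi> using assms by (intro cocycle.intro cocycle_axioms.intro)
  show ?thesis
  proof (rule with_bracket_leibnizI[OF supermodule_sum[OF c.L.supermodule_axioms V]])
    show "even_bilinear_map R (L \<oplus>\<^sub>s V) (L \<oplus>\<^sub>s V) (\<lambda>x y. (bracket L (fst x) (fst y), \<psi> (fst x) (fst y)))"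
      unfolding even_bilinear_map_def
      by (auto simp: c.linear_simps c.graded c.L.br.linear_simps c.L.br.graded)
  next
    fix x y z p q r
    assume "x \<in> gr (L \<oplus>\<^sub>s V) r" "y \<in> gr (L \<oplus>\<^sub>s V) p" "z \<in> gr (L \<oplus>\<^sub>s V) q"
    then have h: "fst x \<in> carrier L" "fst y \<in> gr L p" "fst z \<in> gr L q" "fst y \<in> carrier L" "fst z \<in> carrier L"
      using c.L.gr_carrier by (cases x; cases y; cases z; fastforce)+
    show "(bracket L (fst x) (fst (bracket L (fst y) (fst z), \<psi> (fst y) (fst z))),
         \<psi> (fst x) (fst (bracket L (fst y) (fst z), \<psi> (fst y) (fst z)))) =
       (bracket L (fst (bracket L (fst x) (fst y), \<psi> (fst x) (fst y))) (fst z),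
        \<psi> (fst (bracket L (fst x) (fst y), \<psi> (fst x) (fst y))) (fst z)) \<ominus>\<^bsub>L \<oplus>\<^sub>s V\<^esub>
       koszul R (p * q) \<odot>\<^bsub>L \<oplus>\<^sub>s V\<^esub>
       (bracket L (fst (bracket L (fst x) (fst z), \<psi> (fst x) (fst z))) (fst y),
        \<psi> (fst (bracket L (fst x) (fst z), \<psi> (fst x) (fst z))) (fst y))"
      using h c.identity[OF h(1-3)] c.L.leibniz_identity[OF h(1-3)]
      by (simp add: sum_minus[OF c.L.module_axioms c.V.module_axioms])
  qed
qed

text \<open>As \<beta> has central values and vanishes when one argument is itself a value of
  \<beta>, all mixed terms of the Leibniz identity for the new bracket disappear; what remains is
  the identity of M minus the cocycle identity of \<beta>.\<close>

lemma cocycle_twist: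
  assumes M: "leibniz_superalgebra R M" and c: "leibniz_cocycle R M M \<beta>"
    and centre: "\<And>x y. x \<in> carrier M \<Longrightarrow> y \<in> carrier M \<Longrightarrow> \<beta> x y \<in> centre M"
    and vanish: "\<And>x y z. x \<in> carrier M \<Longrightarrow> y \<in> carrier M \<Longrightarrow> z \<in> carrier M \<Longrightarrow>
      \<beta> x (\<beta> y z) = \<zero>\<^bsub>M\<^esub> \<and> \<beta> (\<beta> y z) x = \<zero>\<^bsub>M\<^esub>"
  shows "leibniz_superalgebra R (with_bracket M (\<lambda>x y. bracket M x y \<ominus>\<^bsub>M\<^esub> \<beta> x y))"
proof -
  interpret c: cocycle R M M \<beta>
    using M c leibniz_superalgebra.axioms(1)[OF M] by (intro cocycle.intro cocycle_axioms.intro)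
  have z: "bracket M x (\<beta> y z) = \<zero>\<^bsub>M\<^esub>" "bracket M (\<beta> y z) x = \<zero>\<^bsub>M\<^esub>"
    if "x \<in> carrier M" "y \<in> carrier M" "z \<in> carrier M" for x y z
    using centre[of y z] that by (auto simp: centre_def)
  show ?thesis
  proof (rule with_bracket_leibnizI[OF c.L.supermodule_axioms])
    show "even_bilinear_map R M M (\<lambda>x y. bracket M x y \<ominus>\<^bsub>M\<^esub> \<beta> x y)"
      unfolding even_bilinear_map_def
      by (auto simp: c.linear_simps c.graded c.L.br.linear_simps c.L.br.graded c.L.gr_minus
          c.L.smult_diff c.L.M.diff_simps c.L.M.a_ac)
  next
    fix x y u p q r assume h: "x \<in> gr M r" "y \<in> gr M p" "u \<in> gr M q"
    then have cc: "x \<in> carrier M" "y \<in> carrier M" "u \<in> carrier M" using c.L.gr_carrier by auto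
    show "bracket M x (bracket M y u \<ominus>\<^bsub>M\<^esub> \<beta> y u) \<ominus>\<^bsub>M\<^esub> \<beta> x (bracket M y u \<ominus>\<^bsub>M\<^esub> \<beta> y u) =
      bracket M (bracket M x y \<ominus>\<^bsub>M\<^esub> \<beta> x y) u \<ominus>\<^bsub>M\<^esub> \<beta> (bracket M x y \<ominus>\<^bsub>M\<^esub> \<beta> x y) u \<ominus>\<^bsub>M\<^esub>
      koszul R (p * q) \<odot>\<^bsub>M\<^esub> (bracket M (bracket M x u \<ominus>\<^bsub>M\<^esub> \<beta> x u) y \<ominus>\<^bsub>M\<^esub> \<beta> (bracket M x u \<ominus>\<^bsub>M\<^esub> \<beta> x u) y)"
    proof -
      have "bracket M x (bracket M y u \<ominus>\<^bsub>M\<^esub> \<beta> y u) \<ominus>\<^bsub>M\<^esub> \<beta> x (bracket M y u \<ominus>\<^bsub>M\<^esub> \<beta> y u) =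
        bracket M x (bracket M y u) \<ominus>\<^bsub>M\<^esub> \<beta> x (bracket M y u)"
        using cc by (simp add: c.linear_simps c.L.br.linear_simps z vanish c.L.M.diff_zero)
      also have "\<dots> = (bracket M (bracket M x y) u \<ominus>\<^bsub>M\<^esub> \<beta> (bracket M x y) u) \<ominus>\<^bsub>M\<^esub>
        (koszul R (p * q) \<odot>\<^bsub>M\<^esub> bracket M (bracket M x u) y \<ominus>\<^bsub>M\<^esub> koszul R (p * q) \<odot>\<^bsub>M\<^esub> \<beta> (bracket M x u) y)"
        unfolding c.identity[OF cc(1) h(2,3)] c.L.leibniz_identity[OF cc(1) h(2,3)]
        using cc by (simp add: c.L.M.diff_simps c.L.M.a_ac)
      also have "\<dots> = bracket M (bracket M x y \<ominus>\<^bsub>M\<^esub> \<beta> x y) u \<ominus>\<^bsub>M\<^esub> \<beta> (bracket M x y \<ominus>\<^bsub>M\<^esub> \<beta> x y) u \<ominus>\<^bsub>M\<^esub>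
        koszul R (p * q) \<odot>\<^bsub>M\<^esub> (bracket M (bracket M x u \<ominus>\<^bsub>M\<^esub> \<beta> x u) y \<ominus>\<^bsub>M\<^esub> \<beta> (bracket M x u \<ominus>\<^bsub>M\<^esub> \<beta> x u) y)"
        using cc by (simp add: c.linear_simps c.L.br.linear_simps z vanish c.L.M.diff_zero c.L.smult_diff)
      finally show ?thesis .
    qed
  qed
qed

section \<open>Polarised minors as cocycles\<close>

lemma lterms_components:
  assumes M: "leibniz_superalgebra R M" and e: "\<And>p g. g \<in> G p \<Longrightarrow> e g \<in> gr M p"
    and t: "t \<in> lterms R G"
  shows "\<exists>a b. homog_term R G 0 a \<and> homog_term R G 1 b \<and>
    lterm_eval M e t = lterm_eval M e a \<oplus>\<^bsub>M\<^esub> lterm_eval M e b"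
proof -
  interpret M: leibniz_superalgebra R M by fact
  let ?ev = "lterm_eval M e"
  have c: "?ev a \<in> carrier M" if "homog_term R G p a" for a p
    by (rule M.gr_carrier, rule lterm_eval_homog[OF M _ that]) (rule e)
  note I = homog_term.intros
  show ?thesis using t
  proof induction
    case (1 g p)
    have g: "homog_term R G p (Gen g)" using 1 by (rule I(1))
    show ?case
    proof (cases p)
      case zero
      then show ?thesis using g I(2)[of R G 1] c[OF g]
        by (intro exI[of _ "Gen g"] exI[of _ TZero]) auto
    next
      case one
      then show ?thesis using g I(2)[of R G 0] c[OF g]
        by (intro exI[of _ TZero] exI[of _ "Gen g"]) auto
    qed
  next
    case 2
    then show ?case using I(2)[of R G] by (intro exI[of _ TZero]) simp
  next
    case (3 s t)
    then obtain a b a' b' where h: "homog_term R G 0 a" "homog_term R G 1 b" "?ev s = ?ev a \<oplus>\<^bsub>M\<^esub> ?ev b"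
      "homog_term R G 0 a'" "homog_term R G 1 b'" "?ev t = ?ev a' \<oplus>\<^bsub>M\<^esub> ?ev b'" by blast
    then show ?case
      using I(3)[OF h(1,4)] I(3)[OF h(2,5)] c
      by (intro exI[of _ "TAdd a a'"] exI[of _ "TAdd b b'"]) (simp add: M.M.a_ac)
  next
    case (4 r t)
    then obtain a b where h: "homog_term R G 0 a" "homog_term R G 1 b" "?ev t = ?ev a \<oplus>\<^bsub>M\<^esub> ?ev b" by blast
    then show ?case
      using I(4)[OF 4(1) h(1)] I(4)[OF 4(1) h(2)] c 4(1)
      by (intro exI[of _ "TScale r a"] exI[of _ "TScale r b"]) (simp add: M.smult_r_distr)
  next
    case (5 s t)
    then obtain a b a' b' where h: "homog_term R G 0 a" "homog_term R G 1 b" "?ev s = ?ev a \<oplus>\<^bsub>M\<^esub> ?ev b"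
      "homog_term R G 0 a'" "homog_term R G 1 b'" "?ev t = ?ev a' \<oplus>\<^bsub>M\<^esub> ?ev b'" by blast
    have "homog_term R G 0 (TAdd (TBr a a') (TBr b b'))" "homog_term R G 1 (TAdd (TBr a b') (TBr b a'))"
      using I(5)[OF h(1,4)] I(5)[OF h(2,5)] I(5)[OF h(1,5)] I(5)[OF h(2,4)] by (auto intro: I(3))
    then show ?case
      using h c by (intro exI[of _ "TAdd (TBr a a') (TBr b b')"] exI[of _ "TAdd (TBr a b') (TBr b a')"])
        (simp add: M.br.linear_simps M.M.a_ac)
  qed
qed

text \<open>Inductions over \<open>homog_term\<close> need a homogeneous term for each homogeneous
  element. Splitting an arbitrary term as in \<open>lterms_components\<close> and comparing degrees
  provides one.\<close>

lemma homog_generated: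
  assumes M: "leibniz_superalgebra R M" and e: "\<And>p g. g \<in> G p \<Longrightarrow> e g \<in> gr M p"
    and gen: "carrier M \<subseteq> lterm_eval M e ` lterms R G" and x: "x \<in> gr M p"
  obtains t where "homog_term R G p t" "x = lterm_eval M e t"
proof -
  interpret M: leibniz_superalgebra R M by fact
  obtain t where t: "t \<in> lterms R G" "x = lterm_eval M e t" using gen M.gr_carrier[OF x] by blast
  obtain a b where h: "homog_term R G 0 a" "homog_term R G 1 b" "x = lterm_eval M e a \<oplus>\<^bsub>M\<^esub> lterm_eval M e b"
    using lterms_components[OF M _ t(1), of e] e t(2) by auto
  have eg: "lterm_eval M e t \<in> gr M p" if "homog_term R G p t" for t p
    by (rule lterm_eval_homog[OF M _ that]) (rule e)
  note u = M.hcomp_unique[OF eg[OF h(1)] eg[OF h(2)] h(3)]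
  show thesis
    using u[of p] M.hcomp_homog[OF x, of p] h(1,2) that by (cases p) auto
qed

text \<open>The elements z that satisfy the identity for all x and y are closed under sums,
  multiples and brackets, much as derivations are, so z may be taken to be a generator. For the
  minors this reduces a condition on three matrices to one in which the third is elementary.\<close>

lemma cocycle_generated:
  assumes L: "leibniz_superalgebra R L" and V: "supermodule R V" and bil: "even_bilinear_map R L V \<psi>"
    and e: "\<And>p g. g \<in> G p \<Longrightarrow> e g \<in> gr L p"
    and gen: "carrier L \<subseteq> lterm_eval L e ` lterms R G"
    and id: "\<And>p q r g x y. g \<in> G r \<Longrightarrow> x \<in> gr L p \<Longrightarrow> y \<in> gr L q \<Longrightarrow>
      \<psi> x (bracket L y (e g)) =
        \<psi> (bracket L x y) (e g) \<ominus>\<^bsub>V\<^esub> koszul R (q * r) \<odot>\<^bsub>V\<^esub> \<psi> (bracket L x (e g)) y"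
  shows "leibniz_cocycle R L V \<psi>"
proof -
  interpret L: leibniz_superalgebra R L by fact
  interpret b: bilinear_map R L V \<psi>
    by (intro bilinear_map.intro bilinear_map_axioms.intro V bil L.supermodule_axioms)
  let ?I = "\<lambda>r z. \<forall>q. \<forall>x\<in>carrier L. \<forall>y\<in>gr L q. \<psi> x (bracket L y z) =
        \<psi> (bracket L x y) z \<ominus>\<^bsub>V\<^esub> koszul R (q * r) \<odot>\<^bsub>V\<^esub> \<psi> (bracket L x z) y"
  let ?ev = "lterm_eval L e"
  have eg: "?ev t \<in> gr L p" if "homog_term R G p t" for t p by (rule lterm_eval_homog[OF L _ that]) (rule e)
  have ec: "?ev t \<in> carrier L" if "homog_term R G p t" for t p using eg[OF that] L.gr_carrier by blast
  have "?I p (?ev t)" if "homog_term R G p t" for p t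
    using that
  proof induction
    case (1 g r)
    show ?case
    proof (intro allI ballI)
      fix q x y assume x: "x \<in> carrier L" and y: "y \<in> gr L q"
      have c: "e g \<in> carrier L" "y \<in> carrier L" using e[OF 1] y L.gr_carrier by auto
      obtain a a' where a: "a \<in> gr L 0" "a' \<in> gr L 1" "x = a \<oplus>\<^bsub>L\<^esub> a'" by (rule L.gr_decomp[OF x])
      have ac: "a \<in> carrier L" "a' \<in> carrier L" using a L.gr_carrier by auto
      show "\<psi> x (bracket L y (?ev (Gen g))) = \<psi> (bracket L x y) (?ev (Gen g)) \<ominus>\<^bsub>V\<^esub>
          koszul R (q * r) \<odot>\<^bsub>V\<^esub> \<psi> (bracket L x (?ev (Gen g))) y"
        unfolding a(3) using ac c
        by (simp add: b.linear_simps L.br.linear_simps id[OF 1 a(1) y] id[OF 1 a(2) y] b.V.smult_r_distr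
            b.V.M.minus_eq b.V.M.minus_add b.V.M.a_ac)
    qed
  next
    case (2 p)
    then show ?case by (simp add: L.gr_carrier b.V.M.minus_eq)
  next
    case (3 p s t)
    then show ?case
      by (simp add: L.gr_carrier ec L.br.linear_simps b.linear_simps b.V.smult_r_distr
          b.V.M.minus_eq b.V.M.minus_add b.V.M.a_ac)
  next
    case (4 r p t)
    then show ?case
      by (simp add: L.gr_carrier ec L.br.linear_simps b.linear_simps b.V.smult_diff b.V.smult_koszul_commute)
  next
    \<comment> \<open>The bracket \<open>[y, [z, w]]\<close> is expanded by the Leibniz identity of
      L, then the hypotheses on w and z are applied. The terms in which y stands between z and w
      cancel in pairs.\<close>
    case (5 p s s' t)
    let ?z = "?ev s" and ?w = "?ev t"
    note z = eg[OF 5(1)] and w = eg[OF 5(2)]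
    have Iz: "\<psi> x (bracket L y ?z) = \<psi> (bracket L x y) ?z \<ominus>\<^bsub>V\<^esub> koszul R (q * p) \<odot>\<^bsub>V\<^esub> \<psi> (bracket L x ?z) y"
      if "x \<in> carrier L" "y \<in> gr L q" for x y q using 5(3) that by blast
    have Iw: "\<psi> x (bracket L y ?w) = \<psi> (bracket L x y) ?w \<ominus>\<^bsub>V\<^esub> koszul R (q * s') \<odot>\<^bsub>V\<^esub> \<psi> (bracket L x ?w) y"
      if "x \<in> carrier L" "y \<in> gr L q" for x y q using 5(4) that by blast
    show ?case
    proof (intro allI ballI)
      fix q x y assume x: "x \<in> carrier L" and y: "y \<in> gr L q"
      have c: "?z \<in> carrier L" "?w \<in> carrier L" "y \<in> carrier L" using z w y L.gr_carrier by auto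
      note g = L.br.graded
      have 1: "\<psi> x (bracket L y (bracket L ?z ?w)) =
        \<psi> x (bracket L (bracket L y ?z) ?w) \<ominus>\<^bsub>V\<^esub> koszul R (p * s') \<odot>\<^bsub>V\<^esub> \<psi> x (bracket L (bracket L y ?w) ?z)"
        using L.leibniz_identity[OF c(3) z w] c x by (simp add: b.linear_simps)
      have 2: "\<psi> x (bracket L (bracket L y ?z) ?w) =
        (\<psi> (bracket L (bracket L x y) ?z) ?w \<ominus>\<^bsub>V\<^esub> koszul R (q * p) \<odot>\<^bsub>V\<^esub> \<psi> (bracket L (bracket L x ?z) y) ?w) \<ominus>\<^bsub>V\<^esub>
        koszul R ((q + p) * s') \<odot>\<^bsub>V\<^esub>
          (\<psi> (bracket L (bracket L x ?w) y) ?z \<ominus>\<^bsub>V\<^esub> koszul R (q * p) \<odot>\<^bsub>V\<^esub> \<psi> (bracket L (bracket L x ?w) ?z) y)"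
        using Iw[OF x g[OF y z]] L.leibniz_identity[OF x y z] Iz[OF _ y, of "bracket L x ?w"] c x
        by (simp add: b.linear_simps)
      have 3: "\<psi> x (bracket L (bracket L y ?w) ?z) =
        (\<psi> (bracket L (bracket L x y) ?w) ?z \<ominus>\<^bsub>V\<^esub> koszul R (q * s') \<odot>\<^bsub>V\<^esub> \<psi> (bracket L (bracket L x ?w) y) ?z) \<ominus>\<^bsub>V\<^esub>
        koszul R ((q + s') * p) \<odot>\<^bsub>V\<^esub>
          (\<psi> (bracket L (bracket L x ?z) y) ?w \<ominus>\<^bsub>V\<^esub> koszul R (q * s') \<odot>\<^bsub>V\<^esub> \<psi> (bracket L (bracket L x ?z) ?w) y)"
        using Iz[OF x g[OF y w]] L.leibniz_identity[OF x y w] Iw[OF _ y, of "bracket L x ?z"] c x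
        by (simp add: b.linear_simps)
      have 4: "\<psi> (bracket L x y) (bracket L ?z ?w) =
        \<psi> (bracket L (bracket L x y) ?z) ?w \<ominus>\<^bsub>V\<^esub> koszul R (p * s') \<odot>\<^bsub>V\<^esub> \<psi> (bracket L (bracket L x y) ?w) ?z"
        using Iw[OF _ z] c x by simp
      have 5: "\<psi> (bracket L x (bracket L ?z ?w)) y =
        \<psi> (bracket L (bracket L x ?z) ?w) y \<ominus>\<^bsub>V\<^esub> koszul R (p * s') \<odot>\<^bsub>V\<^esub> \<psi> (bracket L (bracket L x ?w) ?z) y"
        using L.leibniz_identity[OF x z w] c x by (simp add: b.linear_simps)
      show "\<psi> x (bracket L y (?ev (TBr s t))) = \<psi> (bracket L x y) (?ev (TBr s t)) \<ominus>\<^bsub>V\<^esub>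
          koszul R (q * (p + s')) \<odot>\<^bsub>V\<^esub> \<psi> (bracket L x (?ev (TBr s t))) y"
        unfolding lterm_eval.simps 1 2 3 4 5 using c x
        by (cases p; cases q; cases s') (simp_all add: b.V.M.diff_simps b.V.M.a_ac)
    qed
  qed
  moreover have "\<exists>t. homog_term R G p t \<and> z = ?ev t" if "z \<in> gr L p" for z p
    by (rule homog_generated[OF L _ gen that]) (use e in blast)+
  ultimately have "?I p z" if "z \<in> gr L p" for z p using that by metis
  then show ?thesis unfolding leibniz_cocycle_def using bil by blast
qed

section \<open>Triple products and signs modulo the ideals\<close>

context superdialgebra
begin

context
  fixes \<kappa> :: nat
begin

abbreviation "V \<equiv> dialg_quot R D \<kappa>"
abbreviation "I \<equiv> I_ideal R D \<kappa>"
abbreviation "cl \<equiv> graded_submodule.coset D (I_ideal R D \<kappa>)"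

interpretation q: graded_submodule R D I by (rule graded_submodule_I)
interpretation V: supermodule R V by (rule supermodule_dialg_quot)
interpretation cl: even_linear_map R D V cl
  using q.coset_even_linear by unfold_locales (simp add: dialg_quot_def)

lemma cl_zero_iff: "a \<in> carrier D \<Longrightarrow> cl a = \<zero>\<^bsub>V\<^esub> \<longleftrightarrow> a \<in> I"
  unfolding dialg_quot_def by (rule q.coset_zero_iff)

lemma cl_comm:
  assumes "a \<in> gr D p" "b \<in> gr D q"
  shows "cl (b \<turnstile>\<^bsub>D\<^esub> a) = koszul R (p * q) \<odot>\<^bsub>V\<^esub> cl (a \<stileturn>\<^bsub>D\<^esub> b)"
proof -
  have c: "a \<in> carrier D" "b \<in> carrier D" using assms gr_carrier by auto
  have "a \<stileturn>\<^bsub>D\<^esub> b \<ominus>\<^bsub>D\<^esub> koszul R (p * q) \<odot>\<^bsub>D\<^esub> (b \<turnstile>\<^bsub>D\<^esub> a) \<in> I"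
    by (rule I_ideal_gens) (use assms in \<open>auto simp: I_gens_def\<close>)
  then have "cl (a \<stileturn>\<^bsub>D\<^esub> b) = koszul R (p * q) \<odot>\<^bsub>V\<^esub> cl (b \<turnstile>\<^bsub>D\<^esub> a)"
    using c by (simp add: cl_zero_iff[symmetric] cl.minus cl.smult V.M.diff_simps)
  then show ?thesis using c by (simp add: V.koszul_koszul)
qed

text \<open>The common normal form of the triple products in the cocycle identity for minors:
  \<open>tau_triple\<close> reduces each of them to a signed \<open>\<rho> a b c\<close>.\<close>

definition "\<rho> a b c = cl ((a \<stileturn>\<^bsub>D\<^esub> b) \<stileturn>\<^bsub>D\<^esub> c)"

lemma rho_closed [simp]: "a \<in> carrier D \<Longrightarrow> b \<in> carrier D \<Longrightarrow> c \<in> carrier D \<Longrightarrow> \<rho> a b c \<in> carrier V"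
  by (simp add: \<rho>_def)

text \<open>Multiply the generator of the ideal that compares \<open>c \<stileturn> b\<close> with
  \<open>b \<turnstile> c\<close> from the left by a. Under \<open>a \<stileturn>\<close> the two
  inner operations coincide, which leaves an exchange of the last two factors.\<close>

lemma rho_swap:
  assumes a: "a \<in> carrier D" and b: "b \<in> gr D q" and c: "c \<in> gr D r"
  shows "\<rho> a c b = koszul R (q * r) \<odot>\<^bsub>V\<^esub> \<rho> a b c"
proof -
  have bc: "b \<in> carrier D" "c \<in> carrier D" using b c gr_carrier by auto
  have "c \<stileturn>\<^bsub>D\<^esub> b \<ominus>\<^bsub>D\<^esub> koszul R (r * q) \<odot>\<^bsub>D\<^esub> (b \<turnstile>\<^bsub>D\<^esub> c) \<in> I"
    by (rule I_ideal_gens) (use b c in \<open>auto simp: I_gens_def\<close>)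
  from I_ideal_mult(2)[OF this a] show ?thesis
    using a bc by (simp add: lp.linear_simps assoc_simps cl_zero_iff[symmetric] cl.minus cl.smult
        V.M.diff_simps \<rho>_def mult.commute)
qed

lemma rho_left:
  assumes a: "a \<in> gr D p" and b: "b \<in> gr D q" and c: "c \<in> carrier D"
  shows "cl ((b \<turnstile>\<^bsub>D\<^esub> a) \<stileturn>\<^bsub>D\<^esub> c) = koszul R (p * q) \<odot>\<^bsub>V\<^esub> \<rho> a b c"
proof -
  have ab: "a \<in> carrier D" "b \<in> carrier D" using a b gr_carrier by auto
  have "a \<stileturn>\<^bsub>D\<^esub> b \<ominus>\<^bsub>D\<^esub> koszul R (p * q) \<odot>\<^bsub>D\<^esub> (b \<turnstile>\<^bsub>D\<^esub> a) \<in> I"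
    by (rule I_ideal_gens) (use a b in \<open>auto simp: I_gens_def\<close>)
  from I_ideal_mult(1)[OF this c]
  have "\<rho> a b c = koszul R (p * q) \<odot>\<^bsub>V\<^esub> cl ((b \<turnstile>\<^bsub>D\<^esub> a) \<stileturn>\<^bsub>D\<^esub> c)"
    using ab c by (simp add: lp.linear_simps cl_zero_iff[symmetric] cl.minus cl.smult V.M.diff_simps \<rho>_def)
  then show ?thesis using ab c by (simp add: V.koszul_koszul)
qed

lemma rho_middle_zero: "a \<in> carrier D \<Longrightarrow> t \<in> I \<Longrightarrow> c \<in> carrier D \<Longrightarrow> \<rho> a t c = \<zero>\<^bsub>V\<^esub>"
  and rho_left_zero: "b \<in> carrier D \<Longrightarrow> t \<in> I \<Longrightarrow> c \<in> carrier D \<Longrightarrow> \<rho> t b c = \<zero>\<^bsub>V\<^esub>"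
  using submoduleE(1)[OF I_ideal_submodule] unfolding \<rho>_def
  by (subst cl_zero_iff; force intro: I_ideal_mult)+

text \<open>The parity involution, written with components so that it is linear on all of D.\<close>

definition "\<sigma> a = hcomp D 0 a \<ominus>\<^bsub>D\<^esub> hcomp D 1 a"

lemma sigma_homog: "a \<in> gr D p \<Longrightarrow> \<sigma> a = koszul R p \<odot>\<^bsub>D\<^esub> a"
  unfolding \<sigma>_def using hcomp_homog[of a p] gr_carrier[of a p]
  by (cases p) (simp_all add: M.minus_eq)

lemma sigma_linear: "even_linear R D D \<sigma>"
  unfolding even_linear_def
  by (auto simp: \<sigma>_def hcomp_add hcomp_smult smult_diff M.diff_simps M.a_ac,
      simp add: sigma_homog[unfolded \<sigma>_def] gr_koszul_smult)

interpretation \<sigma>: even_linear_map R D D \<sigma>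
  by (intro even_linear_map.intro even_linear_map_axioms.intro supermodule_axioms sigma_linear)

text \<open>The sign (-1)^|b| introduced by \<sigma> is dictated by the values of an arbitrary
  cocycle, see \<open>B_eq_Q\<close>.\<close>

definition "\<tau> a b = cl (a \<stileturn>\<^bsub>D\<^esub> \<sigma> b)"

lemma tau_bilinear: "even_bilinear_map R D V \<tau>"
  unfolding even_bilinear_map_def \<tau>_def
  by (auto simp: \<sigma>.add \<sigma>.smult lp.linear_simps cl.add cl.smult intro!: cl.graded lp.graded \<sigma>.graded)

interpretation \<tau>: bilinear_map R D V \<tau>
  by (intro bilinear_map.intro bilinear_map_axioms.intro supermodule_axioms V.supermodule_axioms tau_bilinear)

lemma tau_homog: "a \<in> carrier D \<Longrightarrow> b \<in> gr D q \<Longrightarrow> \<tau> a b = koszul R q \<odot>\<^bsub>V\<^esub> cl (a \<stileturn>\<^bsub>D\<^esub> b)"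
  using gr_carrier[of b q] by (simp add: \<tau>_def sigma_homog lp.linear_simps cl.smult)

text \<open>In the cocycle identity tested against an elementary matrix with entry c, an entry a of
  X, an entry b of Y and c meet in one of these six shapes.\<close>

lemma tau_triple:
  assumes a: "a \<in> gr D p" and b: "b \<in> gr D q" and c: "c \<in> gr D r"
  shows "\<tau> a (b \<stileturn>\<^bsub>D\<^esub> c) = koszul R (q + r) \<odot>\<^bsub>V\<^esub> \<rho> a b c"
    and "\<tau> a (c \<turnstile>\<^bsub>D\<^esub> b) = koszul R (q + r + q * r) \<odot>\<^bsub>V\<^esub> \<rho> a b c"
    and "\<tau> (a \<stileturn>\<^bsub>D\<^esub> c) b = koszul R (q + q * r) \<odot>\<^bsub>V\<^esub> \<rho> a b c"
    and "\<tau> (c \<turnstile>\<^bsub>D\<^esub> a) b = koszul R (q + p * r + q * r) \<odot>\<^bsub>V\<^esub> \<rho> a b c"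
    and "\<tau> (a \<stileturn>\<^bsub>D\<^esub> b) c = koszul R r \<odot>\<^bsub>V\<^esub> \<rho> a b c"
    and "\<tau> (b \<turnstile>\<^bsub>D\<^esub> a) c = koszul R (r + p * q) \<odot>\<^bsub>V\<^esub> \<rho> a b c"
proof -
  have x: "a \<in> carrier D" "b \<in> carrier D" "c \<in> carrier D" using assms gr_carrier by auto
  note T = tau_homog
  have kk: "koszul R u \<odot>\<^bsub>V\<^esub> (koszul R v \<odot>\<^bsub>V\<^esub> \<rho> a b c) = koszul R (u + v) \<odot>\<^bsub>V\<^esub> \<rho> a b c" for u v
    using x by (simp add: V.koszul_koszul)
  show "\<tau> a (b \<stileturn>\<^bsub>D\<^esub> c) = koszul R (q + r) \<odot>\<^bsub>V\<^esub> \<rho> a b c"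
    using x by (simp add: T[OF x(1) lp.graded[OF b c]] assoc_simps \<rho>_def)
  show "\<tau> a (c \<turnstile>\<^bsub>D\<^esub> b) = koszul R (q + r + q * r) \<odot>\<^bsub>V\<^esub> \<rho> a b c"
    using x rho_swap[OF x(1) b c] unfolding T[OF x(1) rp.graded[OF c b]]
    by (simp add: assoc_simps \<rho>_def[symmetric] kk add.commute[of r q])
  show "\<tau> (a \<stileturn>\<^bsub>D\<^esub> c) b = koszul R (q + q * r) \<odot>\<^bsub>V\<^esub> \<rho> a b c"
    using x rho_swap[OF x(1) b c] by (simp add: T[OF _ b] \<rho>_def[symmetric] kk)
  show "\<tau> (c \<turnstile>\<^bsub>D\<^esub> a) b = koszul R (q + p * r + q * r) \<odot>\<^bsub>V\<^esub> \<rho> a b c"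
    using x by (simp add: T[OF _ b] rho_left[OF a c x(2)] rho_swap[OF x(1) b c] kk add.assoc)
  show "\<tau> (a \<stileturn>\<^bsub>D\<^esub> b) c = koszul R r \<odot>\<^bsub>V\<^esub> \<rho> a b c"
    using x by (simp add: T[OF _ c] \<rho>_def)
  show "\<tau> (b \<turnstile>\<^bsub>D\<^esub> a) c = koszul R (r + p * q) \<odot>\<^bsub>V\<^esub> \<rho> a b c"
    using x by (simp add: T[OF _ c] rho_left[OF a b x(3)] kk)
qed

text \<open>Twice an element is a generator of the ideal for \<kappa> = 2, so signs are invisible in
  the quotient.\<close>

lemma V_two:
  assumes "\<kappa> = 2" and v: "v \<in> carrier V"
  shows "\<ominus>\<^bsub>V\<^esub> v = v" "koszul R p \<odot>\<^bsub>V\<^esub> v = v"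
proof -
  obtain a where a: "a \<in> carrier D" "v = cl a" using v by (auto simp: dialg_quot_def q.quot_sel)
  have "[(2::nat)] \<cdot>\<^bsub>D\<^esub> a = a \<oplus>\<^bsub>D\<^esub> a" using a by (simp add: numeral_2_eq_2)
  moreover have "[(2::nat)] \<cdot>\<^bsub>D\<^esub> a \<in> I_gens 2" using a(1) unfolding I_gens_def by blast
  ultimately have "a \<oplus>\<^bsub>D\<^esub> a \<in> I" using assms I_ideal_gens[of "[(2::nat)] \<cdot>\<^bsub>D\<^esub> a" 2] by simp
  then have "v \<oplus>\<^bsub>V\<^esub> v = \<zero>\<^bsub>V\<^esub>" using a by (simp add: cl_zero_iff[symmetric] cl.add)
  then show "\<ominus>\<^bsub>V\<^esub> v = v" using v by (simp add: V.M.neg_eq_eq)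
  then show "koszul R p \<odot>\<^bsub>V\<^esub> v = v" using v by (cases p) simp_all
qed

end

end

lemma idx_deg_sum: "(\<Sum>i\<in>{1..2 + 2}. idx_deg 2 i) = 0"
proof -
  have "{1..2 + 2::nat} = {1, 2, 3, 4}" by auto
  then show ?thesis by (simp add: idx_deg_def)
qed

section \<open>Entries of brackets with elementary matrices\<close>

context superdialgebra
begin

lemma mat_prod_elem_right:
  assumes bil: "even_bilinear_map R D D f" and X: "X \<in> carrier (MM m n)" and c: "c \<in> carrier D"
    and N: "a \<in> NN m n" "u \<in> NN m n" "v \<in> NN m n"
  shows "mat_prod m n f X (E m n a b c) (u, v) = (if v = b then f (X (u, a)) c else \<zero>\<^bsub>D\<^esub>)"
proof -
  interpret f: bilinear_map R D D f by unfold_locales (rule bil)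
  have "mat_prod m n f X (E m n a b c) (u, v) =
      (\<Oplus>\<^bsub>D\<^esub>w\<in>NN m n. if w = a then (if v = b then f (X (u, a)) c else \<zero>\<^bsub>D\<^esub>) else \<zero>\<^bsub>D\<^esub>)"
    unfolding mat_prod_entry[OF N(2,3)] using X c N mat_entry_closed[OF X]
    by (intro M.finsum_cong') auto
  then show ?thesis using N X c mat_entry_closed[OF X] by (simp add: M.finsum_single)
qed

lemma mat_prod_elem_left:
  assumes bil: "even_bilinear_map R D D f" and X: "X \<in> carrier (MM m n)" and c: "c \<in> carrier D"
    and N: "b \<in> NN m n" "u \<in> NN m n" "v \<in> NN m n"
  shows "mat_prod m n f (E m n a b c) X (u, v) = (if u = a then f c (X (b, v)) else \<zero>\<^bsub>D\<^esub>)"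
proof -
  interpret f: bilinear_map R D D f by unfold_locales (rule bil)
  have "mat_prod m n f (E m n a b c) X (u, v) =
      (\<Oplus>\<^bsub>D\<^esub>w\<in>NN m n. if w = b then (if u = a then f c (X (b, v)) else \<zero>\<^bsub>D\<^esub>) else \<zero>\<^bsub>D\<^esub>)"
    unfolding mat_prod_entry[OF N(2,3)] using X c N mat_entry_closed[OF X]
    by (intro M.finsum_cong') auto
  then show ?thesis using N X c mat_entry_closed[OF X] by (simp add: M.finsum_single)
qed

lemma mat_bracket_entry:
  assumes "X \<in> gr (MM m n) p" "Y \<in> gr (MM m n) q" "u \<in> NN m n" "v \<in> NN m n"
  shows "dialg_bracket R (MM m n) X Y (u, v) = mat_prod m n (\<stileturn>\<^bsub>D\<^esub>) X Y (u, v) \<ominus>\<^bsub>D\<^esub>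
    koszul R (p * q) \<odot>\<^bsub>D\<^esub> mat_prod m n (\<turnstile>\<^bsub>D\<^esub>) Y X (u, v)"
proof -
  interpret Mat: superdialgebra R "MM m n" by (rule superdialgebra_mat)
  have c: "mat_prod m n (\<stileturn>\<^bsub>D\<^esub>) X Y \<in> carrier (MM m n)" "mat_prod m n (\<turnstile>\<^bsub>D\<^esub>) Y X \<in> carrier (MM m n)"
    using assms mat_gr_carrier by (auto intro!: mat_prod_closed lp.bilinear rp.bilinear)
  show ?thesis
    unfolding Mat.dialg_bracket_homog[OF assms(1,2)] mat_sel(6,7)
    using c assms(3,4) by (simp add: mat_minus_entry)
qed

lemma elem_bracket_entry:
  assumes X: "X \<in> gr (MM m n) p" and c: "c \<in> gr D r"
    and N: "a \<in> NN m n" "b \<in> NN m n" "u \<in> NN m n" "v \<in> NN m n"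
  shows "dialg_bracket R (MM m n) X (E m n a b c) (u, v) =
    (if v = b then X (u, a) \<stileturn>\<^bsub>D\<^esub> c else \<zero>\<^bsub>D\<^esub>) \<ominus>\<^bsub>D\<^esub>
    koszul R (p * (r + d m a + d m b)) \<odot>\<^bsub>D\<^esub> (if u = a then c \<turnstile>\<^bsub>D\<^esub> X (b, v) else \<zero>\<^bsub>D\<^esub>)"
  unfolding mat_bracket_entry[OF X elem_gr[OF c N(1,2)] N(3,4)]
  using mat_prod_elem_right[OF lp.bilinear mat_gr_carrier[OF X] gr_carrier[OF c] N(1,3,4)]
    mat_prod_elem_left[OF rp.bilinear mat_gr_carrier[OF X] gr_carrier[OF c] N(2,3,4)] by simp

end

text \<open>The rows of the minor are i and k, its columns j and l. By \<open>mode\<close> either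
  \<kappa> is 2, where signs do not matter, or both rows have one parity and both columns the other,
  where all signs are expressed by the parity of i and the degrees of the arguments.\<close>

locale minor = unital_superdialgebra +
  fixes \<kappa> i k j l :: nat
  assumes idx: "{i, k, j, l} = {1..2 + 2}" and dist: "distinct [i, k, j, l]"
    and mode: "\<kappa> = 2 \<or> idx_deg 2 k = idx_deg 2 i \<and> idx_deg 2 j = idx_deg 2 i + 1 \<and> idx_deg 2 l = idx_deg 2 i + 1"
begin

abbreviation "A4 \<equiv> mat_superdialg 2 2 D"
abbreviation "L4 \<equiv> sl R 2 2 D"
abbreviation "dd \<equiv> idx_deg 2"
abbreviation "V4 \<equiv> dialg_quot R D \<kappa>"

interpretation V: supermodule R V4 by (rule supermodule_dialg_quot)
interpretation \<tau>: bilinear_map R D V4 "\<tau> \<kappa>"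
  by (intro bilinear_map.intro bilinear_map_axioms.intro supermodule_axioms V.supermodule_axioms tau_bilinear)
interpretation A: superdialgebra R A4 by (rule superdialgebra_mat)
interpretation L: leibniz_superalgebra R L4 by (rule leibniz_sl)

lemma idx_in [simp]: "i \<in> {1..2 + 2}" "k \<in> {1..2 + 2}" "j \<in> {1..2 + 2}" "l \<in> {1..2 + 2}"
  unfolding idx[symmetric] by simp_all

lemma idx_in4 [simp]: "i \<in> {1..4}" "k \<in> {1..4}" "j \<in> {1..4}" "l \<in> {1..4}"
  using idx_in by simp_all

lemma idx_neq [simp]: "i \<noteq> k" "i \<noteq> j" "i \<noteq> l" "k \<noteq> j" "k \<noteq> l" "j \<noteq> l"
    "k \<noteq> i" "j \<noteq> i" "l \<noteq> i" "j \<noteq> k" "l \<noteq> k" "l \<noteq> j"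
  using dist by auto

declare atLeastAtMost_iff [simp del]

text \<open>The parities of two even and two odd indices add up to zero, which makes every minor an
  even map.\<close>

lemma dd_sum: "dd l = dd i + dd k + dd j"
proof -
  have "(\<Sum>u\<in>{i, k, j, l}. dd u) = 0" unfolding idx by (rule idx_deg_sum)
  then have "dd i + (dd k + (dd j + dd l)) = 0" by (simp add: insert_absorb)
  then show ?thesis by (cases "dd i"; cases "dd k"; cases "dd j"; cases "dd l") simp_all
qed

text \<open>Exchanging rows or columns changes a minor only by its sign. With these symmetries four
  positions of the elementary matrix stand for all twelve.\<close>

lemma minor_swap_rows: "minor R D \<kappa> k i j l"
  by unfold_locales (use idx dist mode in auto)

lemma minor_swap_cols: "minor R D \<kappa> i k l j"
  by unfold_locales (use idx dist mode in auto)

definition "mnr X Y = ((\<tau> \<kappa> (X (i, j)) (Y (k, l)) \<ominus>\<^bsub>V4\<^esub> \<tau> \<kappa> (X (i, l)) (Y (k, j))) \<ominus>\<^bsub>V4\<^esub>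
   \<tau> \<kappa> (X (k, j)) (Y (i, l))) \<oplus>\<^bsub>V4\<^esub> \<tau> \<kappa> (X (k, l)) (Y (i, j))"

lemma entry [simp]: "X \<in> carrier A4 \<Longrightarrow> u \<in> {1..2 + 2} \<Longrightarrow> v \<in> {1..2 + 2} \<Longrightarrow> X (u, v) \<in> carrier D"
  by (rule mat_entry_closed)

lemma minor_bilinear_mat: "even_bilinear_map R A4 V4 mnr"
  unfolding even_bilinear_map_def
proof (intro conjI allI ballI)
  fix p q X Y assume XY: "X \<in> gr A4 p" "Y \<in> gr A4 q"
  have t: "\<tau> \<kappa> (X (a, b)) (Y (u, v)) \<in> gr V4 (p + q)"
    if N: "a \<in> {1..2 + 2}" "b \<in> {1..2 + 2}" "u \<in> {1..2 + 2}" "v \<in> {1..2 + 2}" and s: "dd a + dd b + dd u + dd v = 0" for a b u v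
  proof -
    have "(p + dd a + dd b) + (q + dd u + dd v) = p + q + (dd a + dd b + dd u + dd v)" by (simp add: ac_simps)
    then have "(p + dd a + dd b) + (q + dd u + dd v) = p + q" unfolding s by simp
    then show ?thesis using \<tau>.graded[OF mat_gr_entry[OF XY(1) N(1,2)] mat_gr_entry[OF XY(2) N(3,4)]] by metis
  qed
  have s: "dd i + dd j + dd k + dd l = 0" "dd i + dd l + dd k + dd j = 0"
    "dd k + dd j + dd i + dd l = 0" "dd k + dd l + dd i + dd j = 0"
    unfolding dd_sum by (cases "dd i"; cases "dd k"; cases "dd j"; simp)+
  show "mnr X Y \<in> gr V4 (p + q)"
    unfolding mnr_def by (intro V.gr_add V.gr_minus t s idx_in)
qed (simp_all add: mnr_def \<tau>.linear_simps V.smult_r_distr V.smult_diff V.M.diff_simps V.M.a_ac)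

interpretation mnr: bilinear_map R A4 V4 mnr
  by (intro bilinear_map.intro bilinear_map_axioms.intro A.supermodule_axioms V.supermodule_axioms minor_bilinear_mat)

definition "r4 \<equiv> \<rho> \<kappa>"

lemma r4_closed [simp]: "a \<in> carrier D \<Longrightarrow> b \<in> carrier D \<Longrightarrow> c \<in> carrier D \<Longrightarrow> r4 a b c \<in> carrier V4"
  unfolding r4_def by (rule rho_closed)

text \<open>In the first case equal terms cancel and signs drop out by rewriting; in the second all
  signs become functions of \<open>dd i\<close> and of degrees, so a finite case split settles
  them.\<close>

lemma mode_cases:
  obtains "\<forall>v\<in>carrier V4. \<ominus>\<^bsub>V4\<^esub> v = v \<and> v \<oplus>\<^bsub>V4\<^esub> v = \<zero>\<^bsub>V4\<^esub> \<and> (\<forall>w\<in>carrier V4. v \<oplus>\<^bsub>V4\<^esub> (v \<oplus>\<^bsub>V4\<^esub> w) = w) \<and>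
      (\<forall>p. koszul R p \<odot>\<^bsub>V4\<^esub> v = v)"
  | "dd k = dd i" "dd j = dd i + 1" "dd l = dd i + 1"
proof (cases "\<kappa> = 2")
  case True
  have "v \<oplus>\<^bsub>V4\<^esub> v = \<zero>\<^bsub>V4\<^esub>" if "v \<in> carrier V4" for v
    using V_two(1)[OF True that] V.M.r_neg[OF that] by simp
  then show thesis using V_two[OF True] that(1) by (simp add: V.M.a_assoc[symmetric])
qed (use mode that(2) in blast)

interpretation cl: even_linear_map R D V4 "cl \<kappa>"
  by (intro even_linear_map.intro even_linear_map_axioms.intro supermodule_axioms V.supermodule_axioms
      graded_submodule.coset_even_linear[OF graded_submodule_I, of \<kappa>, folded dialg_quot_def])

lemma finsum_idx:
  assumes "\<And>w. w \<in> {1..2 + 2} \<Longrightarrow> g w \<in> carrier D"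
  shows "(\<Oplus>\<^bsub>D\<^esub>w\<in>{1..2 + 2}. g w) = g i \<oplus>\<^bsub>D\<^esub> (g k \<oplus>\<^bsub>D\<^esub> (g j \<oplus>\<^bsub>D\<^esub> g l))"
  unfolding idx[symmetric] using assms by simp

lemma prod_entry:
  assumes "even_bilinear_map R D D f" "X \<in> carrier A4" "Y \<in> carrier A4" "u \<in> {1..2 + 2}" "v \<in> {1..2 + 2}"
  shows "mat_prod 2 2 f X Y (u, v) = f (X (u, i)) (Y (i, v)) \<oplus>\<^bsub>D\<^esub> (f (X (u, k)) (Y (k, v)) \<oplus>\<^bsub>D\<^esub>
    (f (X (u, j)) (Y (j, v)) \<oplus>\<^bsub>D\<^esub> f (X (u, l)) (Y (l, v))))"
proof -
  interpret f: bilinear_map R D D f by unfold_locales (rule assms)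
  show ?thesis unfolding mat_prod_entry[OF assms(4,5)] using assms(2-5) by (subst finsum_idx) simp_all
qed

lemma r4_linear:
  assumes "a \<in> carrier D" "b \<in> carrier D" "c \<in> carrier D"
  shows "a' \<in> carrier D \<Longrightarrow> r4 (a \<oplus>\<^bsub>D\<^esub> a') b c = r4 a b c \<oplus>\<^bsub>V4\<^esub> r4 a' b c"
    "a' \<in> carrier D \<Longrightarrow> r4 b (a \<oplus>\<^bsub>D\<^esub> a') c = r4 b a c \<oplus>\<^bsub>V4\<^esub> r4 b a' c"
    "a' \<in> carrier D \<Longrightarrow> r4 (a \<ominus>\<^bsub>D\<^esub> a') b c = r4 a b c \<ominus>\<^bsub>V4\<^esub> r4 a' b c"
    "a' \<in> carrier D \<Longrightarrow> r4 b (a \<ominus>\<^bsub>D\<^esub> a') c = r4 b a c \<ominus>\<^bsub>V4\<^esub> r4 b a' c"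
    "r \<in> carrier R \<Longrightarrow> r4 (r \<odot>\<^bsub>D\<^esub> a) b c = r \<odot>\<^bsub>V4\<^esub> r4 a b c"
    "r \<in> carrier R \<Longrightarrow> r4 b (r \<odot>\<^bsub>D\<^esub> a) c = r \<odot>\<^bsub>V4\<^esub> r4 b a c"
  using assms by (simp_all add: r4_def \<rho>_def lp.linear_simps cl.add cl.minus cl.smult)

text \<open>If rows and columns have opposite parities, this is the supertrace of a matrix of degree
  q up to an overall sign; for \<kappa> = 2 the signs do not matter modulo the ideal.\<close>

definition "trace q Y = (Y (i, i) \<oplus>\<^bsub>D\<^esub> Y (k, k)) \<ominus>\<^bsub>D\<^esub> koszul R q \<odot>\<^bsub>D\<^esub> (Y (j, j) \<oplus>\<^bsub>D\<^esub> Y (l, l))"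

text \<open>Modulo the ideal the diagonal entry at u of a bracket is a sum of contributions
  \<open>C u v\<close>, and \<open>C v u\<close> agrees with \<open>C u v\<close> up to sign; in the
  signed sum over u they cancel in pairs.\<close>

lemma trace_bracket:
  assumes X: "X \<in> gr A4 p" and Y: "Y \<in> gr A4 q"
  shows "trace (p + q) (dialg_bracket R A4 X Y) \<in> I_ideal R D \<kappa>"
proof -
  have c: "X \<in> carrier A4" "Y \<in> carrier A4" using X Y mat_gr_carrier by auto
  interpret b: bilinear_map R A4 A4 "dialg_bracket R A4"
    by (intro bilinear_map.intro bilinear_map_axioms.intro A.supermodule_axioms A.dialg_bracket_bilinear)
  have b: "dialg_bracket R A4 X Y \<in> carrier A4" using c by simp
  note cm = cl_comm[OF mat_gr_entry[OF X] mat_gr_entry[OF Y], of _ _ _ _ \<kappa>]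
  define e where "e u v = p * q + (p + dd u + dd v) * (q + dd u + dd v)" for u v
  define C where "C u v = cl \<kappa> (X (u, v) \<stileturn>\<^bsub>D\<^esub> Y (v, u)) \<ominus>\<^bsub>V4\<^esub>
    koszul R (e u v) \<odot>\<^bsub>V4\<^esub> cl \<kappa> (X (v, u) \<stileturn>\<^bsub>D\<^esub> Y (u, v))" for u v
  have Cc [simp]: "C u v \<in> carrier V4" if "u \<in> {1..2 + 2}" "v \<in> {1..2 + 2}" for u v
    using that c by (simp add: C_def)
  have C0: "C u u = \<zero>\<^bsub>V4\<^esub>" if "u \<in> {1..2 + 2}" for u
    using that c by (simp add: C_def e_def V.M.diff_self add.assoc)
  have Csym: "C v u = \<ominus>\<^bsub>V4\<^esub> (koszul R (e u v) \<odot>\<^bsub>V4\<^esub> C u v)"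
    if "u \<in> {1..2 + 2}" "v \<in> {1..2 + 2}" for u v
  proof -
    have "e v u = e u v" by (simp add: e_def ac_simps)
    then show ?thesis
      using that c by (simp add: C_def V.smult_diff V.koszul_koszul V.M.neg_diff_eq)
  qed
  have S: "cl \<kappa> (dialg_bracket R A4 X Y (u, u)) = C u i \<oplus>\<^bsub>V4\<^esub> (C u k \<oplus>\<^bsub>V4\<^esub> (C u j \<oplus>\<^bsub>V4\<^esub> C u l))"
    if u: "u \<in> {1..2 + 2}" for u
  proof -
    have "koszul R (p * q) \<odot>\<^bsub>V4\<^esub> cl \<kappa> (Y (u, v) \<turnstile>\<^bsub>D\<^esub> X (v, u)) =
        koszul R (e u v) \<odot>\<^bsub>V4\<^esub> cl \<kappa> (X (v, u) \<stileturn>\<^bsub>D\<^esub> Y (u, v))" if "v \<in> {1..2 + 2}" for v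
      using that u c cm[of v u u v] by (simp add: V.koszul_koszul e_def ac_simps)
    then show ?thesis
      using c u by (simp add: mat_bracket_entry[OF X Y] prod_entry[OF lp.bilinear] prod_entry[OF rp.bilinear]
        cl.add cl.minus cl.smult V.smult_r_distr C_def V.M.diff_simps V.M.a_ac)
  qed
  have "cl \<kappa> (trace (p + q) (dialg_bracket R A4 X Y)) = \<zero>\<^bsub>V4\<^esub>"
    using b
    by (simp add: trace_def cl.add cl.minus cl.smult S C0 Csym[of i] Csym[of j l] Csym[of k j] Csym[of k l])
      (cases rule: mode_cases, simp add: V.M.minus_eq V.M.a_ac, cases "dd i"; cases p; cases q;
        simp add: e_def V.smult_r_distr V.smult_r_minus V.smult_diff V.M.diff_simps V.M.a_ac)
  moreover have "trace (p + q) (dialg_bracket R A4 X Y) \<in> carrier D" using b by (simp add: trace_def)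
  ultimately show ?thesis by (simp add: cl_zero_iff)
qed

context
  fixes X Y c p q r
  assumes X: "X \<in> gr A4 p" and Y: "Y \<in> gr A4 q" and c: "c \<in> gr D r"
begin

lemma cc [simp]: "X \<in> carrier A4" "Y \<in> carrier A4" "c \<in> carrier D"
  using X Y c mat_gr_carrier gr_carrier by auto

lemmas tt = tau_triple[OF mat_gr_entry[OF X] mat_gr_entry[OF Y] c, of _ _ _ _ \<kappa>, folded r4_def]

text \<open>\<open>minor_AB_1\<close> to \<open>minor_AB_3\<close> expand the three terms of the
  cocycle identity against \<open>E 2 2 i j c\<close>, with i a row and j a column of the minor.
  Positions of this kind are the only ones where diagonal entries do not cancel by
  themselves.\<close>

lemma minor_AB_1:
  "mnr X (dialg_bracket R A4 Y (E 2 2 i j c)) = koszul R (r + q) \<odot>\<^bsub>V4\<^esub>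
    (((r4 (X (k, l)) (Y (i, i)) c \<ominus>\<^bsub>V4\<^esub> koszul R q \<odot>\<^bsub>V4\<^esub> r4 (X (k, l)) (Y (j, j)) c) \<ominus>\<^bsub>V4\<^esub>
      r4 (X (i, l)) (Y (k, i)) c) \<oplus>\<^bsub>V4\<^esub> koszul R q \<odot>\<^bsub>V4\<^esub> r4 (X (k, j)) (Y (j, l)) c)"
  unfolding mnr_def
  by (simp add: elem_bracket_entry[OF Y c] \<tau>.linear_simps M.diff_zero M.zero_diff tt)
    (cases rule: mode_cases; cases "dd i"; cases q; cases r;
      simp add: V.M.minus_eq V.smult_r_distr V.smult_r_minus V.M.minus_add V.M.a_ac)

lemma minor_AB_2:
  "mnr (dialg_bracket R A4 X Y) (E 2 2 i j c) = koszul R r \<odot>\<^bsub>V4\<^esub>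
    ((((r4 (X (k, i)) (Y (i, l)) c \<oplus>\<^bsub>V4\<^esub> r4 (X (k, k)) (Y (k, l)) c) \<oplus>\<^bsub>V4\<^esub>
      (r4 (X (k, j)) (Y (j, l)) c \<oplus>\<^bsub>V4\<^esub> r4 (X (k, l)) (Y (l, l)) c)) \<ominus>\<^bsub>V4\<^esub>
      koszul R q \<odot>\<^bsub>V4\<^esub> (r4 (X (i, l)) (Y (k, i)) c \<oplus>\<^bsub>V4\<^esub> r4 (X (k, l)) (Y (k, k)) c)) \<ominus>\<^bsub>V4\<^esub>
      koszul R p \<odot>\<^bsub>V4\<^esub> (r4 (X (j, l)) (Y (k, j)) c \<oplus>\<^bsub>V4\<^esub> r4 (X (l, l)) (Y (k, l)) c))"
  unfolding mnr_def
  by (simp add: mat_bracket_entry[OF X Y] prod_entry[OF lp.bilinear] prod_entry[OF rp.bilinear]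
      \<tau>.linear_simps V.M.diff_zero tt)
    (cases rule: mode_cases; cases "dd i"; cases p; cases q; cases r;
      simp add: V.M.minus_eq V.smult_r_distr V.smult_r_minus V.M.minus_add V.M.a_ac)

lemma minor_AB_3:
  "koszul R (q * (r + dd i + dd j)) \<odot>\<^bsub>V4\<^esub> mnr (dialg_bracket R A4 X (E 2 2 i j c)) Y = koszul R (r + 1) \<odot>\<^bsub>V4\<^esub>
    (((r4 (X (i, i)) (Y (k, l)) c \<ominus>\<^bsub>V4\<^esub> koszul R p \<odot>\<^bsub>V4\<^esub> r4 (X (j, j)) (Y (k, l)) c) \<ominus>\<^bsub>V4\<^esub>
      r4 (X (k, i)) (Y (i, l)) c) \<oplus>\<^bsub>V4\<^esub> koszul R p \<odot>\<^bsub>V4\<^esub> r4 (X (j, l)) (Y (k, j)) c)"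
  unfolding mnr_def
  by (simp add: elem_bracket_entry[OF X c] \<tau>.linear_simps M.diff_zero M.zero_diff tt)
    (cases rule: mode_cases; cases "dd i"; cases p; cases q; cases r;
      simp add: V.M.minus_eq V.smult_r_distr V.smult_r_minus V.M.minus_add V.M.a_ac)

lemma minor_AB:
  assumes "trace p X \<in> I_ideal R D \<kappa>" "trace q Y \<in> I_ideal R D \<kappa>"
  shows "mnr X (dialg_bracket R A4 Y (E 2 2 i j c)) = mnr (dialg_bracket R A4 X Y) (E 2 2 i j c) \<ominus>\<^bsub>V4\<^esub>
    koszul R (q * (r + dd i + dd j)) \<odot>\<^bsub>V4\<^esub> mnr (dialg_bracket R A4 X (E 2 2 i j c)) Y"
proof -
  \<comment> \<open>The traces lie in the ideal, so these triple products vanish. Solved for the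
    \<open>(i, i)\<close> entries they eliminate those entries, after which the three expansions
    match.\<close>
  have "r4 (X (k, l)) (trace q Y) c = \<zero>\<^bsub>V4\<^esub>" "r4 (trace p X) (Y (k, l)) c = \<zero>\<^bsub>V4\<^esub>"
    unfolding r4_def using assms by (intro rho_middle_zero rho_left_zero; simp)+
  then have t: "r4 (X (k, l)) (Y (i, i)) c = koszul R q \<odot>\<^bsub>V4\<^esub>
      (r4 (X (k, l)) (Y (j, j)) c \<oplus>\<^bsub>V4\<^esub> r4 (X (k, l)) (Y (l, l)) c) \<ominus>\<^bsub>V4\<^esub> r4 (X (k, l)) (Y (k, k)) c"
    "r4 (X (i, i)) (Y (k, l)) c = koszul R p \<odot>\<^bsub>V4\<^esub>
      (r4 (X (j, j)) (Y (k, l)) c \<oplus>\<^bsub>V4\<^esub> r4 (X (l, l)) (Y (k, l)) c) \<ominus>\<^bsub>V4\<^esub> r4 (X (k, k)) (Y (k, l)) c"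
    by (simp_all add: trace_def r4_linear V.M.diff_simps)
  show ?thesis
    unfolding minor_AB_1 minor_AB_2 minor_AB_3 t
    by (cases p; cases q; cases r) (simp_all add: V.smult_r_distr V.smult_diff V.M.diff_simps V.M.a_ac)
qed

text \<open>The position \<open>(i, k)\<close> lies outside the minor, so the term with the
  elementary matrix as an argument of \<open>mnr\<close> vanishes. The rest is the infinitesimal
  invariance of a 2 by 2 minor under row operations, for which no trace is involved.\<close>

lemma minor_AA:
  "mnr X (dialg_bracket R A4 Y (E 2 2 i k c)) = mnr (dialg_bracket R A4 X Y) (E 2 2 i k c) \<ominus>\<^bsub>V4\<^esub>
    koszul R (q * (r + dd i + dd k)) \<odot>\<^bsub>V4\<^esub> mnr (dialg_bracket R A4 X (E 2 2 i k c)) Y"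
  unfolding mnr_def
  by (simp add: elem_bracket_entry[OF Y c] elem_bracket_entry[OF X c] mat_bracket_entry[OF X Y]
      prod_entry[OF lp.bilinear] prod_entry[OF rp.bilinear] \<tau>.linear_simps M.diff_zero M.zero_diff tt)
    (cases rule: mode_cases; cases "dd i"; cases p; cases q; cases r;
      simp add: V.M.minus_eq V.smult_r_distr V.smult_r_minus V.M.minus_add V.M.a_ac)

lemma minor_BB:
  "mnr X (dialg_bracket R A4 Y (E 2 2 j l c)) = mnr (dialg_bracket R A4 X Y) (E 2 2 j l c) \<ominus>\<^bsub>V4\<^esub>
    koszul R (q * (r + dd j + dd l)) \<odot>\<^bsub>V4\<^esub> mnr (dialg_bracket R A4 X (E 2 2 j l c)) Y"
  unfolding mnr_def
  by (simp add: elem_bracket_entry[OF Y c] elem_bracket_entry[OF X c] mat_bracket_entry[OF X Y]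
      prod_entry[OF lp.bilinear] prod_entry[OF rp.bilinear] \<tau>.linear_simps M.diff_zero M.zero_diff tt)
    (cases rule: mode_cases; cases "dd i"; cases p; cases q; cases r;
      simp add: V.M.minus_eq V.smult_r_distr V.smult_r_minus V.M.minus_add V.M.a_ac)

text \<open>All three terms vanish: a bracket with \<open>E 2 2 j i c\<close> has entries only in
  row j and column i, and neither meets the minor.\<close>

lemma minor_BA:
  "mnr X (dialg_bracket R A4 Y (E 2 2 j i c)) = mnr (dialg_bracket R A4 X Y) (E 2 2 j i c) \<ominus>\<^bsub>V4\<^esub>
    koszul R (q * (r + dd j + dd i)) \<odot>\<^bsub>V4\<^esub> mnr (dialg_bracket R A4 X (E 2 2 j i c)) Y"
  unfolding mnr_def
  by (simp add: elem_bracket_entry[OF Y c] elem_bracket_entry[OF X c] mat_bracket_entry[OF X Y]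
      prod_entry[OF lp.bilinear] prod_entry[OF rp.bilinear] \<tau>.linear_simps M.diff_zero M.zero_diff
      V.M.diff_zero)

end

end

section \<open>The cocycle identity for minors on sl\<close>

context minor
begin

declare atLeastAtMost_iff [simp del]

interpretation V: supermodule R V4 by (rule supermodule_dialg_quot)
interpretation A: superdialgebra R A4 by (rule superdialgebra_mat)
interpretation mnr: bilinear_map R A4 V4 mnr
  by (intro bilinear_map.intro bilinear_map_axioms.intro A.supermodule_axioms V.supermodule_axioms minor_bilinear_mat)
interpretation \<tau>: bilinear_map R D V4 "\<tau> \<kappa>"
  by (intro bilinear_map.intro bilinear_map_axioms.intro supermodule_axioms V.supermodule_axioms tau_bilinear)

lemma gr_sl_mat: "X \<in> gr L4 p \<Longrightarrow> X \<in> gr A4 p"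
  by (simp add: sl_sel)

lemma gens_gr4: "g \<in> stl_gens 2 2 D p \<Longrightarrow> (case g of (i, j, a) \<Rightarrow> E 2 2 i j a) \<in> gr L4 p"
  by (rule gens_gr) simp_all

lemma ev_def4: "ev 2 2 t = lterm_eval L4 (\<lambda>(i, j, a). E 2 2 i j a) t"
  by (simp add: ev_def)

lemma ev_simps4:
  "ev 2 2 TZero = \<zero>\<^bsub>A4\<^esub>" "ev 2 2 (TAdd s t) = ev 2 2 s \<oplus>\<^bsub>A4\<^esub> ev 2 2 t"
  "ev 2 2 (TScale r t) = r \<odot>\<^bsub>A4\<^esub> ev 2 2 t" "ev 2 2 (TBr s t) = dialg_bracket R A4 (ev 2 2 s) (ev 2 2 t)"
  by (simp_all add: ev_def4 sl_sel)

lemma ev_gens_gr: "homog_term R (stl_gens 2 2 D) p t \<Longrightarrow> ev 2 2 t \<in> gr L4 p"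
  unfolding ev_def4 by (rule lterm_eval_homog[OF leibniz_sl gens_gr4])

lemma sl_generated: "carrier L4 \<subseteq> lterm_eval L4 (\<lambda>(i, j, a). E 2 2 i j a) ` lterms R (stl_gens 2 2 D)"
  using Sl_generated[of 2 2] by (simp add: sl_sel ev_def)

text \<open>Generators have zero diagonal and brackets are covered by \<open>trace_bracket\<close>,
  so induction over homogeneous terms suffices.\<close>

lemma trace_sl:
  assumes "Y \<in> gr L4 q"
  shows "trace q Y \<in> I_ideal R D \<kappa>"
proof -
  have "\<exists>t. homog_term R (stl_gens 2 2 D) q t \<and> Y = ev 2 2 t"
    unfolding ev_def4 by (rule homog_generated[OF leibniz_sl _ sl_generated assms]) (use gens_gr4 in blast)+
  then obtain t where t: "homog_term R (stl_gens 2 2 D) q t" "Y = ev 2 2 t" by blast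
  note IE = submoduleE[OF I_ideal_submodule[of \<kappa>]]
  have "trace q (ev 2 2 t) \<in> I_ideal R D \<kappa>"
    using t(1)
  proof induction
    case (1 g p)
    then obtain a b c where g: "g = (a, b, c)" "a \<noteq> b" by (auto simp: stl_gens_def)
    then have "trace p (ev 2 2 (Gen g)) = \<zero>\<^bsub>D\<^esub>" by (auto simp: trace_def ev_def M.minus_eq)
    then show ?case by (simp add: submodule_zero[OF I_ideal_submodule])
  next
    case (2 p)
    have "trace p (ev 2 2 TZero) = \<zero>\<^bsub>D\<^esub>" by (simp add: trace_def ev_def sl_sel M.minus_eq)
    then show ?case by (simp add: submodule_zero[OF I_ideal_submodule])
  next
    case (3 p s t)
    have c: "ev 2 2 s \<in> carrier A4" "ev 2 2 t \<in> carrier A4"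
      using ev_gens_gr[OF 3(1)] ev_gens_gr[OF 3(2)] gr_sl_mat mat_gr_carrier by blast+
    have "trace p (ev 2 2 (TAdd s t)) = trace p (ev 2 2 s) \<oplus>\<^bsub>D\<^esub> trace p (ev 2 2 t)"
      using c by (simp add: trace_def ev_simps4 smult_r_distr M.diff_simps M.a_ac)
    then show ?case using IE(5)[OF 3(3,4)] by simp
  next
    case (4 r p t)
    have c: "ev 2 2 t \<in> carrier A4" using ev_gens_gr[OF 4(2)] gr_sl_mat mat_gr_carrier by blast
    have "trace p (ev 2 2 (TScale r t)) = r \<odot>\<^bsub>D\<^esub> trace p (ev 2 2 t)"
      using c 4(1) by (simp add: trace_def ev_simps4 smult_r_distr smult_diff smult_koszul_commute)
    then show ?case using IE(4)[OF 4(1,3)] by simp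
  next
    case (5 p s q t)
    show ?case
      using trace_bracket[OF gr_sl_mat[OF ev_gens_gr[OF 5(1)]] gr_sl_mat[OF ev_gens_gr[OF 5(2)]]]
      by (simp add: ev_simps4)
  qed
  then show ?thesis using t(2) by simp
qed

text \<open>The map f is a parameter so that the identity can be transferred between a minor and the
  minors with rows or columns exchanged.\<close>

definition "elem_id f a b \<longleftrightarrow> (\<forall>p q r X Y c. X \<in> gr L4 p \<longrightarrow> Y \<in> gr L4 q \<longrightarrow> c \<in> gr D r \<longrightarrow>
  f X (dialg_bracket R A4 Y (E 2 2 a b c)) = f (dialg_bracket R A4 X Y) (E 2 2 a b c) \<ominus>\<^bsub>V4\<^esub>
    koszul R (q * (r + dd a + dd b)) \<odot>\<^bsub>V4\<^esub> f (dialg_bracket R A4 X (E 2 2 a b c)) Y)"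

lemma elem_id_neg:
  assumes g: "elem_id g a b" and eq: "\<And>X Y. X \<in> carrier A4 \<Longrightarrow> Y \<in> carrier A4 \<Longrightarrow> g X Y = \<ominus>\<^bsub>V4\<^esub> f X Y"
    and f: "\<And>X Y. X \<in> carrier A4 \<Longrightarrow> Y \<in> carrier A4 \<Longrightarrow> f X Y \<in> carrier V4"
  shows "elem_id f a b"
  unfolding elem_id_def
proof (intro allI impI)
  fix p q r X Y c assume h: "X \<in> gr L4 p" "Y \<in> gr L4 q" "c \<in> gr D r"
  interpret b: bilinear_map R A4 A4 "dialg_bracket R A4"
    by (intro bilinear_map.intro bilinear_map_axioms.intro A.supermodule_axioms A.dialg_bracket_bilinear)
  have c: "X \<in> carrier A4" "Y \<in> carrier A4" "E 2 2 a b c \<in> carrier A4"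
    using mat_gr_carrier[OF gr_sl_mat[OF h(1)]] mat_gr_carrier[OF gr_sl_mat[OF h(2)]] gr_carrier[OF h(3)]
    by simp_all
  have "f X (dialg_bracket R A4 Y (E 2 2 a b c)) = \<ominus>\<^bsub>V4\<^esub> g X (dialg_bracket R A4 Y (E 2 2 a b c))"
    using c by (simp add: eq f)
  also have "g X (dialg_bracket R A4 Y (E 2 2 a b c)) = g (dialg_bracket R A4 X Y) (E 2 2 a b c) \<ominus>\<^bsub>V4\<^esub>
    koszul R (q * (r + dd a + dd b)) \<odot>\<^bsub>V4\<^esub> g (dialg_bracket R A4 X (E 2 2 a b c)) Y"
    using g h unfolding elem_id_def by blast
  finally show "f X (dialg_bracket R A4 Y (E 2 2 a b c)) = f (dialg_bracket R A4 X Y) (E 2 2 a b c) \<ominus>\<^bsub>V4\<^esub>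
    koszul R (q * (r + dd a + dd b)) \<odot>\<^bsub>V4\<^esub> f (dialg_bracket R A4 X (E 2 2 a b c)) Y"
    using c by (simp add: eq f V.smult_r_minus V.M.minus_eq V.M.minus_add)
qed

lemma elem_id_AB: "elem_id mnr i j"
  unfolding elem_id_def using minor_AB gr_sl_mat trace_sl by blast

lemma elem_id_AA: "elem_id mnr i k"
  unfolding elem_id_def using minor_AA gr_sl_mat by blast

lemma elem_id_BB: "elem_id mnr j l"
  unfolding elem_id_def using minor_BB gr_sl_mat by blast

lemma elem_id_BA: "elem_id mnr j i"
  unfolding elem_id_def using minor_BA gr_sl_mat by blast

lemma mnr_closed: "X \<in> carrier A4 \<Longrightarrow> Y \<in> carrier A4 \<Longrightarrow> mnr X Y \<in> carrier V4"
  by simp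

lemma mnr_swap_cols:
  "X \<in> carrier A4 \<Longrightarrow> Y \<in> carrier A4 \<Longrightarrow> minor.mnr R D \<kappa> i k l j X Y = \<ominus>\<^bsub>V4\<^esub> mnr X Y"
  unfolding minor.mnr_def[OF minor_swap_cols] mnr_def
  by (simp add: V.M.minus_eq V.M.minus_add V.M.a_ac)

lemma mnr_swap_rows:
  "X \<in> carrier A4 \<Longrightarrow> Y \<in> carrier A4 \<Longrightarrow> minor.mnr R D \<kappa> k i j l X Y = \<ominus>\<^bsub>V4\<^esub> mnr X Y"
  unfolding minor.mnr_def[OF minor_swap_rows] mnr_def
  by (simp add: V.M.minus_eq V.M.minus_add V.M.a_ac)

lemma elem_id_cols: "elem_id mnr i l" "elem_id mnr l i" "elem_id mnr l j"
proof -
  interpret s: minor R D \<kappa> i k l j by (rule minor_swap_cols)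
  note e = elem_id_neg[OF _ mnr_swap_cols mnr_closed]
  show "elem_id mnr i l" "elem_id mnr l i" "elem_id mnr l j"
    by (rule e[OF s.elem_id_AB] e[OF s.elem_id_BA] e[OF s.elem_id_BB]; assumption)+
qed

lemma elem_id_rows: "elem_id mnr k j" "elem_id mnr k l" "elem_id mnr j k" "elem_id mnr l k" "elem_id mnr k i"
proof -
  interpret s: minor R D \<kappa> k i j l by (rule minor_swap_rows)
  note e = elem_id_neg[OF _ mnr_swap_rows mnr_closed]
  show "elem_id mnr k j" "elem_id mnr k l" "elem_id mnr j k" "elem_id mnr l k" "elem_id mnr k i"
    by (rule e[OF s.elem_id_AB] e[OF s.elem_id_cols(1)] e[OF s.elem_id_BA] e[OF s.elem_id_cols(2)]
        e[OF s.elem_id_AA]; assumption)+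
qed

theorem minor_cocycle: "leibniz_cocycle R L4 V4 mnr"
proof (rule cocycle_generated[OF leibniz_sl V.supermodule_axioms _ _ sl_generated])
  show "even_bilinear_map R L4 V4 mnr"
    using minor_bilinear_mat sl_carrier_mat[of _ 2 2] gr_sl_mat
    unfolding even_bilinear_map_def by (simp add: sl_sel)
next
  fix p g assume "g \<in> stl_gens 2 2 D p"
  then show "(case g of (i, j, a) \<Rightarrow> E 2 2 i j a) \<in> gr L4 p" by (rule gens_gr4)
next
  fix p q r g X Y assume g: "g \<in> stl_gens 2 2 D r" and XY: "X \<in> gr L4 p" "Y \<in> gr L4 q"
  obtain a b c where abc: "g = (a, b, c)" "a \<in> {1..2 + 2}" "b \<in> {1..2 + 2}" "a \<noteq> b" "c \<in> gr D (r + dd a + dd b)"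
    using g by (auto simp: stl_gens_def)
  \<comment> \<open>A generator of degree r at \<open>(a, b)\<close> has an entry of degree r + |a|
    + |b|; \<open>elem_id\<close> adds the two parities once more.\<close>
  have "r + dd a + dd b + dd a + dd b = r" by (cases "dd a"; cases "dd b") simp_all
  moreover have "elem_id mnr a b"
    using abc(2-4) unfolding idx[symmetric]
    by (elim insertE emptyE) (auto simp: elem_id_AA elem_id_AB elem_id_BB elem_id_BA elem_id_cols elem_id_rows)
  ultimately have "mnr X (dialg_bracket R A4 Y (E 2 2 a b c)) = mnr (dialg_bracket R A4 X Y) (E 2 2 a b c) \<ominus>\<^bsub>V4\<^esub>
    koszul R (q * r) \<odot>\<^bsub>V4\<^esub> mnr (dialg_bracket R A4 X (E 2 2 a b c)) Y"
    using XY abc(5) unfolding elem_id_def by metis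
  then show "mnr X (bracket L4 Y (case g of (i, j, a) \<Rightarrow> E 2 2 i j a)) =
    mnr (bracket L4 X Y) (case g of (i, j, a) \<Rightarrow> E 2 2 i j a) \<ominus>\<^bsub>V4\<^esub>
    koszul R (q * r) \<odot>\<^bsub>V4\<^esub> mnr (bracket L4 X (case g of (i, j, a) \<Rightarrow> E 2 2 i j a)) Y"
    by (simp add: abc(1) sl_sel)
qed

end

section \<open>Cocycles on the special linear superalgebra\<close>

locale sl_cocycle = unital_superdialgebra +
  fixes M :: "('a, 'm) leibniz" and B :: "(nat \<times> nat \<Rightarrow> 'c) \<Rightarrow> (nat \<times> nat \<Rightarrow> 'c) \<Rightarrow> 'm"
  assumes supermodule_M: "supermodule R M" and cocycle_B: "leibniz_cocycle R (sl R 2 2 D) M B"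
begin

abbreviation "SL4 \<equiv> sl R 2 2 D"
abbreviation "dg4 \<equiv> idx_deg 2"
abbreviation "E4 \<equiv> elem_mat 2 2 D"

sublocale B: cocycle R SL4 M B
  by (intro cocycle.intro cocycle_axioms.intro leibniz_sl supermodule_M cocycle_B)

interpretation A: superdialgebra R "mat_superdialg 2 2 D" by (rule superdialgebra_mat)

declare atLeastAtMost_iff [simp del]

lemma E4_closed [simp]: "\<lbrakk>a \<in> carrier D; i \<in> {1..4}; j \<in> {1..4}; i \<noteq> j\<rbrakk> \<Longrightarrow> E4 i j a \<in> carrier SL4"
  using elem_carrier_sl[of 2 2] by simp

lemma E4_gr: "\<lbrakk>a \<in> gr D p; i \<in> {1..4}; j \<in> {1..4}; i \<noteq> j\<rbrakk> \<Longrightarrow> E4 i j a \<in> gr SL4 (p + dg4 i + dg4 j)"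
  using elem_gr_sl[of 2 2] by simp

lemma E4_linear:
  "a \<in> carrier D \<Longrightarrow> b \<in> carrier D \<Longrightarrow> E4 i j (a \<oplus>\<^bsub>D\<^esub> b) = E4 i j a \<oplus>\<^bsub>SL4\<^esub> E4 i j b"
  "a \<in> carrier D \<Longrightarrow> r \<in> carrier R \<Longrightarrow> E4 i j (r \<odot>\<^bsub>D\<^esub> a) = r \<odot>\<^bsub>SL4\<^esub> E4 i j a"
  by (simp_all add: sl_sel elem_linear)

text \<open>The minus sign of the reversed product is recorded as an additional \<open>+ 1\<close>
  in the exponent, so that signs compose by \<open>koszul_koszul\<close>.\<close>

lemma E4_br:
  assumes ab: "a \<in> gr D p" "b \<in> gr D q"
    and N: "i \<in> {1..4}" "j \<in> {1..4}" "k \<in> {1..4}" "l \<in> {1..4}"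
  shows "j = k \<Longrightarrow> i \<noteq> l \<Longrightarrow> bracket SL4 (E4 i j a) (E4 k l b) = E4 i l (a \<stileturn>\<^bsub>D\<^esub> b)"
    and "j \<noteq> k \<Longrightarrow> i = l \<Longrightarrow> k \<noteq> j \<Longrightarrow> bracket SL4 (E4 i j a) (E4 k l b) =
      koszul R ((p + dg4 i + dg4 j) * (q + dg4 k + dg4 l) + 1) \<odot>\<^bsub>SL4\<^esub> E4 k j (b \<turnstile>\<^bsub>D\<^esub> a)"
    and "j \<noteq> k \<Longrightarrow> i \<noteq> l \<Longrightarrow> bracket SL4 (E4 i j a) (E4 k l b) = \<zero>\<^bsub>SL4\<^esub>"
proof -
  have c: "a \<in> carrier D" "b \<in> carrier D" using ab gr_carrier by auto
  note b = elem_bracket[OF ab, of i 2 2 j k l]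
  show "bracket SL4 (E4 i j a) (E4 k l b) = E4 i l (a \<stileturn>\<^bsub>D\<^esub> b)" if "j = k" "i \<noteq> l"
    using b N c that by (simp add: sl_sel A.M.diff_zero)
  show "bracket SL4 (E4 i j a) (E4 k l b) = \<zero>\<^bsub>SL4\<^esub>" if "j \<noteq> k" "i \<noteq> l"
    using b N c that by (simp add: sl_sel A.M.diff_zero)
  show "bracket SL4 (E4 i j a) (E4 k l b) =
      koszul R ((p + dg4 i + dg4 j) * (q + dg4 k + dg4 l) + 1) \<odot>\<^bsub>SL4\<^esub> E4 k j (b \<turnstile>\<^bsub>D\<^esub> a)"
    if "j \<noteq> k" "i = l" "k \<noteq> j"
    using b N c that A.koszul_koszul[of "E4 k j (b \<turnstile>\<^bsub>D\<^esub> a)" 1]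
    by (simp add: sl_sel A.M.zero_diff add.commute)
qed

lemma B_koszul: "x \<in> carrier SL4 \<Longrightarrow> y \<in> carrier SL4 \<Longrightarrow> B (koszul R p \<odot>\<^bsub>SL4\<^esub> x) y = koszul R p \<odot>\<^bsub>M\<^esub> B x y"
  by (simp add: B.smult_l)

context
  fixes i j k l :: nat
  assumes N [simp]: "i \<in> {1..4}" "j \<in> {1..4}" "k \<in> {1..4}" "l \<in> {1..4}" and ds: "distinct [i, j, k, l]"
begin

lemma neq: "i \<noteq> j" "i \<noteq> k" "i \<noteq> l" "j \<noteq> k" "j \<noteq> l" "k \<noteq> l"
    "j \<noteq> i" "k \<noteq> i" "l \<noteq> i" "k \<noteq> j" "l \<noteq> j" "l \<noteq> k"
  using ds by auto

context
  notes neq [simp]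
begin

text \<open>Write \<open>E4 k l b\<close> as the bracket of \<open>E4 k j b\<close> and
  \<open>E4 j l 1\<close>. The first factor has bracket zero with \<open>E4 i j a\<close>, the
  second turns it into \<open>E4 i l a\<close>.\<close>

lemma swap_cols:
  assumes a: "a \<in> gr D p" and b: "b \<in> gr D q"
  shows "B (E4 i j a) (E4 k l b) = koszul R ((q + dg4 k + dg4 j) * (dg4 j + dg4 l) + 1) \<odot>\<^bsub>M\<^esub> B (E4 i l a) (E4 k j b)"
proof -
  have c [simp]: "a \<in> carrier D" "b \<in> carrier D" using a b gr_carrier by auto
  note o = bar_unit_even
  have "B (E4 i j a) (E4 k l b) = B (E4 i j a) (bracket SL4 (E4 k j b) (E4 j l \<one>\<^bsub>D\<^esub>))"
    by (simp add: E4_br(1)[OF b o] lprod_bar_unit)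
  also have "\<dots> = \<ominus>\<^bsub>M\<^esub> (koszul R ((q + dg4 k + dg4 j) * (dg4 j + dg4 l)) \<odot>\<^bsub>M\<^esub> B (E4 i l a) (E4 k j b))"
    using B.identity[OF _ E4_gr[OF b, of k j] E4_gr[OF o, of j l], of "E4 i j a"]
    by (simp add: E4_br(3)[OF a b] E4_br(1)[OF a o] lprod_bar_unit B.V.M.zero_diff)
  also have "\<dots> = koszul R ((q + dg4 k + dg4 j) * (dg4 j + dg4 l) + 1) \<odot>\<^bsub>M\<^esub> B (E4 i l a) (E4 k j b)"
    using B.V.koszul_koszul[of "B (E4 i l a) (E4 k j b)" 1] by (simp add: add.commute)
  finally show ?thesis .
qed

text \<open>Apply the identity to \<open>E4 i k a\<close>, \<open>E4 k j b\<close>,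
  \<open>E4 k l c\<close>: the last two have bracket zero, and bracketing the first with each of
  them gives the two sides.\<close>

lemma swap_middle:
  assumes a: "a \<in> gr D p" and b: "b \<in> gr D q" and c: "c \<in> gr D r"
  shows "B (E4 i j (a \<stileturn>\<^bsub>D\<^esub> b)) (E4 k l c) =
    koszul R ((q + dg4 k + dg4 j) * (r + dg4 k + dg4 l)) \<odot>\<^bsub>M\<^esub> B (E4 i l (a \<stileturn>\<^bsub>D\<^esub> c)) (E4 k j b)"
proof -
  have cc [simp]: "a \<in> carrier D" "b \<in> carrier D" "c \<in> carrier D" using a b c gr_carrier by auto
  show ?thesis
    using B.identity[OF _ E4_gr[OF b, of k j] E4_gr[OF c, of k l], of "E4 i k a"]
    by (simp add: E4_br(3)[OF b c] E4_br(1)[OF a b] E4_br(1)[OF a c] B.V.M.diff_simps)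
qed

text \<open>Here \<open>E4 k l b\<close> is factored through i. The factor \<open>E4 i l 1\<close>
  has bracket zero with \<open>E4 i j a\<close>, and the bracket of \<open>E4 i j a\<close> with
  \<open>E4 k i b\<close> is a reversed product, which is where \<open>\<turnstile>\<close>
  enters.\<close>

lemma swap_rows:
  assumes a: "a \<in> gr D p" and b: "b \<in> gr D q"
  shows "B (E4 i j a) (E4 k l b) = koszul R ((p + dg4 i + dg4 j) * (q + dg4 k + dg4 i) + 1) \<odot>\<^bsub>M\<^esub>
    B (E4 k j (b \<turnstile>\<^bsub>D\<^esub> a)) (E4 i l \<one>\<^bsub>D\<^esub>)"
proof -
  have c [simp]: "a \<in> carrier D" "b \<in> carrier D" using a b gr_carrier by auto
  note o = bar_unit_even
  have "B (E4 i j a) (E4 k l b) = B (E4 i j a) (bracket SL4 (E4 k i b) (E4 i l \<one>\<^bsub>D\<^esub>))"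
    by (simp add: E4_br(1)[OF b o] lprod_bar_unit)
  also have "\<dots> = koszul R ((p + dg4 i + dg4 j) * (q + dg4 k + dg4 i) + 1) \<odot>\<^bsub>M\<^esub>
    B (E4 k j (b \<turnstile>\<^bsub>D\<^esub> a)) (E4 i l \<one>\<^bsub>D\<^esub>)"
    using B.identity[OF _ E4_gr[OF b, of k i] E4_gr[OF o, of i l], of "E4 i j a"]
    by (simp add: E4_br(2)[OF a b] E4_br(3)[OF a o] B_koszul B.V.M.diff_zero)
  finally show ?thesis .
qed

text \<open>The second matrix is factored through an index that makes both factors commute with
  \<open>E4 i j a\<close>.\<close>

lemma B_zero:
  assumes a: "a \<in> gr D p" and b: "b \<in> gr D q"
  shows "B (E4 i j a) (E4 i l b) = \<zero>\<^bsub>M\<^esub>" "B (E4 i j a) (E4 k j b) = \<zero>\<^bsub>M\<^esub>" "B (E4 i j a) (E4 i j b) = \<zero>\<^bsub>M\<^esub>"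
proof -
  have c [simp]: "a \<in> carrier D" "b \<in> carrier D" using a b gr_carrier by auto
  note o = bar_unit_even
  have "B (E4 i j a) (E4 i l b) = B (E4 i j a) (bracket SL4 (E4 i k b) (E4 k l \<one>\<^bsub>D\<^esub>))"
    by (simp add: E4_br(1)[OF b o] lprod_bar_unit)
  also have "\<dots> = \<zero>\<^bsub>M\<^esub>"
    using B.identity[OF _ E4_gr[OF b, of i k] E4_gr[OF o, of k l], of "E4 i j a"]
    by (simp add: E4_br(3)[OF a b] E4_br(3)[OF a o] B.V.M.diff_zero)
  finally show "B (E4 i j a) (E4 i l b) = \<zero>\<^bsub>M\<^esub>" .
  have "B (E4 i j a) (E4 k j b) = B (E4 i j a) (bracket SL4 (E4 k l b) (E4 l j \<one>\<^bsub>D\<^esub>))"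
    by (simp add: E4_br(1)[OF b o] lprod_bar_unit)
  also have "\<dots> = \<zero>\<^bsub>M\<^esub>"
    using B.identity[OF _ E4_gr[OF b, of k l] E4_gr[OF o, of l j], of "E4 i j a"]
    by (simp add: E4_br(3)[OF a b] E4_br(3)[OF a o] B.V.M.diff_zero)
  finally show "B (E4 i j a) (E4 k j b) = \<zero>\<^bsub>M\<^esub>" .
  have "B (E4 i j a) (E4 i j b) = B (E4 i j a) (bracket SL4 (E4 i k b) (E4 k j \<one>\<^bsub>D\<^esub>))"
    by (simp add: E4_br(1)[OF b o] lprod_bar_unit)
  also have "\<dots> = \<zero>\<^bsub>M\<^esub>"
    using B.identity[OF _ E4_gr[OF b, of i k] E4_gr[OF o, of k j], of "E4 i j a"]
    by (simp add: E4_br(3)[OF a b] E4_br(3)[OF a o] B.V.M.diff_zero)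
  finally show "B (E4 i j a) (E4 i j b) = \<zero>\<^bsub>M\<^esub>" .
qed

text \<open>Factoring \<open>E4 j l b\<close> through k shows that the value does not depend on the
  intermediate index, which makes \<open>Ft\<close> well defined.\<close>

lemma B_left:
  assumes a: "a \<in> gr D p" and b: "b \<in> gr D q"
  shows "B (E4 i j a) (E4 j l b) = B (E4 i k (a \<stileturn>\<^bsub>D\<^esub> b)) (E4 k l \<one>\<^bsub>D\<^esub>)"
proof -
  have c [simp]: "a \<in> carrier D" "b \<in> carrier D" using a b gr_carrier by auto
  note o = bar_unit_even
  have "B (E4 i j a) (E4 j l b) = B (E4 i j a) (bracket SL4 (E4 j k b) (E4 k l \<one>\<^bsub>D\<^esub>))"
    by (simp add: E4_br(1)[OF b o] lprod_bar_unit)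
  also have "\<dots> = B (E4 i k (a \<stileturn>\<^bsub>D\<^esub> b)) (E4 k l \<one>\<^bsub>D\<^esub>)"
    using B.identity[OF _ E4_gr[OF b, of j k] E4_gr[OF o, of k l], of "E4 i j a"]
    by (simp add: E4_br(1)[OF a b] E4_br(3)[OF a o] B.V.M.diff_zero)
  finally show ?thesis .
qed

text \<open>Apply the identity to \<open>E4 i l a\<close>, \<open>E4 k i b\<close>,
  \<open>E4 l j 1\<close>: the last two have bracket zero, and the first and third have bracket
  \<open>E4 i j a\<close>.\<close>

lemma B_right:
  assumes a: "a \<in> gr D p" and b: "b \<in> gr D q"
  shows "B (E4 i j a) (E4 k i b) = koszul R ((p + dg4 i + dg4 j) * (q + dg4 k + dg4 i) + 1) \<odot>\<^bsub>M\<^esub>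
    B (E4 k l (b \<turnstile>\<^bsub>D\<^esub> a)) (E4 l j \<one>\<^bsub>D\<^esub>)"
proof -
  have c [simp]: "a \<in> carrier D" "b \<in> carrier D" using a b gr_carrier by auto
  note o = bar_unit_even
  let ?x = "B (E4 i j a) (E4 k i b)" and ?y = "B (E4 k l (b \<turnstile>\<^bsub>D\<^esub> a)) (E4 l j \<one>\<^bsub>D\<^esub>)"
  let ?s = "(q + dg4 k + dg4 i) * (dg4 l + dg4 j)" and ?t = "(p + dg4 i + dg4 l) * (q + dg4 k + dg4 i) + 1"
  have "koszul R ?s \<odot>\<^bsub>M\<^esub> ?x = koszul R ?t \<odot>\<^bsub>M\<^esub> ?y"
    using B.identity[OF _ E4_gr[OF b, of k i] E4_gr[OF o, of l j], of "E4 i l a"]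
    by (simp add: E4_br(2)[OF a b] E4_br(1)[OF a o] E4_br(3)[OF b o] lprod_bar_unit B_koszul B.V.M.diff_simps)
  \<comment> \<open>Signs are involutions, so multiplying by the sign of \<open>?x\<close> isolates
    it.\<close>
  then have "koszul R ?s \<odot>\<^bsub>M\<^esub> (koszul R ?s \<odot>\<^bsub>M\<^esub> ?x) = koszul R (?s + ?t) \<odot>\<^bsub>M\<^esub> ?y"
    by (simp add: B.V.koszul_koszul)
  moreover have "?s + ?t = (p + dg4 i + dg4 j) * (q + dg4 k + dg4 i) + 1"
    by (cases p; cases q; cases "dg4 i"; cases "dg4 j"; cases "dg4 k"; cases "dg4 l") simp_all
  ultimately show ?thesis by (simp add: B.V.koszul_koszul)
qed

end

end

section \<open>Canonical lifts of the elementary matrices\<close>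

lemma fourth_index:
  obtains k :: nat where "k \<in> {1..4}" "k \<notin> {a, b, c}"
proof -
  have "\<not> {1..4} \<subseteq> {a, b, c}"
  proof
    assume "{1..4} \<subseteq> {a, b, c}"
    then have "card {1..4::nat} \<le> card {a, b, c}" by (intro card_mono) auto
    also have "\<dots> \<le> 3" by (simp add: card_insert_if)
    finally show False by simp
  qed
  then show thesis using that by blast
qed

text \<open>When B is the lifted bracket of a central extension, this is the canonical lift of
  \<open>E4 i l a\<close>, since a bracket does not depend on the lifts of its factors. By
  \<open>Ft_eq\<close> the choice of j is immaterial.\<close>

definition "Ft i l a = (let j = (SOME j. j \<in> {1..4} \<and> j \<noteq> i \<and> j \<noteq> l) in B (E4 i j a) (E4 j l \<one>\<^bsub>D\<^esub>))"

lemma Ft_eq: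
  assumes a: "a \<in> gr D p" and N: "i \<in> {1..4}" "k \<in> {1..4}" "l \<in> {1..4}" "distinct [i, k, l]"
  shows "Ft i l a = B (E4 i k a) (E4 k l \<one>\<^bsub>D\<^esub>)"
proof -
  define j where "j = (SOME j. j \<in> {1..4} \<and> j \<noteq> i \<and> j \<noteq> l)"
  have "\<exists>j. j \<in> {1..4} \<and> j \<noteq> i \<and> j \<noteq> l" using N(2,4) by (intro exI[of _ k]) simp
  then have "j \<in> {1..4} \<and> j \<noteq> i \<and> j \<noteq> l" unfolding j_def by (rule someI_ex)
  then have j: "j \<in> {1..4}" "j \<noteq> i" "j \<noteq> l" by blast+
  have e: "Ft i l a = B (E4 i j a) (E4 j l \<one>\<^bsub>D\<^esub>)" by (simp only: Ft_def Let_def j_def)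
  show ?thesis
  proof (cases "j = k")
    case True
    then show ?thesis by (simp only: e)
  next
    case False
    have "B (E4 i j a) (E4 j l \<one>\<^bsub>D\<^esub>) = B (E4 i k (a \<stileturn>\<^bsub>D\<^esub> \<one>\<^bsub>D\<^esub>)) (E4 k l \<one>\<^bsub>D\<^esub>)"
      by (rule B_left[OF N(1) j(1) N(2,3) _ a bar_unit_even]) (use N(4) j False in simp)
    then show ?thesis by (simp only: e lprod_bar_unit[OF gr_carrier[OF a]])
  qed
qed

lemma Ft_left:
  assumes a: "a \<in> gr D p" and b: "b \<in> gr D q" and N: "i \<in> {1..4}" "j \<in> {1..4}" "l \<in> {1..4}" "distinct [i, j, l]"
  shows "B (E4 i j a) (E4 j l b) = Ft i l (a \<stileturn>\<^bsub>D\<^esub> b)"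
proof -
  obtain k where k: "k \<in> {1..4}" "k \<notin> {i, j, l}" by (rule fourth_index)
  have kd: "distinct [i, k, l]" "distinct [i, j, k, l]" using k(2) N(4) by auto
  show ?thesis
    unfolding Ft_eq[OF lp.graded[OF a b] N(1) k(1) N(3) kd(1)]
    by (rule B_left[OF N(1,2) k(1) N(3) kd(2) a b])
qed

lemma Ft_right:
  assumes a: "a \<in> gr D p" and b: "b \<in> gr D q" and N: "i \<in> {1..4}" "j \<in> {1..4}" "k \<in> {1..4}" "distinct [i, j, k]"
  shows "B (E4 i j a) (E4 k i b) =
    koszul R ((p + dg4 i + dg4 j) * (q + dg4 k + dg4 i) + 1) \<odot>\<^bsub>M\<^esub> Ft k j (b \<turnstile>\<^bsub>D\<^esub> a)"
proof -
  obtain l where l: "l \<in> {1..4}" "l \<notin> {i, j, k}" by (rule fourth_index)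
  have ld: "distinct [k, l, j]" "distinct [i, j, k, l]" using l(2) N(4) by auto
  show ?thesis
    unfolding Ft_eq[OF rp.graded[OF b a] N(3) l(1) N(2) ld(1)]
    by (rule B_right[OF N(1,2,3) l(1) ld(2) a b])
qed

text \<open>These are the zero relations of the Steinberg superalgebra that leave an index free for
  factoring. For four distinct indices none is left, and the minors take over.\<close>

lemma Ft_zero:
  assumes a: "a \<in> gr D p" and b: "b \<in> gr D q"
    and N: "i \<in> {1..4}" "j \<in> {1..4}" "k \<in> {1..4}" "l \<in> {1..4}" "i \<noteq> j" "k \<noteq> l" "i \<noteq> l" "j \<noteq> k" "i = k \<or> j = l"
  shows "B (E4 i j a) (E4 k l b) = \<zero>\<^bsub>M\<^esub>"
proof -
  consider "i = k" "j = l" | "i = k" "j \<noteq> l" | "i \<noteq> k" "j = l" using N by blast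
  then show ?thesis
  proof cases
    case 1
    obtain u where u: "u \<in> {1..4}" "u \<notin> {i, j, j}" by (rule fourth_index)
    obtain v where v: "v \<in> {1..4}" "v \<notin> {i, j, u}" by (rule fourth_index)
    have "distinct [i, j, u, v]" using N u v by auto
    from B_zero(3)[OF N(1,2) u(1) v(1) this a b] show ?thesis using 1 by simp
  next
    case 2
    obtain v where v: "v \<in> {1..4}" "v \<notin> {i, j, l}" by (rule fourth_index)
    have "distinct [i, j, v, l]" using N v 2 by auto
    from B_zero(1)[OF N(1,2) v(1) N(4) this a b] show ?thesis using 2 by simp
  next
    case 3
    obtain v where v: "v \<in> {1..4}" "v \<notin> {i, j, k}" by (rule fourth_index)
    have "distinct [i, j, k, v]" using N v 3 by auto
    from B_zero(2)[OF N(1,2,3) v(1) this a b] show ?thesis using 3 by simp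
  qed
qed

lemma Ft_gr:
  assumes a: "a \<in> gr D p" and N: "i \<in> {1..4}" "j \<in> {1..4}" "i \<noteq> j"
  shows "Ft i j a \<in> gr M (p + dg4 i + dg4 j)"
proof -
  obtain k where k: "k \<in> {1..4}" "k \<notin> {i, j, j}" by (rule fourth_index)
  have kd: "distinct [i, k, j]" "i \<noteq> k" "k \<noteq> j" using k(2) N(3) by auto
  have e: "(p + dg4 i + dg4 k) + (0 + dg4 k + dg4 j) = p + dg4 i + dg4 j"
    by (cases p; cases "dg4 i"; cases "dg4 j"; cases "dg4 k") simp_all
  show ?thesis
    unfolding Ft_eq[OF a N(1) k(1) N(2) kd(1)]
    by (rule B.graded[OF E4_gr[OF a N(1) k(1) kd(2)] E4_gr[OF bar_unit_even k(1) N(2) kd(3)], unfolded e])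
qed

lemma Ft_add:
  assumes ab: "a \<in> gr D p" "b \<in> gr D p" and N: "i \<in> {1..4}" "j \<in> {1..4}" "i \<noteq> j"
  shows "Ft i j (a \<oplus>\<^bsub>D\<^esub> b) = Ft i j a \<oplus>\<^bsub>M\<^esub> Ft i j b"
proof -
  obtain k where k: "k \<in> {1..4}" "k \<notin> {i, j, j}" by (rule fourth_index)
  have kd: "distinct [i, k, j]" "i \<noteq> k" "k \<noteq> j" using k(2) N(3) by auto
  note F = Ft_eq[OF _ N(1) k(1) N(2) kd(1)]
  show ?thesis
    unfolding F[OF ab(1)] F[OF ab(2)] F[OF gr_add[OF ab]]
    using ab[THEN gr_carrier] N k(1) kd by (simp add: E4_linear B.add_l)
qed

lemma Ft_smult:
  assumes a: "a \<in> gr D p" and r: "r \<in> carrier R" and N: "i \<in> {1..4}" "j \<in> {1..4}" "i \<noteq> j"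
  shows "Ft i j (r \<odot>\<^bsub>D\<^esub> a) = r \<odot>\<^bsub>M\<^esub> Ft i j a"
proof -
  obtain k where k: "k \<in> {1..4}" "k \<notin> {i, j, j}" by (rule fourth_index)
  have kd: "distinct [i, k, j]" "i \<noteq> k" "k \<noteq> j" using k(2) N(3) by auto
  note F = Ft_eq[OF _ N(1) k(1) N(2) kd(1)]
  show ?thesis
    unfolding F[OF a] F[OF gr_smult[OF r a]]
    using gr_carrier[OF a] N k(1) kd r by (simp add: E4_linear B.smult_l)
qed

end

text \<open>A minor whose ideal is the one that is forced by the cocycle identity.\<close>

locale minor_lift = sl_cocycle + minor +
  assumes sharp: "\<kappa> = 2 \<and> idx_deg 2 j \<noteq> idx_deg 2 l \<or>
    \<kappa> = 0 \<and> idx_deg 2 k = idx_deg 2 i \<and> idx_deg 2 j = idx_deg 2 i + 1 \<and> idx_deg 2 l = idx_deg 2 i + 1"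
begin

interpretation V: supermodule R V4 by (rule supermodule_dialg_quot)

text \<open>By \<open>B_eq_Q\<close> and the exchanges this linear function of one argument
  determines all values of B on the rows i, k and the columns j, l.\<close>

definition "Q a = B (E4 i j a) (E4 k l \<one>\<^bsub>D\<^esub>)"

lemma ds1: "distinct [i, j, k, l]" "distinct [i, l, k, j]" "distinct [k, j, i, l]" "distinct [k, l, i, j]"
  using dist by auto

lemma lift_swap_rows: "minor_lift R D M B \<kappa> k i j l"
  by (intro minor_lift.intro sl_cocycle_axioms minor_swap_rows minor_lift_axioms.intro) (use sharp in auto)

lemma lift_swap_cols: "minor_lift R D M B \<kappa> i k l j"
  by (intro minor_lift.intro sl_cocycle_axioms minor_swap_cols minor_lift_axioms.intro) (use sharp in auto)

lemma Q_even_linear: "even_linear R D M Q"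
proof -
  have "Q a \<in> gr M p" if "a \<in> gr D p" for a p
  proof -
    have e: "(p + dg4 i + dg4 j) + (0 + dg4 k + dg4 l) = p"
      using dd_sum by (cases "dg4 i"; cases "dg4 j"; cases "dg4 k") simp_all
    show ?thesis
      unfolding Q_def using B.graded[OF E4_gr[OF that, of i j] E4_gr[OF bar_unit_even, of k l]] unfolding e by simp
  qed
  then show ?thesis
    unfolding even_linear_def by (simp add: Q_def E4_linear B.add_l B.smult_l)
qed

interpretation Q: even_linear_map R D M Q
  by (intro even_linear_map.intro even_linear_map_axioms.intro supermodule_axioms supermodule_M Q_even_linear)

lemma Q_cols: "a \<in> gr D p \<Longrightarrow> B (E4 i l a) (E4 k j \<one>\<^bsub>D\<^esub>) = koszul R ((dg4 k + dg4 l) * (dg4 j + dg4 l) + 1) \<odot>\<^bsub>M\<^esub> Q a"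
  using swap_cols[of i l k j a p "\<one>\<^bsub>D\<^esub>" 0] ds1 bar_unit_even by (simp add: Q_def add.commute)

text \<open>Exchanging the columns and exchanging them back produces the total sign (-1)^(|j| +
  |l|). For \<kappa> = 2 the columns have different parity, so \<open>Q a\<close> is its own
  negative.\<close>

lemma Q_torsion:
  assumes a: "a \<in> gr D p" and "\<kappa> = 2"
  shows "\<ominus>\<^bsub>M\<^esub> Q a = Q a" "koszul R u \<odot>\<^bsub>M\<^esub> Q a = Q a"
proof -
  have c: "a \<in> carrier D" using a gr_carrier by blast
  have "Q a = koszul R (((dg4 k + dg4 j) * (dg4 j + dg4 l) + 1) + ((dg4 k + dg4 l) * (dg4 j + dg4 l) + 1)) \<odot>\<^bsub>M\<^esub> Q a"
    using swap_cols[of i j k l a p "\<one>\<^bsub>D\<^esub>" 0] ds1 a bar_unit_even c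
    by (simp add: Q_cols[OF a] B.V.koszul_koszul Q_def[symmetric])
  moreover have "((dg4 k + dg4 j) * (dg4 j + dg4 l) + 1) + ((dg4 k + dg4 l) * (dg4 j + dg4 l) + 1) = 1"
    using sharp assms(2) by (cases "dg4 k"; cases "dg4 j"; cases "dg4 l") auto
  ultimately have "Q a = koszul R 1 \<odot>\<^bsub>M\<^esub> Q a" by metis
  then show n: "\<ominus>\<^bsub>M\<^esub> Q a = Q a" using c by simp
  then show "koszul R u \<odot>\<^bsub>M\<^esub> Q a = Q a" using c by (cases u) simp_all
qed

lemma sharp_cases:
  assumes "a \<in> gr D p"
  obtains "\<forall>u. koszul R u \<odot>\<^bsub>M\<^esub> Q a = Q a" "\<ominus>\<^bsub>M\<^esub> Q a = Q a"
  | "dg4 k = dg4 i" "dg4 j = dg4 i + 1" "dg4 l = dg4 i + 1"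
  using sharp Q_torsion[OF assms] by blast

text \<open>By \<open>swap_middle\<close> with the unit in the middle, b moves into the first
  argument while the columns are exchanged; \<open>Q_cols\<close> exchanges them back. In both cases
  of \<open>sharp_cases\<close> the signs combine to (-1)^q.\<close>

lemma B_eq_Q:
  assumes a: "a \<in> gr D p" and b: "b \<in> gr D q"
  shows "B (E4 i j a) (E4 k l b) = koszul R q \<odot>\<^bsub>M\<^esub> Q (a \<stileturn>\<^bsub>D\<^esub> b)"
proof -
  have c: "a \<in> carrier D" "b \<in> carrier D" using a b gr_carrier by auto
  have "B (E4 i j a) (E4 k l b) = koszul R ((dg4 k + dg4 j) * (q + dg4 k + dg4 l)) \<odot>\<^bsub>M\<^esub> B (E4 i l (a \<stileturn>\<^bsub>D\<^esub> b)) (E4 k j \<one>\<^bsub>D\<^esub>)"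
    using swap_middle[of i j k l a p "\<one>\<^bsub>D\<^esub>" 0 b q] a b ds1 bar_unit_even c by (simp add: lprod_bar_unit)
  also have "\<dots> = koszul R q \<odot>\<^bsub>M\<^esub> Q (a \<stileturn>\<^bsub>D\<^esub> b)"
    using c unfolding Q_cols[OF lp.graded[OF a b]]
    by (cases rule: sharp_cases[OF lp.graded[OF a b]]; cases "dg4 i"; cases q) simp_all
  finally show ?thesis .
qed

lemma Q_rows: "a \<in> gr D p \<Longrightarrow> B (E4 k j a) (E4 i l \<one>\<^bsub>D\<^esub>) = \<ominus>\<^bsub>M\<^esub> Q a"
proof -
  assume a: "a \<in> gr D p"
  have c: "a \<in> carrier D" using a gr_carrier by blast
  have "B (E4 k j a) (E4 i l \<one>\<^bsub>D\<^esub>) = koszul R ((p + dg4 k + dg4 j) * (dg4 i + dg4 k) + 1) \<odot>\<^bsub>M\<^esub> Q a"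
    using swap_rows[of k j i l a p "\<one>\<^bsub>D\<^esub>" 0] a ds1 bar_unit_even c by (simp add: bar_unit_rprod Q_def)
  then show ?thesis using c by (cases rule: sharp_cases[OF a]; cases "dg4 i"; cases p) simp_all
qed

lemma Q_cols': "a \<in> gr D p \<Longrightarrow> B (E4 i l a) (E4 k j \<one>\<^bsub>D\<^esub>) = \<ominus>\<^bsub>M\<^esub> Q a"
proof -
  assume a: "a \<in> gr D p"
  have c: "a \<in> carrier D" using a gr_carrier by blast
  show ?thesis using c unfolding Q_cols[OF a] by (cases rule: sharp_cases[OF a]; cases "dg4 i"; cases p) simp_all
qed

text \<open>A row exchange for general a and b, undone by \<open>Q_rows\<close>, compares
  \<open>a \<stileturn> b\<close> with \<open>b \<turnstile> a\<close>: Q respects the commutation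
  generators of the ideal.\<close>

lemma Q_comm:
  assumes a: "a \<in> gr D p" and b: "b \<in> gr D q"
  shows "Q (a \<stileturn>\<^bsub>D\<^esub> b) = koszul R (p * q) \<odot>\<^bsub>M\<^esub> Q (b \<turnstile>\<^bsub>D\<^esub> a)"
proof -
  have c: "a \<in> carrier D" "b \<in> carrier D" using a b gr_carrier by auto
  have ba: "b \<turnstile>\<^bsub>D\<^esub> a \<in> gr D (q + p)" by (rule rp.graded[OF b a])
  have "koszul R q \<odot>\<^bsub>M\<^esub> Q (a \<stileturn>\<^bsub>D\<^esub> b) =
     koszul R ((p + dg4 i + dg4 j) * (q + dg4 k + dg4 i) + 1) \<odot>\<^bsub>M\<^esub> (\<ominus>\<^bsub>M\<^esub> Q (b \<turnstile>\<^bsub>D\<^esub> a))"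
    using swap_rows[of i j k l a p b q] a b ds1 unfolding B_eq_Q[OF a b] Q_rows[OF ba] by simp
  then have "koszul R q \<odot>\<^bsub>M\<^esub> (koszul R q \<odot>\<^bsub>M\<^esub> Q (a \<stileturn>\<^bsub>D\<^esub> b)) =
     koszul R q \<odot>\<^bsub>M\<^esub> (koszul R ((p + dg4 i + dg4 j) * (q + dg4 k + dg4 i) + 1) \<odot>\<^bsub>M\<^esub> (\<ominus>\<^bsub>M\<^esub> Q (b \<turnstile>\<^bsub>D\<^esub> a)))" by simp
  moreover have "koszul R q \<odot>\<^bsub>M\<^esub> (koszul R ((p + dg4 i + dg4 j) * (q + dg4 k + dg4 i) + 1) \<odot>\<^bsub>M\<^esub> (\<ominus>\<^bsub>M\<^esub> Q (b \<turnstile>\<^bsub>D\<^esub> a))) =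
    koszul R (p * q) \<odot>\<^bsub>M\<^esub> Q (b \<turnstile>\<^bsub>D\<^esub> a)"
    using c by (cases rule: sharp_cases[OF ba]; cases "dg4 i"; cases p; cases q) simp_all
  ultimately show ?thesis using c by (simp add: B.V.koszul_koszul)
qed

text \<open>This is \<open>swap_middle\<close> followed by a column exchange; it is the counterpart
  of \<open>rho_swap\<close> for an arbitrary cocycle.\<close>

lemma Q_swap:
  assumes a: "a \<in> gr D p" and b: "b \<in> gr D q" and c: "c \<in> gr D r"
  shows "Q ((a \<stileturn>\<^bsub>D\<^esub> b) \<stileturn>\<^bsub>D\<^esub> c) = koszul R (q * r) \<odot>\<^bsub>M\<^esub> Q ((a \<stileturn>\<^bsub>D\<^esub> c) \<stileturn>\<^bsub>D\<^esub> b)"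
proof -
  interpret s: minor_lift R D M B \<kappa> i k l j by (rule lift_swap_cols)
  have cc: "a \<in> carrier D" "b \<in> carrier D" "c \<in> carrier D" using a b c gr_carrier by auto
  note ab = lp.graded[OF a b] and ac = lp.graded[OF a c]
  note acb = lp.graded[OF ac b]
  have sQ: "s.Q x = \<ominus>\<^bsub>M\<^esub> Q x" if "x \<in> gr D u" for x u using Q_cols'[OF that] by (simp add: s.Q_def)
  have "koszul R r \<odot>\<^bsub>M\<^esub> Q ((a \<stileturn>\<^bsub>D\<^esub> b) \<stileturn>\<^bsub>D\<^esub> c) =
      koszul R ((q + dg4 k + dg4 j) * (r + dg4 k + dg4 l)) \<odot>\<^bsub>M\<^esub> (koszul R q \<odot>\<^bsub>M\<^esub> (\<ominus>\<^bsub>M\<^esub> Q ((a \<stileturn>\<^bsub>D\<^esub> c) \<stileturn>\<^bsub>D\<^esub> b)))"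
    using swap_middle[of i j k l a p b q c r] a b c ds1
    unfolding B_eq_Q[OF ab c] s.B_eq_Q[OF ac b] sQ[OF acb] by simp
  then have "koszul R r \<odot>\<^bsub>M\<^esub> (koszul R r \<odot>\<^bsub>M\<^esub> Q ((a \<stileturn>\<^bsub>D\<^esub> b) \<stileturn>\<^bsub>D\<^esub> c)) =
      koszul R r \<odot>\<^bsub>M\<^esub> (koszul R ((q + dg4 k + dg4 j) * (r + dg4 k + dg4 l)) \<odot>\<^bsub>M\<^esub> (koszul R q \<odot>\<^bsub>M\<^esub> (\<ominus>\<^bsub>M\<^esub> Q ((a \<stileturn>\<^bsub>D\<^esub> c) \<stileturn>\<^bsub>D\<^esub> b))))"
    by simp
  moreover have "koszul R r \<odot>\<^bsub>M\<^esub> (koszul R ((q + dg4 k + dg4 j) * (r + dg4 k + dg4 l)) \<odot>\<^bsub>M\<^esub> (koszul R q \<odot>\<^bsub>M\<^esub> (\<ominus>\<^bsub>M\<^esub> Q ((a \<stileturn>\<^bsub>D\<^esub> c) \<stileturn>\<^bsub>D\<^esub> b)))) =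
      koszul R (q * r) \<odot>\<^bsub>M\<^esub> Q ((a \<stileturn>\<^bsub>D\<^esub> c) \<stileturn>\<^bsub>D\<^esub> b)"
    using cc by (cases rule: sharp_cases[OF acb]; cases "dg4 i"; cases r; cases q) simp_all
  ultimately show ?thesis using cc by (simp add: B.V.koszul_koszul)
qed

text \<open>To obtain a family stable under products, K also asks that Q vanish on all
  \<open>a \<stileturn> b\<close> and \<open>b \<stileturn> a\<close>. Products with
  \<open>\<turnstile>\<close> and longer products are reduced to these by \<open>Q_comm\<close> and
  \<open>Q_swap\<close>.\<close>

lemma Q_kernel:
  assumes x: "x \<in> I_ideal R D \<kappa>"
  shows "Q x = \<zero>\<^bsub>M\<^esub>"
proof -
  define K where "K p = {a \<in> gr D p. Q a = \<zero>\<^bsub>M\<^esub> \<and> (\<forall>r. \<forall>b\<in>gr D r. Q (a \<stileturn>\<^bsub>D\<^esub> b) = \<zero>\<^bsub>M\<^esub> \<and> Q (b \<stileturn>\<^bsub>D\<^esub> a) = \<zero>\<^bsub>M\<^esub>)}" for p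
  \<comment> \<open>\<open>Q a\<close> itself is the case where b is the bar-unit, since
    \<open>a \<stileturn> 1 = a\<close>.\<close>
  have KI: "a \<in> K p" if a: "a \<in> gr D p"
    and "\<And>r b. b \<in> gr D r \<Longrightarrow> Q (a \<stileturn>\<^bsub>D\<^esub> b) = \<zero>\<^bsub>M\<^esub>" "\<And>r b. b \<in> gr D r \<Longrightarrow> Q (b \<stileturn>\<^bsub>D\<^esub> a) = \<zero>\<^bsub>M\<^esub>" for a p
    unfolding K_def using that bar_unit_even lprod_bar_unit[OF gr_carrier[OF a]] by force
  have Kg: "a \<in> gr D p" and K1: "b \<in> gr D r \<Longrightarrow> Q (a \<stileturn>\<^bsub>D\<^esub> b) = \<zero>\<^bsub>M\<^esub>" and K2: "b \<in> gr D r \<Longrightarrow> Q (b \<stileturn>\<^bsub>D\<^esub> a) = \<zero>\<^bsub>M\<^esub>"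
    if "a \<in> K p" for a p b r using that unfolding K_def by blast+
  have kz: "koszul R u \<odot>\<^bsub>M\<^esub> \<zero>\<^bsub>M\<^esub> = \<zero>\<^bsub>M\<^esub>" for u by simp
  have "hcomp D p x \<in> K p" for p
  proof (rule I_ideal_hcomp_induct[OF _ _ _ _ _ _ _ x, of K])
    show "K p \<subseteq> gr D p" for p unfolding K_def by blast
    show "\<zero>\<^bsub>D\<^esub> \<in> K p" for p using gr_carrier by (intro KI) (simp_all add: gr_zero)
  next
    fix p a b assume ab: "a \<in> K p" "b \<in> K p"
    note g = ab[THEN Kg]
    note c = g[THEN gr_carrier]
    show "a \<oplus>\<^bsub>D\<^esub> b \<in> K p"
      by (rule KI[OF gr_add[OF g]])
        (use c in \<open>simp_all add: gr_carrier lp.linear_simps Q.add K1[OF ab(1)] K1[OF ab(2)] K2[OF ab(1)] K2[OF ab(2)]\<close>)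
  next
    fix p r a assume r: "r \<in> carrier R" and a: "a \<in> K p"
    show "r \<odot>\<^bsub>D\<^esub> a \<in> K p"
      by (rule KI[OF gr_smult[OF r Kg[OF a]]])
        (use gr_carrier[OF Kg[OF a]] r in \<open>simp_all add: gr_carrier lp.linear_simps Q.smult K1[OF a] K2[OF a]\<close>)
  next
    fix p q a y assume a': "a \<in> K p" and y: "y \<in> gr D q"
    note a = Kg[OF a']
    have c: "a \<in> carrier D" "y \<in> carrier D" using a y gr_carrier by auto
    have t1: "Q (a \<stileturn>\<^bsub>D\<^esub> (y \<stileturn>\<^bsub>D\<^esub> b)) = \<zero>\<^bsub>M\<^esub>" "Q (b \<stileturn>\<^bsub>D\<^esub> (a \<stileturn>\<^bsub>D\<^esub> y)) = \<zero>\<^bsub>M\<^esub>" "Q (b \<stileturn>\<^bsub>D\<^esub> (y \<stileturn>\<^bsub>D\<^esub> a)) = \<zero>\<^bsub>M\<^esub>"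
      "Q ((y \<stileturn>\<^bsub>D\<^esub> b) \<stileturn>\<^bsub>D\<^esub> a) = \<zero>\<^bsub>M\<^esub>" "Q ((a \<stileturn>\<^bsub>D\<^esub> b) \<stileturn>\<^bsub>D\<^esub> y) = \<zero>\<^bsub>M\<^esub>" if b: "b \<in> gr D r" for b r
    proof -
      have bc: "b \<in> carrier D" using b gr_carrier by blast
      show 1: "Q (a \<stileturn>\<^bsub>D\<^esub> (y \<stileturn>\<^bsub>D\<^esub> b)) = \<zero>\<^bsub>M\<^esub>" by (rule K1[OF a' lp.graded[OF y b]])
      have "Q (b \<stileturn>\<^bsub>D\<^esub> (a \<stileturn>\<^bsub>D\<^esub> y)) = koszul R (p * q) \<odot>\<^bsub>M\<^esub> Q ((b \<stileturn>\<^bsub>D\<^esub> y) \<stileturn>\<^bsub>D\<^esub> a)"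
        using Q_swap[OF b a y] c bc by (simp add: assoc_simps)
      then show "Q (b \<stileturn>\<^bsub>D\<^esub> (a \<stileturn>\<^bsub>D\<^esub> y)) = \<zero>\<^bsub>M\<^esub>" using K2[OF a' lp.graded[OF b y]] by simp
      show "Q (b \<stileturn>\<^bsub>D\<^esub> (y \<stileturn>\<^bsub>D\<^esub> a)) = \<zero>\<^bsub>M\<^esub>" using K2[OF a' lp.graded[OF b y]] c bc by (simp add: assoc_simps)
      show "Q ((y \<stileturn>\<^bsub>D\<^esub> b) \<stileturn>\<^bsub>D\<^esub> a) = \<zero>\<^bsub>M\<^esub>" by (rule K2[OF a' lp.graded[OF y b]])
      show "Q ((a \<stileturn>\<^bsub>D\<^esub> b) \<stileturn>\<^bsub>D\<^esub> y) = \<zero>\<^bsub>M\<^esub>" using K1[OF a' lp.graded[OF b y]] c bc by (simp add: assoc_simps)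
    qed
    have 1: "a \<stileturn>\<^bsub>D\<^esub> y \<in> K (p + q)"
      by (rule KI[OF lp.graded[OF a y]]) (use t1 c gr_carrier in \<open>simp_all add: lprod_assoc\<close>)
    have 2: "y \<stileturn>\<^bsub>D\<^esub> a \<in> K (p + q)"
    proof (rule KI)
      show "y \<stileturn>\<^bsub>D\<^esub> a \<in> gr D (p + q)" using lp.graded[OF y a] by (simp add: add.commute)
      fix r b assume b: "b \<in> gr D r"
      show "Q ((y \<stileturn>\<^bsub>D\<^esub> a) \<stileturn>\<^bsub>D\<^esub> b) = \<zero>\<^bsub>M\<^esub>" using Q_swap[OF y a b] t1(4)[OF b] by simp
      show "Q (b \<stileturn>\<^bsub>D\<^esub> (y \<stileturn>\<^bsub>D\<^esub> a)) = \<zero>\<^bsub>M\<^esub>" by (rule t1(3)[OF b])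
    qed
    \<comment> \<open>Here \<open>(a \<turnstile> y) \<stileturn> b = a \<turnstile> (y \<stileturn>
      b)\<close>, which \<open>Q_comm\<close> turns into
      \<open>(y \<stileturn> b) \<stileturn> a\<close>; under \<open>b \<stileturn>\<close> the
      inner \<open>\<turnstile>\<close> may be replaced by \<open>\<stileturn>\<close>.\<close>
    have 3: "a \<turnstile>\<^bsub>D\<^esub> y \<in> K (p + q)"
    proof (rule KI[OF rp.graded[OF a y]])
      fix r b assume b: "b \<in> gr D r"
      have bc: "b \<in> carrier D" using b gr_carrier by blast
      have z: "Q ((y \<stileturn>\<^bsub>D\<^esub> b) \<stileturn>\<^bsub>D\<^esub> a) = koszul R ((q + r) * p) \<odot>\<^bsub>M\<^esub> Q (a \<turnstile>\<^bsub>D\<^esub> (y \<stileturn>\<^bsub>D\<^esub> b))"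
        by (rule Q_comm[OF lp.graded[OF y b] a])
      have "koszul R ((q + r) * p) \<odot>\<^bsub>M\<^esub> (koszul R ((q + r) * p) \<odot>\<^bsub>M\<^esub> Q (a \<turnstile>\<^bsub>D\<^esub> (y \<stileturn>\<^bsub>D\<^esub> b))) = \<zero>\<^bsub>M\<^esub>"
        unfolding z[symmetric] t1(4)[OF b] by (rule kz)
      then show "Q ((a \<turnstile>\<^bsub>D\<^esub> y) \<stileturn>\<^bsub>D\<^esub> b) = \<zero>\<^bsub>M\<^esub>"
        using c bc by (simp add: B.V.koszul_koszul rprod_lprod)
      show "Q (b \<stileturn>\<^bsub>D\<^esub> (a \<turnstile>\<^bsub>D\<^esub> y)) = \<zero>\<^bsub>M\<^esub>"
        using t1(2)[OF b] lprod_lprod_rprod[OF bc c] by simp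
    qed
    have 4: "y \<turnstile>\<^bsub>D\<^esub> a \<in> K (p + q)"
    proof (rule KI)
      show "y \<turnstile>\<^bsub>D\<^esub> a \<in> gr D (p + q)" using rp.graded[OF y a] by (simp add: add.commute)
      fix r b assume b: "b \<in> gr D r"
      have bc: "b \<in> carrier D" using b gr_carrier by blast
      have z: "Q ((a \<stileturn>\<^bsub>D\<^esub> b) \<stileturn>\<^bsub>D\<^esub> y) = koszul R ((p + r) * q) \<odot>\<^bsub>M\<^esub> Q (y \<turnstile>\<^bsub>D\<^esub> (a \<stileturn>\<^bsub>D\<^esub> b))"
        by (rule Q_comm[OF lp.graded[OF a b] y])
      have "koszul R ((p + r) * q) \<odot>\<^bsub>M\<^esub> (koszul R ((p + r) * q) \<odot>\<^bsub>M\<^esub> Q (y \<turnstile>\<^bsub>D\<^esub> (a \<stileturn>\<^bsub>D\<^esub> b))) = \<zero>\<^bsub>M\<^esub>"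
        unfolding z[symmetric] t1(5)[OF b] by (rule kz)
      then show "Q ((y \<turnstile>\<^bsub>D\<^esub> a) \<stileturn>\<^bsub>D\<^esub> b) = \<zero>\<^bsub>M\<^esub>"
        using c bc by (simp add: B.V.koszul_koszul rprod_lprod)
      show "Q (b \<stileturn>\<^bsub>D\<^esub> (y \<turnstile>\<^bsub>D\<^esub> a)) = \<zero>\<^bsub>M\<^esub>"
        using t1(3)[OF b] lprod_lprod_rprod[OF bc c(2,1)] by simp
    qed
    show "a \<stileturn>\<^bsub>D\<^esub> y \<in> K (p + q) \<and> y \<stileturn>\<^bsub>D\<^esub> a \<in> K (p + q) \<and> a \<turnstile>\<^bsub>D\<^esub> y \<in> K (p + q) \<and> y \<turnstile>\<^bsub>D\<^esub> a \<in> K (p + q)"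
      using 1 2 3 4 by blast
  next
    fix p a assume a: "a \<in> gr D p"
    have c: "a \<in> carrier D" using a gr_carrier by blast
    show "[\<kappa>] \<cdot>\<^bsub>D\<^esub> a \<in> K p"
    proof (cases "\<kappa> = 2")
      case True
      then have e: "[\<kappa>] \<cdot>\<^bsub>D\<^esub> a = a \<oplus>\<^bsub>D\<^esub> a" using c by (simp add: numeral_2_eq_2)
      have z: "Q y \<oplus>\<^bsub>M\<^esub> Q y = \<zero>\<^bsub>M\<^esub>" if "y \<in> gr D r" for y r
        using Q_torsion(1)[OF that True] B.V.M.r_neg[OF Q.closed[OF gr_carrier[OF that]]] by simp
      show ?thesis unfolding e
        using a c gr_carrier z[OF lp.graded[OF a]] z[OF lp.graded[OF _ a]]
        by (intro KI) (simp_all add: gr_add lp.linear_simps Q.add)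
    next
      case False
      then have "[\<kappa>] \<cdot>\<^bsub>D\<^esub> a = \<zero>\<^bsub>D\<^esub>" using sharp by simp
      then show ?thesis using gr_carrier by (intro KI) (simp_all add: gr_zero)
    qed
  next
    fix p q a b assume a: "a \<in> gr D p" and b: "b \<in> gr D q"
    have c: "a \<in> carrier D" "b \<in> carrier D" using a b gr_carrier by auto
    let ?c = "a \<stileturn>\<^bsub>D\<^esub> b \<ominus>\<^bsub>D\<^esub> koszul R (p * q) \<odot>\<^bsub>D\<^esub> (b \<turnstile>\<^bsub>D\<^esub> a)"
    show "?c \<in> K (p + q)"
    proof (rule KI)
      show "?c \<in> gr D (p + q)"
        using lp.graded[OF a b] rp.graded[OF b a] by (intro gr_minus gr_koszul_smult) (simp_all add: add.commute)
      fix r y assume y: "y \<in> gr D r"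
      have yc: "y \<in> carrier D" using y gr_carrier by blast
      \<comment> \<open>Commuting b past \<open>a \<stileturn> y\<close> by \<open>Q_comm\<close>
        and then exchanging y and b by \<open>Q_swap\<close> handles the right multiples of the
        generator.\<close>
      have "Q ((a \<stileturn>\<^bsub>D\<^esub> y) \<stileturn>\<^bsub>D\<^esub> b) = koszul R ((p + r) * q) \<odot>\<^bsub>M\<^esub> Q (b \<turnstile>\<^bsub>D\<^esub> (a \<stileturn>\<^bsub>D\<^esub> y))"
        by (rule Q_comm[OF lp.graded[OF a y] b])
      then have "Q ((a \<stileturn>\<^bsub>D\<^esub> b) \<stileturn>\<^bsub>D\<^esub> y) = koszul R (p * q) \<odot>\<^bsub>M\<^esub> Q (b \<turnstile>\<^bsub>D\<^esub> (a \<stileturn>\<^bsub>D\<^esub> y))"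
        using Q_swap[OF a b y] c yc
        by (cases p; cases q; cases r) (simp_all add: B.V.koszul_koszul B.V.M.minus_minus)
      then show "Q (?c \<stileturn>\<^bsub>D\<^esub> y) = \<zero>\<^bsub>M\<^esub>"
        using c yc by (simp add: lp.linear_simps rprod_lprod Q.minus Q.smult B.V.M.diff_self)
      have "y \<stileturn>\<^bsub>D\<^esub> (b \<turnstile>\<^bsub>D\<^esub> a) = (y \<stileturn>\<^bsub>D\<^esub> b) \<stileturn>\<^bsub>D\<^esub> a" "y \<stileturn>\<^bsub>D\<^esub> (a \<stileturn>\<^bsub>D\<^esub> b) = (y \<stileturn>\<^bsub>D\<^esub> a) \<stileturn>\<^bsub>D\<^esub> b"
        using c yc by (simp_all add: assoc_simps)
      then show "Q (y \<stileturn>\<^bsub>D\<^esub> ?c) = \<zero>\<^bsub>M\<^esub>"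
        using c yc Q_swap[OF y a b] by (simp add: lp.linear_simps Q.minus Q.smult B.V.M.diff_self)
    qed
  qed
  then have "Q (hcomp D 0 x) = \<zero>\<^bsub>M\<^esub>" "Q (hcomp D 1 x) = \<zero>\<^bsub>M\<^esub>" unfolding K_def by blast+
  moreover have "x \<in> carrier D" using x submoduleE(1)[OF I_ideal_submodule] by blast
  ultimately show ?thesis
    using Q.add[of "hcomp D 0 x" "hcomp D 1 x"] by (simp add: hcomp_decomp)
qed

text \<open>Since Q vanishes on the ideal, it factors through the quotient as h. The other three
  arrangements follow from the minors with exchanged rows or columns, whose Q differs from this one
  by a sign for each exchange.\<close>

theorem minor_lift:
  obtains h where "even_linear R V4 M h"
    and "\<And>a b p q. a \<in> gr D p \<Longrightarrow> b \<in> gr D q \<Longrightarrow> B (E4 i j a) (E4 k l b) = h (\<tau> \<kappa> a b)"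
    and "\<And>a b p q. a \<in> gr D p \<Longrightarrow> b \<in> gr D q \<Longrightarrow> B (E4 i l a) (E4 k j b) = \<ominus>\<^bsub>M\<^esub> h (\<tau> \<kappa> a b)"
    and "\<And>a b p q. a \<in> gr D p \<Longrightarrow> b \<in> gr D q \<Longrightarrow> B (E4 k j a) (E4 i l b) = \<ominus>\<^bsub>M\<^esub> h (\<tau> \<kappa> a b)"
    and "\<And>a b p q. a \<in> gr D p \<Longrightarrow> b \<in> gr D q \<Longrightarrow> B (E4 k l a) (E4 i j b) = h (\<tau> \<kappa> a b)"
proof -
  interpret q: graded_submodule R D "I_ideal R D \<kappa>" by (rule graded_submodule_I)
  obtain h where h: "even_linear R V4 M h" "\<And>x. x \<in> carrier D \<Longrightarrow> h (cl \<kappa> x) = Q x"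
    using q.quot_factor[OF Q_even_linear Q_kernel supermodule_M] unfolding dialg_quot_def[symmetric] by blast
  interpret h: even_linear_map R V4 M h
    by (intro even_linear_map.intro even_linear_map_axioms.intro V.supermodule_axioms supermodule_M h(1))
  have clc: "cl \<kappa> x \<in> carrier V4" if "x \<in> carrier D" for x
    using q.coset_even_linear that unfolding even_linear_def dialg_quot_def by blast
  have ht: "h (\<tau> \<kappa> a b) = koszul R q \<odot>\<^bsub>M\<^esub> Q (a \<stileturn>\<^bsub>D\<^esub> b)" if "a \<in> gr D p" "b \<in> gr D q" for a b p q
    using that gr_carrier by (simp add: tau_homog[OF _ that(2)] h.smult h(2) clc)
  interpret s: minor_lift R D M B \<kappa> i k l j by (rule lift_swap_cols)
  interpret t: minor_lift R D M B \<kappa> k i j l by (rule lift_swap_rows)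
  interpret u: minor_lift R D M B \<kappa> k i l j by (rule t.lift_swap_cols)
  show thesis
  proof (rule that[OF h(1)])
    fix a b p q assume a: "a \<in> gr D p" and b: "b \<in> gr D q"
    note ab = lp.graded[OF a b]
    have c: "a \<stileturn>\<^bsub>D\<^esub> b \<in> carrier D" using ab gr_carrier by blast
    show "B (E4 i j a) (E4 k l b) = h (\<tau> \<kappa> a b)" unfolding ht[OF a b] by (rule B_eq_Q[OF a b])
    have "s.Q (a \<stileturn>\<^bsub>D\<^esub> b) = \<ominus>\<^bsub>M\<^esub> Q (a \<stileturn>\<^bsub>D\<^esub> b)" using Q_cols'[OF ab] by (simp add: s.Q_def)
    then show "B (E4 i l a) (E4 k j b) = \<ominus>\<^bsub>M\<^esub> h (\<tau> \<kappa> a b)"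
      using s.B_eq_Q[OF a b] c by (simp add: ht[OF a b] B.V.smult_r_minus)
    have t: "t.Q (a \<stileturn>\<^bsub>D\<^esub> b) = \<ominus>\<^bsub>M\<^esub> Q (a \<stileturn>\<^bsub>D\<^esub> b)" using Q_rows[OF ab] by (simp add: t.Q_def)
    then show "B (E4 k j a) (E4 i l b) = \<ominus>\<^bsub>M\<^esub> h (\<tau> \<kappa> a b)"
      using t.B_eq_Q[OF a b] c by (simp add: ht[OF a b] B.V.smult_r_minus)
    have "u.Q (a \<stileturn>\<^bsub>D\<^esub> b) = \<ominus>\<^bsub>M\<^esub> t.Q (a \<stileturn>\<^bsub>D\<^esub> b)" using t.Q_cols'[OF ab] by (simp add: u.Q_def)
    then show "B (E4 k l a) (E4 i j b) = h (\<tau> \<kappa> a b)"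
      using u.B_eq_Q[OF a b] c by (simp add: t ht[OF a b] B.V.M.minus_minus)
  qed
qed

end

section \<open>The Steinberg Leibniz superalgebra\<close>

lemma (in module) koszul_Suc: "koszul R (p + 1) = \<ominus> koszul R p"
  by (cases p) (simp_all add: R.minus_minus)

lemma (in module) submodule_finsum:
  assumes "submodule P R M" "finite A" "\<And>x. x \<in> A \<Longrightarrow> f x \<in> P"
  shows "(\<Oplus>\<^bsub>M\<^esub>x\<in>A. f x) \<in> P"
  using assms(2,3)
proof (induction rule: finite_induct)
  case empty
  then show ?case using submodule_zero[OF assms(1)] by simp
next
  case (insert x F)
  then have "f \<in> F \<rightarrow> carrier M" "f x \<in> carrier M" using submoduleE(1)[OF assms(1)] by blast+
  then show ?case using insert submoduleE(5)[OF assms(1)] by simp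
qed

context unital_superdialgebra
begin

abbreviation "gens4 \<equiv> stl_gens 2 2 D"
abbreviation "rels4 \<equiv> stl_rels R 2 2 D"
abbreviation "St \<equiv> stl R 2 2 D"
abbreviation "Sl4 \<equiv> sl R 2 2 D"
abbreviation "e4 \<equiv> elem_mat 2 2 D"
abbreviation "dgr \<equiv> idx_deg 2"

declare atLeastAtMost_iff [simp del]

lemma gens4_iff: "(i, j, a) \<in> gens4 p \<longleftrightarrow> i \<in> {1..4} \<and> j \<in> {1..4} \<and> i \<noteq> j \<and> a \<in> gr D (p + dgr i + dgr j)"
  by (simp add: stl_gens_def)

lemma gens4I: "\<lbrakk>a \<in> gr D p; i \<in> {1..4}; j \<in> {1..4}; i \<noteq> j\<rbrakk> \<Longrightarrow> (i, j, a) \<in> gens4 (p + dgr i + dgr j)"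
  by (simp add: gens4_iff)

lemma sl_cocycle_sl: "sl_cocycle R D Sl4 (bracket Sl4)"
proof -
  interpret L: leibniz_superalgebra R Sl4 by (rule leibniz_sl)
  show ?thesis
    by (intro sl_cocycle.intro sl_cocycle_axioms.intro unital_superdialgebra_axioms
        L.supermodule_axioms L.bracket_cocycle)
qed

interpretation sl: sl_cocycle R D Sl4 "bracket Sl4" by (rule sl_cocycle_sl)

text \<open>A generator of both degrees has its entry in both graded parts, hence has entry 0.
  Linearity of the generators with scalar 0 then makes it congruent to zero.\<close>

lemma presentation_stl: "presentation R gens4 rels4"
proof (rule presentation.intro)
  show "cring R" by (rule is_cring)
next
  fix s t assume "(s, t) \<in> rels4"
  then show "\<exists>p. homog_term R gens4 p s \<and> homog_term R gens4 p t"
  proof cases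
    case (add i j a p b)
    then show ?thesis
      by (intro exI[of _ "p + dgr i + dgr j"]) (simp add: homog_term.intros gens4I gr_add)
  next
    case (smult i j r a p)
    then show ?thesis
      by (intro exI[of _ "p + dgr i + dgr j"]) (simp add: homog_term.intros gens4I gr_smult)
  next
    case (left i j k l a p b q)
    \<comment> \<open>The middle index occurs twice because j = k, so its parity drops out.\<close>
    have e: "(p + dgr i + dgr j) + (q + dgr k + dgr l) = p + q + dgr i + dgr l"
      using left by (cases "dgr k") (simp_all add: ac_simps)
    have "homog_term R gens4 ((p + dgr i + dgr j) + (q + dgr k + dgr l)) s"
      unfolding left(1) using left by (intro homog_term.intros(5) homog_term.intros(1) gens4I) auto
    moreover have "homog_term R gens4 (p + q + dgr i + dgr l) t"
      unfolding left(2) using left by (intro homog_term.intros(1) gens4I lp.graded) auto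
    ultimately show ?thesis unfolding e by blast
  next
    case (right i j k l a p b q)
    have e: "(p + dgr i + dgr j) + (q + dgr k + dgr l) = q + p + dgr k + dgr j"
      using right by (cases "dgr l") (simp_all add: ac_simps)
    have "homog_term R gens4 ((p + dgr i + dgr j) + (q + dgr k + dgr l)) s"
      unfolding right(1) using right by (intro homog_term.intros(5) homog_term.intros(1) gens4I) auto
    moreover have "homog_term R gens4 (q + p + dgr k + dgr j) t"
      unfolding right(2) using right by (intro homog_term.intros(4) homog_term.intros(1) gens4I rp.graded) auto
    ultimately show ?thesis unfolding e by blast
  next
    case (zero i j k l a p b q)
    then show ?thesis
      by (intro exI[of _ "(p + dgr i + dgr j) + (q + dgr k + dgr l)"]) (simp add: homog_term.intros gens4I)
  qed
next
  fix g assume g: "g \<in> gens4 0" "g \<in> gens4 1"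
  obtain i j a where ija: "g = (i, j, a)" by (cases g)
  have N: "i \<in> {1..4}" "j \<in> {1..4}" "i \<noteq> j" "a \<in> gr D (0 + dgr i + dgr j)" "a \<in> gr D (1 + dgr i + dgr j)"
    using g by (auto simp: ija gens4_iff)
  have "a = \<zero>\<^bsub>D\<^esub>" by (rule gr_disjoint[OF N(4,5)]) (cases "dgr i"; cases "dgr j"; simp)
  then have "(Gen (i, j, a), TScale \<zero> (Gen (i, j, a))) \<in> rels4"
    using stl_rels.smult[of i 2 2 j \<zero> R a D 0] N(1-3) gr_zero by simp
  then have "(Gen g, TScale \<zero> (Gen g)) \<in> leibniz_cong R gens4 rels4"
    unfolding ija by (rule leibniz_cong.rel)
  moreover have "(TScale \<zero> (Gen g), TZero) \<in> leibniz_cong R gens4 rels4"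
    using g(1) by (intro leibniz_cong.scale_zero lterms.intros(1))
  ultimately show "(Gen g, TZero) \<in> leibniz_cong R gens4 rels4" by (rule leibniz_cong.trans)
qed

interpretation P: presentation R gens4 rels4 by (rule presentation_stl)

lemma leibniz_stl: "leibniz_superalgebra R St"
  unfolding stl_def by (rule P.leibniz_superalgebra_presented)

interpretation S: leibniz_superalgebra R St by (rule leibniz_stl)

lemma stl_gen_eq: "stl_gen R 2 2 D i j a = P.cls (Gen (i, j, a))"
  by (simp add: stl_gen_def P.cls_def)

abbreviation "F \<equiv> stl_gen R 2 2 D"

lemma stl_eval: "t \<in> lterms R gens4 \<Longrightarrow> lterm_eval St (\<lambda>(i, j, a). F i j a) t = P.cls t"
proof -
  assume t: "t \<in> lterms R gens4"
  have "(\<lambda>(i, j, a). F i j a) = (\<lambda>g. P.cls (Gen g))" by (auto simp: stl_gen_eq fun_eq_iff)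
  then show ?thesis using P.lterm_eval_presented[OF t] by (simp add: stl_def)
qed

lemma stl_carrier: "carrier St = (\<lambda>t. lterm_eval St (\<lambda>(i, j, a). F i j a) t) ` lterms R gens4"
  using stl_eval by (simp add: stl_def P.carrier_presented cong: image_cong)

lemma F_gr: "\<lbrakk>a \<in> gr D p; i \<in> {1..4}; j \<in> {1..4}; i \<noteq> j\<rbrakk> \<Longrightarrow> F i j a \<in> gr St (p + dgr i + dgr j)"
  unfolding stl_gen_eq stl_def P.gr_presented hterms_def
  by (intro imageI CollectI homog_term.intros(1) gens4I)

lemma F_gens_gr: "g \<in> gens4 p \<Longrightarrow> (case g of (i, j, a) \<Rightarrow> F i j a) \<in> gr St p"
proof -
  assume g: "g \<in> gens4 p"
  obtain i j a where ija: "g = (i, j, a)" by (cases g)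
  then show ?thesis using g F_gr[of a "p + dgr i + dgr j" i j] by (simp add: gens4_iff)
qed

lemma Gen_l: "\<lbrakk>a \<in> gr D p; i \<in> {1..4}; j \<in> {1..4}; i \<noteq> j\<rbrakk> \<Longrightarrow> Gen (i, j, a) \<in> lterms R gens4"
  by (rule lterms.intros(1)[of _ _ "p + dgr i + dgr j"]) (rule gens4I)

lemma stl_rel_cls: "(s, t) \<in> rels4 \<Longrightarrow> P.cls s = P.cls t"
  by (intro P.cls_eqI leibniz_cong.rel)

lemma F_add:
  assumes "a \<in> gr D p" "b \<in> gr D p" "i \<in> {1..4}" "j \<in> {1..4}" "i \<noteq> j"
  shows "F i j (a \<oplus>\<^bsub>D\<^esub> b) = F i j a \<oplus>\<^bsub>St\<^esub> F i j b"
  using stl_rel_cls[OF stl_rels.add[of i 2 2 j a D p b R]] assms Gen_l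
  by (simp add: stl_gen_eq stl_def P.add_presented)

lemma F_smult:
  assumes "a \<in> gr D p" "r \<in> carrier R" "i \<in> {1..4}" "j \<in> {1..4}" "i \<noteq> j"
  shows "F i j (r \<odot>\<^bsub>D\<^esub> a) = r \<odot>\<^bsub>St\<^esub> F i j a"
  using stl_rel_cls[OF stl_rels.smult[of i 2 2 j r R a D p]] assms Gen_l
  by (simp add: stl_gen_eq stl_def P.smult_presented)

lemma F_br:
  assumes ab: "a \<in> gr D p" "b \<in> gr D q"
    and N: "i \<in> {1..4}" "j \<in> {1..4}" "k \<in> {1..4}" "l \<in> {1..4}" "i \<noteq> j" "k \<noteq> l"
  shows "j = k \<Longrightarrow> i \<noteq> l \<Longrightarrow> bracket St (F i j a) (F k l b) = F i l (a \<stileturn>\<^bsub>D\<^esub> b)"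
    and "j \<noteq> k \<Longrightarrow> i = l \<Longrightarrow> bracket St (F i j a) (F k l b) =
      (\<ominus> koszul R ((p + dgr i + dgr j) * (q + dgr k + dgr l))) \<odot>\<^bsub>St\<^esub> F k j (b \<turnstile>\<^bsub>D\<^esub> a)"
    and "j \<noteq> k \<Longrightarrow> i \<noteq> l \<Longrightarrow> bracket St (F i j a) (F k l b) = \<zero>\<^bsub>St\<^esub>"
proof -
  have g: "Gen (i, j, a) \<in> lterms R gens4" "Gen (k, l, b) \<in> lterms R gens4" using ab N Gen_l by blast+
  have br: "bracket St (F i j a) (F k l b) = P.cls (TBr (Gen (i, j, a)) (Gen (k, l, b)))"
    using g by (simp add: stl_gen_eq stl_def P.bracket_presented)
  show "bracket St (F i j a) (F k l b) = F i l (a \<stileturn>\<^bsub>D\<^esub> b)" if "j = k" "i \<noteq> l"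
    unfolding br unfolding stl_gen_eq by (rule stl_rel_cls[OF stl_rels.left]) (use ab N that in auto)
  show "bracket St (F i j a) (F k l b) = \<zero>\<^bsub>St\<^esub>" if "j \<noteq> k" "i \<noteq> l"
    using stl_rel_cls[OF stl_rels.zero[of i j k l 2 2 a D p b q R]] ab N that
    unfolding br by (simp add: stl_def P.zero_presented)
  show "bracket St (F i j a) (F k l b) =
      (\<ominus> koszul R ((p + dgr i + dgr j) * (q + dgr k + dgr l))) \<odot>\<^bsub>St\<^esub> F k j (b \<turnstile>\<^bsub>D\<^esub> a)" if "j \<noteq> k" "i = l"
  proof -
    have gk: "Gen (k, j, b \<turnstile>\<^bsub>D\<^esub> a) \<in> lterms R gens4" using rp.graded[OF ab(2,1)] N that by (intro Gen_l) auto
    show ?thesis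
      using stl_rel_cls[OF stl_rels.right[of i j k l 2 2 a D p b q R]] ab N that gk
      unfolding br by (simp add: stl_gen_eq stl_def P.smult_presented add.commute add.left_commute)
  qed
qed

text \<open>The universal property of the presentation, with coinciding indices identified and the
  minus sign of the right relation moved into the exponent, to match the statements about
  \<open>E4\<close> and \<open>Ft\<close>.\<close>

lemma stl_hom:
  assumes M: "leibniz_superalgebra R M" and e: "\<And>p i j a. \<lbrakk>a \<in> gr D p; i \<in> {1..4}; j \<in> {1..4}; i \<noteq> j\<rbrakk> \<Longrightarrow>
      f i j a \<in> gr M (p + dgr i + dgr j)"
    and add: "\<And>p i j a b. \<lbrakk>a \<in> gr D p; b \<in> gr D p; i \<in> {1..4}; j \<in> {1..4}; i \<noteq> j\<rbrakk> \<Longrightarrow>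
      f i j (a \<oplus>\<^bsub>D\<^esub> b) = f i j a \<oplus>\<^bsub>M\<^esub> f i j b"
    and smult: "\<And>p i j r a. \<lbrakk>a \<in> gr D p; r \<in> carrier R; i \<in> {1..4}; j \<in> {1..4}; i \<noteq> j\<rbrakk> \<Longrightarrow>
      f i j (r \<odot>\<^bsub>D\<^esub> a) = r \<odot>\<^bsub>M\<^esub> f i j a"
    and left: "\<And>p q i j l a b. \<lbrakk>a \<in> gr D p; b \<in> gr D q; i \<in> {1..4}; j \<in> {1..4}; l \<in> {1..4}; distinct [i, j, l]\<rbrakk> \<Longrightarrow>
      bracket M (f i j a) (f j l b) = f i l (a \<stileturn>\<^bsub>D\<^esub> b)"
    and right: "\<And>p q i j k a b. \<lbrakk>a \<in> gr D p; b \<in> gr D q; i \<in> {1..4}; j \<in> {1..4}; k \<in> {1..4}; distinct [i, j, k]\<rbrakk> \<Longrightarrow>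
      bracket M (f i j a) (f k i b) = koszul R ((p + dgr i + dgr j) * (q + dgr k + dgr i) + 1) \<odot>\<^bsub>M\<^esub> f k j (b \<turnstile>\<^bsub>D\<^esub> a)"
    and zero: "\<And>p q i j k l a b. \<lbrakk>a \<in> gr D p; b \<in> gr D q; i \<in> {1..4}; j \<in> {1..4}; k \<in> {1..4}; l \<in> {1..4};
      i \<noteq> j; k \<noteq> l; i \<noteq> l; j \<noteq> k\<rbrakk> \<Longrightarrow> bracket M (f i j a) (f k l b) = \<zero>\<^bsub>M\<^esub>"
  shows "\<exists>g\<in>leibniz_hom R St M. \<forall>t\<in>lterms R gens4. g (P.cls t) = lterm_eval M (\<lambda>(i, j, a). f i j a) t"
  unfolding stl_def
proof (rule P.presented_hom[OF M])
  fix p g assume g: "g \<in> gens4 p"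
  obtain i j a where ija: "g = (i, j, a)" by (cases g)
  then show "(case g of (i, j, a) \<Rightarrow> f i j a) \<in> gr M p"
    using g e[of a "p + dgr i + dgr j" i j] by (simp add: gens4_iff)
next
  fix s t assume "(s, t) \<in> rels4"
  then show "lterm_eval M (\<lambda>(i, j, a). f i j a) s = lterm_eval M (\<lambda>(i, j, a). f i j a) t"
  proof cases
    case (add i j a p b)
    then show ?thesis using assms(3)[of a p b i j] by simp
  next
    case (smult i j r a p)
    then show ?thesis using assms(4)[of a p r i j] by simp
  next
    case (left i j k l a p b q)
    then show ?thesis using assms(5)[of a p b q i j l] by simp
  next
    case (right i j k l a p b q)
    interpret M: leibniz_superalgebra R M by (rule M)
    show ?thesis using right assms(6)[of a p b q i j k]
      unfolding M.koszul_Suc by (simp add: add.commute add.left_commute)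
  next
    case (zero i j k l a p b q)
    then show ?thesis using assms(7)[of a p b q i j k l] by simp
  qed
qed

text \<open>The Steinberg relations hold for elementary matrices by \<open>E4_br\<close>.
  Surjectivity is the generation of sl by off-diagonal elementary matrices.\<close>

lemma stl_to_sl:
  obtains \<pi> :: "('a, nat \<times> nat \<times> 'c) lterm set \<Rightarrow> nat \<times> nat \<Rightarrow> 'c" where "\<pi> \<in> leibniz_hom R St Sl4"
    and "\<And>t. t \<in> lterms R gens4 \<Longrightarrow> \<pi> (P.cls t) = lterm_eval Sl4 (\<lambda>(i, j, a). e4 i j a) t"
    and "\<And>i j a p. \<lbrakk>a \<in> gr D p; i \<in> {1..4}; j \<in> {1..4}; i \<noteq> j\<rbrakk> \<Longrightarrow> \<pi> (F i j a) = e4 i j a"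
    and "\<pi> ` carrier St = carrier Sl4"
proof -
  have "\<exists>g\<in>leibniz_hom R St Sl4. \<forall>t\<in>lterms R gens4. g (P.cls t) = lterm_eval Sl4 (\<lambda>(i, j, a). e4 i j a) t"
  proof (rule stl_hom[OF leibniz_sl])
    fix p q and i j k :: nat and a b assume "a \<in> gr D p" "b \<in> gr D q" "i \<in> {1..4}" "j \<in> {1..4}" "k \<in> {1..4}" "distinct [i, j, k]"
    then show "bracket Sl4 (e4 i j a) (e4 k i b) =
        koszul R ((p + dgr i + dgr j) * (q + dgr k + dgr i) + 1) \<odot>\<^bsub>Sl4\<^esub> e4 k j (b \<turnstile>\<^bsub>D\<^esub> a)"
      by (intro sl.E4_br(2)) auto
  qed (auto simp: sl.E4_gr sl.E4_linear gr_carrier intro: sl.E4_br)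
  then obtain \<pi> where p: "\<pi> \<in> leibniz_hom R St Sl4"
    "\<And>t. t \<in> lterms R gens4 \<Longrightarrow> \<pi> (P.cls t) = lterm_eval Sl4 (\<lambda>(i, j, a). e4 i j a) t" by blast
  have "\<pi> ` carrier St = lterm_eval Sl4 (\<lambda>(i, j, a). e4 i j a) ` lterms R gens4"
    unfolding stl_def P.carrier_presented image_image by (rule image_cong) (simp_all add: p(2))
  also have "\<dots> = carrier Sl4"
    using Sl_generated[of 2 2] by (simp add: sl_sel ev_def)
  finally show thesis using that p by (simp add: stl_gen_eq Gen_l)
qed

text \<open>Generators exist only for homogeneous entries; this is their linear extension to all of
  D.\<close>

definition "Fx i j a = F i j (hcomp D 0 a) \<oplus>\<^bsub>St\<^esub> F i j (hcomp D 1 a)"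

context
  fixes i j :: nat
  assumes ij: "i \<in> {1..4}" "j \<in> {1..4}" "i \<noteq> j"
begin

lemma F_closed: "a \<in> gr D p \<Longrightarrow> F i j a \<in> carrier St"
  using F_gr[OF _ ij] S.gr_carrier by blast

lemma F_zero: "F i j \<zero>\<^bsub>D\<^esub> = \<zero>\<^bsub>St\<^esub>"
  using F_smult[OF gr_zero[of 0] _ ij, of \<zero>] F_closed[OF gr_zero[of 0]] by simp

lemma Fx_closed: "a \<in> carrier D \<Longrightarrow> Fx i j a \<in> carrier St"
  unfolding Fx_def using F_closed hcomp_closed by blast

lemma Fx_homog: "a \<in> gr D p \<Longrightarrow> Fx i j a = F i j a"
  unfolding Fx_def using hcomp_homog[of a p] F_closed by (cases p) (simp_all add: F_zero)

lemma Fx_add: "a \<in> carrier D \<Longrightarrow> b \<in> carrier D \<Longrightarrow> Fx i j (a \<oplus>\<^bsub>D\<^esub> b) = Fx i j a \<oplus>\<^bsub>St\<^esub> Fx i j b"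
  unfolding Fx_def using F_closed[OF hcomp_closed]
  by (simp add: hcomp_add F_add[OF hcomp_closed hcomp_closed ij] S.M.a_ac)

lemma Fx_smult: "r \<in> carrier R \<Longrightarrow> a \<in> carrier D \<Longrightarrow> Fx i j (r \<odot>\<^bsub>D\<^esub> a) = r \<odot>\<^bsub>St\<^esub> Fx i j a"
  unfolding Fx_def using F_closed[OF hcomp_closed]
  by (simp add: hcomp_smult F_smult[OF hcomp_closed _ ij] S.smult_r_distr)

end

text \<open>The root space of weight \<open>(i, j)\<close>.\<close>

definition "Nn i j = Fx i j ` carrier D"

lemma Nn_submodule:
  assumes ij: "i \<in> {1..4}" "j \<in> {1..4}" "i \<noteq> j"
  shows "submodule (Nn i j) R St"
proof (rule S.submoduleI)
  note l = Fx_add[OF ij] Fx_smult[OF ij] Fx_closed[OF ij]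
  show "Nn i j \<subseteq> carrier St" unfolding Nn_def using l(3) by blast
  have "Fx i j \<zero>\<^bsub>D\<^esub> = \<zero>\<^bsub>St\<^esub>" using F_zero[OF ij] by (simp add: Fx_def)
  then show "\<zero>\<^bsub>St\<^esub> \<in> Nn i j" unfolding Nn_def by (intro image_eqI[of _ _ "\<zero>\<^bsub>D\<^esub>"]) simp_all
  fix x assume "x \<in> Nn i j"
  then obtain a where a: "a \<in> carrier D" "x = Fx i j a" unfolding Nn_def by blast
  have "\<ominus>\<^bsub>St\<^esub> x = Fx i j ((\<ominus> \<one>) \<odot>\<^bsub>D\<^esub> a)"
    using a l(2)[of "\<ominus> \<one>" a] l(3)[of a] by (simp del: koszul_smult(2))
  then show "\<ominus>\<^bsub>St\<^esub> x \<in> Nn i j" using a unfolding Nn_def by (intro image_eqI[of _ _ "(\<ominus> \<one>) \<odot>\<^bsub>D\<^esub> a"]) simp_all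
next
  fix x y assume "x \<in> Nn i j" "y \<in> Nn i j"
  then obtain a b where "a \<in> carrier D" "x = Fx i j a" "b \<in> carrier D" "y = Fx i j b" unfolding Nn_def by blast
  then show "x \<oplus>\<^bsub>St\<^esub> y \<in> Nn i j" unfolding Nn_def
    by (intro image_eqI[of _ _ "a \<oplus>\<^bsub>D\<^esub> b"]) (simp_all add: Fx_add[OF ij])
next
  fix r x assume "r \<in> carrier R" "x \<in> Nn i j"
  then obtain a where "a \<in> carrier D" "x = Fx i j a" unfolding Nn_def by blast
  then show "r \<odot>\<^bsub>St\<^esub> x \<in> Nn i j" unfolding Nn_def using \<open>r \<in> carrier R\<close>
    by (intro image_eqI[of _ _ "r \<odot>\<^bsub>D\<^esub> a"]) (simp_all add: Fx_smult[OF ij])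
qed

lemma F_in_Nn: "\<lbrakk>a \<in> gr D p; i \<in> {1..4}; j \<in> {1..4}; i \<noteq> j\<rbrakk> \<Longrightarrow> F i j a \<in> Nn i j"
  unfolding Nn_def using gr_carrier by (intro image_eqI[of _ _ a]) (simp_all add: Fx_homog)

lemma Nn_bracket:
  assumes x: "x \<in> Nn i j" and y: "y \<in> Nn k l"
    and N: "i \<in> {1..4}" "j \<in> {1..4}" "k \<in> {1..4}" "l \<in> {1..4}" "i \<noteq> j" "k \<noteq> l"
  shows "j = k \<Longrightarrow> i \<noteq> l \<Longrightarrow> bracket St x y \<in> Nn i l"
    and "j \<noteq> k \<Longrightarrow> i = l \<Longrightarrow> bracket St x y \<in> Nn k j"
    and "j \<noteq> k \<Longrightarrow> i \<noteq> l \<Longrightarrow> bracket St x y = \<zero>\<^bsub>St\<^esub>"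
proof -
  obtain a where a: "a \<in> carrier D" "x = F i j (hcomp D 0 a) \<oplus>\<^bsub>St\<^esub> F i j (hcomp D 1 a)"
    using x unfolding Nn_def Fx_def by blast
  obtain b where b: "b \<in> carrier D" "y = F k l (hcomp D 0 b) \<oplus>\<^bsub>St\<^esub> F k l (hcomp D 1 b)"
    using y unfolding Nn_def Fx_def by blast
  note ha = hcomp_closed[OF a(1)] and hb = hcomp_closed[OF b(1)]
  have c: "F i j (hcomp D p a) \<in> carrier St" "F k l (hcomp D p b) \<in> carrier St" for p
    using F_closed[OF N(1,2,5) ha] F_closed[OF N(3,4,6) hb] by auto
  have e: "bracket St x y =
      (bracket St (F i j (hcomp D 0 a)) (F k l (hcomp D 0 b)) \<oplus>\<^bsub>St\<^esub> bracket St (F i j (hcomp D 0 a)) (F k l (hcomp D 1 b))) \<oplus>\<^bsub>St\<^esub>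
      (bracket St (F i j (hcomp D 1 a)) (F k l (hcomp D 0 b)) \<oplus>\<^bsub>St\<^esub> bracket St (F i j (hcomp D 1 a)) (F k l (hcomp D 1 b)))"
    unfolding a(2) b(2) using c by (simp add: S.br.linear_simps S.M.a_ac)
  have sum4: "bracket St x y \<in> X"
    if X: "submodule X R St" and m: "\<And>p q. bracket St (F i j (hcomp D p a)) (F k l (hcomp D q b)) \<in> X" for X
    unfolding e by (intro S.submoduleE(5)[OF X] m)
  show "bracket St x y \<in> Nn i l" if "j = k" "i \<noteq> l"
    by (rule sum4[OF Nn_submodule[OF N(1,4) that(2)]])
      (simp only: F_br(1)[OF ha hb N that] F_in_Nn[OF lp.graded[OF ha hb] N(1,4) that(2)])
  show "bracket St x y \<in> Nn k j" if "j \<noteq> k" "i = l"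
  proof (rule sum4[OF Nn_submodule[OF N(3,2) that(1)[symmetric]]])
    fix p q
    show "bracket St (F i j (hcomp D p a)) (F k l (hcomp D q b)) \<in> Nn k j"
      unfolding F_br(2)[OF ha hb N that]
      by (intro S.submoduleE(4)[OF Nn_submodule[OF N(3,2) that(1)[symmetric]]]
          F_in_Nn[OF rp.graded[OF hb ha] N(3,2) that(1)[symmetric]]) simp
  qed
  show "bracket St x y = \<zero>\<^bsub>St\<^esub>" if "j \<noteq> k" "i \<noteq> l"
    unfolding e by (simp add: F_br(3)[OF ha hb N that])
qed

lemma Nn_l: "\<lbrakk>x \<in> Nn i j; y \<in> Nn j l; i \<in> {1..4}; j \<in> {1..4}; l \<in> {1..4}; i \<noteq> j; j \<noteq> l; i \<noteq> l\<rbrakk> \<Longrightarrow>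
    bracket St x y \<in> Nn i l"
  by (rule Nn_bracket(1)) auto

lemma Nn_r: "\<lbrakk>x \<in> Nn i j; y \<in> Nn k i; i \<in> {1..4}; j \<in> {1..4}; k \<in> {1..4}; i \<noteq> j; k \<noteq> i; k \<noteq> j\<rbrakk> \<Longrightarrow>
    bracket St x y \<in> Nn k j"
  by (rule Nn_bracket(2)) auto

lemma Nn_z: "\<lbrakk>x \<in> Nn i j; y \<in> Nn k l; i \<in> {1..4}; j \<in> {1..4}; k \<in> {1..4}; l \<in> {1..4}; i \<noteq> j; k \<noteq> l;
    i \<noteq> l; j \<noteq> k\<rbrakk> \<Longrightarrow> bracket St x y = \<zero>\<^bsub>St\<^esub>"
  by (rule Nn_bracket(3)[where i = i and j = j and k = k and l = l]) auto

text \<open>The weight-zero elements \<open>[F\<^sub>i\<^sub>j(a), F\<^sub>j\<^sub>i(b)]\<close> act diagonally; for the weights \<open>\<plusminus>(i, j)\<close> this is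
  seen by factoring the generator through a third index.\<close>

lemma weight_zero_action:
  assumes ij: "i \<in> {1..4}" "j \<in> {1..4}" "i \<noteq> j" and ab: "a \<in> gr D p" "b \<in> gr D q"
    and kl: "k \<in> {1..4}" "l \<in> {1..4}" "k \<noteq> l" and c: "c \<in> gr D r"
  defines "h \<equiv> bracket St (F i j a) (F j i b)"
  shows "bracket St h (F k l c) \<in> Nn k l" and "bracket St (F k l c) h \<in> Nn k l"
proof -
  have hg: "h \<in> gr St ((p + dgr i + dgr j) + (q + dgr j + dgr i))"
    unfolding h_def using ij ab by (intro S.br.graded F_gr) auto
  then have hc: "h \<in> carrier St" using S.gr_carrier by blast
  have main: "bracket St h (F k l c) \<in> Nn k l \<and> bracket St (F k l c) h \<in> Nn k l"
    if kl: "k \<in> {1..4}" "l \<in> {1..4}" "k \<noteq> l" and c: "c \<in> gr D r" and ne: "{k, l} \<noteq> {i, j}" for k l c r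
  proof -
    note g1 = F_gr[OF ab(1) ij] and g2 = F_gr[OF ab(2) ij(2,1) ij(3)[symmetric]] and g3 = F_gr[OF c kl]
    note n1 = F_in_Nn[OF ab(1) ij] and n2 = F_in_Nn[OF ab(2) ij(2,1) ij(3)[symmetric]] and n3 = F_in_Nn[OF c kl]
    note c123 = g1[THEN S.gr_carrier] g2[THEN S.gr_carrier] g3[THEN S.gr_carrier]
    note sm = Nn_submodule[OF kl]
    \<comment> \<open>By the Leibniz identity both actions of h are signed sums of these four nested
      brackets. When \<open>{k, l}\<close> differs from \<open>{i, j}\<close>, no intermediate
      bracket pairs opposite positions, so each stays among the root spaces or vanishes.\<close>
    have t: "bracket St (F i j a) (bracket St (F j i b) (F k l c)) \<in> Nn k l \<and>
      bracket St (bracket St (F i j a) (F k l c)) (F j i b) \<in> Nn k l \<and>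
      bracket St (bracket St (F k l c) (F i j a)) (F j i b) \<in> Nn k l \<and>
      bracket St (bracket St (F k l c) (F j i b)) (F i j a) \<in> Nn k l"
    proof -
      note z = S.submodule_zero[OF sm]
      consider "k = i" "l \<noteq> i" "l \<noteq> j" | "k = j" "l \<noteq> i" "l \<noteq> j" | "l = i" "k \<noteq> i" "k \<noteq> j" | "l = j" "k \<noteq> i" "k \<noteq> j"
        | "k \<noteq> i" "k \<noteq> j" "l \<noteq> i" "l \<noteq> j" using ne kl by auto
      then show ?thesis
      proof cases
      case 1
      note n3' = n3[unfolded 1(1)] and kl' = kl[unfolded 1(1)]
      have b1: "bracket St (F j i b) (F i l c) \<in> Nn j l" by (rule Nn_l[OF n2 n3']) (use ij kl' 1 in simp_all)
      have a1: "bracket St (F i j a) (bracket St (F j i b) (F i l c)) \<in> Nn i l" by (rule Nn_l[OF n1 b1]) (use ij kl' 1 in simp_all)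
      have a2: "bracket St (F i j a) (F i l c) = \<zero>\<^bsub>St\<^esub>" by (rule Nn_z[OF n1 n3']) (use ij kl' 1 in simp_all)
      have a3: "bracket St (F i l c) (F i j a) = \<zero>\<^bsub>St\<^esub>" by (rule Nn_z[OF n3' n1]) (use ij kl' 1 in simp_all)
      have b4: "bracket St (F i l c) (F j i b) \<in> Nn j l" by (rule Nn_r[OF n3' n2]) (use ij kl' 1 in simp_all)
      have a4: "bracket St (bracket St (F i l c) (F j i b)) (F i j a) \<in> Nn i l" by (rule Nn_r[OF b4 n1]) (use ij kl' 1 in simp_all)
      show ?thesis unfolding 1(1) using a1 a4 z[unfolded 1(1)] c123 by (simp add: a2 a3)
      next
      case 2
      note n3' = n3[unfolded 2(1)] and kl' = kl[unfolded 2(1)]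
      have a1: "bracket St (F j i b) (F j l c) = \<zero>\<^bsub>St\<^esub>" by (rule Nn_z[OF n2 n3']) (use ij kl' 2 in simp_all)
      have b2: "bracket St (F i j a) (F j l c) \<in> Nn i l" by (rule Nn_l[OF n1 n3']) (use ij kl' 2 in simp_all)
      have a2: "bracket St (bracket St (F i j a) (F j l c)) (F j i b) \<in> Nn j l" by (rule Nn_r[OF b2 n2]) (use ij kl' 2 in simp_all)
      have b3: "bracket St (F j l c) (F i j a) \<in> Nn i l" by (rule Nn_r[OF n3' n1]) (use ij kl' 2 in simp_all)
      have a3: "bracket St (bracket St (F j l c) (F i j a)) (F j i b) \<in> Nn j l" by (rule Nn_r[OF b3 n2]) (use ij kl' 2 in simp_all)
      have a4: "bracket St (F j l c) (F j i b) = \<zero>\<^bsub>St\<^esub>" by (rule Nn_z[OF n3' n2]) (use ij kl' 2 in simp_all)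
      show ?thesis unfolding 2(1) using a2 a3 z[unfolded 2(1)] c123 by (simp add: a1 a4)
      next
      case 3
      note n3' = n3[unfolded 3(1)] and kl' = kl[unfolded 3(1)]
      have a1: "bracket St (F j i b) (F k i c) = \<zero>\<^bsub>St\<^esub>" by (rule Nn_z[OF n2 n3']) (use ij kl' 3 in simp_all)
      have b2: "bracket St (F i j a) (F k i c) \<in> Nn k j" by (rule Nn_r[OF n1 n3']) (use ij kl' 3 in simp_all)
      have a2: "bracket St (bracket St (F i j a) (F k i c)) (F j i b) \<in> Nn k i" by (rule Nn_l[OF b2 n2]) (use ij kl' 3 in simp_all)
      have b3: "bracket St (F k i c) (F i j a) \<in> Nn k j" by (rule Nn_l[OF n3' n1]) (use ij kl' 3 in simp_all)
      have a3: "bracket St (bracket St (F k i c) (F i j a)) (F j i b) \<in> Nn k i" by (rule Nn_l[OF b3 n2]) (use ij kl' 3 in simp_all)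
      have a4: "bracket St (F k i c) (F j i b) = \<zero>\<^bsub>St\<^esub>" by (rule Nn_z[OF n3' n2]) (use ij kl' 3 in simp_all)
      show ?thesis unfolding 3(1) using a2 a3 z[unfolded 3(1)] c123 by (simp add: a1 a4)
      next
      case 4
      note n3' = n3[unfolded 4(1)] and kl' = kl[unfolded 4(1)]
      have b1: "bracket St (F j i b) (F k j c) \<in> Nn k i" by (rule Nn_r[OF n2 n3']) (use ij kl' 4 in simp_all)
      have a1: "bracket St (F i j a) (bracket St (F j i b) (F k j c)) \<in> Nn k j" by (rule Nn_r[OF n1 b1]) (use ij kl' 4 in simp_all)
      have a2: "bracket St (F i j a) (F k j c) = \<zero>\<^bsub>St\<^esub>" by (rule Nn_z[OF n1 n3']) (use ij kl' 4 in simp_all)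
      have a3: "bracket St (F k j c) (F i j a) = \<zero>\<^bsub>St\<^esub>" by (rule Nn_z[OF n3' n1]) (use ij kl' 4 in simp_all)
      have b4: "bracket St (F k j c) (F j i b) \<in> Nn k i" by (rule Nn_l[OF n3' n2]) (use ij kl' 4 in simp_all)
      have a4: "bracket St (bracket St (F k j c) (F j i b)) (F i j a) \<in> Nn k j" by (rule Nn_l[OF b4 n1]) (use ij kl' 4 in simp_all)
      show ?thesis unfolding 4(1) using a1 a4 z[unfolded 4(1)] c123 by (simp add: a2 a3)
      next
      case 5
      have "bracket St (F j i b) (F k l c) = \<zero>\<^bsub>St\<^esub>" by (rule Nn_z[OF n2 n3]) (use ij kl 5 in simp_all)
      moreover have "bracket St (F i j a) (F k l c) = \<zero>\<^bsub>St\<^esub>" by (rule Nn_z[OF n1 n3]) (use ij kl 5 in simp_all)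
      moreover have "bracket St (F k l c) (F j i b) = \<zero>\<^bsub>St\<^esub>" by (rule Nn_z[OF n3 n2]) (use ij kl 5 in simp_all)
      moreover have "bracket St (F k l c) (F i j a) = \<zero>\<^bsub>St\<^esub>" by (rule Nn_z[OF n3 n1]) (use ij kl 5 in simp_all)
      ultimately show ?thesis using z c123 by simp
      qed
    qed
    show ?thesis
      unfolding h_def S.leibniz_left[OF c123(1) g2 g3] S.leibniz_identity[OF c123(3) g1 g2]
      using t by (intro conjI S.submoduleE(5)[OF sm] S.submodule_minus[OF sm] S.submoduleE(4)[OF sm] koszul_closed_R) simp_all
  qed
  have "bracket St h (F k l c) \<in> Nn k l \<and> bracket St (F k l c) h \<in> Nn k l"
  proof (cases "{k, l} = {i, j}")
    case False
    then show ?thesis using main[OF kl c] by blast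
  next
    case True
    obtain u where u: "u \<in> {1..4}" "u \<notin> {k, l, l}" by (rule sl.fourth_index)
    have d: "k \<noteq> u" "u \<noteq> l" "u \<noteq> k" "l \<noteq> u" "l \<noteq> k" using u kl by auto
    \<comment> \<open>The index u lies outside \<open>{k, l} = {i, j}\<close>, so
      \<open>main\<close> applies to both factors of \<open>F k l c\<close>.\<close>
    have s: "{k, u} \<noteq> {i, j}" "{u, l} \<noteq> {i, j}" using True u kl by (auto simp: doubleton_eq_iff)
    note m1 = main[OF kl(1) u(1) d(1) c s(1)] and m2 = main[OF u(1) kl(2) d(2) bar_unit_even s(2)]
    note n1 = F_in_Nn[OF c kl(1) u(1) d(1)] and n2 = F_in_Nn[OF bar_unit_even u(1) kl(2) d(2)]
    note g1 = F_gr[OF c kl(1) u(1) d(1)] and g2 = F_gr[OF bar_unit_even u(1) kl(2) d(2)]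
    note sm = Nn_submodule[OF kl]
    have f: "F k l c = bracket St (F k u c) (F u l \<one>\<^bsub>D\<^esub>)"
      using F_br(1)[OF c bar_unit_even kl(1) u(1) u(1) kl(2) d(1,2) HOL.refl kl(3)] gr_carrier[OF c]
      by (simp add: lprod_bar_unit)
    have "bracket St (bracket St h (F k u c)) (F u l \<one>\<^bsub>D\<^esub>) \<in> Nn k l" "bracket St (bracket St (F k u c) h) (F u l \<one>\<^bsub>D\<^esub>) \<in> Nn k l"
      by (rule Nn_l[OF _ n2 kl(1) u(1) kl(2) d(1,2) kl(3)]; use m1 in blast)+
    moreover have "bracket St (bracket St h (F u l \<one>\<^bsub>D\<^esub>)) (F k u c) \<in> Nn k l"
      by (rule Nn_r[OF _ n1 u(1) kl(2) kl(1) d(2,1) kl(3)]; use m2 in blast)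
    moreover have "bracket St (F k u c) (bracket St (F u l \<one>\<^bsub>D\<^esub>) h) \<in> Nn k l"
      by (rule Nn_l[OF n1 _ kl(1) u(1) kl(2) d(1,2) kl(3)]; use m2 in blast)
    ultimately show ?thesis
      unfolding f S.leibniz_identity[OF hc g1 g2] S.leibniz_left[OF S.gr_carrier[OF g1] g2 hg]
      by (intro conjI S.submoduleE(5)[OF sm] S.submodule_minus[OF sm] S.submoduleE(4)[OF sm] koszul_closed_R)
  qed
  then show "bracket St h (F k l c) \<in> Nn k l" "bracket St (F k l c) h \<in> Nn k l" by auto
qed

end

section \<open>The kernel of the canonical homomorphism\<close>

lemma (in module) submoduleI':
  assumes "P \<subseteq> carrier M" "\<zero>\<^bsub>M\<^esub> \<in> P" "\<And>x y. x \<in> P \<Longrightarrow> y \<in> P \<Longrightarrow> x \<oplus>\<^bsub>M\<^esub> y \<in> P"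
    and s: "\<And>r x. r \<in> carrier R \<Longrightarrow> x \<in> P \<Longrightarrow> r \<odot>\<^bsub>M\<^esub> x \<in> P"
  shows "submodule P R M"
proof (rule submoduleI)
  fix x assume "x \<in> P"
  then show "\<ominus>\<^bsub>M\<^esub> x \<in> P" using s[of "\<ominus> \<one>" x] assms(1) by (simp add: subset_iff smult_l_minus)
qed (use assms in auto)

context unital_superdialgebra
begin

declare atLeastAtMost_iff [simp del]

interpretation sl: sl_cocycle R D Sl4 "bracket Sl4" by (rule sl_cocycle_sl)
interpretation S: leibniz_superalgebra R St by (rule leibniz_stl)

text \<open>The bracket case may assume homogeneous arguments, which the Leibniz identity requires:
  a homogeneous element is the value of a homogeneous term, and a general one is the sum of its two
  components.\<close>

lemma St_induct [consumes 1, case_names gen zero add smult br]: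
  assumes x: "x \<in> carrier St"
    and gen: "\<And>i j a p. \<lbrakk>a \<in> gr D p; i \<in> {1..4}; j \<in> {1..4}; i \<noteq> j\<rbrakk> \<Longrightarrow> Q (F i j a)"
    and zero: "Q \<zero>\<^bsub>St\<^esub>"
    and add: "\<And>x y. \<lbrakk>x \<in> carrier St; y \<in> carrier St; Q x; Q y\<rbrakk> \<Longrightarrow> Q (x \<oplus>\<^bsub>St\<^esub> y)"
    and smult: "\<And>r x. \<lbrakk>r \<in> carrier R; x \<in> carrier St; Q x\<rbrakk> \<Longrightarrow> Q (r \<odot>\<^bsub>St\<^esub> x)"
    and br: "\<And>p q x y. \<lbrakk>x \<in> gr St p; y \<in> gr St q; Q x; Q y\<rbrakk> \<Longrightarrow> Q (bracket St x y)"
  shows "Q x"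
proof -
  let ?e = "\<lambda>(i, j, a). F i j a"
  let ?ev = "lterm_eval St ?e"
  have ev: "?ev t \<in> gr St p" if "homog_term R gens4 p t" for p t
    by (rule lterm_eval_homog[OF leibniz_stl _ that]) (rule F_gens_gr)
  have evQ: "Q (?ev t)" if "homog_term R gens4 p t" for p t
    using that
  proof induction
    case (1 g p)
    obtain i j a where g: "g = (i, j, a)" by (cases g)
    show ?case using 1 gen[of a "p + dgr i + dgr j" i j] by (simp add: g gens4_iff)
  next
    case (2 p)
    then show ?case by (simp add: zero)
  next
    case (3 p s t)
    then show ?case using add[OF S.gr_carrier[OF ev[OF 3(1)]] S.gr_carrier[OF ev[OF 3(2)]]] by simp
  next
    case (4 r p t)
    then show ?case using smult[OF 4(1) S.gr_carrier[OF ev[OF 4(2)]]] by simp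
  next
    case (5 p s q t)
    then show ?case using br[OF ev[OF 5(1)] ev[OF 5(2)]] by simp
  qed
  have h: "Q y" if y: "y \<in> gr St p" for y p
  proof -
    obtain t where t: "homog_term R gens4 p t" "y = ?ev t"
    proof (rule homog_generated[OF leibniz_stl _ _ y])
      show "carrier St \<subseteq> ?ev ` lterms R gens4" using stl_carrier by simp
    qed (rule F_gens_gr)
    show ?thesis unfolding t(2) by (rule evQ[OF t(1)])
  qed
  have "Q (hcomp St 0 x \<oplus>\<^bsub>St\<^esub> hcomp St 1 x)"
    by (intro add h[OF S.hcomp_closed] S.hcomp_carrier x)
  then show ?thesis using S.hcomp_decomp[OF x] by simp
qed

definition "I4 = {(i :: nat, j :: nat). i \<in> {1..4} \<and> j \<in> {1..4} \<and> i \<noteq> j}"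

lemma finite_I4: "finite I4"
  by (rule finite_subset[of _ "{1..4} \<times> {1..4}"]) (auto simp: I4_def)

lemma Fx_in_Nn: "a \<in> carrier D \<Longrightarrow> Fx i j a \<in> Nn i j"
  unfolding Nn_def by blast

lemma Sl4_entry:
  assumes "i \<in> {1..4}" "j \<in> {1..4}"
  shows "x \<in> carrier Sl4 \<Longrightarrow> x (i, j) \<in> carrier D"
    and "(x \<oplus>\<^bsub>Sl4\<^esub> y) (i, j) = x (i, j) \<oplus>\<^bsub>D\<^esub> y (i, j)"
    and "(r \<odot>\<^bsub>Sl4\<^esub> x) (i, j) = r \<odot>\<^bsub>D\<^esub> x (i, j)"
    and "\<zero>\<^bsub>Sl4\<^esub> (i, j) = \<zero>\<^bsub>D\<^esub>"
  using assms mat_entry_closed[of x 2 2 i j] sl_carrier_mat[of x 2 2] by (auto simp: sl_sel)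

lemma I4D: "s \<in> I4 \<Longrightarrow> fst s \<in> {1..4}" "s \<in> I4 \<Longrightarrow> snd s \<in> {1..4}" "s \<in> I4 \<Longrightarrow> fst s \<noteq> snd s"
  by (auto simp: I4_def)

lemma I4_entry:
  assumes "s \<in> I4"
  shows "x \<in> carrier Sl4 \<Longrightarrow> x s \<in> carrier D"
    and "(x \<oplus>\<^bsub>Sl4\<^esub> y) s = x s \<oplus>\<^bsub>D\<^esub> y s"
    and "(r \<odot>\<^bsub>Sl4\<^esub> x) s = r \<odot>\<^bsub>D\<^esub> x s"
    and "\<zero>\<^bsub>Sl4\<^esub> s = \<zero>\<^bsub>D\<^esub>"
  using Sl4_entry[OF I4D(1,2)[OF assms]] by simp_all

lemma elem_mat_entry: "i \<in> {1..4} \<Longrightarrow> j \<in> {1..4} \<Longrightarrow> e4 k l a (i, j) = (if i = k \<and> j = l then a else \<zero>\<^bsub>D\<^esub>)"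
  using elem_entry[of i 2 2 j k l a] by simp

section \<open>Decomposition into root spaces and a weight-zero part\<close>

context
  fixes \<pi> assumes pi: "\<pi> \<in> leibniz_hom R St Sl4"
    and pi_F: "\<And>i j a p. \<lbrakk>a \<in> gr D p; i \<in> {1..4}; j \<in> {1..4}; i \<noteq> j\<rbrakk> \<Longrightarrow> \<pi> (F i j a) = e4 i j a"
begin

interpretation pi: even_linear_map R St Sl4 \<pi>
  by (intro even_linear_map.intro even_linear_map_axioms.intro S.supermodule_axioms leibniz_superalgebra.axioms(1)[OF leibniz_sl]
      leibniz_hom_even_linear[OF pi])

lemma pi_Fx: "\<lbrakk>a \<in> carrier D; i \<in> {1..4}; j \<in> {1..4}; i \<noteq> j\<rbrakk> \<Longrightarrow> \<pi> (Fx i j a) = e4 i j a"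
  unfolding Fx_def using F_closed[of i j "hcomp D 0 a" 0] F_closed[of i j "hcomp D 1 a" 1]
  by (simp add: pi.add pi_F[OF hcomp_closed] hcomp_closed sl.E4_linear[symmetric] hcomp_decomp)

text \<open>The off-diagonal entries of the image, lifted back: the identity on every root space and
  zero on elements with diagonal image.\<close>

definition "off z = (\<Oplus>\<^bsub>St\<^esub>s\<in>I4. Fx (fst s) (snd s) (\<pi> z s))"

lemma off_term: "z \<in> carrier St \<Longrightarrow> s \<in> I4 \<Longrightarrow> Fx (fst s) (snd s) (\<pi> z s) \<in> carrier St"
  by (intro Fx_closed I4D I4_entry(1) pi.closed)

lemma off_closed: "z \<in> carrier St \<Longrightarrow> off z \<in> carrier St"
  unfolding off_def by (intro S.M.finsum_closed funcsetI off_term)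

lemma off_add:
  assumes "x \<in> carrier St" "y \<in> carrier St"
  shows "off (x \<oplus>\<^bsub>St\<^esub> y) = off x \<oplus>\<^bsub>St\<^esub> off y"
proof -
  have "off (x \<oplus>\<^bsub>St\<^esub> y) = (\<Oplus>\<^bsub>St\<^esub>s\<in>I4. Fx (fst s) (snd s) (\<pi> x s) \<oplus>\<^bsub>St\<^esub> Fx (fst s) (snd s) (\<pi> y s))"
    unfolding off_def using assms
    by (intro S.M.finsum_cong') (simp_all add: off_term I4D I4_entry pi.add Fx_add)
  also have "\<dots> = off x \<oplus>\<^bsub>St\<^esub> off y"
    unfolding off_def using assms by (intro S.M.finsum_addf funcsetI off_term)
  finally show ?thesis .
qed

lemma off_smult:
  assumes "r \<in> carrier R" "x \<in> carrier St"
  shows "off (r \<odot>\<^bsub>St\<^esub> x) = r \<odot>\<^bsub>St\<^esub> off x"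
proof -
  have "off (r \<odot>\<^bsub>St\<^esub> x) = (\<Oplus>\<^bsub>St\<^esub>s\<in>I4. r \<odot>\<^bsub>St\<^esub> Fx (fst s) (snd s) (\<pi> x s))"
    unfolding off_def using assms
    by (intro S.M.finsum_cong') (simp_all add: off_term I4D I4_entry pi.smult Fx_smult)
  also have "\<dots> = r \<odot>\<^bsub>St\<^esub> off x"
    unfolding off_def using assms by (intro S.finsum_smult_ldistr[symmetric] finite_I4 funcsetI off_term)
  finally show ?thesis .
qed

lemma Fx_0: "i \<in> {1..4} \<Longrightarrow> j \<in> {1..4} \<Longrightarrow> i \<noteq> j \<Longrightarrow> Fx i j \<zero>\<^bsub>D\<^esub> = \<zero>\<^bsub>St\<^esub>"
  by (simp add: Fx_def F_zero)

lemma off_Fx: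
  assumes a: "a \<in> carrier D" and ij: "i \<in> {1..4}" "j \<in> {1..4}" "i \<noteq> j"
  shows "off (Fx i j a) = Fx i j a"
proof -
  have e: "Fx (fst s) (snd s) (\<pi> (Fx i j a) s) = (if s = (i, j) then Fx i j a else \<zero>\<^bsub>St\<^esub>)" if "s \<in> I4" for s
    using elem_mat_entry[OF I4D(1,2)[OF that], of i j a] I4D[OF that]
    by (cases "s = (i, j)") (auto simp only: pi_Fx[OF a ij] prod.collapse fst_conv snd_conv prod_eq_iff Fx_0 if_True if_False simp_thms)
  have "off (Fx i j a) = (\<Oplus>\<^bsub>St\<^esub>s\<in>I4. if s = (i, j) then Fx i j a else \<zero>\<^bsub>St\<^esub>)"
    unfolding off_def using a ij by (intro S.M.finsum_cong') (simp_all add: e Fx_closed)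
  also have "\<dots> = Fx i j a"
    using a ij by (intro S.M.finsum_single finite_I4 Fx_closed) (auto simp: I4_def)
  finally show ?thesis .
qed

lemma off_diag:
  assumes "z \<in> carrier St" "\<And>i j. \<lbrakk>i \<in> {1..4}; j \<in> {1..4}; i \<noteq> j\<rbrakk> \<Longrightarrow> \<pi> z (i, j) = \<zero>\<^bsub>D\<^esub>"
  shows "off z = \<zero>\<^bsub>St\<^esub>"
proof -
  have "\<pi> z s = \<zero>\<^bsub>D\<^esub>" if "s \<in> I4" for s using assms(2)[OF I4D[OF that]] by simp
  then show ?thesis unfolding off_def by (intro S.M.add.finprod_one_eqI) (simp add: I4D Fx_0)
qed

text \<open>The weight-zero part, described by its action on root spaces instead of as the span of
  the brackets \<open>[F i j a, F j i b]\<close>. In this form it is visibly a submodule, and it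
  contains those brackets by \<open>weight_zero_action\<close>.\<close>

definition "Hh = {h \<in> carrier St. \<forall>i j p c. i \<in> {1..4} \<longrightarrow> j \<in> {1..4} \<longrightarrow> i \<noteq> j \<longrightarrow>
  \<pi> h (i, j) = \<zero>\<^bsub>D\<^esub> \<and> (c \<in> gr D p \<longrightarrow> bracket St h (F i j c) \<in> Nn i j \<and> bracket St (F i j c) h \<in> Nn i j)}"

lemma HhD:
  assumes "h \<in> Hh"
  shows "h \<in> carrier St" "\<lbrakk>i \<in> {1..4}; j \<in> {1..4}; i \<noteq> j\<rbrakk> \<Longrightarrow> \<pi> h (i, j) = \<zero>\<^bsub>D\<^esub>"
    "\<lbrakk>i \<in> {1..4}; j \<in> {1..4}; i \<noteq> j; c \<in> gr D p\<rbrakk> \<Longrightarrow> bracket St h (F i j c) \<in> Nn i j"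
    "\<lbrakk>i \<in> {1..4}; j \<in> {1..4}; i \<noteq> j; c \<in> gr D p\<rbrakk> \<Longrightarrow> bracket St (F i j c) h \<in> Nn i j"
  using assms unfolding Hh_def by blast+

lemma HhI:
  assumes "h \<in> carrier St" "\<And>i j. \<lbrakk>i \<in> {1..4}; j \<in> {1..4}; i \<noteq> j\<rbrakk> \<Longrightarrow> \<pi> h (i, j) = \<zero>\<^bsub>D\<^esub>"
    "\<And>i j c p. \<lbrakk>i \<in> {1..4}; j \<in> {1..4}; i \<noteq> j; c \<in> gr D p\<rbrakk> \<Longrightarrow> bracket St h (F i j c) \<in> Nn i j"
    "\<And>i j c p. \<lbrakk>i \<in> {1..4}; j \<in> {1..4}; i \<noteq> j; c \<in> gr D p\<rbrakk> \<Longrightarrow> bracket St (F i j c) h \<in> Nn i j"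
  shows "h \<in> Hh"
  using assms unfolding Hh_def by blast

lemma Hh_submodule: "submodule Hh R St"
proof (rule S.submoduleI')
  show "Hh \<subseteq> carrier St" unfolding Hh_def by blast
  show "\<zero>\<^bsub>St\<^esub> \<in> Hh"
    by (rule HhI) (simp_all add: Sl4_entry F_closed S.submodule_zero[OF Nn_submodule])
next
  fix x y assume "x \<in> Hh" "y \<in> Hh"
  note H = HhD[OF this(1)] HhD[OF this(2)]
  show "x \<oplus>\<^bsub>St\<^esub> y \<in> Hh"
    by (rule HhI)
      (simp_all add: H Sl4_entry pi.add S.br.linear_simps F_closed S.submoduleE(5)[OF Nn_submodule])
next
  fix r x assume r: "r \<in> carrier R" and "x \<in> Hh"
  note H = HhD[OF this(2)]
  show "r \<odot>\<^bsub>St\<^esub> x \<in> Hh"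
    by (rule HhI)
      (simp_all add: r H Sl4_entry pi.smult S.br.linear_simps F_closed S.submoduleE(4)[OF Nn_submodule])
qed

lemma bracket_in_Hh:
  assumes ij: "i \<in> {1..4}" "j \<in> {1..4}" "i \<noteq> j" and ab: "a \<in> gr D p" "b \<in> gr D q"
  shows "bracket St (F i j a) (F j i b) \<in> Hh"
proof (rule HhI)
  have c: "a \<in> carrier D" "b \<in> carrier D" using ab gr_carrier by auto
  have F: "F i j a \<in> carrier St" "F j i b \<in> carrier St" using F_closed ij ab by auto
  show "bracket St (F i j a) (F j i b) \<in> carrier St" using F by simp
  fix k l :: nat assume kl: "k \<in> {1..4}" "l \<in> {1..4}" "k \<noteq> l"
  interpret A: superdialgebra R "mat_superdialg 2 2 D" by (rule superdialgebra_mat)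
  show "\<pi> (bracket St (F i j a) (F j i b)) (k, l) = \<zero>\<^bsub>D\<^esub>"
    using elem_bracket[OF ab, of i 2 2 j j i] ij kl c lp.closed[of a b] rp.closed[of b a]
    by (simp add: leibniz_homD(5)[OF pi F] pi_F[OF ab(1) ij] pi_F[OF ab(2) ij(2,1) ij(3)[symmetric]] sl_sel
        mat_minus_entry elem_mat_entry A.gr_carrier M.diff_zero) auto
  fix r c assume "c \<in> gr D r"
  then show "bracket St (bracket St (F i j a) (F j i b)) (F k l c) \<in> Nn k l"
    "bracket St (F k l c) (bracket St (F i j a) (F j i b)) \<in> Nn k l"
    using weight_zero_action[OF ij ab kl] by blast+
qed

text \<open>These are the sums of root vectors and an element of \<open>Hh\<close>;
  \<open>Pp_all\<close> shows that nothing else exists.\<close>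

definition "Pp = {z \<in> carrier St. z \<ominus>\<^bsub>St\<^esub> off z \<in> Hh}"

lemma Pp_submodule: "submodule Pp R St"
proof (rule S.submoduleI')
  note H = S.submoduleE(1,4,5)[OF Hh_submodule]
  show "\<zero>\<^bsub>St\<^esub> \<in> Pp"
    using off_diag[of "\<zero>\<^bsub>St\<^esub>"] S.submodule_zero[OF Hh_submodule]
    by (simp add: Pp_def Sl4_entry S.M.diff_zero)
  fix x y assume xy: "x \<in> Pp" "y \<in> Pp"
  then have c: "x \<in> carrier St" "y \<in> carrier St" by (auto simp: Pp_def)
  have "(x \<oplus>\<^bsub>St\<^esub> y) \<ominus>\<^bsub>St\<^esub> off (x \<oplus>\<^bsub>St\<^esub> y) = (x \<ominus>\<^bsub>St\<^esub> off x) \<oplus>\<^bsub>St\<^esub> (y \<ominus>\<^bsub>St\<^esub> off y)"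
    using c off_closed by (simp add: off_add S.M.minus_eq S.M.minus_add S.M.a_ac)
  then show "x \<oplus>\<^bsub>St\<^esub> y \<in> Pp" using xy H(3) by (simp add: Pp_def)
next
  note H = S.submoduleE(1,4,5)[OF Hh_submodule]
  fix r x assume r: "r \<in> carrier R" and x: "x \<in> Pp"
  have "r \<odot>\<^bsub>St\<^esub> x \<ominus>\<^bsub>St\<^esub> off (r \<odot>\<^bsub>St\<^esub> x) = r \<odot>\<^bsub>St\<^esub> (x \<ominus>\<^bsub>St\<^esub> off x)"
    using r x off_closed by (simp add: Pp_def off_smult S.smult_diff)
  then show "r \<odot>\<^bsub>St\<^esub> x \<in> Pp" using r x H(2) by (simp add: Pp_def)
qed (auto simp: Pp_def)

lemma Hh_Pp: "h \<in> Hh \<Longrightarrow> h \<in> Pp"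
  using off_diag[of h] HhD[of h] by (simp add: Pp_def S.M.diff_zero)

lemma Nn_Pp:
  assumes "x \<in> Nn i j" "i \<in> {1..4}" "j \<in> {1..4}" "i \<noteq> j"
  shows "x \<in> Pp"
proof -
  obtain a where a: "a \<in> carrier D" "x = Fx i j a" using assms(1) unfolding Nn_def by blast
  have c: "Fx i j a \<in> carrier St" using a assms(2-4) by (intro Fx_closed)
  show ?thesis using off_Fx[OF a(1) assms(2-4)] S.submodule_zero[OF Hh_submodule] c
    by (simp add: Pp_def a(2) S.M.diff_self)
qed

text \<open>Root spaces at composable positions bracket into a root space, at unrelated positions to
  zero and at opposite positions into \<open>Hh\<close>; elements of \<open>Hh\<close> preserve root
  spaces by definition.\<close>

lemma Pp_bracket_F:
  assumes z: "z \<in> Pp" and c: "c \<in> gr D p" and kl: "k \<in> {1..4}" "l \<in> {1..4}" "k \<noteq> l"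
  shows "bracket St z (F k l c) \<in> Pp"
proof -
  note F = F_closed[OF kl c] and n = F_in_Nn[OF c kl] and sm = Pp_submodule
  have zc: "z \<in> carrier St" "z \<ominus>\<^bsub>St\<^esub> off z \<in> Hh" using z by (auto simp: Pp_def)
  have t: "bracket St (Fx i j d) (F k l c) \<in> Pp" if ij: "i \<in> {1..4}" "j \<in> {1..4}" "i \<noteq> j" and d: "d \<in> carrier D" for i j d
  proof -
    note m = Fx_in_Nn[OF d, of i j]
    consider "j = k" "i \<noteq> l" | "j \<noteq> k" "i = l" | "j \<noteq> k" "i \<noteq> l" | "j = k" "i = l" by blast
    then show ?thesis
    proof cases
      case 1
      show ?thesis by (rule Nn_Pp[OF Nn_bracket(1)[OF m n ij(1,2) kl(1,2) ij(3) kl(3) 1] ij(1) kl(2) 1(2)])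
    next
      case 2
      show ?thesis
        by (rule Nn_Pp[OF Nn_bracket(2)[OF m n ij(1,2) kl(1,2) ij(3) kl(3) 2] kl(1) ij(2) 2(1)[symmetric]])
    next
      case 3
      show ?thesis
        unfolding Nn_bracket(3)[OF m n ij(1,2) kl(1,2) ij(3) kl(3) 3] by (rule S.submodule_zero[OF sm])
    next
      case 4
      have f: "F i j (hcomp D p d) \<in> carrier St" for p using F_closed[OF ij hcomp_closed[OF d]] .
      have "bracket St (F i j (hcomp D p d)) (F k l c) \<in> Pp" for p
        unfolding 4 using bracket_in_Hh[OF ij hcomp_closed[OF d] c, of p] 4 by (intro Hh_Pp) simp
      then show ?thesis
        unfolding Fx_def using S.submoduleE(5)[OF sm] f F by (simp add: S.br.add_l)
    qed
  qed
  have "bracket St (off z) (F k l c) = (\<Oplus>\<^bsub>St\<^esub>s\<in>I4. bracket St (Fx (fst s) (snd s) (\<pi> z s)) (F k l c))"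
    unfolding off_def using zc F finite_I4 by (intro S.br.finsum_l) (auto intro: off_term)
  also have "\<dots> \<in> Pp"
    using zc(1) by (intro S.submodule_finsum[OF sm] finite_I4 t) (auto simp: I4_def Sl4_entry)
  finally have 1: "bracket St (off z) (F k l c) \<in> Pp" .
  have 2: "bracket St (z \<ominus>\<^bsub>St\<^esub> off z) (F k l c) \<in> Pp"
    by (rule Nn_Pp[OF HhD(3)[OF zc(2) kl c] kl])
  have "z = (z \<ominus>\<^bsub>St\<^esub> off z) \<oplus>\<^bsub>St\<^esub> off z"
    using zc off_closed by (simp add: S.M.minus_eq S.M.a_assoc S.M.l_neg)
  then have "bracket St z (F k l c) = bracket St ((z \<ominus>\<^bsub>St\<^esub> off z) \<oplus>\<^bsub>St\<^esub> off z) (F k l c)" by simp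
  also have "\<dots> = bracket St (z \<ominus>\<^bsub>St\<^esub> off z) (F k l c) \<oplus>\<^bsub>St\<^esub> bracket St (off z) (F k l c)"
    using zc off_closed F by (intro S.br.add_l) simp_all
  finally show ?thesis using S.submoduleE(5)[OF sm 2 1] by simp
qed

text \<open>The quantifier over z is inside the induction, so that the Leibniz identity reduces a
  bracket with \<open>[x, y]\<close> to successive brackets with x and y.\<close>

lemma Pp_bracket:
  assumes "y \<in> carrier St"
  shows "\<forall>z\<in>Pp. bracket St z y \<in> Pp"
  using assms
proof (induction rule: St_induct)
  case (gen i j a p)
  then show ?case using Pp_bracket_F by blast
next
  case zero
  then show ?case using S.submodule_zero[OF Pp_submodule] by (simp add: Pp_def)
next
  case (add x y)
  have "bracket St z (x \<oplus>\<^bsub>St\<^esub> y) \<in> Pp" if z: "z \<in> Pp" for z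
  proof -
    have "z \<in> carrier St" using z by (simp add: Pp_def)
    then show ?thesis using add(1,2) bspec[OF add(3) z] bspec[OF add(4) z] S.submoduleE(5)[OF Pp_submodule]
      by (simp add: S.br.add_r)
  qed
  then show ?case by blast
next
  case (smult r x)
  have "bracket St z (r \<odot>\<^bsub>St\<^esub> x) \<in> Pp" if z: "z \<in> Pp" for z
  proof -
    have "z \<in> carrier St" using z by (simp add: Pp_def)
    then show ?thesis using smult(1,2) bspec[OF smult(3) z] S.submoduleE(4)[OF Pp_submodule]
      by (simp add: S.br.smult_r)
  qed
  then show ?case by blast
next
  case (br p q x y)
  have "bracket St z (bracket St x y) \<in> Pp" if z: "z \<in> Pp" for z
  proof -
    have "z \<in> carrier St" using z by (simp add: Pp_def)
    then show ?thesis
      unfolding S.leibniz_identity[OF \<open>z \<in> carrier St\<close> br(1,2)]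
      using bspec[OF br(4) bspec[OF br(3) z]] bspec[OF br(3) bspec[OF br(4) z]]
      by (intro S.submodule_minus[OF Pp_submodule] S.submoduleE(4)[OF Pp_submodule] koszul_closed_R)
  qed
  then show ?case by blast
qed

lemma Pp_all:
  assumes "x \<in> carrier St"
  shows "x \<in> Pp"
  using assms
proof (induction rule: St_induct)
  case (gen i j a p)
  then show ?case using Nn_Pp F_in_Nn by blast
next
  case zero
  then show ?case by (rule S.submodule_zero[OF Pp_submodule])
next
  case (add x y)
  then show ?case using S.submoduleE(5)[OF Pp_submodule] by blast
next
  case (smult r x)
  then show ?case using S.submoduleE(4)[OF Pp_submodule] by blast
next
  case (br p q x y)
  then show ?case using Pp_bracket[OF S.gr_carrier[OF br(2)]] by blast
qed

text \<open>The entry at \<open>(i, j)\<close> of the image recovers a, so \<pi> is injective on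
  each root space.\<close>

lemma Nn_pi_zero:
  assumes "x \<in> Nn i j" "\<pi> x = \<zero>\<^bsub>Sl4\<^esub>" and ij: "i \<in> {1..4}" "j \<in> {1..4}" "i \<noteq> j"
  shows "x = \<zero>\<^bsub>St\<^esub>"
proof -
  obtain a where a: "a \<in> carrier D" "x = Fx i j a" using assms(1) unfolding Nn_def by blast
  have "e4 i j a = \<zero>\<^bsub>Sl4\<^esub>" using assms(2) pi_Fx[OF a(1) ij] by (simp add: a(2))
  then have "e4 i j a (i, j) = \<zero>\<^bsub>D\<^esub>" using ij by (simp only: Sl4_entry)
  then have "a = \<zero>\<^bsub>D\<^esub>" using ij by (simp add: elem_mat_entry)
  then show ?thesis by (simp add: a(2) Fx_0[OF ij])
qed

text \<open>An element of the kernel has no off-diagonal part, so it lies in \<open>Hh\<close>. Its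
  brackets with a generator then lie in one root space and in the kernel, hence vanish; homogeneity
  of z lets \<open>leibniz_left\<close> pass from generators to brackets.\<close>

lemma kernel_central_homog:
  assumes z: "z \<in> gr St r" "\<pi> z = \<zero>\<^bsub>Sl4\<^esub>" and x: "x \<in> carrier St"
  shows "bracket St z x = \<zero>\<^bsub>St\<^esub> \<and> bracket St x z = \<zero>\<^bsub>St\<^esub>"
proof -
  have zc: "z \<in> carrier St" using z S.gr_carrier by blast
  have "off z = \<zero>\<^bsub>St\<^esub>" using zc z by (intro off_diag) (simp_all add: Sl4_entry)
  then have H: "z \<in> Hh" using Pp_all[OF zc] by (simp add: Pp_def S.M.diff_zero zc)
  show ?thesis using x
  proof (induction rule: St_induct)
    case (gen i j a p)
    have F: "F i j a \<in> carrier St" using gen by (intro F_closed)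
    show ?case
      by (intro conjI; rule Nn_pi_zero[OF _ _ gen(2-4)])
        (use HhD(3,4)[OF H gen(2-4,1)] F zc z in \<open>simp_all add: leibniz_homD(5)[OF pi]\<close>)
  next
    case zero
    then show ?case using zc by simp
  next
    case (add x y)
    then show ?case using zc by (simp add: S.br.linear_simps)
  next
    case (smult r x)
    then show ?case using zc by (simp add: S.br.linear_simps)
  next
    case (br p q x y)
    then show ?case
      using S.leibniz_identity[OF zc br(1,2)] S.leibniz_left[OF S.gr_carrier[OF br(1)] br(2) z(1)]
      by (simp add: S.gr_carrier S.M.diff_zero)
  qed
qed

lemma kernel_central:
  assumes z: "z \<in> carrier St" "\<pi> z = \<zero>\<^bsub>Sl4\<^esub>" and x: "x \<in> carrier St"
  shows "bracket St z x = \<zero>\<^bsub>St\<^esub>" "bracket St x z = \<zero>\<^bsub>St\<^esub>"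
proof -
  have "\<pi> (hcomp St p z) = \<zero>\<^bsub>Sl4\<^esub>" for p using pi.hcomp[OF z(1), of p] z(2) by simp
  note h = kernel_central_homog[OF S.hcomp_closed[OF z(1)] this x]
  have "bracket St (hcomp St 0 z \<oplus>\<^bsub>St\<^esub> hcomp St 1 z) x = \<zero>\<^bsub>St\<^esub>"
    "bracket St x (hcomp St 0 z \<oplus>\<^bsub>St\<^esub> hcomp St 1 z) = \<zero>\<^bsub>St\<^esub>"
    using h z x by (simp_all add: S.br.linear_simps)
  then show "bracket St z x = \<zero>\<^bsub>St\<^esub>" "bracket St x z = \<zero>\<^bsub>St\<^esub>" using S.hcomp_decomp[OF z(1)] by simp_all
qed

end

end

section \<open>Central extensions of the special linear superalgebra\<close>

text \<open>Preimages in M differ by central elements, so the bracket of M depends only on the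
  images. Every property of B can therefore be checked on whichever preimages are
  convenient.\<close>

lemma central_extension_lift:
  assumes ce: "central_extension R M L \<phi>"
  obtains B where "leibniz_cocycle R L M B"
    and "\<And>m n. m \<in> carrier M \<Longrightarrow> n \<in> carrier M \<Longrightarrow> B (\<phi> m) (\<phi> n) = bracket M m n"
    and "\<And>x y. x \<in> carrier L \<Longrightarrow> y \<in> carrier L \<Longrightarrow> \<phi> (B x y) = bracket L x y"
proof -
  have M: "leibniz_superalgebra R M" and L: "leibniz_superalgebra R L" and phi: "\<phi> \<in> leibniz_hom R M L"
    and surj: "\<phi> ` carrier M = carrier L" and ker: "a_kernel M L \<phi> \<subseteq> centre M"
    using ce unfolding central_extension_def by simp_all
  interpret M: leibniz_superalgebra R M by fact
  interpret L: leibniz_superalgebra R L by fact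
  interpret phi: even_linear_map R M L \<phi>
    by (intro even_linear_map.intro even_linear_map_axioms.intro M.supermodule_axioms L.supermodule_axioms
        leibniz_hom_even_linear[OF phi])
  define s where "s x = (SOME m. m \<in> carrier M \<and> \<phi> m = x)" for x
  define B where "B x y = bracket M (s x) (s y)" for x y
  have cr: "\<exists>m\<in>carrier M. x = \<phi> m" if "x \<in> carrier L" for x
    using that unfolding surj[symmetric] by (rule imageE) (rule bexI)
  have s: "s x \<in> carrier M" "\<phi> (s x) = x" if "x \<in> carrier L" for x
  proof -
    have "\<exists>m. m \<in> carrier M \<and> \<phi> m = x" using cr[OF that] by (elim bexE) (intro exI conjI; simp)
    then have "s x \<in> carrier M \<and> \<phi> (s x) = x" unfolding s_def by (rule someI_ex)
    then show "s x \<in> carrier M" "\<phi> (s x) = x" by auto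
  qed
  have z: "s (\<phi> m) \<ominus>\<^bsub>M\<^esub> m \<in> centre M" if "m \<in> carrier M" for m
  proof -
    have "s (\<phi> m) \<ominus>\<^bsub>M\<^esub> m \<in> a_kernel M L \<phi>"
      using that s[of "\<phi> m"] by (simp add: a_kernel_def' phi.minus L.M.diff_self)
    then show ?thesis by (rule subsetD[OF ker])
  qed
  have B: "B (\<phi> m) (\<phi> n) = bracket M m n" if "m \<in> carrier M" "n \<in> carrier M" for m n
  proof -
    note sc = s(1)[OF phi.closed]
    have d: "s (\<phi> m) = m \<oplus>\<^bsub>M\<^esub> (s (\<phi> m) \<ominus>\<^bsub>M\<^esub> m)" if "m \<in> carrier M" for m
      using that sc M.M.a_lcomm[of m "s (\<phi> m)" "\<ominus>\<^bsub>M\<^esub> m"] by (simp add: M.M.minus_eq M.M.r_neg)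
    have zc: "s (\<phi> m) \<ominus>\<^bsub>M\<^esub> m \<in> carrier M" if "m \<in> carrier M" for m using that sc by simp
    have c: "bracket M (s (\<phi> m) \<ominus>\<^bsub>M\<^esub> m) x = \<zero>\<^bsub>M\<^esub>" "bracket M x (s (\<phi> m) \<ominus>\<^bsub>M\<^esub> m) = \<zero>\<^bsub>M\<^esub>"
      if "m \<in> carrier M" "x \<in> carrier M" for m x
      using z[OF that(1)] that(2) by (auto simp: centre_def)
    have "B (\<phi> m) (\<phi> n) = bracket M (m \<oplus>\<^bsub>M\<^esub> (s (\<phi> m) \<ominus>\<^bsub>M\<^esub> m)) (n \<oplus>\<^bsub>M\<^esub> (s (\<phi> n) \<ominus>\<^bsub>M\<^esub> n))"
      unfolding B_def using d[OF that(1)] d[OF that(2)] by simp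
    also have "\<dots> = bracket M m n"
      using that zc by (simp add: M.br.linear_simps(1,2) c)
    finally show ?thesis .
  qed
  \<comment> \<open>The component of an arbitrary preimage is a homogeneous preimage, because \<phi>
    is even.\<close>
  have gr: "\<exists>m\<in>gr M p. x = \<phi> m" if x: "x \<in> gr L p" for x p
  proof -
    note c = L.gr_carrier[OF x]
    have "\<phi> (hcomp M p (s x)) = x" using phi.hcomp[of "s x" p] s[OF c] L.hcomp_homog[OF x, of p] by simp
    then show ?thesis using M.hcomp_closed[OF s(1)[OF c], of p] by (intro bexI[of _ "hcomp M p (s x)"]) simp_all
  qed

  note F = leibniz_homD[OF phi]
  have bl: "B x y \<in> carrier M" "\<phi> (B x y) = bracket L x y" if "x \<in> carrier L" "y \<in> carrier L" for x y
    using s that by (simp_all add: B_def F(5))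
  have "leibniz_cocycle R L M B"
    unfolding leibniz_cocycle_def even_bilinear_map_def
  proof (intro conjI ballI allI)
    fix x y assume "x \<in> carrier L" "y \<in> carrier L" then show "B x y \<in> carrier M" by (rule bl)
  next
    fix x x' y assume "x \<in> carrier L" "x' \<in> carrier L" "y \<in> carrier L"
    from this[THEN cr] obtain m m' n where m: "m \<in> carrier M" "m' \<in> carrier M" "n \<in> carrier M"
      "x = \<phi> m" "x' = \<phi> m'" "y = \<phi> n" by (elim bexE)
    show "B (x \<oplus>\<^bsub>L\<^esub> x') y = B x y \<oplus>\<^bsub>M\<^esub> B x' y" "B y (x \<oplus>\<^bsub>L\<^esub> x') = B y x \<oplus>\<^bsub>M\<^esub> B y x'"
      using m(1-3) unfolding m(4-6) by (simp_all add: phi.add[symmetric] B M.br.linear_simps)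
  next
    fix r x y assume r: "r \<in> carrier R" and "x \<in> carrier L" "y \<in> carrier L"
    from this(2,3)[THEN cr] obtain m n where m: "m \<in> carrier M" "n \<in> carrier M" "x = \<phi> m" "y = \<phi> n"
      by (elim bexE)
    show "B (r \<odot>\<^bsub>L\<^esub> x) y = r \<odot>\<^bsub>M\<^esub> B x y" "B x (r \<odot>\<^bsub>L\<^esub> y) = r \<odot>\<^bsub>M\<^esub> B x y"
      using r m(1,2) unfolding m(3,4) by (simp_all add: phi.smult[symmetric] B M.br.linear_simps)
  next
    fix p q x y assume "x \<in> gr L p" "y \<in> gr L q"
    from this[THEN gr] obtain m n where m: "m \<in> gr M p" "n \<in> gr M q" "x = \<phi> m" "y = \<phi> n" by (elim bexE)
    then show "B x y \<in> gr M (p + q)" by (simp add: B M.gr_carrier M.br.graded)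
  next
    fix p q x y z assume "x \<in> carrier L" "y \<in> gr L p" "z \<in> gr L q"
    from cr[OF this(1)] this(2,3)[THEN gr] obtain m n k where m: "m \<in> carrier M" "n \<in> gr M p" "k \<in> gr M q"
      "x = \<phi> m" "y = \<phi> n" "z = \<phi> k" by (elim bexE)
    then show "B x (bracket L y z) = B (bracket L x y) z \<ominus>\<^bsub>M\<^esub> koszul R (p * q) \<odot>\<^bsub>M\<^esub> B (bracket L x z) y"
      using M.leibniz_identity[OF m(1-3)] M.gr_carrier[OF m(2)] M.gr_carrier[OF m(3)]
      by (simp add: F(5)[symmetric] B)
  qed
  then show thesis by (rule that[OF _ B bl(2)])
qed

context minor
begin

interpretation V: supermodule R V4 by (rule supermodule_dialg_quot)
interpretation \<tau>: bilinear_map R D V4 "\<tau> \<kappa>"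
  by (intro bilinear_map.intro bilinear_map_axioms.intro supermodule_axioms V.supermodule_axioms tau_bilinear)

lemma mnr_elem:
  assumes c: "x \<in> carrier D" "y \<in> carrier D"
  shows "mnr (e4 a b x) (e4 a' b' y) =
    (if a = i \<and> b = j \<and> a' = k \<and> b' = l \<or> a = k \<and> b = l \<and> a' = i \<and> b' = j then \<tau> \<kappa> x y
     else if a = i \<and> b = l \<and> a' = k \<and> b' = j \<or> a = k \<and> b = j \<and> a' = i \<and> b' = l then \<ominus>\<^bsub>V4\<^esub> \<tau> \<kappa> x y
     else \<zero>\<^bsub>V4\<^esub>)"
proof -
  have e: "\<tau> \<kappa> (e4 a b x (u, v)) (e4 a' b' y (u', v')) =
    (if a = u \<and> b = v \<and> a' = u' \<and> b' = v' then \<tau> \<kappa> x y else \<zero>\<^bsub>V4\<^esub>)"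
    if "u \<in> {1..4}" "v \<in> {1..4}" "u' \<in> {1..4}" "v' \<in> {1..4}" for u v u' v'
    using elem_mat_entry[OF that(1,2), of a b x] elem_mat_entry[OF that(3,4), of a' b' y] c
    by (cases "a = u"; cases "b = v"; cases "a' = u'"; cases "b' = v'") simp_all
  consider "a = i" | "a = k" | "a \<noteq> i" "a \<noteq> k" by blast
  then show ?thesis
    unfolding mnr_def
    by cases (simp_all add: e c V.M.diff_zero V.M.zero_diff V.M.minus_eq)
qed

lemma mnr_elem_zero:
  assumes "x \<in> carrier D" "y \<in> carrier D" "\<not> ({a, a'} = {i, k} \<and> {b, b'} = {j, l})"
  shows "mnr (e4 a b x) (e4 a' b' y) = \<zero>\<^bsub>V4\<^esub>"
proof -
  have "\<not> (a = i \<and> b = j \<and> a' = k \<and> b' = l)" "\<not> (a = k \<and> b = l \<and> a' = i \<and> b' = j)"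
    "\<not> (a = i \<and> b = l \<and> a' = k \<and> b' = j)" "\<not> (a = k \<and> b = j \<and> a' = i \<and> b' = l)"
    using assms(3) by auto
  then show ?thesis using mnr_elem[OF assms(1,2), of a b a' b'] by (simp only: simp_thms if_False)
qed

end

text \<open>The middle clause covers all pairs of off-diagonal positions, including those outside
  the minor. The last clause writes the values of h as sums of lifted brackets, from which it is
  later read off that they lie in the kernel of the extension.\<close>

lemma (in minor_lift) minor_lift_elem:
  obtains h where "even_linear R V4 M h"
    and "\<And>a b a' b' x y p q. \<lbrakk>x \<in> gr D p; y \<in> gr D q; a \<noteq> b; a' \<noteq> b'\<rbrakk> \<Longrightarrow>
      h (mnr (E4 a b x) (E4 a' b' y)) = (if {a, a'} = {i, k} \<and> {b, b'} = {j, l} then B (E4 a b x) (E4 a' b' y) else \<zero>\<^bsub>M\<^esub>)"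
    and "\<And>v. v \<in> carrier V4 \<Longrightarrow> \<exists>a\<in>gr D 0. \<exists>b\<in>gr D 1. h v =
      B (E4 i j a) (E4 k l \<one>\<^bsub>D\<^esub>) \<oplus>\<^bsub>M\<^esub> B (E4 i j b) (E4 k l \<one>\<^bsub>D\<^esub>)"
proof -
  interpret V: supermodule R V4 by (rule supermodule_dialg_quot)
  interpret \<tau>: bilinear_map R D V4 "\<tau> \<kappa>"
    by (intro bilinear_map.intro bilinear_map_axioms.intro supermodule_axioms V.supermodule_axioms tau_bilinear)
  obtain h where h: "even_linear R V4 M h"
    "\<And>a b p q. a \<in> gr D p \<Longrightarrow> b \<in> gr D q \<Longrightarrow> B (E4 i j a) (E4 k l b) = h (\<tau> \<kappa> a b)"
    "\<And>a b p q. a \<in> gr D p \<Longrightarrow> b \<in> gr D q \<Longrightarrow> B (E4 i l a) (E4 k j b) = \<ominus>\<^bsub>M\<^esub> h (\<tau> \<kappa> a b)"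
    "\<And>a b p q. a \<in> gr D p \<Longrightarrow> b \<in> gr D q \<Longrightarrow> B (E4 k j a) (E4 i l b) = \<ominus>\<^bsub>M\<^esub> h (\<tau> \<kappa> a b)"
    "\<And>a b p q. a \<in> gr D p \<Longrightarrow> b \<in> gr D q \<Longrightarrow> B (E4 k l a) (E4 i j b) = h (\<tau> \<kappa> a b)"
    by (rule minor_lift) blast
  interpret h: even_linear_map R V4 M h
    by (intro even_linear_map.intro V.supermodule_axioms supermodule_M even_linear_map_axioms.intro h(1))
  show thesis
  proof (rule that[OF h(1)])
    fix a b a' b' :: nat and x y p q
    assume xy: "x \<in> gr D p" "y \<in> gr D q" and "a \<noteq> b" "a' \<noteq> b'"
    have cc: "x \<in> carrier D" "y \<in> carrier D" using xy gr_carrier by auto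
    show "h (mnr (E4 a b x) (E4 a' b' y)) = (if {a, a'} = {i, k} \<and> {b, b'} = {j, l} then B (E4 a b x) (E4 a' b' y) else \<zero>\<^bsub>M\<^esub>)"
    proof (cases "{a, a'} = {i, k} \<and> {b, b'} = {j, l}")
      case False
      show ?thesis unfolding mnr_elem_zero[OF cc False] if_not_P[OF False] by simp
    next
      case True
      then consider "a = i \<and> a' = k \<and> b = j \<and> b' = l" | "a = i \<and> a' = k \<and> b = l \<and> b' = j"
        | "a = k \<and> a' = i \<and> b = j \<and> b' = l" | "a = k \<and> a' = i \<and> b = l \<and> b' = j"
        by (metis doubleton_eq_iff)
      then show ?thesis
        unfolding if_P[OF True] mnr_elem[OF cc] using h(2-5)[OF xy] cc
        by cases (simp_all add: h.uminus)
    qed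
  next
    fix v assume v: "v \<in> carrier V4"
    interpret q: graded_submodule R D "I_ideal R D \<kappa>" by (rule graded_submodule_I)
    obtain a where a: "a \<in> carrier D" "v = cl \<kappa> a" using v by (auto simp: dialg_quot_def q.quot_sel)
    \<comment> \<open>The bar-unit is even and \<open>a \<stileturn> 1 = a\<close>, so the class of
      a is a value of \<tau>.\<close>
    have t: "v = \<tau> \<kappa> a \<one>\<^bsub>D\<^esub>"
      using a v by (simp add: tau_homog[OF _ bar_unit_even] lprod_bar_unit)
    also have "\<dots> = \<tau> \<kappa> (hcomp D 0 a) \<one>\<^bsub>D\<^esub> \<oplus>\<^bsub>V4\<^esub> \<tau> \<kappa> (hcomp D 1 a) \<one>\<^bsub>D\<^esub>"
      using a(1) by (simp add: \<tau>.add_l[symmetric] hcomp_decomp)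
    finally have "h v = B (E4 i j (hcomp D 0 a)) (E4 k l \<one>\<^bsub>D\<^esub>) \<oplus>\<^bsub>M\<^esub> B (E4 i j (hcomp D 1 a)) (E4 k l \<one>\<^bsub>D\<^esub>)"
      using a(1) by (simp add: h.add h(2)[OF hcomp_closed bar_unit_even])
    then show "\<exists>a\<in>gr D 0. \<exists>b\<in>gr D 1. h v =
        B (E4 i j a) (E4 k l \<one>\<^bsub>D\<^esub>) \<oplus>\<^bsub>M\<^esub> B (E4 i j b) (E4 k l \<one>\<^bsub>D\<^esub>)"
      using hcomp_closed[OF a(1)] by blast
  qed
qed

text \<open>The six ordered pairs \<open>({i, k}, {j, l})\<close> of complementary two-element sets: \<open>\<kappa> = 2\<close> when the rows
  have different parity and \<open>\<kappa> = 0\<close> when they have the same.\<close>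

definition minor_index :: "nat \<Rightarrow> nat \<Rightarrow> nat \<times> nat \<times> nat \<times> nat" where
  "minor_index \<kappa> w = (if \<kappa> = 2 then [(1, 3, 2, 4), (1, 4, 2, 3), (2, 3, 1, 4), (2, 4, 1, 3)] ! w
     else [(1, 2, 3, 4), (3, 4, 1, 2)] ! w)"

definition "minor_count \<kappa> = (if \<kappa> = 2 then 4 else 2 :: nat)"

lemma minor_index_cases:
  assumes "\<kappa> = 2 \<or> \<kappa> = 0" "w < minor_count \<kappa>" "minor_index \<kappa> w = (i, k, j, l)"
  shows "\<kappa> = 2 \<and> w = 0 \<and> (i, k, j, l) = (1, 3, 2, 4) \<or> \<kappa> = 2 \<and> w = 1 \<and> (i, k, j, l) = (1, 4, 2, 3) \<or>
    \<kappa> = 2 \<and> w = 2 \<and> (i, k, j, l) = (2, 3, 1, 4) \<or> \<kappa> = 2 \<and> w = 3 \<and> (i, k, j, l) = (2, 4, 1, 3) \<or>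
    \<kappa> = 0 \<and> w = 0 \<and> (i, k, j, l) = (1, 2, 3, 4) \<or> \<kappa> = 0 \<and> w = 1 \<and> (i, k, j, l) = (3, 4, 1, 2)"
proof -
  consider (two) "\<kappa> = 2" "w < 4" | (zero) "\<kappa> = 0" "w < 2"
    using assms(1,2) by (cases "\<kappa> = 2") (simp_all add: minor_count_def)
  then show ?thesis
  proof cases
    case two
    then have "w = 0 \<or> w = 1 \<or> w = 2 \<or> w = 3" by arith
    then show ?thesis using assms(3) two(1) by (elim disjE) (simp_all add: minor_index_def)
  next
    case zero
    then have "w = 0 \<or> w = 1" by arith
    then show ?thesis using assms(3) zero(1) by (elim disjE) (simp_all add: minor_index_def)
  qed
qed

lemma interval4: "{1..2 + 2} = {1, 2, 3, 4 :: nat}" by auto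

section \<open>The cocycle on sl assembled from the six minors, and its extension\<close>

context unital_superdialgebra
begin

definition "minor_map \<kappa> w = (case minor_index \<kappa> w of (i, k, j, l) \<Rightarrow> minor.mnr R D \<kappa> i k j l)"

lemma minor_index_minor:
  assumes "\<kappa> = 2 \<or> \<kappa> = 0" "w < minor_count \<kappa>" "minor_index \<kappa> w = (i, k, j, l)"
  shows "minor R D \<kappa> i k j l"
    and "\<kappa> = 2 \<and> idx_deg 2 j \<noteq> idx_deg 2 l \<or>
      \<kappa> = 0 \<and> idx_deg 2 k = idx_deg 2 i \<and> idx_deg 2 j = idx_deg 2 i + 1 \<and> idx_deg 2 l = idx_deg 2 i + 1"
proof -
  note c = minor_index_cases[OF assms]
  have "{i, k, j, l} = {1..2 + 2}" "distinct [i, k, j, l]" unfolding interval4 using c by auto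
  moreover show "\<kappa> = 2 \<and> idx_deg 2 j \<noteq> idx_deg 2 l \<or>
      \<kappa> = 0 \<and> idx_deg 2 k = idx_deg 2 i \<and> idx_deg 2 j = idx_deg 2 i + 1 \<and> idx_deg 2 l = idx_deg 2 i + 1"
    using c by (auto simp: idx_deg_def)
  ultimately show "minor R D \<kappa> i k j l"
    by (intro minor.intro unital_superdialgebra_axioms minor_axioms.intro) auto
qed

lemma minor_map_cocycle:
  assumes "\<kappa> = 2 \<or> \<kappa> = 0" "w < minor_count \<kappa>"
  shows "leibniz_cocycle R Sl4 (dialg_quot R D \<kappa>) (minor_map \<kappa> w)"
proof -
  obtain i k j l where t: "minor_index \<kappa> w = (i, k, j, l)" by (metis prod_cases4)
  show ?thesis unfolding minor_map_def t using minor.minor_cocycle[OF minor_index_minor(1)[OF assms t]] by simp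
qed

abbreviation "Vv \<equiv> supermodule_power (dialg_quot R D 2) 4 \<oplus>\<^sub>s supermodule_power (dialg_quot R D 0) 2"

definition "\<Psi> x y = ((\<lambda>w\<in>{..<4 :: nat}. minor_map 2 w x y), (\<lambda>w\<in>{..<2 :: nat}. minor_map 0 w x y))"

lemma supermodule_Vv: "supermodule R Vv"
  by (intro supermodule_sum supermodule_power supermodule_dialg_quot)

lemma Psi_cocycle: "leibniz_cocycle R Sl4 Vv \<Psi>"
  unfolding \<Psi>_def[abs_def]
  by (intro cocycle_sum cocycle_power supermodule_power supermodule_dialg_quot leibniz_sl minor_map_cocycle)
    (simp_all add: minor_count_def)

definition "stl_ext \<pi> = with_bracket (St \<oplus>\<^sub>s Vv)
  (\<lambda>x y. (bracket St (fst x) (fst y), \<Psi> (\<pi> (fst x)) (\<pi> (fst y))))"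

context
  fixes \<pi> assumes pi: "\<pi> \<in> leibniz_hom R St Sl4"
begin

lemma leibniz_stl_ext: "leibniz_superalgebra R (stl_ext \<pi>)"
  unfolding stl_ext_def
  by (rule cocycle_extension[OF leibniz_stl supermodule_Vv
        cocycle_pullback[OF leibniz_stl leibniz_sl pi supermodule_Vv Psi_cocycle]])

lemma stl_ext_sel:
  "carrier (stl_ext \<pi>) = carrier St \<times> carrier Vv" "\<zero>\<^bsub>stl_ext \<pi>\<^esub> = (\<zero>\<^bsub>St\<^esub>, \<zero>\<^bsub>Vv\<^esub>)"
  "(a, b) \<oplus>\<^bsub>stl_ext \<pi>\<^esub> (a', b') = (a \<oplus>\<^bsub>St\<^esub> a', b \<oplus>\<^bsub>Vv\<^esub> b')"
  "r \<odot>\<^bsub>stl_ext \<pi>\<^esub> (a, b) = (r \<odot>\<^bsub>St\<^esub> a, r \<odot>\<^bsub>Vv\<^esub> b)"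
  "gr (stl_ext \<pi>) p = gr St p \<times> gr Vv p"
  "bracket (stl_ext \<pi>) (a, b) (a', b') = (bracket St a a', \<Psi> (\<pi> a) (\<pi> a'))"
  by (simp_all add: stl_ext_def supermodule_sum_def[of St Vv])

text \<open>A kernel element is \<open>(s, v)\<close> with \<open>\<pi> s = 0\<close>. Then s is
  central by \<open>kernel_central\<close>, and \<Psi> vanishes when one argument is zero, so v is
  arbitrary.\<close>

lemma stl_ext_central:
  assumes pi_F: "\<And>i j a p. \<lbrakk>a \<in> gr D p; i \<in> {1..4}; j \<in> {1..4}; i \<noteq> j\<rbrakk> \<Longrightarrow> \<pi> (F i j a) = e4 i j a"
    and surj: "\<pi> ` carrier St = carrier Sl4"
  shows "central_extension R (stl_ext \<pi>) Sl4 (\<pi> \<circ> fst)"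
  unfolding central_extension_def
proof (intro conjI leibniz_stl_ext leibniz_sl)
  interpret P: cocycle R Sl4 Vv \<Psi>
    by (intro cocycle.intro cocycle_axioms.intro leibniz_sl supermodule_Vv Psi_cocycle)
  note F = leibniz_homD[OF pi]
  show "\<pi> \<circ> fst \<in> leibniz_hom R (stl_ext \<pi>) Sl4"
    unfolding leibniz_hom_def
  proof (intro CollectI conjI ballI allI funcsetI)
  qed (auto simp: stl_ext_sel F simp del: sum_sel)
  have "carrier Vv \<noteq> {}" using P.V.M.zero_closed by blast
  then have "fst ` carrier (stl_ext \<pi>) = carrier St" unfolding stl_ext_sel by (simp only: fst_image_times if_False)
  then show "(\<pi> \<circ> fst) ` carrier (stl_ext \<pi>) = carrier Sl4"
    unfolding image_comp[symmetric] surj[symmetric] by simp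
  show "a_kernel (stl_ext \<pi>) Sl4 (\<pi> \<circ> fst) \<subseteq> centre (stl_ext \<pi>)"
  proof
    fix u assume "u \<in> a_kernel (stl_ext \<pi>) Sl4 (\<pi> \<circ> fst)"
    then obtain s v where u: "u = (s, v)" "s \<in> carrier St" "v \<in> carrier Vv" "\<pi> s = \<zero>\<^bsub>Sl4\<^esub>"
      unfolding a_kernel_def' stl_ext_sel by (auto simp del: sum_sel)
    note k = kernel_central[OF pi pi_F u(2,4)]
    show "u \<in> centre (stl_ext \<pi>)"
      unfolding centre_def
    proof (intro CollectI conjI ballI)
      show "u \<in> carrier (stl_ext \<pi>)" unfolding stl_ext_sel u(1) using u(2,3) by blast
      fix t assume "t \<in> carrier (stl_ext \<pi>)"
      then obtain s' v' where t: "t = (s', v')" "s' \<in> carrier St" unfolding stl_ext_sel by blast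
      show "bracket (stl_ext \<pi>) u t = \<zero>\<^bsub>stl_ext \<pi>\<^esub>" "bracket (stl_ext \<pi>) t u = \<zero>\<^bsub>stl_ext \<pi>\<^esub>"
        unfolding u(1) t(1) stl_ext_sel u(4) using k[OF _ _ _ _ t(2)] F(1)[OF t(2)]
        by (simp_all add: P.zero_l P.zero_r del: sum_sel)
    qed
  qed
qed

end

end

lemma minor_index_simps:
  "minor_index 2 0 = (1, 3, 2, 4)" "minor_index 2 1 = (1, 4, 2, 3)" "minor_index 2 2 = (2, 3, 1, 4)"
  "minor_index 2 3 = (2, 4, 1, 3)" "minor_index 0 0 = (1, 2, 3, 4)" "minor_index 0 1 = (3, 4, 1, 2)"
  by (simp_all add: minor_index_def)

definition "minor_covers \<kappa> w a b a' b' =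
  (case minor_index \<kappa> w of (i, k, j, l) \<Rightarrow> {a, a'} = {i, k} \<and> {b, b'} = {j, l})"

abbreviation "minor_valid \<kappa> w \<equiv> (\<kappa> = 2 \<or> \<kappa> = 0) \<and> w < minor_count \<kappa>"

lemma minor_covers_cases:
  assumes "minor_valid \<kappa> w" "minor_covers \<kappa> w a b a' b'"
  obtains i k j l where "minor_index \<kappa> w = (i, k, j, l)" "{a, a'} = {i, k}" "{b, b'} = {j, l}"
  using assms(2) unfolding minor_covers_def by (cases "minor_index \<kappa> w") simp

lemma minor_covers_distinct:
  assumes v: "minor_valid \<kappa> w" and "minor_covers \<kappa> w a b a' b'"
  shows "distinct [a, b, a', b']"
proof (rule minor_covers_cases[OF assms])
  fix i k j l assume h: "minor_index \<kappa> w = (i, k, j, l)" "{a, a'} = {i, k}" "{b, b'} = {j, l}"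
  have "distinct [i, k, j, l]" using minor_index_cases[OF conjunct1[OF v] conjunct2[OF v] h(1)] by (elim disjE conjE) simp_all
  then show ?thesis using h(2,3) unfolding doubleton_eq_iff by (elim disjE conjE) simp_all
qed

lemma minor_covers_unique:
  assumes v: "minor_valid \<kappa> w" "minor_valid \<kappa>' w'" and m: "minor_index \<kappa> w = (i, k, j, l)"
    and c: "minor_covers \<kappa>' w' i j k l"
  shows "\<kappa>' = \<kappa> \<and> w' = w"
proof (rule minor_covers_cases[OF v(2) c])
  fix i' k' j' l' assume h: "minor_index \<kappa>' w' = (i', k', j', l')" "{i, k} = {i', k'}" "{j, l} = {j', l'}"
  show ?thesis
    using minor_index_cases[OF conjunct1[OF v(2)] conjunct2[OF v(2)] h(1)]
      minor_index_cases[OF conjunct1[OF v(1)] conjunct2[OF v(1)] m] h(2)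
    unfolding doubleton_eq_iff by (elim disjE conjE) simp_all
qed

text \<open>Four distinct indices determine the row pair and thereby a single minor. The explicit
  list of truth values lets a sum over the six minors be evaluated by cases.\<close>

lemma minor_covers_all:
  assumes "a \<in> {1..4}" "b \<in> {1..4}" "a' \<in> {1..4}" "b' \<in> {1..4 :: nat}" "distinct [a, b, a', b']"
  shows "(minor_covers 2 0 a b a' b', minor_covers 2 1 a b a' b', minor_covers 2 2 a b a' b',
      minor_covers 2 3 a b a' b', minor_covers 0 0 a b a' b', minor_covers 0 1 a b a' b') \<in>
    {(True, False, False, False, False, False), (False, True, False, False, False, False),
     (False, False, True, False, False, False), (False, False, False, True, False, False),
     (False, False, False, False, True, False), (False, False, False, False, False, True)}"
proof -
  have c: "x \<in> {1..4} \<Longrightarrow> x = 1 \<or> x = 2 \<or> x = 3 \<or> x = 4" for x :: nat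
    unfolding atLeastAtMost_iff by arith
  show ?thesis
    using c[OF assms(1)] c[OF assms(2)] c[OF assms(3)] c[OF assms(4)] assms(5)
    unfolding minor_covers_def minor_index_simps prod.case doubleton_eq_iff
    by (elim disjE) simp_all
qed

context unital_superdialgebra
begin

declare atLeastAtMost_iff [simp del]

interpretation sl: sl_cocycle R D Sl4 "bracket Sl4" by (rule sl_cocycle_sl)
interpretation S: leibniz_superalgebra R St by (rule leibniz_stl)
interpretation V: supermodule R Vv by (rule supermodule_Vv)
interpretation V\<kappa>: supermodule R "dialg_quot R D \<kappa>" for \<kappa> by (rule supermodule_dialg_quot)

lemma minor_map_zero:
  assumes v: "minor_valid \<kappa> w" and c: "\<not> minor_covers \<kappa> w a b a' b'" and xy: "x \<in> carrier D" "y \<in> carrier D"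
  shows "minor_map \<kappa> w (e4 a b x) (e4 a' b' y) = \<zero>\<^bsub>dialg_quot R D \<kappa>\<^esub>"
proof -
  obtain i k j l where t: "minor_index \<kappa> w = (i, k, j, l)" by (metis prod_cases4)
  have v': "\<kappa> = 2 \<or> \<kappa> = 0" "w < minor_count \<kappa>" using v by auto
  interpret m: minor R D \<kappa> i k j l by (rule minor_index_minor(1)[OF v' t])
  show ?thesis
    unfolding minor_map_def t prod.case
    by (rule m.mnr_elem_zero[OF xy]) (use c in \<open>simp add: minor_covers_def t\<close>)
qed

lemma minor_map_diag:
  assumes v: "minor_valid \<kappa> w" and t: "minor_index \<kappa> w = (i, k, j, l)" and a: "a \<in> carrier D"
  shows "minor_map \<kappa> w (e4 i j a) (e4 k l \<one>\<^bsub>D\<^esub>) = cl \<kappa> a"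
proof -
  have v': "\<kappa> = 2 \<or> \<kappa> = 0" "w < minor_count \<kappa>" using v by auto
  interpret m: minor R D \<kappa> i k j l by (rule minor_index_minor(1)[OF v' t])
  interpret q: graded_submodule R D "I_ideal R D \<kappa>" by (rule graded_submodule_I)
  have "cl \<kappa> a \<in> carrier (dialg_quot R D \<kappa>)"
    using q.coset_even_linear a unfolding even_linear_def dialg_quot_def by blast
  then show ?thesis
    unfolding minor_map_def t prod.case
    using a by (simp add: m.mnr_elem one_closed tau_homog[OF _ bar_unit_even] lprod_bar_unit)
qed

definition "vunit \<kappa> w c =
  ((\<lambda>u\<in>{..<4 :: nat}. if \<kappa> = (2 :: nat) \<and> u = w then c else \<zero>\<^bsub>dialg_quot R D 2\<^esub>),
   (\<lambda>u\<in>{..<2 :: nat}. if \<kappa> = 0 \<and> u = w then c else \<zero>\<^bsub>dialg_quot R D 0\<^esub>))"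

text \<open>Each coordinate of \<open>Vv\<close> is reached separately by \<Psi>, one ingredient of
  the perfectness of the extension.\<close>

lemma Psi_unit:
  assumes v: "minor_valid \<kappa> w" and t: "minor_index \<kappa> w = (i, k, j, l)" and a: "a \<in> carrier D"
  shows "\<Psi> (e4 i j a) (e4 k l \<one>\<^bsub>D\<^esub>) = vunit \<kappa> w (cl \<kappa> a)"
proof -
  have m: "minor_map \<kappa>' u (e4 i j a) (e4 k l \<one>\<^bsub>D\<^esub>) =
      (if \<kappa> = \<kappa>' \<and> u = w then cl \<kappa> a else \<zero>\<^bsub>dialg_quot R D \<kappa>'\<^esub>)" if "minor_valid \<kappa>' u" for \<kappa>' u
  proof (cases "\<kappa> = \<kappa>' \<and> u = w")
    case True
    then show ?thesis using minor_map_diag[OF v t a] by simp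
  next
    case False
    then have "\<not> minor_covers \<kappa>' u i j k l" using minor_covers_unique[OF v that t] by blast
    from minor_map_zero[OF that this a one_closed] show ?thesis unfolding if_not_P[OF False] .
  qed
  show ?thesis unfolding \<Psi>_def vunit_def by (intro arg_cong2[where f = Pair] restrict_ext; subst m) (simp_all add: minor_count_def)
qed

lemma Psi_zero:
  assumes d: "\<not> distinct [a, b, a', b']" and xy: "x \<in> carrier D" "y \<in> carrier D"
  shows "\<Psi> (e4 a b x) (e4 a' b' y) = \<zero>\<^bsub>Vv\<^esub>"
proof -
  have m: "minor_map \<kappa> w (e4 a b x) (e4 a' b' y) = \<zero>\<^bsub>dialg_quot R D \<kappa>\<^esub>" if "minor_valid \<kappa> w" for \<kappa> w
    using minor_covers_distinct[OF that] d by (intro minor_map_zero[OF that _ xy]) blast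
  show ?thesis
    unfolding \<Psi>_def sum_sel power_sel
    by (intro arg_cong2[where f = Pair] restrict_ext; rule m) (simp_all add: minor_count_def)
qed

lemma vunit_add:
  assumes "\<kappa> = 2 \<or> \<kappa> = 0"
  shows "vunit \<kappa> w (c \<oplus>\<^bsub>dialg_quot R D \<kappa>\<^esub> c') = vunit \<kappa> w c \<oplus>\<^bsub>Vv\<^esub> vunit \<kappa> w c'"
  using assms unfolding vunit_def sum_sel power_sel
  by (intro arg_cong2[where f = Pair] restrict_ext; elim disjE) simp_all

lemma vunit_decomp:
  assumes "v \<in> carrier Vv"
  shows "v = ((vunit 2 0 (fst v 0) \<oplus>\<^bsub>Vv\<^esub> vunit 2 1 (fst v 1)) \<oplus>\<^bsub>Vv\<^esub>
    (vunit 2 2 (fst v 2) \<oplus>\<^bsub>Vv\<^esub> vunit 2 3 (fst v 3))) \<oplus>\<^bsub>Vv\<^esub> (vunit 0 0 (snd v 0) \<oplus>\<^bsub>Vv\<^esub> vunit 0 1 (snd v 1))"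
proof -
  obtain x y where v: "v = (x, y)" "x \<in> {..<4} \<rightarrow>\<^sub>E carrier (dialg_quot R D 2)" "y \<in> {..<2} \<rightarrow>\<^sub>E carrier (dialg_quot R D 0)"
    using assms by (cases v) (simp add: power_sel)
  have c4: "u = 0 \<or> u = 1 \<or> u = 2 \<or> u = 3" if "u < 4" for u :: nat using that by arith
  have c2: "u = 0 \<or> u = 1" if "u < 2" for u :: nat using that by arith
  have xc: "x u \<in> carrier (dialg_quot R D 2)" if "u < 4" for u using PiE_mem[OF v(2), of u] that by simp
  have yc: "y u \<in> carrier (dialg_quot R D 0)" if "u < 2" for u using PiE_mem[OF v(3), of u] that by simp
  show ?thesis
    unfolding v(1) vunit_def sum_sel power_sel fst_conv snd_conv prod.inject
  proof (intro conjI)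
    show "x = (\<lambda>i\<in>{..<4}. (\<lambda>i\<in>{..<4}. (\<lambda>i\<in>{..<4}. (\<lambda>u\<in>{..<4}. if 2 = (2 :: nat) \<and> u = 0 then x 0 else \<zero>\<^bsub>dialg_quot R D 2\<^esub>) i \<oplus>\<^bsub>dialg_quot R D 2\<^esub>
        (\<lambda>u\<in>{..<4}. if 2 = (2 :: nat) \<and> u = 1 then x 1 else \<zero>\<^bsub>dialg_quot R D 2\<^esub>) i) i \<oplus>\<^bsub>dialg_quot R D 2\<^esub>
        (\<lambda>i\<in>{..<4}. (\<lambda>u\<in>{..<4}. if 2 = (2 :: nat) \<and> u = 2 then x 2 else \<zero>\<^bsub>dialg_quot R D 2\<^esub>) i \<oplus>\<^bsub>dialg_quot R D 2\<^esub>
        (\<lambda>u\<in>{..<4}. if 2 = (2 :: nat) \<and> u = 3 then x 3 else \<zero>\<^bsub>dialg_quot R D 2\<^esub>) i) i) i \<oplus>\<^bsub>dialg_quot R D 2\<^esub>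
        (\<lambda>i\<in>{..<4}. (\<lambda>u\<in>{..<4}. if 0 = (2 :: nat) \<and> u = 0 then y 0 else \<zero>\<^bsub>dialg_quot R D 2\<^esub>) i \<oplus>\<^bsub>dialg_quot R D 2\<^esub>
        (\<lambda>u\<in>{..<4}. if 0 = (2 :: nat) \<and> u = 1 then y 1 else \<zero>\<^bsub>dialg_quot R D 2\<^esub>) i) i)" (is "x = ?r")
    proof (rule extensionalityI[of _ "{..<4}"])
      fix u :: nat assume "u \<in> {..<4}"
      then have u: "u < 4" by simp
      show "x u = ?r u" using c4[OF u] xc by (elim disjE) simp_all
    qed (use v(2) in \<open>simp_all add: PiE_def\<close>)
    show "y = (\<lambda>i\<in>{..<2}. (\<lambda>i\<in>{..<2}. (\<lambda>i\<in>{..<2}. (\<lambda>u\<in>{..<2}. if 2 = (0 :: nat) \<and> u = 0 then x 0 else \<zero>\<^bsub>dialg_quot R D 0\<^esub>) i \<oplus>\<^bsub>dialg_quot R D 0\<^esub>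
        (\<lambda>u\<in>{..<2}. if 2 = (0 :: nat) \<and> u = 1 then x 1 else \<zero>\<^bsub>dialg_quot R D 0\<^esub>) i) i \<oplus>\<^bsub>dialg_quot R D 0\<^esub>
        (\<lambda>i\<in>{..<2}. (\<lambda>u\<in>{..<2}. if 2 = (0 :: nat) \<and> u = 2 then x 2 else \<zero>\<^bsub>dialg_quot R D 0\<^esub>) i \<oplus>\<^bsub>dialg_quot R D 0\<^esub>
        (\<lambda>u\<in>{..<2}. if 2 = (0 :: nat) \<and> u = 3 then x 3 else \<zero>\<^bsub>dialg_quot R D 0\<^esub>) i) i) i \<oplus>\<^bsub>dialg_quot R D 0\<^esub>
        (\<lambda>i\<in>{..<2}. (\<lambda>u\<in>{..<2}. if 0 = (0 :: nat) \<and> u = 0 then y 0 else \<zero>\<^bsub>dialg_quot R D 0\<^esub>) i \<oplus>\<^bsub>dialg_quot R D 0\<^esub>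
        (\<lambda>u\<in>{..<2}. if 0 = (0 :: nat) \<and> u = 1 then y 1 else \<zero>\<^bsub>dialg_quot R D 0\<^esub>) i) i)" (is "y = ?r")
    proof (rule extensionalityI[of _ "{..<2}"])
      fix u :: nat assume "u \<in> {..<2}"
      then have u: "u < 2" by simp
      show "y u = ?r u" using c2[OF u] yc by (elim disjE) simp_all
    qed (use v(3) in \<open>simp_all add: PiE_def\<close>)
  qed
qed

context
  fixes \<pi> assumes pi: "\<pi> \<in> leibniz_hom R St Sl4"
    and pi_F: "\<And>i j a p. \<lbrakk>a \<in> gr D p; i \<in> {1..4}; j \<in> {1..4}; i \<noteq> j\<rbrakk> \<Longrightarrow> \<pi> (F i j a) = e4 i j a"
begin

lemmas ext_sel = stl_ext_sel[OF pi]

interpretation U: leibniz_superalgebra R "stl_ext \<pi>" by (rule leibniz_stl_ext[OF pi])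

text \<open>Two lifts differ by central elements, hence agree on brackets; the extension is spanned by brackets.\<close>

lemma ext_lift_unique:
  assumes ce: "central_extension R M L \<phi>" and f: "f \<in> leibniz_hom R (stl_ext \<pi>) M"
    and g: "g \<in> leibniz_hom R (stl_ext \<pi>) M" and eq: "\<And>u. u \<in> carrier (stl_ext \<pi>) \<Longrightarrow> \<phi> (f u) = \<phi> (g u)"
    and u: "u \<in> carrier (stl_ext \<pi>)"
  shows "f u = g u"
proof -
  have M: "leibniz_superalgebra R M" and L: "leibniz_superalgebra R L" and phi: "\<phi> \<in> leibniz_hom R M L"
    and ker: "a_kernel M L \<phi> \<subseteq> centre M"
    using ce unfolding central_extension_def by simp_all
  interpret M: leibniz_superalgebra R M by fact
  interpret L: leibniz_superalgebra R L by fact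
  interpret phi: even_linear_map R M L \<phi>
    by (intro even_linear_map.intro even_linear_map_axioms.intro M.supermodule_axioms L.supermodule_axioms
        leibniz_hom_even_linear[OF phi])
  note F = leibniz_homD[OF f] and G = leibniz_homD[OF g]
  define K where "K = {u \<in> carrier (stl_ext \<pi>). f u = g u}"
  have K_br: "bracket (stl_ext \<pi>) x y \<in> K" if x: "x \<in> carrier (stl_ext \<pi>)" and y: "y \<in> carrier (stl_ext \<pi>)" for x y
  proof -
    have c: "bracket M (f z \<ominus>\<^bsub>M\<^esub> g z) m = \<zero>\<^bsub>M\<^esub>" "bracket M m (f z \<ominus>\<^bsub>M\<^esub> g z) = \<zero>\<^bsub>M\<^esub>"
      if "z \<in> carrier (stl_ext \<pi>)" "m \<in> carrier M" for z m
    proof -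
      have "f z \<ominus>\<^bsub>M\<^esub> g z \<in> a_kernel M L \<phi>"
        using that F(1) G(1) eq by (simp add: a_kernel_def' phi.minus L.M.diff_self)
      then have "f z \<ominus>\<^bsub>M\<^esub> g z \<in> centre M" by (rule subsetD[OF ker])
      then show "bracket M (f z \<ominus>\<^bsub>M\<^esub> g z) m = \<zero>\<^bsub>M\<^esub>" "bracket M m (f z \<ominus>\<^bsub>M\<^esub> g z) = \<zero>\<^bsub>M\<^esub>"
        using that(2) by (auto simp: centre_def)
    qed
    \<comment> \<open>The two arguments are replaced one after the other, each time by a difference
      that is central.\<close>
    have 1: "bracket M (f x) (f y) = bracket M (g x) (f y)"
      using c(1)[OF x F(1)[OF y]] F(1) G(1) x y by (simp add: M.br.minus_l M.M.diff_simps)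
    have 2: "bracket M (g x) (f y) = bracket M (g x) (g y)"
      using c(2)[OF y G(1)[OF x]] F(1) G(1) x y by (simp add: M.br.minus_r M.M.diff_simps)
    show ?thesis unfolding K_def using x y 1 2 by (simp add: F(5) G(5))
  qed
  have K_add: "x \<oplus>\<^bsub>stl_ext \<pi>\<^esub> y \<in> K" if "x \<in> K" "y \<in> K" for x y
    using that unfolding K_def by (simp add: F(2) G(2))
  have K_smult: "r \<odot>\<^bsub>stl_ext \<pi>\<^esub> x \<in> K" if "r \<in> carrier R" "x \<in> K" for r x
    using that unfolding K_def by (simp add: F(3) G(3))
  have Fc: "(F i j a, \<zero>\<^bsub>Vv\<^esub>) \<in> carrier (stl_ext \<pi>)" if "a \<in> gr D p" "i \<in> {1..4}" "j \<in> {1..4}" "i \<noteq> j" for i j a p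
    unfolding ext_sel using F_closed[OF that(2-4,1)] V.M.zero_closed by blast
  \<comment> \<open>\<open>F i j a\<close> is the bracket of \<open>F i k a\<close> and
    \<open>F k j 1\<close>; the index k repeats, so \<Psi> contributes nothing.\<close>
  have FK: "(F i j a, \<zero>\<^bsub>Vv\<^esub>) \<in> K" if a: "a \<in> gr D p" and ij: "i \<in> {1..4}" "j \<in> {1..4}" "i \<noteq> j" for i j a p
  proof -
    obtain k where k: "k \<in> {1..4}" "k \<notin> {i, j, j}" by (rule sl.fourth_index)
    have n: "i \<noteq> k" "k \<noteq> j" using k by auto
    have ac: "a \<in> carrier D" by (rule gr_carrier[OF a])
    have "bracket (stl_ext \<pi>) (F i k a, \<zero>\<^bsub>Vv\<^esub>) (F k j \<one>\<^bsub>D\<^esub>, \<zero>\<^bsub>Vv\<^esub>) \<in> K"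
      by (rule K_br) (rule Fc[OF a ij(1) k(1) n(1)] Fc[OF bar_unit_even k(1) ij(2) n(2)])+
    moreover have "\<Psi> (e4 i k a) (e4 k j \<one>\<^bsub>D\<^esub>) = \<zero>\<^bsub>Vv\<^esub>" by (rule Psi_zero) (simp_all add: ac one_closed)
    ultimately show ?thesis
      unfolding ext_sel pi_F[OF a ij(1) k(1) n(1)] pi_F[OF bar_unit_even k(1) ij(2) n(2)]
        F_br(1)[OF a bar_unit_even ij(1) k(1) k(1) ij(2) n(1,2) HOL.refl ij(3)] lprod_bar_unit[OF ac]
      by simp
  qed
  \<comment> \<open>The generators at \<open>(i, j)\<close> and \<open>(k, l)\<close> have bracket
    zero in \<open>St\<close>, so their bracket in the extension is the pure cocycle value.\<close>
  have unit_homog: "(\<zero>\<^bsub>St\<^esub>, vunit \<kappa> w (cl \<kappa> a)) \<in> K" if v: "minor_valid \<kappa> w" and a: "a \<in> gr D p" for \<kappa> w a p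
  proof -
    obtain i k j l where t: "minor_index \<kappa> w = (i, k, j, l)" by (metis prod_cases4)
    have v': "\<kappa> = 2 \<or> \<kappa> = 0" "w < minor_count \<kappa>" using v by auto
    interpret m: minor R D \<kappa> i k j l by (rule minor_index_minor(1)[OF v' t])
    note N = m.idx_in4 m.idx_neq
    have "bracket (stl_ext \<pi>) (F i j a, \<zero>\<^bsub>Vv\<^esub>) (F k l \<one>\<^bsub>D\<^esub>, \<zero>\<^bsub>Vv\<^esub>) \<in> K"
      by (rule K_br) (rule Fc[OF a] Fc[OF bar_unit_even]; simp only: N not_False_eq_True)+
    moreover have "bracket St (F i j a) (F k l \<one>\<^bsub>D\<^esub>) = \<zero>\<^bsub>St\<^esub>"
      by (rule F_br(3)[OF a bar_unit_even]) (simp_all only: N not_False_eq_True)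
    moreover have "\<pi> (F i j a) = e4 i j a" "\<pi> (F k l \<one>\<^bsub>D\<^esub>) = e4 k l \<one>\<^bsub>D\<^esub>"
      by (rule pi_F[OF a] pi_F[OF bar_unit_even]; simp only: N not_False_eq_True)+
    ultimately show ?thesis
      unfolding ext_sel by (simp only: Psi_unit[OF v t gr_carrier[OF a]])
  qed
  have pair_add: "(\<zero>\<^bsub>St\<^esub>, x \<oplus>\<^bsub>Vv\<^esub> y) \<in> K" if "(\<zero>\<^bsub>St\<^esub>, x) \<in> K" "(\<zero>\<^bsub>St\<^esub>, y) \<in> K" for x y
    using K_add[OF that] unfolding ext_sel by simp
  have unit: "(\<zero>\<^bsub>St\<^esub>, vunit \<kappa> w c) \<in> K" if v: "minor_valid \<kappa> w" and c: "c \<in> carrier (dialg_quot R D \<kappa>)" for \<kappa> w c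
  proof -
    interpret q: graded_submodule R D "I_ideal R D \<kappa>" by (rule graded_submodule_I)
    obtain a where a: "a \<in> carrier D" "c = cl \<kappa> a" using c by (auto simp: dialg_quot_def q.quot_sel)
    have "cl \<kappa> (hcomp D 0 a \<oplus>\<^bsub>D\<^esub> hcomp D 1 a) = cl \<kappa> (hcomp D 0 a) \<oplus>\<^bsub>dialg_quot R D \<kappa>\<^esub> cl \<kappa> (hcomp D 1 a)"
      using q.coset_even_linear a(1) unfolding even_linear_def dialg_quot_def by simp
    then have e: "c = cl \<kappa> (hcomp D 0 a) \<oplus>\<^bsub>dialg_quot R D \<kappa>\<^esub> cl \<kappa> (hcomp D 1 a)"
      by (simp add: hcomp_decomp a)
    have "\<kappa> = 2 \<or> \<kappa> = 0" using v by blast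
    then show ?thesis
      unfolding e using vunit_add pair_add unit_homog[OF v hcomp_closed[OF a(1)]] by simp
  qed
  have VK: "(\<zero>\<^bsub>St\<^esub>, v) \<in> K" if v: "v \<in> carrier Vv" for v
  proof -
    have c: "fst v w \<in> carrier (dialg_quot R D 2)" if "w < 4" for w
      using v that PiE_mem[of "fst v" "{..<4}" "\<lambda>_. carrier (dialg_quot R D 2)" w] by (cases v) (simp add: power_sel)
    have d: "snd v w \<in> carrier (dialg_quot R D 0)" if "w < 2" for w
      using v that PiE_mem[of "snd v" "{..<2}" "\<lambda>_. carrier (dialg_quot R D 0)" w] by (cases v) (simp add: power_sel)
    show ?thesis
      by (subst vunit_decomp[OF v]) (intro pair_add unit c d; simp add: minor_count_def)
  qed
  have SK: "(s, \<zero>\<^bsub>Vv\<^esub>) \<in> K" if "s \<in> carrier St" for s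
    using that
  proof (induction rule: St_induct)
    case (gen i j a p)
    then show ?case by (rule FK)
  next
    case zero
    show ?case by (rule VK[OF V.M.zero_closed])
  next
    case (add x y)
    then show ?case using K_add[OF add(3,4)]
      unfolding ext_sel by (simp del: sum_sel)
  next
    case (smult r x)
    then show ?case using K_smult[OF smult(1,3)]
      unfolding ext_sel by (simp del: sum_sel)
  next
    \<comment> \<open>The bracket in the extension has the extra component
      \<open>\<Psi> (\<pi> x) (\<pi> y)\<close>, which can be subtracted because of
      \<open>VK\<close>.\<close>
    case (br p q x y)
    interpret P: cocycle R Sl4 Vv \<Psi>
      by (intro cocycle.intro cocycle_axioms.intro leibniz_sl supermodule_Vv Psi_cocycle)
    have xy: "x \<in> carrier St" "y \<in> carrier St" using br(1,2) S.gr_carrier by auto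
    have P: "\<Psi> (\<pi> x) (\<pi> y) \<in> carrier Vv" using leibniz_homD(1)[OF pi] xy by (intro P.closed)
    have "bracket (stl_ext \<pi>) (x, \<zero>\<^bsub>Vv\<^esub>) (y, \<zero>\<^bsub>Vv\<^esub>) \<in> K"
      using br(3,4) unfolding K_def by (intro K_br[unfolded K_def]) simp_all
    from K_add[OF this VK[OF V.M.a_inv_closed[OF P]]]
    show ?case
      unfolding ext_sel using xy P by (simp add: V.M.r_neg del: sum_sel)
  qed
  obtain s v where sv: "u = (s, v)" "s \<in> carrier St" "v \<in> carrier Vv" using u unfolding ext_sel by blast
  have "(s, \<zero>\<^bsub>Vv\<^esub>) \<oplus>\<^bsub>stl_ext \<pi>\<^esub> (\<zero>\<^bsub>St\<^esub>, v) \<in> K" by (intro K_add SK VK sv)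
  then have "u \<in> K" unfolding ext_sel sv(1) using sv by (simp del: sum_sel)
  then show ?thesis unfolding K_def by blast
qed

end

end

section \<open>Lifting to an arbitrary central extension\<close>

context unital_superdialgebra
begin

declare atLeastAtMost_iff [simp del]

interpretation L: leibniz_superalgebra R Sl4 by (rule leibniz_sl)
interpretation sl: sl_cocycle R D Sl4 "bracket Sl4" by (rule sl_cocycle_sl)
interpretation S: leibniz_superalgebra R St by (rule leibniz_stl)
interpretation V: supermodule R Vv by (rule supermodule_Vv)
interpretation V\<kappa>: supermodule R "dialg_quot R D \<kappa>" for \<kappa> by (rule supermodule_dialg_quot)
interpretation Psi: cocycle R Sl4 Vv \<Psi>
  by (intro cocycle.intro cocycle_axioms.intro leibniz_sl supermodule_Vv Psi_cocycle)

text \<open>Values of h are sums of lifted brackets of matrices at the positions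
  \<open>(i, j)\<close> and \<open>(k, l)\<close>, which commute in sl; hence \<phi> kills
  them.\<close>

lemma minor_map_lift:
  fixes M :: "('a, 'm) leibniz"
  assumes M: "supermodule R M" and B: "leibniz_cocycle R Sl4 M B" and phi: "even_linear R M Sl4 \<phi>"
    and phi_B: "\<And>x y. x \<in> carrier Sl4 \<Longrightarrow> y \<in> carrier Sl4 \<Longrightarrow> \<phi> (B x y) = bracket Sl4 x y"
    and v: "minor_valid \<kappa> w"
  shows "\<exists>h. even_linear R (dialg_quot R D \<kappa>) M h \<and> (\<forall>v\<in>carrier (dialg_quot R D \<kappa>). \<phi> (h v) = \<zero>\<^bsub>Sl4\<^esub>) \<and>
    (\<forall>a b a' b' x y p q. x \<in> gr D p \<longrightarrow> y \<in> gr D q \<longrightarrow> a \<noteq> b \<longrightarrow> a' \<noteq> b' \<longrightarrow>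
      h (minor_map \<kappa> w (e4 a b x) (e4 a' b' y)) =
        (if minor_covers \<kappa> w a b a' b' then B (e4 a b x) (e4 a' b' y) else \<zero>\<^bsub>M\<^esub>))"
proof -
  obtain i k j l where t: "minor_index \<kappa> w = (i, k, j, l)" by (metis prod_cases4)
  have v': "\<kappa> = 2 \<or> \<kappa> = 0" "w < minor_count \<kappa>" using v by auto
  interpret m: minor_lift R D M B \<kappa> i k j l
    by (intro minor_lift.intro sl_cocycle.intro sl_cocycle_axioms.intro unital_superdialgebra_axioms M B
        minor_index_minor(1)[OF v' t] minor_lift_axioms.intro minor_index_minor(2)[OF v' t])
  interpret phi: even_linear_map R M Sl4 \<phi>
    by (intro even_linear_map.intro even_linear_map_axioms.intro M leibniz_superalgebra.axioms(1)[OF leibniz_sl] phi)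
  obtain h where h: "even_linear R (dialg_quot R D \<kappa>) M h"
    "\<And>a b a' b' x y p q. \<lbrakk>x \<in> gr D p; y \<in> gr D q; a \<noteq> b; a' \<noteq> b'\<rbrakk> \<Longrightarrow>
      h (m.mnr (e4 a b x) (e4 a' b' y)) = (if {a, a'} = {i, k} \<and> {b, b'} = {j, l} then B (e4 a b x) (e4 a' b' y) else \<zero>\<^bsub>M\<^esub>)"
    "\<And>v. v \<in> carrier (dialg_quot R D \<kappa>) \<Longrightarrow> \<exists>a\<in>gr D 0. \<exists>b\<in>gr D 1. h v =
      B (e4 i j a) (e4 k l \<one>\<^bsub>D\<^esub>) \<oplus>\<^bsub>M\<^esub> B (e4 i j b) (e4 k l \<one>\<^bsub>D\<^esub>)"
    by (rule m.minor_lift_elem) blast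
  note N = m.idx_in4 m.idx_neq
  have "\<phi> (h v) = \<zero>\<^bsub>Sl4\<^esub>" if vc: "v \<in> carrier (dialg_quot R D \<kappa>)" for v
  proof -
    obtain a b where ab: "a \<in> gr D 0" "b \<in> gr D 1"
      "h v = B (e4 i j a) (e4 k l \<one>\<^bsub>D\<^esub>) \<oplus>\<^bsub>M\<^esub> B (e4 i j b) (e4 k l \<one>\<^bsub>D\<^esub>)"
      using h(3)[OF vc] by blast
    have e: "e4 i j c \<in> carrier Sl4" "e4 k l \<one>\<^bsub>D\<^esub> \<in> carrier Sl4"
      "bracket Sl4 (e4 i j c) (e4 k l \<one>\<^bsub>D\<^esub>) = \<zero>\<^bsub>Sl4\<^esub>" if "c \<in> gr D p" for c p
      using sl.E4_br(3)[OF that bar_unit_even, of i j k l] gr_carrier[OF that] one_closed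
      by (simp_all add: N sl.E4_closed)
    show ?thesis
      unfolding ab(3) using e[OF ab(1)] e[OF ab(2)] by (simp add: phi.add phi_B m.B.closed)
  qed
  then show ?thesis
    using h(1,2) by (intro exI[of _ h]) (simp add: minor_map_def minor_covers_def t)
qed

text \<open>H is the sum of the six maps of \<open>minor_map_lift\<close>. For four distinct indices
  exactly one minor covers the pair of positions, so a single summand survives; otherwise \<Psi> is
  already zero.\<close>

lemma Psi_lift:
  fixes M :: "('a, 'm) leibniz"
  assumes M: "supermodule R M" and B: "leibniz_cocycle R Sl4 M B" and phi: "even_linear R M Sl4 \<phi>"
    and phi_B: "\<And>x y. x \<in> carrier Sl4 \<Longrightarrow> y \<in> carrier Sl4 \<Longrightarrow> \<phi> (B x y) = bracket Sl4 x y"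
  obtains H where "even_linear R Vv M H" and "\<forall>v\<in>carrier Vv. \<phi> (H v) = \<zero>\<^bsub>Sl4\<^esub>"
    and "\<forall>a b a' b' x y p q. x \<in> gr D p \<and> y \<in> gr D q \<and> a \<in> {1..4} \<and> b \<in> {1..4} \<and> a' \<in> {1..4} \<and> b' \<in> {1..4} \<and>
      a \<noteq> b \<and> a' \<noteq> b' \<longrightarrow> H (\<Psi> (e4 a b x) (e4 a' b' y)) =
        (if distinct [a, b, a', b'] then B (e4 a b x) (e4 a' b' y) else \<zero>\<^bsub>M\<^esub>)"
proof -
  interpret M: supermodule R M by fact
  interpret c: cocycle R Sl4 M B by (intro cocycle.intro cocycle_axioms.intro leibniz_sl M B)
  interpret phi: even_linear_map R M Sl4 \<phi>
    by (intro even_linear_map.intro even_linear_map_axioms.intro M leibniz_superalgebra.axioms(1)[OF leibniz_sl] phi)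
  define P where "P \<kappa> w h \<longleftrightarrow> even_linear R (dialg_quot R D \<kappa>) M h \<and>
    (\<forall>v\<in>carrier (dialg_quot R D \<kappa>). \<phi> (h v) = \<zero>\<^bsub>Sl4\<^esub>) \<and>
    (\<forall>a b a' b' x y p q. x \<in> gr D p \<longrightarrow> y \<in> gr D q \<longrightarrow> a \<noteq> b \<longrightarrow> a' \<noteq> b' \<longrightarrow>
      h (minor_map \<kappa> w (e4 a b x) (e4 a' b' y)) =
        (if minor_covers \<kappa> w a b a' b' then B (e4 a b x) (e4 a' b' y) else \<zero>\<^bsub>M\<^esub>))" for \<kappa> w h
  define h where "h \<kappa> w = (SOME h. P \<kappa> w h)" for \<kappa> w
  have P: "P \<kappa> w (h \<kappa> w)" if "minor_valid \<kappa> w" for \<kappa> w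
  proof -
    have "\<exists>h. P \<kappa> w h" unfolding P_def by (rule minor_map_lift[OF M B phi phi_B that])
    then show ?thesis unfolding h_def by (rule someI_ex)
  qed
  have valid: "minor_valid 2 0" "minor_valid 2 1" "minor_valid 2 2" "minor_valid 2 3" "minor_valid 0 0" "minor_valid 0 1"
    by (simp_all add: minor_count_def)
  have hl: "even_linear R (dialg_quot R D \<kappa>) M (h \<kappa> w)" if "minor_valid \<kappa> w" for \<kappa> w
    using P[OF that] unfolding P_def by blast
  have h0: "\<phi> (h \<kappa> w v) = \<zero>\<^bsub>Sl4\<^esub>" if "minor_valid \<kappa> w" "v \<in> carrier (dialg_quot R D \<kappa>)" for \<kappa> w v
    using P[OF that(1)] that(2) unfolding P_def by blast
  have he: "h \<kappa> w (minor_map \<kappa> w (e4 a b x) (e4 a' b' y)) =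
        (if minor_covers \<kappa> w a b a' b' then B (e4 a b x) (e4 a' b' y) else \<zero>\<^bsub>M\<^esub>)"
    if "minor_valid \<kappa> w" "x \<in> gr D p" "y \<in> gr D q" "a \<noteq> b" "a' \<noteq> b'" for \<kappa> w a b a' b' x y p q
    using P[OF that(1)] that(2-5) unfolding P_def by blast
  have hc: "h \<kappa> w c \<in> carrier M" if "minor_valid \<kappa> w" "c \<in> carrier (dialg_quot R D \<kappa>)" for \<kappa> w c
    using hl[OF that(1)] that(2) unfolding even_linear_def by blast
  have ha: "h \<kappa> w (c \<oplus>\<^bsub>dialg_quot R D \<kappa>\<^esub> c') = h \<kappa> w c \<oplus>\<^bsub>M\<^esub> h \<kappa> w c'"
    if "minor_valid \<kappa> w" "c \<in> carrier (dialg_quot R D \<kappa>)" "c' \<in> carrier (dialg_quot R D \<kappa>)" for \<kappa> w c c'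
    using hl[OF that(1)] that(2,3) unfolding even_linear_def by blast
  have hs: "h \<kappa> w (r \<odot>\<^bsub>dialg_quot R D \<kappa>\<^esub> c) = r \<odot>\<^bsub>M\<^esub> h \<kappa> w c"
    if "minor_valid \<kappa> w" "r \<in> carrier R" "c \<in> carrier (dialg_quot R D \<kappa>)" for \<kappa> w c r
    using hl[OF that(1)] that(2,3) unfolding even_linear_def by blast
  have hg: "h \<kappa> w c \<in> gr M p" if "minor_valid \<kappa> w" "c \<in> gr (dialg_quot R D \<kappa>) p" for \<kappa> w c p
    using hl[OF that(1)] that(2) unfolding even_linear_def by blast
  define H where "H v = ((h 2 0 (fst v 0) \<oplus>\<^bsub>M\<^esub> h 2 1 (fst v 1)) \<oplus>\<^bsub>M\<^esub> (h 2 2 (fst v 2) \<oplus>\<^bsub>M\<^esub> h 2 3 (fst v 3))) \<oplus>\<^bsub>M\<^esub>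
    (h 0 0 (snd v 0) \<oplus>\<^bsub>M\<^esub> h 0 1 (snd v 1))" for v :: "(nat \<Rightarrow> 'c set) \<times> (nat \<Rightarrow> 'c set)"
  have c2: "fst v w \<in> carrier (dialg_quot R D 2)" if "v \<in> carrier Vv" "w < 4" for v w
    using that PiE_mem[of "fst v" "{..<4}" "\<lambda>_. carrier (dialg_quot R D 2)" w] by (cases v) (simp add: power_sel)
  have c0: "snd v w \<in> carrier (dialg_quot R D 0)" if "v \<in> carrier Vv" "w < 2" for v w
    using that PiE_mem[of "snd v" "{..<2}" "\<lambda>_. carrier (dialg_quot R D 0)" w] by (cases v) (simp add: power_sel)
  have g2: "fst v w \<in> gr (dialg_quot R D 2) p" if "v \<in> gr Vv p" "w < 4" for v w p
    using that PiE_mem[of "fst v" "{..<4}" "\<lambda>_. gr (dialg_quot R D 2) p" w] by (cases v) (simp add: power_sel)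
  have g0: "snd v w \<in> gr (dialg_quot R D 0) p" if "v \<in> gr Vv p" "w < 2" for v w p
    using that PiE_mem[of "snd v" "{..<2}" "\<lambda>_. gr (dialg_quot R D 0) p" w] by (cases v) (simp add: power_sel)
  have H_closed: "H v \<in> carrier M" if "v \<in> carrier Vv" for v
    unfolding H_def using that by (intro M.M.a_closed hc valid c2 c0) simp_all
  have H_lin: "even_linear R Vv M H"
    unfolding even_linear_def
  proof (intro conjI ballI allI)
    fix v assume "v \<in> carrier Vv" then show "H v \<in> carrier M" by (rule H_closed)
  next
    fix v v' assume v: "v \<in> carrier Vv" "v' \<in> carrier Vv"
    have f: "fst (v \<oplus>\<^bsub>Vv\<^esub> v') w = fst v w \<oplus>\<^bsub>dialg_quot R D 2\<^esub> fst v' w" if "w < 4" for w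
      using that by (cases v; cases v') (simp add: power_sel)
    have s: "snd (v \<oplus>\<^bsub>Vv\<^esub> v') w = snd v w \<oplus>\<^bsub>dialg_quot R D 0\<^esub> snd v' w" if "w < 2" for w
      using that by (cases v; cases v') (simp add: power_sel)
    note C = hc[OF valid(1)] hc[OF valid(2)] hc[OF valid(3)] hc[OF valid(4)] hc[OF valid(5)] hc[OF valid(6)]
    note A = ha[OF valid(1)] ha[OF valid(2)] ha[OF valid(3)] ha[OF valid(4)] ha[OF valid(5)] ha[OF valid(6)]
    show "H (v \<oplus>\<^bsub>Vv\<^esub> v') = H v \<oplus>\<^bsub>M\<^esub> H v'"
      unfolding H_def using c2[OF v(1)] c2[OF v(2)] c0[OF v(1)] c0[OF v(2)]
      by (simp add: f s A C M.M.a_ac del: sum_sel)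
  next
    fix r v assume r: "r \<in> carrier R" and v: "v \<in> carrier Vv"
    have f: "fst (r \<odot>\<^bsub>Vv\<^esub> v) w = r \<odot>\<^bsub>dialg_quot R D 2\<^esub> fst v w" if "w < 4" for w
      using that by (cases v) (simp add: power_sel)
    have s: "snd (r \<odot>\<^bsub>Vv\<^esub> v) w = r \<odot>\<^bsub>dialg_quot R D 0\<^esub> snd v w" if "w < 2" for w
      using that by (cases v) (simp add: power_sel)
    note C = hc[OF valid(1)] hc[OF valid(2)] hc[OF valid(3)] hc[OF valid(4)] hc[OF valid(5)] hc[OF valid(6)]
    note A = hs[OF valid(1)] hs[OF valid(2)] hs[OF valid(3)] hs[OF valid(4)] hs[OF valid(5)] hs[OF valid(6)]
    show "H (r \<odot>\<^bsub>Vv\<^esub> v) = r \<odot>\<^bsub>M\<^esub> H v"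
      unfolding H_def using r c2[OF v] c0[OF v]
      by (simp add: f s A C M.smult_r_distr del: sum_sel)
  next
    fix p v assume v: "v \<in> gr Vv p"
    then show "H v \<in> gr M p"
      unfolding H_def by (intro M.gr_add hg valid g2 g0) simp_all
  qed
  have H_ker: "\<phi> (H v) = \<zero>\<^bsub>Sl4\<^esub>" if v: "v \<in> carrier Vv" for v
  proof -
    note C = hc[OF valid(1)] hc[OF valid(2)] hc[OF valid(3)] hc[OF valid(4)] hc[OF valid(5)] hc[OF valid(6)]
    note Z = h0[OF valid(1)] h0[OF valid(2)] h0[OF valid(3)] h0[OF valid(4)] h0[OF valid(5)] h0[OF valid(6)]
    show ?thesis
      unfolding H_def using c2[OF v] c0[OF v] by (simp add: phi.add C Z)
  qed
  have H_Psi: "H (\<Psi> (e4 a b x) (e4 a' b' y)) = (if distinct [a, b, a', b'] then B (e4 a b x) (e4 a' b' y) else \<zero>\<^bsub>M\<^esub>)"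
    if xy: "x \<in> gr D p" "y \<in> gr D q" and N: "a \<in> {1..4}" "b \<in> {1..4}" "a' \<in> {1..4}" "b' \<in> {1..4}"
      and n: "a \<noteq> b" "a' \<noteq> b'" for a b a' b' x y p q
  proof -
    have xc: "x \<in> carrier D" "y \<in> carrier D" using xy gr_carrier by auto
    have Bc: "B (e4 a b x) (e4 a' b' y) \<in> carrier M"
      using xc N n by (intro c.closed sl.E4_closed)
    show ?thesis
    proof (cases "distinct [a, b, a', b']")
      case True
      have fs: "fst (\<Psi> X Y) 0 = minor_map 2 0 X Y" "fst (\<Psi> X Y) 1 = minor_map 2 1 X Y"
        "fst (\<Psi> X Y) 2 = minor_map 2 2 X Y" "fst (\<Psi> X Y) 3 = minor_map 2 3 X Y"
        "snd (\<Psi> X Y) 0 = minor_map 0 0 X Y" "snd (\<Psi> X Y) 1 = minor_map 0 1 X Y" for X Y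
        by (simp_all add: \<Psi>_def)
      have e: "H (\<Psi> (e4 a b x) (e4 a' b' y)) =
        (((if minor_covers 2 0 a b a' b' then B (e4 a b x) (e4 a' b' y) else \<zero>\<^bsub>M\<^esub>) \<oplus>\<^bsub>M\<^esub>
          (if minor_covers 2 1 a b a' b' then B (e4 a b x) (e4 a' b' y) else \<zero>\<^bsub>M\<^esub>)) \<oplus>\<^bsub>M\<^esub>
         ((if minor_covers 2 2 a b a' b' then B (e4 a b x) (e4 a' b' y) else \<zero>\<^bsub>M\<^esub>) \<oplus>\<^bsub>M\<^esub>
          (if minor_covers 2 3 a b a' b' then B (e4 a b x) (e4 a' b' y) else \<zero>\<^bsub>M\<^esub>))) \<oplus>\<^bsub>M\<^esub>
        ((if minor_covers 0 0 a b a' b' then B (e4 a b x) (e4 a' b' y) else \<zero>\<^bsub>M\<^esub>) \<oplus>\<^bsub>M\<^esub>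
          (if minor_covers 0 1 a b a' b' then B (e4 a b x) (e4 a' b' y) else \<zero>\<^bsub>M\<^esub>))"
        unfolding H_def
        by (simp only: fs he[OF valid(1) xy n] he[OF valid(2) xy n] he[OF valid(3) xy n] he[OF valid(4) xy n]
            he[OF valid(5) xy n] he[OF valid(6) xy n])
      show ?thesis
        unfolding e if_P[OF True] using minor_covers_all[OF N True] Bc
        unfolding insert_iff empty_iff prod.inject by (elim disjE conjE) simp_all
    next
      case False
      interpret H: even_linear_map R Vv M H
        by (intro even_linear_map.intro even_linear_map_axioms.intro supermodule_Vv M H_lin)
      show ?thesis unfolding Psi_zero[OF False xc] if_not_P[OF False] by (rule H.zero)
    qed
  qed
  show thesis
  proof (rule that[OF H_lin])
    show "\<forall>v\<in>carrier Vv. \<phi> (H v) = \<zero>\<^bsub>Sl4\<^esub>" by (rule ballI) (rule H_ker)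
    show "\<forall>a b a' b' x y p q. x \<in> gr D p \<and> y \<in> gr D q \<and> a \<in> {1..4} \<and> b \<in> {1..4} \<and> a' \<in> {1..4} \<and> b' \<in> {1..4} \<and>
      a \<noteq> b \<and> a' \<noteq> b' \<longrightarrow> H (\<Psi> (e4 a b x) (e4 a' b' y)) =
        (if distinct [a, b, a', b'] then B (e4 a b x) (e4 a' b' y) else \<zero>\<^bsub>M\<^esub>)"
      by (intro allI impI, elim conjE, rule H_Psi)
  qed
qed

context
  fixes \<pi> assumes pi: "\<pi> \<in> leibniz_hom R St Sl4"
    and pi_F: "\<And>i j a p. \<lbrakk>a \<in> gr D p; i \<in> {1..4}; j \<in> {1..4}; i \<noteq> j\<rbrakk> \<Longrightarrow> \<pi> (F i j a) = e4 i j a"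
begin

lemmas ext_sel' = stl_ext_sel[OF pi]

text \<open>The brackets \<open>[F\<^sub>i\<^sub>j, F\<^sub>k\<^sub>l]\<close> with four distinct indices, which the relations of the Steinberg
  superalgebra force to vanish, are absorbed by twisting the bracket of the target.\<close>

lemma ext_lift_exists:
  assumes ce: "central_extension R M Sl4 \<phi>"
  shows "\<exists>f\<in>leibniz_hom R (stl_ext \<pi>) M. \<forall>u\<in>carrier (stl_ext \<pi>). \<pi> (fst u) = \<phi> (f u)"
proof -
  have M: "leibniz_superalgebra R M" and phi: "\<phi> \<in> leibniz_hom R M Sl4"
    and ker: "a_kernel M Sl4 \<phi> \<subseteq> centre M"
    using ce unfolding central_extension_def by simp_all
  note F = leibniz_homD[OF phi]
  note L = leibniz_superalgebra.axioms(1)[OF leibniz_sl]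
  interpret M: leibniz_superalgebra R M by fact
  interpret phi: even_linear_map R M Sl4 \<phi>
    by (intro even_linear_map.intro even_linear_map_axioms.intro M.supermodule_axioms L leibniz_hom_even_linear[OF phi])
  obtain B where B: "leibniz_cocycle R Sl4 M B"
    "\<And>m n. m \<in> carrier M \<Longrightarrow> n \<in> carrier M \<Longrightarrow> B (\<phi> m) (\<phi> n) = bracket M m n"
    "\<And>x y. x \<in> carrier Sl4 \<Longrightarrow> y \<in> carrier Sl4 \<Longrightarrow> \<phi> (B x y) = bracket Sl4 x y"
    by (rule central_extension_lift[OF ce]) blast
  interpret c: sl_cocycle R D M B
    by (intro sl_cocycle.intro sl_cocycle_axioms.intro unital_superdialgebra_axioms M.supermodule_axioms B(1))
  obtain H where H1: "even_linear R Vv M H" and H2: "\<forall>v\<in>carrier Vv. \<phi> (H v) = \<zero>\<^bsub>Sl4\<^esub>"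
    and H3: "\<forall>a b a' b' x y p q. x \<in> gr D p \<and> y \<in> gr D q \<and> a \<in> {1..4} \<and> b \<in> {1..4} \<and> a' \<in> {1..4} \<and> b' \<in> {1..4} \<and>
      a \<noteq> b \<and> a' \<noteq> b' \<longrightarrow> H (\<Psi> (e4 a b x) (e4 a' b' y)) =
        (if distinct [a, b, a', b'] then B (e4 a b x) (e4 a' b' y) else \<zero>\<^bsub>M\<^esub>)"
    by (rule Psi_lift[OF M.supermodule_axioms B(1) leibniz_hom_even_linear[OF phi] B(3)])
  note H = H1 bspec[OF H2]
  have H_Psi: "H (\<Psi> (e4 a b x) (e4 a' b' y)) =
        (if distinct [a, b, a', b'] then B (e4 a b x) (e4 a' b' y) else \<zero>\<^bsub>M\<^esub>)"
    if "x \<in> gr D p" "y \<in> gr D q" "a \<in> {1..4}" "b \<in> {1..4}" "a' \<in> {1..4}" "b' \<in> {1..4}" "a \<noteq> b" "a' \<noteq> b'"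
    for a b a' b' x y p q
    by (rule H3[rule_format, where p = p and q = q]) (intro conjI that)
  interpret H: even_linear_map R Vv M H
    by (intro even_linear_map.intro even_linear_map_axioms.intro supermodule_Vv M.supermodule_axioms H(1))
  \<comment> \<open>H takes values in the kernel of \<phi>, which is central.\<close>
  have Hc: "H v \<in> centre M" if "v \<in> carrier Vv" for v
    by (rule subsetD[OF ker]) (use that H(2) H.closed in \<open>simp add: a_kernel_def' del: sum_sel\<close>)
  have Hz: "bracket M (H v) m = \<zero>\<^bsub>M\<^esub>" "bracket M m (H v) = \<zero>\<^bsub>M\<^esub>" if "v \<in> carrier Vv" "m \<in> carrier M" for v m
    using Hc[OF that(1)] that(2) unfolding centre_def by blast+
  define \<beta> where "\<beta> x y = H (\<Psi> (\<phi> x) (\<phi> y))" for x y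
  have Pc: "\<Psi> (\<phi> x) (\<phi> y) \<in> carrier Vv" if "x \<in> carrier M" "y \<in> carrier M" for x y
    using that by (intro Psi.closed F(1))
  define M' where "M' = with_bracket M (\<lambda>x y. bracket M x y \<ominus>\<^bsub>M\<^esub> \<beta> x y)"
  have sel: "carrier M' = carrier M" "zero M' = zero M" "add M' = add M" "smult M' = smult M" "gr M' = gr M"
    "bracket M' = (\<lambda>x y. bracket M x y \<ominus>\<^bsub>M\<^esub> \<beta> x y)"
    unfolding M'_def by simp_all
  have M': "leibniz_superalgebra R M'"
    unfolding M'_def
  proof (rule cocycle_twist[OF M])
    show "leibniz_cocycle R M M \<beta>"
      unfolding \<beta>_def
      by (rule cocycle_pushforward[OF M supermodule_Vv M.supermodule_axioms H(1)
            cocycle_pullback[OF M leibniz_sl phi supermodule_Vv Psi_cocycle]])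
  next
    fix x y assume "x \<in> carrier M" "y \<in> carrier M"
    then show "\<beta> x y \<in> centre M" unfolding \<beta>_def by (intro Hc Pc)
  next
    \<comment> \<open>The values of \<beta> are killed by \<phi>, so \<Psi> vanishes as soon as one
      of them is an argument.\<close>
    fix x y z assume xyz: "x \<in> carrier M" "y \<in> carrier M" "z \<in> carrier M"
    have "\<phi> (\<beta> y z) = \<zero>\<^bsub>Sl4\<^esub>" unfolding \<beta>_def by (rule H(2)[OF Pc[OF xyz(2,3)]])
    then show "\<beta> x (\<beta> y z) = \<zero>\<^bsub>M\<^esub> \<and> \<beta> (\<beta> y z) x = \<zero>\<^bsub>M\<^esub>"
      unfolding \<beta>_def[of x] \<beta>_def[of _ x] using F(1)[OF xyz(1)]
      by (simp add: Psi.zero_l Psi.zero_r H.zero del: sum_sel)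
  qed
  have phi_Ft: "\<phi> (c.Ft i j a) = e4 i j a" if a: "a \<in> gr D p" and ij: "i \<in> {1..4}" "j \<in> {1..4}" "i \<noteq> j" for i j a p
  proof -
    obtain k where k: "k \<in> {1..4}" "k \<notin> {i, j, j}" by (rule sl.fourth_index)
    have n: "i \<noteq> k" "k \<noteq> j" "distinct [i, k, j]" using k ij by auto
    have ac: "a \<in> carrier D" by (rule gr_carrier[OF a])
    show ?thesis
      unfolding c.Ft_eq[OF a ij(1) k(1) ij(2) n(3)]
        B(3)[OF sl.E4_closed[OF ac ij(1) k(1) n(1)] sl.E4_closed[OF one_closed k(1) ij(2) n(2)]]
        sl.E4_br(1)[OF a bar_unit_even ij(1) k(1) k(1) ij(2) HOL.refl ij(3)] lprod_bar_unit[OF ac]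
      by (rule HOL.refl)
  qed
  have Ft_c: "c.Ft i j a \<in> carrier M" if "a \<in> gr D p" "i \<in> {1..4}" "j \<in> {1..4}" "i \<noteq> j" for i j a p
    by (rule M.gr_carrier[OF c.Ft_gr[OF that]])
  \<comment> \<open>The twist removes exactly the brackets with four distinct indices and leaves the
    others equal to B.\<close>
  have br: "bracket M' (c.Ft i j a) (c.Ft k l b) =
      (if distinct [i, j, k, l] then \<zero>\<^bsub>M\<^esub> else B (e4 i j a) (e4 k l b))"
    if a: "a \<in> gr D p" and ij: "i \<in> {1..4}" "j \<in> {1..4}" "i \<noteq> j" and b: "b \<in> gr D q"
      and kl: "k \<in> {1..4}" "l \<in> {1..4}" "k \<noteq> l" for i j k l a b p q
  proof -
    note f = phi_Ft[OF a ij] phi_Ft[OF b kl]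
    have Bf: "bracket M (c.Ft i j a) (c.Ft k l b) = B (e4 i j a) (e4 k l b)"
      using B(2)[OF Ft_c[OF a ij] Ft_c[OF b kl]] unfolding f by simp
    have Bc: "B (e4 i j a) (e4 k l b) \<in> carrier M"
      using Ft_c[OF a ij] Ft_c[OF b kl] unfolding Bf[symmetric] by simp
    show ?thesis
      unfolding sel \<beta>_def f Bf H_Psi[OF a b ij(1,2) kl(1,2) ij(3) kl(3)] using Bc
      by (cases "distinct [i, j, k, l]") (simp_all only: if_True if_False M.M.diff_self M.M.diff_zero)
  qed
  \<comment> \<open>All Steinberg relations hold for \<open>Ft\<close> in \<open>M'\<close>: those
    with an index to spare by the lemmas on \<open>Ft\<close>, the remaining ones by the
    twist.\<close>
  have "\<exists>g\<in>leibniz_hom R St M'. \<forall>t\<in>lterms R gens4. g (presentation.cls R gens4 rels4 t) =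
      lterm_eval M' (\<lambda>(i, j, a). c.Ft i j a) t"
  proof (rule stl_hom[OF M'], unfold sel(1-5))
    fix p and i j :: nat and a assume "a \<in> gr D p" "i \<in> {1..4}" "j \<in> {1..4}" "i \<noteq> j"
    then show "c.Ft i j a \<in> gr M (p + dgr i + dgr j)" by (rule c.Ft_gr)
  next
    fix p and i j :: nat and a b assume "a \<in> gr D p" "b \<in> gr D p" "i \<in> {1..4}" "j \<in> {1..4}" "i \<noteq> j"
    then show "c.Ft i j (a \<oplus>\<^bsub>D\<^esub> b) = c.Ft i j a \<oplus>\<^bsub>M\<^esub> c.Ft i j b" by (rule c.Ft_add)
  next
    fix p and i j :: nat and r a assume "a \<in> gr D p" "r \<in> carrier R" "i \<in> {1..4}" "j \<in> {1..4}" "i \<noteq> j"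
    then show "c.Ft i j (r \<odot>\<^bsub>D\<^esub> a) = r \<odot>\<^bsub>M\<^esub> c.Ft i j a" by (rule c.Ft_smult)
  next
    fix p q and i j l :: nat and a b
    assume h: "a \<in> gr D p" "b \<in> gr D q" "i \<in> {1..4}" "j \<in> {1..4}" "l \<in> {1..4}" "distinct [i, j, l]"
    then have n: "i \<noteq> j" "j \<noteq> l" "\<not> distinct [i, j, j, l]" by auto
    show "bracket M' (c.Ft i j a) (c.Ft j l b) = c.Ft i l (a \<stileturn>\<^bsub>D\<^esub> b)"
      unfolding br[OF h(1,3,4) n(1) h(2,4,5) n(2)] if_not_P[OF n(3)] by (rule c.Ft_left[OF h])
  next
    fix p q and i j k :: nat and a b
    assume h: "a \<in> gr D p" "b \<in> gr D q" "i \<in> {1..4}" "j \<in> {1..4}" "k \<in> {1..4}" "distinct [i, j, k]"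
    then have n: "i \<noteq> j" "k \<noteq> i" "\<not> distinct [i, j, k, i]" by auto
    show "bracket M' (c.Ft i j a) (c.Ft k i b) =
        koszul R ((p + dgr i + dgr j) * (q + dgr k + dgr i) + 1) \<odot>\<^bsub>M\<^esub> c.Ft k j (b \<turnstile>\<^bsub>D\<^esub> a)"
      unfolding br[OF h(1,3,4) n(1) h(2,5,3) n(2)] if_not_P[OF n(3)] by (rule c.Ft_right[OF h])
  next
    fix p q and i j k l :: nat and a b
    assume h: "a \<in> gr D p" "b \<in> gr D q" "i \<in> {1..4}" "j \<in> {1..4}" "k \<in> {1..4}" "l \<in> {1..4}"
      "i \<noteq> j" "k \<noteq> l" "i \<noteq> l" "j \<noteq> k"
    show "bracket M' (c.Ft i j a) (c.Ft k l b) = \<zero>\<^bsub>M\<^esub>"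
    proof (cases "distinct [i, j, k, l]")
      case True
      then show ?thesis unfolding br[OF h(1,3,4,7,2,5,6,8)] by (rule if_P)
    next
      case False
      then have "i = k \<or> j = l" using h(7-10) by auto
      then show ?thesis unfolding br[OF h(1,3,4,7,2,5,6,8)] if_not_P[OF False] by (rule c.Ft_zero[OF h])
    qed
  qed
  then obtain g where g: "g \<in> leibniz_hom R St M'"
    "\<And>t. t \<in> lterms R gens4 \<Longrightarrow> g (presentation.cls R gens4 rels4 t) = lterm_eval M' (\<lambda>(i, j, a). c.Ft i j a) t"
    by blast
  note G = leibniz_homD[OF g(1), unfolded sel]
  have gF: "g (F i j a) = c.Ft i j a" if "a \<in> gr D p" "i \<in> {1..4}" "j \<in> {1..4}" "i \<noteq> j" for i j a p
    using g(2)[OF Gen_l[OF that]] by (simp add: stl_gen_eq)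
  have phig: "\<phi> (g s) = \<pi> s" if "s \<in> carrier St" for s
    using that
  proof (induction rule: St_induct)
    case (gen i j a p)
    then show ?case using gF[OF gen] phi_Ft[OF gen] pi_F[OF gen] by simp
  next
    case zero
    interpret g: even_linear_map R St M' g
      by (intro even_linear_map.intro even_linear_map_axioms.intro S.supermodule_axioms
          leibniz_superalgebra.axioms(1)[OF M'] leibniz_hom_even_linear[OF g(1)])
    interpret pi: even_linear_map R St Sl4 \<pi>
      by (intro even_linear_map.intro even_linear_map_axioms.intro S.supermodule_axioms L leibniz_hom_even_linear[OF pi])
    show ?case using g.zero by (simp add: sel)
  next
    case (add x y)
    then show ?case by (simp add: G leibniz_homD[OF pi] phi.add)
  next
    case (smult r x)
    then show ?case by (simp add: G leibniz_homD[OF pi] phi.smult)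
  next
    case (br p q x y)
    have xy: "x \<in> carrier St" "y \<in> carrier St" using br(1,2) S.gr_carrier by auto
    have bc: "\<beta> (g x) (g y) \<in> carrier M" unfolding \<beta>_def using G(1) xy by (intro H.closed Pc)
    have "\<phi> (\<beta> (g x) (g y)) = \<zero>\<^bsub>Sl4\<^esub>" unfolding \<beta>_def using G(1) xy by (intro H(2) Pc)
    then show ?case
      using br(3,4) xy bc G(1) L.br.closed[OF leibniz_homD(1)[OF pi xy(1)] leibniz_homD(1)[OF pi xy(2)]]
      by (simp add: G(5) leibniz_homD(5)[OF pi] phi.minus F(5) L.M.diff_zero F(1))
  qed
  \<comment> \<open>In M the bracket of \<open>g s\<close> and \<open>g s'\<close> exceeds their
    bracket in \<open>M'\<close> by \<open>H (\<Psi> (\<pi> s) (\<pi> s'))\<close>, which is what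
    the second summand restores. So f respects the original bracket of M.\<close>
  define f where "f u = g (fst u) \<oplus>\<^bsub>M\<^esub> H (snd u)" for u
  have "f \<in> leibniz_hom R (stl_ext \<pi>) M"
    unfolding leibniz_hom_def
  proof (intro CollectI conjI ballI allI funcsetI)
    fix u assume "u \<in> carrier (stl_ext \<pi>)"
    then show "f u \<in> carrier M" unfolding ext_sel' f_def by (auto simp del: sum_sel intro!: G(1) H.closed)
  next
    fix u u' assume "u \<in> carrier (stl_ext \<pi>)" "u' \<in> carrier (stl_ext \<pi>)"
    then obtain s v s' v' where u: "u = (s, v)" "s \<in> carrier St" "v \<in> carrier Vv"
      "u' = (s', v')" "s' \<in> carrier St" "v' \<in> carrier Vv" unfolding ext_sel' by blast
    note gc = G(1)[OF u(2)] G(1)[OF u(5)] and hc = H.closed[OF u(3)] H.closed[OF u(6)]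
    show "f (u \<oplus>\<^bsub>stl_ext \<pi>\<^esub> u') = f u \<oplus>\<^bsub>M\<^esub> f u'"
      unfolding u(1,4) ext_sel' f_def fst_conv snd_conv G(2)[OF u(2,5)] H.add[OF u(3,6)]
      using gc hc by (simp add: M.M.a_ac)
    have b: "\<beta> (g s) (g s') = H (\<Psi> (\<pi> s) (\<pi> s'))" unfolding \<beta>_def phig[OF u(2)] phig[OF u(5)] by (rule HOL.refl)
    have bc: "H (\<Psi> (\<pi> s) (\<pi> s')) \<in> carrier M" unfolding b[symmetric] \<beta>_def by (intro H.closed Pc gc)
    have "f (bracket (stl_ext \<pi>) u u') = bracket M (g s) (g s')"
      unfolding u(1,4) ext_sel' f_def fst_conv snd_conv G(5)[OF u(2,5)] b
      using gc bc by (simp add: M.M.minus_eq M.M.a_assoc M.M.l_neg)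
    also have "\<dots> = bracket M (f u) (f u')"
      unfolding u(1,4) f_def fst_conv snd_conv using gc hc Hz u(3,6)
      by (simp add: M.br.linear_simps(1,2) del: sum_sel)
    finally show "f (bracket (stl_ext \<pi>) u u') = bracket M (f u) (f u')" .
  next
    fix r u assume r: "r \<in> carrier R" and "u \<in> carrier (stl_ext \<pi>)"
    then obtain s v where u: "u = (s, v)" "s \<in> carrier St" "v \<in> carrier Vv" unfolding ext_sel' by blast
    show "f (r \<odot>\<^bsub>stl_ext \<pi>\<^esub> u) = r \<odot>\<^bsub>M\<^esub> f u"
      unfolding u(1) ext_sel' f_def fst_conv snd_conv G(3)[OF r u(2)] H.smult[OF r u(3)]
      using G(1)[OF u(2)] H.closed[OF u(3)] r by (simp add: M.smult_r_distr)
  next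
    fix p u assume "u \<in> gr (stl_ext \<pi>) p"
    then obtain s v where u: "u = (s, v)" "s \<in> gr St p" "v \<in> gr Vv p" unfolding ext_sel' by blast
    show "f u \<in> gr M p"
      unfolding u(1) f_def fst_conv snd_conv by (intro M.gr_add G(4) H.graded u)
  qed
  moreover have "\<pi> (fst u) = \<phi> (f u)" if uc: "u \<in> carrier (stl_ext \<pi>)" for u
  proof -
    obtain s v where u: "u = (s, v)" "s \<in> carrier St" "v \<in> carrier Vv" using uc unfolding ext_sel' by blast
    show ?thesis
      unfolding u(1) f_def fst_conv snd_conv using G(1)[OF u(2)] H.closed[OF u(3)] H(2)[OF u(3)]
        leibniz_homD(1)[OF pi u(2)]
      by (simp add: phi.add phig[OF u(2)])
  qed
  ultimately show ?thesis by blast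
qed

lemma stl_ext_universal:
  assumes surj: "\<pi> ` carrier St = carrier Sl4"
  shows "universal_central_extension R (stl_ext \<pi>) Sl4 (\<pi> \<circ> fst)"
  unfolding universal_central_extension_def
proof (intro conjI allI impI)
  show "central_extension R (stl_ext \<pi>) Sl4 (\<pi> \<circ> fst)" by (rule stl_ext_central[OF pi pi_F surj])
  \<comment> \<open>The carrier type is the one prescribed by
    \<open>universal_central_extension\<close>; the existence and uniqueness lemmas hold for every
    type.\<close>
  fix M :: "('a, ('a, (nat \<times> nat \<Rightarrow> 'c) +
      (('a, nat \<times> nat \<times> 'c) lterm set \<times> (nat \<Rightarrow> 'c set) \<times> (nat \<Rightarrow> 'c set)) +
      (('a, nat \<times> nat \<times> 'c) lterm set \<times> (nat \<Rightarrow> 'c set) \<times> (nat \<Rightarrow> 'c set))) lterm) leibniz" and \<phi>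
  assume ce: "central_extension R M Sl4 \<phi>"
  obtain f where f: "f \<in> leibniz_hom R (stl_ext \<pi>) M" "\<forall>u\<in>carrier (stl_ext \<pi>). \<pi> (fst u) = \<phi> (f u)"
    using ext_lift_exists[OF ce] by blast
  let ?f = "restrict f (carrier (stl_ext \<pi>))"
  show "\<exists>!f. f \<in> leibniz_hom R (stl_ext \<pi>) M \<inter> extensional (carrier (stl_ext \<pi>)) \<and>
      (\<forall>x\<in>carrier (stl_ext \<pi>). (\<pi> \<circ> fst) x = \<phi> (f x))"
  proof (rule ex1I[of _ ?f])
    have "?f \<in> leibniz_hom R (stl_ext \<pi>) M"
      by (rule leibniz_hom_cong[OF leibniz_stl_ext[OF pi] f(1)]) simp
    then show "?f \<in> leibniz_hom R (stl_ext \<pi>) M \<inter> extensional (carrier (stl_ext \<pi>)) \<and>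
      (\<forall>x\<in>carrier (stl_ext \<pi>). (\<pi> \<circ> fst) x = \<phi> (?f x))" using f(2) by simp
  next
    fix g assume g: "g \<in> leibniz_hom R (stl_ext \<pi>) M \<inter> extensional (carrier (stl_ext \<pi>)) \<and>
      (\<forall>x\<in>carrier (stl_ext \<pi>). (\<pi> \<circ> fst) x = \<phi> (g x))"
    show "g = ?f"
    proof (rule extensionalityI[of _ "carrier (stl_ext \<pi>)"])
      fix u assume u: "u \<in> carrier (stl_ext \<pi>)"
      have "g u = f u"
      proof (rule ext_lift_unique[OF pi pi_F ce _ f(1) _ u])
        show "g \<in> leibniz_hom R (stl_ext \<pi>) M" using g by blast
        fix u assume "u \<in> carrier (stl_ext \<pi>)"
        then show "\<phi> (g u) = \<phi> (f u)" using g f(2) by (metis comp_apply)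
      qed
      then show "g u = ?f u" using u by simp
    qed (use g in auto)
  qed
qed

end

end

theorem theorem4p5:
  fixes R :: "('a, 'x) ring_scheme" and D :: "('a, 'd) superdialg"
  assumes "cring R" and "unital_superdialgebra R D"
  shows "\<exists>\<pi> \<in> leibniz_hom R (stl R 2 2 D) (sl R 2 2 D).
    (\<forall>i\<in>{1..4}. \<forall>j\<in>{1..4}. \<forall>p. \<forall>a\<in>gr D p. i \<noteq> j \<longrightarrow>
       \<pi> (stl_gen R 2 2 D i j a) = elem_mat 2 2 D i j a) \<and>
    (\<exists>br. universal_central_extension R
       (with_bracket
         (stl R 2 2 D \<oplus>\<^sub>s supermodule_power (dialg_quot R D 2) 4 \<oplus>\<^sub>s supermodule_power (dialg_quot R D 0) 2)
         br)
       (sl R 2 2 D) (\<pi> \<circ> fst))"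
proof -
  interpret unital_superdialgebra R D by fact
  obtain \<pi> :: "('a, nat \<times> nat \<times> 'd) lterm set \<Rightarrow> nat \<times> nat \<Rightarrow> 'd"
    where pi: "\<pi> \<in> leibniz_hom R (stl R 2 2 D) (sl R 2 2 D)"
      "\<And>i j a p. \<lbrakk>a \<in> gr D p; i \<in> {1..4}; j \<in> {1..4}; i \<noteq> j\<rbrakk> \<Longrightarrow> \<pi> (stl_gen R 2 2 D i j a) = elem_mat 2 2 D i j a"
      "\<pi> ` carrier (stl R 2 2 D) = carrier (sl R 2 2 D)"
    by (rule stl_to_sl) blast
  show ?thesis
  proof (intro bexI[OF _ pi(1)] conjI ballI allI impI)
    fix i j p a assume "i \<in> {1..4 :: nat}" "j \<in> {1..4 :: nat}" "a \<in> gr D p" "i \<noteq> j"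
    then show "\<pi> (stl_gen R 2 2 D i j a) = elem_mat 2 2 D i j a" by (intro pi(2))
  next
    show "\<exists>br. universal_central_extension R
       (with_bracket
         (stl R 2 2 D \<oplus>\<^sub>s supermodule_power (dialg_quot R D 2) 4 \<oplus>\<^sub>s supermodule_power (dialg_quot R D 0) 2)
         br)
       (sl R 2 2 D) (\<pi> \<circ> fst)"
      \<comment> \<open>The witness is the bracket of \<open>stl_ext\<close>: the bracket of stl
        paired with \<Psi> of the images under \<pi>.\<close>
      by (rule exI) (rule stl_ext_universal[OF pi, unfolded stl_ext_def])
  qed
qed

end
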